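(* Let $G$ be a finite group and let $H\unlhd G$ be a normal subgroup with the property that every inner automorphism of $G$ restricts to an inner automorphism of $H$. Then $(R(G),\alpha,\alpha^* )$ is a $[G:H]$-PSH module over $R(H)$, where $\alpha:R(H)\otimes R(G)\to R(G)$ and $\alpha^*:R(G)\to R(H)\otimes R(G)$ are the maps given by induction and restriction, as defined in the context.
   Context: A T-group is a free abelian group $M$ with a specified $\mathbb{Z}$-basis $\Omega(M)$, whose elements are called irreducible; $\langle\cdot,\cdot\rangle$ is the bilinear form making $\Omega(M)$ orthonormal. An element $x$ is positive if $\langle x,\omega\rangle\ge 0$ for all $\omega\in\Omega(M)$. $\mathbb{Z}$ is a T-group with irreducible element $1$; irreducibles of a tensor product are tensor products of irreducibles. A T-group is graded if $M=\bigoplus_{n\ge 0}M_n$ with every irreducible element homogeneous. A map is positive if it sends positive elements to positive elements; $f:M\to N$, $g:N\to M$ are adjoint if $\langle f(m),n\rangle=\langle m,g(n)\rangle$ for all $m,n$. A PSH-algebra is a Hopf algebra $(A,\mu,\mu^*,e,e^*,T)$ over $\mathbb{Z}$ that is a graded T-group $A=\bigoplus_{n\ge 0}A_n$, with all structure maps graded ($\mathbb{Z}$ in degree $0$; no signs), connected ($e:\mathbb{Z}\to A_0$ and $e^*:A_0\to\mathbb{Z}$ mutually inverse isomorphisms), with $\mu,\mu^*,e,e^*$ positive and with $(\mu,\mu^* )$, $(e,e^* )$ pairs of adjoint maps. For $k\ge1$, $\Psi^k=\mu^{(k)}\circ\mu^{*(k)}:A\to A$, where $\mu^{(k)}:A^{\otimes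 k}\to A$ and $\mu^{*(k)}:A\to A^{\otimes k}$ are iterated multiplication and comultiplication; $\Psi^0=e\circ e^*$. Sumless Sweedler notation: $\mu^*(h)=h_{(1)}\otimes h_{(2)}$, $\alpha^*(m)=m_{(1)}\otimes m_{(2)}$. A $k$-PSH module over $A$ is a graded T-group $M=\bigoplus_{n\ge0}M_n$ with graded, positive, mutually adjoint $\mathbb{Z}$-linear maps $\alpha:A\otimes M\to M$ (written $hm$) and $\alpha^*:M\to A\otimes M$ satisfying associativity $a(bm)=(ab)m$, coassociativity $(\mu^*\otimes 1)\alpha^*=(1\otimes\alpha^* )\alpha^*$, unit $e(a)m=am$, counit $e^*(m_{(1)})m_{(2)}=m$, and the $k$-Hopf axiom $\alpha^*(hm)=\Psi^k(h_{(1)})m_{(1)}\otimes h_{(2)}m_{(2)}$. For a finite group $G$, $S_n[G]=S_n\ltimes G^n$ is the wreath product ($S_n$ permuting coordinates). $R(G)=\bigoplus_{n\ge0}R_n(G)$, with $R_0(G)=\mathbb{Z}$ and, for $n>0$, $R_n(G)$ the Grothendieck group of finite-dimensional complex representations of $S_n[G]$; irreducible elements are the classes of irreducible representations (and $1\in\mathbb{Z}$ in degree $0$). $R(G)$ is a PSH-algebra (Zelevinsky) with multiplication given on representations $\sigma$ of $S_k[G]$, $\tau$ of $S_l[G]$ by $\mathrm{Ind}_{S_k[G]\times S_l[G]}^{S_{k+l}[G]}(\sigma\otimes\tau)$, comultiplication given on representations of $S_n[G]$ by $\sum_{k+l=n}\mathrm{Res}^{S_n[G]}_{S_k[G]\times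 S_l[G]}$ (using $K_0(\mathrm{Rep}(A\times B))\cong K_0(\mathrm{Rep} A)\otimes K_0(\mathrm{Rep} B)$), unit and counit the identification with and graded projection to $R_0(G)=\mathbb{Z}$. For a subgroup $H\subset G$, view $S_k[H]\times S_l[G]$ as a subgroup of $S_{k+l}[G]$ in the obvious way. The map $\alpha:R(H)\otimes R(G)\to R(G)$ is given on $R_k(H)\otimes R_l(G)$ by $\mathrm{Ind}_{S_k[H]\times S_l[G]}^{S_{k+l}[G]}$ and $\alpha^*:R(G)\to R(H)\otimes R(G)$ is given on $R_n(G)$ by $\sum_{k+l=n}\mathrm{Res}^{S_n[G]}_{S_k[H]\times S_l[G]}$. *)

theory Defs
  imports
    "HOL-Algebra.Free_Abelian_Groups"
    "HOL-Algebra.Sym_Groups"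
    "Jordan_Normal_Form.Matrix_Kernel"
begin

section \<open>T-groups\<close>

text \<open>
  Abelian groups are commutative groups of the library, so inside a T-group the library's
  multiplicative notation stands for addition: the group operation is the sum, \<open>\<one>\<close> is the
  zero element and \<open>x [^] z\<close> is the integer multiple \<open>z\<cdot>x\<close>.  \<open>free_Abelian_group S\<close> consists
  of the finitely supported functions \<open>S \<Rightarrow> int\<close>.
\<close>

record 'a tgroup = "'a monoid" +
  irr :: "'a set"

record 'a graded_tgroup = "'a tgroup" +
  grade :: "nat \<Rightarrow> 'a set"

text \<open>The \<open>\<int>\<close>-linear extension of \<open>f\<close> from basis elements to the free abelian group.\<close>

definition zlift :: "('c, 'm) monoid_scheme \<Rightarrow> ('b \<Rightarrow> 'c) \<Rightarrow> ('b \<Rightarrow>\<^sub>0 int) \<Rightarrow> 'c" where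
  "zlift N f c = finprod N (\<lambda>b. f b [^]\<^bsub>N\<^esub> Poly_Mapping.lookup c b) (Poly_Mapping.keys c)"

locale tgroup = comm_group M for M :: "('a, 'm) tgroup_scheme" (structure) +
  assumes irr_closed: "irr M \<subseteq> carrier M"
    and irr_basis: "bij_betw (zlift M (\<lambda>x. x)) (carrier (free_Abelian_group (irr M))) (carrier M)"

definition coords :: "('a, 'm) tgroup_scheme \<Rightarrow> 'a \<Rightarrow> ('a \<Rightarrow>\<^sub>0 int)" where
  "coords M x = inv_into (carrier (free_Abelian_group (irr M))) (zlift M (\<lambda>x. x)) x"

definition pairing :: "('a, 'm) tgroup_scheme \<Rightarrow> 'a \<Rightarrow> 'a \<Rightarrow> int" where
  "pairing M x y = (\<Sum>w\<in>Poly_Mapping.keys (coords M x).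
     Poly_Mapping.lookup (coords M x) w * Poly_Mapping.lookup (coords M y) w)"

definition positive :: "('a, 'm) tgroup_scheme \<Rightarrow> 'a set" where
  "positive M = {x \<in> carrier M. \<forall>w\<in>irr M. 0 \<le> pairing M x w}"

definition positive_map ::
    "('a, 'm) tgroup_scheme \<Rightarrow> ('b, 'n) tgroup_scheme \<Rightarrow> ('a \<Rightarrow> 'b) \<Rightarrow> bool" where
  "positive_map M N f \<longleftrightarrow> f ` positive M \<subseteq> positive N"

definition adjoint_maps ::
    "('a, 'm) tgroup_scheme \<Rightarrow> ('b, 'n) tgroup_scheme \<Rightarrow> ('a \<Rightarrow> 'b) \<Rightarrow> ('b \<Rightarrow> 'a) \<Rightarrow> bool" where
  "adjoint_maps M N f g \<longleftrightarrow>
     (\<forall>x\<in>carrier M. \<forall>y\<in>carrier N. pairing N (f x) y = pairing M x (g y))"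

text \<open>Internal direct sum decomposition into the subgroups \<open>grade M n\<close>.\<close>

locale graded_tgroup = tgroup M for M :: "('a, 'm) graded_tgroup_scheme" (structure) +
  assumes grade_subgroup: "\<And>n. subgroup (grade M n) M"
    and grade_direct_sum:
      "bij_betw (\<lambda>x. gfinprod M x UNIV)
         (carrier (sum_group UNIV (\<lambda>n. M\<lparr>carrier := grade M n\<rparr>))) (carrier M)"
    and irr_homogeneous: "\<And>w. w \<in> irr M \<Longrightarrow> \<exists>n. w \<in> grade M n"

definition graded_map ::
    "('a, 'm) graded_tgroup_scheme \<Rightarrow> ('b, 'n) graded_tgroup_scheme \<Rightarrow> ('a \<Rightarrow> 'b) \<Rightarrow> bool" where
  "graded_map M N f \<longleftrightarrow> (\<forall>n. f ` grade M n \<subseteq> grade N n)"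

definition int_tgroup :: "int graded_tgroup" where
  "int_tgroup = \<lparr>carrier = UNIV, monoid.mult = (+), one = 0, irr = {1},
     grade = (\<lambda>n. if n = 0 then UNIV else {0})\<rparr>"

text \<open>
  Tensor product of T-groups: the free abelian group on pairs of irreducibles, the pair
  \<open>(w, v)\<close> standing for \<open>w \<otimes> v\<close>.  The universal bilinear map is \<open>tens\<close>.
\<close>

definition tensor ::
    "('a, 'm) graded_tgroup_scheme \<Rightarrow> ('b, 'n) graded_tgroup_scheme \<Rightarrow> ('a \<times> 'b \<Rightarrow>\<^sub>0 int) graded_tgroup"
  where
  "tensor M N =
    \<lparr>carrier = carrier (free_Abelian_group (irr M \<times> irr N)), monoid.mult = (+), one = 0,
     irr = frag_of ` (irr M \<times> irr N),
     grade = (\<lambda>n. {t \<in> carrier (free_Abelian_group (irr M \<times> irr N)).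
       \<forall>(w, v)\<in>Poly_Mapping.keys t. \<exists>k l. k + l = n \<and> w \<in> grade M k \<and> v \<in> grade N l})\<rparr>"

definition tens ::
    "('a, 'm) tgroup_scheme \<Rightarrow> ('b, 'n) tgroup_scheme \<Rightarrow> 'a \<Rightarrow> 'b \<Rightarrow> ('a \<times> 'b \<Rightarrow>\<^sub>0 int)" where
  "tens M N x y =
     frag_extend (\<lambda>w. frag_extend (\<lambda>v. frag_of (w, v)) (coords N y)) (coords M x)"

text \<open>The map \<open>f \<otimes> g\<close> with values in \<open>M \<otimes> N\<close>.\<close>

definition tensor_map ::
    "('c, 'm) tgroup_scheme \<Rightarrow> ('d, 'n) tgroup_scheme \<Rightarrow> ('a \<Rightarrow> 'c) \<Rightarrow> ('b \<Rightarrow> 'd)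
     \<Rightarrow> ('a \<times> 'b \<Rightarrow>\<^sub>0 int) \<Rightarrow> ('c \<times> 'd \<Rightarrow>\<^sub>0 int)" where
  "tensor_map M N f g = frag_extend (\<lambda>(x, y). tens M N (f x) (g y))"

text \<open>
  The canonical isomorphism \<open>(L \<otimes> M) \<otimes> N \<cong> L \<otimes> (M \<otimes> N)\<close>; the irreducibles of \<open>L \<otimes> M\<close> are the
  \<open>frag_of (a, b)\<close>.
\<close>

definition tensor_assoc ::
    "(('a \<times> 'b \<Rightarrow>\<^sub>0 int) \<times> 'c \<Rightarrow>\<^sub>0 int) \<Rightarrow> ('a \<times> ('b \<times> 'c \<Rightarrow>\<^sub>0 int) \<Rightarrow>\<^sub>0 int)" where
  "tensor_assoc =
     frag_extend (\<lambda>(s, c). frag_extend (\<lambda>(a, b). frag_of (a, frag_of (b, c))) s)"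


section \<open>PSH-algebras and PSH modules\<close>

record 'a psh = "'a graded_tgroup" +
  psh_mult :: "('a \<times> 'a \<Rightarrow>\<^sub>0 int) \<Rightarrow> 'a"
  psh_comult :: "'a \<Rightarrow> ('a \<times> 'a \<Rightarrow>\<^sub>0 int)"
  psh_unit :: "int \<Rightarrow> 'a"
  psh_counit :: "'a \<Rightarrow> int"

abbreviation psh_prod :: "('a, 'm) psh_scheme \<Rightarrow> 'a \<Rightarrow> 'a \<Rightarrow> 'a" where
  "psh_prod A x y \<equiv> psh_mult A (tens A A x y)"

text \<open>
  The antipode is determined by the remaining structure, so only its existence is recorded.
  A Sweedler expression in \<open>x\<^sub>1 \<otimes> x\<^sub>2\<close> is the linear extension, evaluated at the comultiplication
  of \<open>x\<close>, of its values on pairs of irreducibles.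
\<close>

locale psh_algebra = graded_tgroup A for A :: "('a, 'm) psh_scheme" (structure) +
  assumes mult_hom: "psh_mult A \<in> hom (tensor A A) A"
    and comult_hom: "psh_comult A \<in> hom A (tensor A A)"
    and unit_hom: "psh_unit A \<in> hom int_tgroup A"
    and counit_hom: "psh_counit A \<in> hom A int_tgroup"
    and mult_graded: "graded_map (tensor A A) A (psh_mult A)"
    and comult_graded: "graded_map A (tensor A A) (psh_comult A)"
    and unit_graded: "graded_map int_tgroup A (psh_unit A)"
    and counit_graded: "graded_map A int_tgroup (psh_counit A)"
    and mult_assoc: "\<And>x y z. \<lbrakk>x \<in> carrier A; y \<in> carrier A; z \<in> carrier A\<rbrakk> \<Longrightarrow>
      psh_prod A (psh_prod A x y) z = psh_prod A x (psh_prod A y z)"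
    and mult_unit_left: "\<And>x. x \<in> carrier A \<Longrightarrow> psh_prod A (psh_unit A 1) x = x"
    and mult_unit_right: "\<And>x. x \<in> carrier A \<Longrightarrow> psh_prod A x (psh_unit A 1) = x"
    and comult_coassoc: "\<And>x. x \<in> carrier A \<Longrightarrow>
      tensor_assoc (tensor_map (tensor A A) A (psh_comult A) (\<lambda>y. y) (psh_comult A x)) =
      tensor_map A (tensor A A) (\<lambda>y. y) (psh_comult A) (psh_comult A x)"
    and counit_left: "\<And>x. x \<in> carrier A \<Longrightarrow>
      zlift A (\<lambda>(y, z). z [^] psh_counit A y) (psh_comult A x) = x"
    and counit_right: "\<And>x. x \<in> carrier A \<Longrightarrow>
      zlift A (\<lambda>(y, z). y [^] psh_counit A z) (psh_comult A x) = x"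
    and comult_mult: "\<And>x y. \<lbrakk>x \<in> carrier A; y \<in> carrier A\<rbrakk> \<Longrightarrow>
      psh_comult A (psh_prod A x y) =
      frag_extend (\<lambda>(x1, x2). frag_extend (\<lambda>(y1, y2).
        tens A A (psh_prod A x1 y1) (psh_prod A x2 y2)) (psh_comult A y)) (psh_comult A x)"
    and comult_unit: "psh_comult A (psh_unit A 1) = tens A A (psh_unit A 1) (psh_unit A 1)"
    and counit_mult: "\<And>x y. \<lbrakk>x \<in> carrier A; y \<in> carrier A\<rbrakk> \<Longrightarrow>
      psh_counit A (psh_prod A x y) = psh_counit A x * psh_counit A y"
    and counit_unit: "psh_counit A (psh_unit A 1) = 1"
    and antipode: "\<exists>T. T \<in> hom A A \<and> graded_map A A T \<and>
      (\<forall>x\<in>carrier A.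
        psh_mult A (tensor_map A A T (\<lambda>y. y) (psh_comult A x)) = psh_unit A (psh_counit A x) \<and>
        psh_mult A (tensor_map A A (\<lambda>y. y) T (psh_comult A x)) = psh_unit A (psh_counit A x))"
    and connected: "\<And>z. psh_counit A (psh_unit A z) = z"
      "\<And>x. x \<in> grade A 0 \<Longrightarrow> psh_unit A (psh_counit A x) = x"
    and mult_positive: "positive_map (tensor A A) A (psh_mult A)"
    and comult_positive: "positive_map A (tensor A A) (psh_comult A)"
    and unit_positive: "positive_map int_tgroup A (psh_unit A)"
    and counit_positive: "positive_map A int_tgroup (psh_counit A)"
    and mult_comult_adjoint: "adjoint_maps (tensor A A) A (psh_mult A) (psh_comult A)"
    and unit_counit_adjoint: "adjoint_maps int_tgroup A (psh_unit A) (psh_counit A)"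

text \<open>
  The \<open>k\<close>-fold tensor power is the free abelian group on lists of irreducibles of length \<open>k\<close>.
  \<open>iter_mult A\<close> gives the value of the iterated multiplication on such a list, and
  \<open>iter_comult A k\<close> is the iterated comultiplication into the \<open>k\<close>-fold tensor power.
\<close>

fun iter_mult :: "('a, 'm) psh_scheme \<Rightarrow> 'a list \<Rightarrow> 'a" where
  "iter_mult A [] = psh_unit A 1"
| "iter_mult A [x] = x"
| "iter_mult A (x # y # zs) = psh_prod A x (iter_mult A (y # zs))"

fun iter_comult :: "('a, 'm) psh_scheme \<Rightarrow> nat \<Rightarrow> 'a \<Rightarrow> ('a list \<Rightarrow>\<^sub>0 int)" where
  "iter_comult A 0 x = frag_cmul (psh_counit A x) (frag_of [])"
| "iter_comult A (Suc 0) x = frag_extend (\<lambda>w. frag_of [w]) (coords A x)"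
| "iter_comult A (Suc (Suc k)) x =
     frag_extend (\<lambda>(y, z). frag_extend (\<lambda>ws. frag_of (y # ws)) (iter_comult A (Suc k) z))
       (psh_comult A x)"

definition psh_Psi :: "('a, 'm) psh_scheme \<Rightarrow> nat \<Rightarrow> 'a \<Rightarrow> 'a" where
  "psh_Psi A k x =
     (if k = 0 then psh_unit A (psh_counit A x) else zlift A (iter_mult A) (iter_comult A k x))"

locale psh_module = A: psh_algebra A + M: graded_tgroup M
  for k :: nat
    and A :: "('a, 'm) psh_scheme"
    and M :: "('b, 'n) graded_tgroup_scheme"
    and act :: "('a \<times> 'b \<Rightarrow>\<^sub>0 int) \<Rightarrow> 'b"
    and coact :: "'b \<Rightarrow> ('a \<times> 'b \<Rightarrow>\<^sub>0 int)" +
  assumes act_hom: "act \<in> hom (tensor A M) M"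
    and coact_hom: "coact \<in> hom M (tensor A M)"
    and act_graded: "graded_map (tensor A M) M act"
    and coact_graded: "graded_map M (tensor A M) coact"
    and act_positive: "positive_map (tensor A M) M act"
    and coact_positive: "positive_map M (tensor A M) coact"
    and act_coact_adjoint: "adjoint_maps (tensor A M) M act coact"
    and act_assoc: "\<And>a b x. \<lbrakk>a \<in> carrier A; b \<in> carrier A; x \<in> carrier M\<rbrakk> \<Longrightarrow>
      act (tens A M a (act (tens A M b x))) = act (tens A M (psh_prod A a b) x)"
    and coact_coassoc: "\<And>x. x \<in> carrier M \<Longrightarrow>
      tensor_assoc (tensor_map (tensor A A) M (psh_comult A) (\<lambda>y. y) (coact x)) =
      tensor_map A (tensor A M) (\<lambda>a. a) coact (coact x)"
    and act_unit: "\<And>z x. x \<in> carrier M \<Longrightarrow>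
      act (tens A M (psh_unit A z) x) = x [^]\<^bsub>M\<^esub> z"
    and coact_counit: "\<And>x. x \<in> carrier M \<Longrightarrow>
      zlift M (\<lambda>(a, y). y [^]\<^bsub>M\<^esub> psh_counit A a) (coact x) = x"
    and k_hopf: "\<And>h x. \<lbrakk>h \<in> carrier A; x \<in> carrier M\<rbrakk> \<Longrightarrow>
      coact (act (tens A M h x)) =
      frag_extend (\<lambda>(h1, h2). frag_extend (\<lambda>(x1, x2).
        tens A M (psh_prod A (psh_Psi A k h1) x1) (act (tens A M h2 x2)))
        (coact x)) (psh_comult A h)"


section \<open>Complex matrix representations\<close>

definition rep_deg :: "('x, 'm) monoid_scheme \<Rightarrow> ('x \<Rightarrow> complex mat) \<Rightarrow> nat" where
  "rep_deg X \<rho> = dim_row (\<rho> \<one>\<^bsub>X\<^esub>)"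

definition is_rep :: "('x, 'm) monoid_scheme \<Rightarrow> ('x \<Rightarrow> complex mat) \<Rightarrow> bool" where
  "is_rep X \<rho> \<longleftrightarrow>
     (\<forall>g\<in>carrier X. \<rho> g \<in> carrier_mat (rep_deg X \<rho>) (rep_deg X \<rho>)) \<and>
     \<rho> \<one>\<^bsub>X\<^esub> = 1\<^sub>m (rep_deg X \<rho>) \<and>
     (\<forall>g\<in>carrier X. \<forall>h\<in>carrier X. \<rho> (g \<otimes>\<^bsub>X\<^esub> h) = \<rho> g * \<rho> h)"

definition irreducible_rep :: "('x, 'm) monoid_scheme \<Rightarrow> ('x \<Rightarrow> complex mat) \<Rightarrow> bool" where
  "irreducible_rep X \<rho> \<longleftrightarrow> is_rep X \<rho> \<and> rep_deg X \<rho> \<noteq> 0 \<and>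
     (\<forall>W. W \<subseteq> carrier_vec (rep_deg X \<rho>) \<and> 0\<^sub>v (rep_deg X \<rho>) \<in> W \<and>
          (\<forall>v\<in>W. \<forall>w\<in>W. v + w \<in> W) \<and> (\<forall>c. \<forall>v\<in>W. c \<cdot>\<^sub>v v \<in> W) \<and>
          (\<forall>g\<in>carrier X. \<forall>v\<in>W. \<rho> g *\<^sub>v v \<in> W)
        \<longrightarrow> W = {0\<^sub>v (rep_deg X \<rho>)} \<or> W = carrier_vec (rep_deg X \<rho>))"

definition intertwiners ::
    "('x, 'm) monoid_scheme \<Rightarrow> ('x \<Rightarrow> complex mat) \<Rightarrow> ('x \<Rightarrow> complex mat) \<Rightarrow> complex mat set" where
  "intertwiners X \<rho> \<sigma> =
     {P \<in> carrier_mat (rep_deg X \<sigma>) (rep_deg X \<rho>). \<forall>g\<in>carrier X. P * \<rho> g = \<sigma> g * P}"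

text \<open>There is an exact sequence \<open>0 \<rightarrow> \<rho> \<rightarrow> \<sigma> \<rightarrow> \<tau> \<rightarrow> 0\<close>.\<close>

definition exact_reps ::
    "('x, 'm) monoid_scheme \<Rightarrow> ('x \<Rightarrow> complex mat) \<Rightarrow> ('x \<Rightarrow> complex mat) \<Rightarrow> ('x \<Rightarrow> complex mat) \<Rightarrow> bool"
  where
  "exact_reps X \<rho> \<sigma> \<tau> \<longleftrightarrow> is_rep X \<rho> \<and> is_rep X \<sigma> \<and> is_rep X \<tau> \<and>
     (\<exists>P\<in>intertwiners X \<rho> \<sigma>. \<exists>Q\<in>intertwiners X \<sigma> \<tau>.
        inj_on ((*\<^sub>v) P) (carrier_vec (rep_deg X \<rho>)) \<and>
        (*\<^sub>v) P ` carrier_vec (rep_deg X \<rho>) = mat_kernel Q \<and>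
        (*\<^sub>v) Q ` carrier_vec (rep_deg X \<sigma>) = carrier_vec (rep_deg X \<tau>))"

definition kron :: "complex mat \<Rightarrow> complex mat \<Rightarrow> complex mat" where
  "kron P Q = mat (dim_row P * dim_row Q) (dim_col P * dim_col Q)
     (\<lambda>(i, j). P $$ (i div dim_row Q, j div dim_col Q) * Q $$ (i mod dim_row Q, j mod dim_col Q))"

definition outer_rep ::
    "('x \<Rightarrow> complex mat) \<Rightarrow> ('y \<Rightarrow> complex mat) \<Rightarrow> ('x \<times> 'y \<Rightarrow> complex mat)" where
  "outer_rep \<sigma> \<tau> = (\<lambda>(x, y). kron (\<sigma> x) (\<tau> y))"

text \<open>
  Induction from \<open>K\<close> to \<open>X\<close> along an injective homomorphism \<open>\<iota>\<close>, with respect to a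
  transversal \<open>t\<close> of the left cosets of the image: the \<open>(i, j)\<close> block of \<open>g\<close> is
  \<open>\<sigma> (t\<^sub>i\<inverse> g t\<^sub>j)\<close> if \<open>t\<^sub>i\<inverse> g t\<^sub>j\<close> lies in the image and zero otherwise.  Up to isomorphism this
  does not depend on the transversal.
\<close>

definition left_transversal :: "('x, 'm) monoid_scheme \<Rightarrow> 'x set \<Rightarrow> 'x list" where
  "left_transversal X U = (SOME ts. distinct ts \<and> set ts \<subseteq> carrier X \<and>
     (\<forall>g\<in>carrier X. \<exists>!t. t \<in> set ts \<and> g \<in> t <#\<^bsub>X\<^esub> U))"

definition ind_rep ::
    "('x, 'm) monoid_scheme \<Rightarrow> ('y, 'n) monoid_scheme \<Rightarrow> ('y \<Rightarrow> 'x)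
     \<Rightarrow> ('y \<Rightarrow> complex mat) \<Rightarrow> ('x \<Rightarrow> complex mat)" where
  "ind_rep X K \<iota> \<sigma> g =
    (let ts = left_transversal X (\<iota> ` carrier K); d = rep_deg K \<sigma> in
     mat (length ts * d) (length ts * d) (\<lambda>(i, j).
       (let x = inv\<^bsub>X\<^esub> (ts ! (i div d)) \<otimes>\<^bsub>X\<^esub> g \<otimes>\<^bsub>X\<^esub> (ts ! (j div d)) in
        (if x \<in> \<iota> ` carrier K
         then \<sigma> (inv_into (carrier K) \<iota> x) $$ (i mod d, j mod d) else 0))))"

definition res_rep :: "('y \<Rightarrow> 'x) \<Rightarrow> ('x \<Rightarrow> complex mat) \<Rightarrow> ('y \<Rightarrow> complex mat)" where
  "res_rep \<iota> \<rho> = (\<lambda>y. \<rho> (\<iota> y))"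


section \<open>Grothendieck groups\<close>

abbreviation free_reps :: "('x, 'm) monoid_scheme \<Rightarrow> (('x \<Rightarrow> complex mat) \<Rightarrow>\<^sub>0 int) monoid" where
  "free_reps X \<equiv> free_Abelian_group {\<rho>. is_rep X \<rho>}"

definition K0_rel :: "('x, 'm) monoid_scheme \<Rightarrow> (('x \<Rightarrow> complex mat) \<Rightarrow>\<^sub>0 int) set" where
  "K0_rel X = generate (free_reps X)
     {frag_of \<sigma> - frag_of \<rho> - frag_of \<tau> | \<rho> \<sigma> \<tau>. exact_reps X \<rho> \<sigma> \<tau>}"

type_synonym 'x k0 = "(('x \<Rightarrow> complex mat) \<Rightarrow>\<^sub>0 int) set"

definition K0_class :: "('x, 'm) monoid_scheme \<Rightarrow> (('x \<Rightarrow> complex mat) \<Rightarrow>\<^sub>0 int) \<Rightarrow> 'x k0" where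
  "K0_class X c = K0_rel X #>\<^bsub>free_reps X\<^esub> c"

definition K0 :: "('x, 'm) monoid_scheme \<Rightarrow> 'x k0 tgroup" where
  "K0 X = \<lparr>carrier = carrier (free_reps X Mod K0_rel X),
           monoid.mult = monoid.mult (free_reps X Mod K0_rel X),
           one = one (free_reps X Mod K0_rel X),
           irr = {K0_class X (frag_of \<rho>) | \<rho>. irreducible_rep X \<rho>}\<rparr>"

text \<open>The map of Grothendieck groups induced by an exact functor, given on objects.\<close>

definition K0_map ::
    "('x, 'm) monoid_scheme \<Rightarrow> ('y, 'n) monoid_scheme
     \<Rightarrow> (('x \<Rightarrow> complex mat) \<Rightarrow> ('y \<Rightarrow> complex mat)) \<Rightarrow> 'x k0 \<Rightarrow> 'y k0" where
  "K0_map X Y F C = the_elem ((\<lambda>c. K0_class Y (frag_extend (\<lambda>\<rho>. frag_of (F \<rho>)) c)) ` C)"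

text \<open>
  The bilinear map sending the classes of \<open>\<sigma>\<close> and \<open>\<tau>\<close> to the class of the outer tensor product,
  and the inverse of the resulting isomorphism from \<open>K0 X \<otimes> K0 Y\<close> to \<open>K0 (X \<times>\<times> Y)\<close>.
\<close>

definition K0_outer ::
    "('x, 'm) monoid_scheme \<Rightarrow> ('y, 'n) monoid_scheme \<Rightarrow> 'x k0 \<Rightarrow> 'y k0 \<Rightarrow> ('x \<times> 'y) k0" where
  "K0_outer X Y C D = the_elem ((\<lambda>(c, d). K0_class (X \<times>\<times> Y)
     (frag_extend (\<lambda>\<sigma>. frag_extend (\<lambda>\<tau>. frag_of (outer_rep \<sigma> \<tau>)) d) c)) ` (C \<times> D))"

definition K0_split ::
    "('x, 'm) monoid_scheme \<Rightarrow> ('y, 'n) monoid_scheme \<Rightarrow> ('x \<times> 'y) k0 \<Rightarrow> ('x k0 \<times> 'y k0 \<Rightarrow>\<^sub>0 int)"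
  where
  "K0_split X Y = inv_into (carrier (free_Abelian_group (irr (K0 X) \<times> irr (K0 Y))))
     (zlift (K0 (X \<times>\<times> Y)) (\<lambda>(C, D). K0_outer X Y C D))"


section \<open>Wreath products and their representations\<close>

text \<open>
  The pair \<open>(p, f)\<close> is \<open>f\<cdot>p\<close> in the semidirect product, where \<open>p\<close> acts on tuples from the left by
  \<open>(p\<cdot>f) i = f (p\<inverse> i)\<close>.
\<close>

type_synonym 'g wreath = "(nat \<Rightarrow> nat) \<times> (nat \<Rightarrow> 'g)"

definition wreath :: "nat \<Rightarrow> ('g, 'm) monoid_scheme \<Rightarrow> 'g wreath monoid" where
  "wreath n G =
    \<lparr>carrier = carrier (sym_group n) \<times> carrier (product_group {1..n} (\<lambda>_. G)),
     monoid.mult = (\<lambda>(p, f) (q, g).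
       (p \<circ> q, \<lambda>i\<in>{1..n}. f i \<otimes>\<^bsub>G\<^esub> g (inv_into UNIV p i))),
     one = (id, \<lambda>i\<in>{1..n}. \<one>\<^bsub>G\<^esub>)\<rparr>"

text \<open>The inclusion of the product of the \<open>k\<close>-th and \<open>l\<close>-th wreath products in the \<open>(k + l)\<close>-th.\<close>

definition wreath_emb :: "nat \<Rightarrow> nat \<Rightarrow> 'g wreath \<times> 'g wreath \<Rightarrow> 'g wreath" where
  "wreath_emb k l = (\<lambda>((p, f), (q, g)).
     ((\<lambda>i. if i \<le> k then p i else q (i - k) + k),
      (\<lambda>i\<in>{1..k + l}. if i \<le> k then f i else g (i - k))))"

type_synonym 'g repgrp = "nat \<Rightarrow> 'g wreath k0"

definition R_inj :: "('g, 'm) monoid_scheme \<Rightarrow> nat \<Rightarrow> 'g wreath k0 \<Rightarrow> 'g repgrp" where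
  "R_inj G n C = (\<lambda>m. if m = n then C else \<one>\<^bsub>K0 (wreath m G)\<^esub>)"

text \<open>
  The degree zero part is the Grothendieck group of the trivial group \<open>wreath 0 G\<close>, identified
  with \<open>\<int>\<close> by \<open>R_unit\<close> below.
\<close>

definition R_group :: "('g, 'm) monoid_scheme \<Rightarrow> 'g repgrp graded_tgroup" where
  "R_group G =
    (let S = sum_group UNIV (\<lambda>n. K0 (wreath n G)) in
     \<lparr>carrier = carrier S, monoid.mult = monoid.mult S, one = one S,
      irr = (\<Union>n. R_inj G n ` irr (K0 (wreath n G))),
      grade = (\<lambda>n. R_inj G n ` carrier (K0 (wreath n G)))\<rparr>)"

text \<open>
  In the following two maps \<open>K\<close> is a subgroup of \<open>G\<close> regarded as a group.  On irreducibles \<open>x\<close> of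
  \<open>R(K)\<close> and \<open>y\<close> of \<open>R(G)\<close> (in fact on all elements), the degree \<open>n\<close> part of \<open>x\<cdot>y\<close> is the sum over
  \<open>k \<le> n\<close> of the inductions of the outer products of the parts of degrees \<open>k\<close> and \<open>n - k\<close>.
\<close>

definition ind_map ::
    "('g, 'm) monoid_scheme \<Rightarrow> ('g, 'n) monoid_scheme \<Rightarrow> ('g repgrp \<times> 'g repgrp \<Rightarrow>\<^sub>0 int) \<Rightarrow> 'g repgrp" where
  "ind_map K G = zlift (R_group G) (\<lambda>(x, y) n.
     finprod (K0 (wreath n G)) (\<lambda>k.
       K0_map (wreath k K \<times>\<times> wreath (n - k) G) (wreath n G)
         (ind_rep (wreath n G) (wreath k K \<times>\<times> wreath (n - k) G) (wreath_emb k (n - k)))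
         (K0_outer (wreath k K) (wreath (n - k) G) (x k) (y (n - k)))) {..n})"

definition res_map ::
    "('g, 'm) monoid_scheme \<Rightarrow> ('g, 'n) monoid_scheme \<Rightarrow> 'g repgrp \<Rightarrow> ('g repgrp \<times> 'g repgrp \<Rightarrow>\<^sub>0 int)" where
  "res_map K G x = (\<Sum>n | x n \<noteq> \<one>\<^bsub>K0 (wreath n G)\<^esub>. \<Sum>k\<le>n.
     frag_extend (\<lambda>(C, D). frag_of (R_inj K k C, R_inj G (n - k) D))
       (K0_split (wreath k K) (wreath (n - k) G)
         (K0_map (wreath n G) (wreath k K \<times>\<times> wreath (n - k) G)
           (res_rep (wreath_emb k (n - k))) (x n))))"

definition R_unit :: "('g, 'm) monoid_scheme \<Rightarrow> int \<Rightarrow> 'g repgrp" where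
  "R_unit G z = R_inj G 0
     (K0_class (wreath 0 G) (frag_of (\<lambda>_. 1\<^sub>m 1)) [^]\<^bsub>K0 (wreath 0 G)\<^esub> z)"

definition R_counit :: "('g, 'm) monoid_scheme \<Rightarrow> 'g repgrp \<Rightarrow> int" where
  "R_counit G x = inv_into UNIV (R_unit G) (R_inj G 0 (x 0))"

definition R_psh :: "('g, 'm) monoid_scheme \<Rightarrow> 'g repgrp psh" where
  "R_psh G = graded_tgroup.extend (R_group G)
     (psh.fields (ind_map G G) (res_map G G) (R_unit G) (R_counit G))"

end

theory Submission
 imports Defs "Jordan_Normal_Form.Char_Poly" "HOL-Computational_Algebra.Fundamental_Theorem_Algebra"
begin

text \<open>
 Characters separate the elements of the Grothendieck groups, so every axiom becomes an identity
 of class functions.  A conjugacy class of a wreath product is given by a finite set \<open>V\<close>, a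
 permutation \<open>r\<close> of \<open>V\<close> and labels \<open>d j\<close> in \<open>G\<close>, up to gauge equivalence, and \<open>hat x V r d\<close> is the
 value of \<open>x\<close> there.  Restriction to a product of wreath products is evaluation at a disjoint union.
 Induction from \<open>H\<close> to \<open>G\<close> is the sum over the \<open>r\<close>-stable subsets \<open>S\<close> of \<open>V\<close> and the labellings of \<open>S\<close>
 by cosets of \<open>H\<close> that bring \<open>d\<close> into \<open>H\<close>.  If \<open>d\<close> already lies in \<open>H\<close> on \<open>S\<close>, normality forces
 such a labelling to be constant on cycles, and the assumption on inner automorphisms says that the
 labelling does not change the value.  The number of these labellings, \<open>[G:H]\<close> to the number of
 cycles of \<open>S\<close>, is the scalar by which \<open>\<Psi>\<close> of index \<open>[G:H]\<close> acts, which gives the Hopf axiom.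
 Adjointness is Frobenius reciprocity, and positivity holds because induction preserves
 representations.  The case \<open>H = G\<close> gives the bialgebra axioms of \<open>R(G)\<close>.
\<close>

section \<open>Linear evaluation and T-groups\<close>

text \<open>Phrased with subgroups, the Hopf axiom is a Mackey formula over double cosets of wreath
  products, with shuffle permutations everywhere. Points on arbitrary finite sets avoid both: block
  sums become disjoint unions, and a stable subset of \<open>V1 \<union> V2\<close> is a pair of
  stable subsets, which is the whole combinatorial content of the bialgebra identity. Iterating,
  \<Psi> of index \<open>k\<close> sums over ordered decompositions of \<open>V\<close> into
  \<open>k\<close> stable parts, that is over colourings with \<open>k\<close> colours that are
  constant on cycles. Where the labels lie in \<open>H\<close>, the coset labellings met in an
  induction are colourings of this kind by the cosets of \<open>H\<close>, which is where
  \<open>k = [G:H]\<close> comes from. Since \<open>K0\<close> is a quotient of the free group on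
  all matrix representations, character theory is developed from exact sequences: traces are
  additive on them, and Schur's lemma turns this into a basis of irreducibles. The antipode is a
  convolution inverse whose scalars at points must come from an operator on the lattice; it is
  therefore built from the identity and the unit and counit, one size of point sets after the
  other.\<close>

abbreviation "keys \<equiv> Poly_Mapping.keys"
abbreviation "lookup \<equiv> Poly_Mapping.lookup"
abbreviation "KW n G \<equiv> K0 (wreath n G)"

text \<open>The target is an arbitrary commutative ring because the same evaluation serves integer
  coordinates and complex character values; \<open>lin_of_int\<close> passes between the
  two.\<close>

definition lin :: "('a \<Rightarrow>\<^sub>0 int) => ('a => 'b::comm_ring_1) => 'b" where
 "lin c u = (\<Sum>b\<in>keys c. of_int (lookup c b) * u b)"

lemma lin_superset:
 "finite S ==> keys c \<subseteq> S ==> lin c u = (\<Sum>b\<in>S. of_int (lookup c b) * u b)"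
 unfolding lin_def by (rule sum.mono_neutral_left) (auto simp: in_keys_iff)

lemma lin_0 [simp]: "lin 0 u = 0"
 by (simp add: lin_def)

lemma lin_of [simp]: "lin (frag_of b) u = u b"
 by (simp add: lin_def keys_frag_of)

lemma lin_add: "lin (c + d) u = lin c u + lin d u"
proof -
 let ?S = "keys c \<union> keys d"
 have "lin (c + d) u = (\<Sum>b\<in>?S. of_int (lookup (c + d) b) * u b)"
  by (rule lin_superset) (auto simp: keys_add dest: subsetD[OF keys_add])
 also have "... = (\<Sum>b\<in>?S. of_int (lookup c b) * u b) + (\<Sum>b\<in>?S. of_int (lookup d b) * u b)"
  by (simp add: lookup_add distrib_right sum.distrib)
 also have "... = lin c u + lin d u"
  by (simp add: lin_superset[of ?S])
 finally show ?thesis .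
qed

lemma lin_uminus: "lin (- c) u = - lin c u"
 by (simp add: lin_def sum_negf)

lemma lin_diff: "lin (c - d) u = lin c u - lin d u"
 using lin_add[of c "- d" u] by (simp add: lin_uminus)

lemma lin_cmul: "lin (frag_cmul z c) u = of_int z * lin c u"
proof -
 have "lin (frag_cmul z c) u = (\<Sum>b\<in>keys c. of_int (lookup (frag_cmul z c) b) * u b)"
  by (rule lin_superset) (auto simp: keys_cmul)
 then show ?thesis
  by (simp add: lin_def sum_distrib_left mult.assoc)
qed

lemma lin_sum: "lin (sum c I) u = (\<Sum>i\<in>I. lin (c i) u)"
 by (induction I rule: infinite_finite_induct) (auto simp: lin_add)

lemma lin_extend: "lin (frag_extend f c) u = lin c (%b. lin (f b) u)"
 by (simp add: frag_extend_def lin_sum lin_cmul lin_def[of c])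

lemma lin_cong: "(!!b. b \<in> keys c ==> u b = v b) ==> lin c u = lin c v"
 by (simp add: lin_def)

lemma lin_zero [simp]: "lin c (%b. 0) = 0"
 by (simp add: lin_def)

lemma lin_fun_add: "lin c (%b. u b + v b) = lin c u + lin c v"
 by (simp add: lin_def distrib_left sum.distrib)

lemma lin_fun_sum: "lin c (%b. \<Sum>i\<in>I. u i b) = (\<Sum>i\<in>I. lin c (u i))"
 by (induction I rule: infinite_finite_induct) (auto simp: lin_fun_add)

lemma lin_mult_left: "lin c (%b. a * u b) = a * lin c u"
 by (simp add: lin_def sum_distrib_left mult.left_commute)

lemma lin_mult_right: "lin c (%b. u b * a) = lin c u * a"
 by (simp add: lin_def sum_distrib_right mult.assoc)

lemma lin_swap: "lin c (%a. lin d (%b. u a b)) = lin d (%b. lin c (%a. u a b))"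
 unfolding lin_def sum_distrib_left by (subst sum.swap) (simp add: mult.left_commute)

lemma lin_of_int: "lin c (%b. of_int (u b)) = of_int (lin c u)"
 by (simp add: lin_def)


lemma lookup_frag_sum: "lookup (sum c I) p = (\<Sum>i\<in>I. lookup (c i) p)"
 by (induction I rule: infinite_finite_induct) (auto simp: lookup_add)

lemma lookup_frag_extend: "lookup (frag_extend f c) p = lin c (%b. lookup (f b) p)"
 by (simp add: frag_extend_def lookup_frag_sum lin_def)

text \<open>A coefficient is itself a linear evaluation, so the exchange and extension rules for
  \<open>lin\<close> also apply to coordinates.\<close>

lemma lookup_eq_lin: "lookup c p = lin c (%q. if q = p then 1 else 0)"
proof (cases "p \<in> keys c")
 case False
 then have "lin c (%q. if q = p then 1 else 0) = lin c (%q. 0 :: int)"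
  by (intro lin_cong) auto
 with False show ?thesis by (simp add: in_keys_iff)
next
 case True
 then show ?thesis
  by (simp add: lin_def if_distrib[of "%x. _ * x"] cong: if_cong)
qed

lemma keys_sum_subset:
 "(!!i. i \<in> I ==> keys (c i) \<subseteq> S) ==> keys (sum c I) \<subseteq> S"
 using keys_sum[of c I] by blast

lemma keys_frag_extend_subset:
 "(!!b. b \<in> keys c ==> keys (f b) \<subseteq> S) ==> keys (frag_extend f c) \<subseteq> S"
 using keys_frag_extend[of f c] by blast

section \<open>Additive functions on abelian groups, and coordinates in T-groups\<close>

definition add_fun :: "('a, 'm) monoid_scheme => ('a => 'b::comm_ring_1) => bool" where
 "add_fun M e \<longleftrightarrow> (\<forall>x\<in>carrier M. \<forall>y\<in>carrier M. e (x \<otimes>\<^bsub>M\<^esub> y) = e x + e y)"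

lemma add_funI: "(!!x y. x \<in> carrier M ==> y \<in> carrier M ==> e (x \<otimes>\<^bsub>M\<^esub> y) = e x + e y) ==> add_fun M e"
 by (simp add: add_fun_def)

lemma add_fun_mult: "add_fun M e ==> x \<in> carrier M ==> y \<in> carrier M ==> e (x \<otimes>\<^bsub>M\<^esub> y) = e x + e y"
 by (simp add: add_fun_def)


lemma add_fun_sum: "(!!i. i \<in> I ==> add_fun M (%x. e i x)) ==> add_fun M (%x. \<Sum>i\<in>I. e i x)"
 by (simp add: add_fun_def sum.distrib)

lemma add_fun_mult_left: "add_fun M e ==> add_fun M (%x. a * e x)"
 by (simp add: add_fun_def distrib_left)

context group begin

lemma add_fun_one: assumes "add_fun G e" shows "e \<one> = 0"
 using add_fun_mult[OF assms, of \<one> \<one>] by simp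

lemma add_fun_inv: assumes "add_fun G e" "x \<in> carrier G" shows "e (inv x) = - e x"
 using add_fun_mult[OF assms(1), of x "inv x"] add_fun_one[OF assms(1)] assms(2)
 by (simp add: eq_neg_iff_add_eq_0 add.commute)

lemma add_fun_nat_pow: assumes "add_fun G e" "x \<in> carrier G" shows "e (x [^] (n::nat)) = of_nat n * e x"
 by (induction n) (auto simp: add_fun_mult[OF assms(1)] add_fun_one[OF assms(1)] assms algebra_simps)

lemma add_fun_int_pow: assumes "add_fun G e" "x \<in> carrier G" shows "e (x [^] (z::int)) = of_int z * e x"
proof (cases z rule: int_cases2)
 case (nonneg n)
 then show ?thesis using add_fun_nat_pow[OF assms] by (simp add: int_pow_int)
next
 case (nonpos n)
 then show ?thesis using add_fun_nat_pow[OF assms] assms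
  by (simp add: int_pow_neg int_pow_int add_fun_inv[OF assms(1)])
qed

end

context comm_group begin

lemma add_fun_finprod:
 assumes "add_fun G e" "f \<in> A \<rightarrow> carrier G"
 shows "e (finprod G f A) = (\<Sum>i\<in>A. e (f i))"
 using assms(2)
 by (induction A rule: infinite_finite_induct)
  (auto simp: add_fun_one[OF assms(1)] add_fun_mult[OF assms(1)] Pi_def)

lemma zlift_superset:
 assumes "finite S" "keys c \<subseteq> S" "!!b. b \<in> S ==> f b \<in> carrier G"
 shows "zlift G f c = finprod G (%b. f b [^] lookup c b) S"
 unfolding zlift_def
 by (rule finprod_mono_neutral_cong_left) (use assms in \<open>auto simp: in_keys_iff\<close>)

lemma zlift_closed: "(!!b. b \<in> keys c ==> f b \<in> carrier G) ==> zlift G f c \<in> carrier G"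
 unfolding zlift_def by (rule finprod_closed) auto

lemma zlift_add:
 assumes "!!b. b \<in> keys c \<union> keys d ==> f b \<in> carrier G"
 shows "zlift G f (c + d) = zlift G f c \<otimes> zlift G f d"
proof -
 let ?S = "keys c \<union> keys d"
 have "zlift G f (c + d) = finprod G (%b. f b [^] lookup (c + d) b) ?S"
  by (rule zlift_superset) (use assms keys_add[of c d] in auto)
 also have "... = finprod G (%b. f b [^] lookup c b \<otimes> f b [^] lookup d b) ?S"
  using assms by (intro finprod_cong') (auto simp: lookup_add int_pow_mult)
 also have "... = zlift G f c \<otimes> zlift G f d"
 proof -
  have "zlift G f c = finprod G (%b. f b [^] lookup c b) ?S"
   "zlift G f d = finprod G (%b. f b [^] lookup d b) ?S"
   by (rule zlift_superset; use assms in auto)+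
  then show ?thesis
   using assms by (subst finprod_multf) auto
 qed
 finally show ?thesis .
qed

lemma zlift_zero [simp]: "zlift G f 0 = \<one>"
 by (simp add: zlift_def)

lemma zlift_of: "f b \<in> carrier G ==> zlift G f (frag_of b) = f b"
 by (simp add: zlift_def keys_frag_of int_pow_1)


text \<open>Converts an identity in a multiplicatively written abelian group into one about sums of
  numbers. Character values and coordinates enter the proof as such additive functions.\<close>

lemma add_fun_zlift:
 assumes "add_fun G e" "!!b. b \<in> keys c ==> f b \<in> carrier G"
 shows "e (zlift G f c) = lin c (%b. e (f b))"
 unfolding zlift_def lin_def
 by (subst add_fun_finprod[OF assms(1)]) (use assms in \<open>auto simp: add_fun_int_pow\<close>)


end

text \<open>\<open>d w\<close> is a candidate, given by a formula, for the coordinate at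
  \<open>w\<close>. For representations it will be a scalar product of characters, the multiplicity
  of \<open>w\<close>.\<close>

definition dual_system :: "('a, 'm) tgroup_scheme => ('a => 'a => complex) => bool" where
 "dual_system M d \<longleftrightarrow> (\<forall>w\<in>irr M. add_fun M (d w) & (\<forall>v\<in>irr M. d w v = (if v = w then 1 else 0)))"

lemma lookup_eq_lin_dual:
 assumes "dual_system M d" "keys c \<subseteq> irr M" "w \<in> irr M"
 shows "of_int (lookup c w) = lin c (d w)"
proof -
 have "lin c (d w) = lin c (%v. of_int (if v = w then 1 else 0))"
  using assms by (intro lin_cong) (auto simp: dual_system_def subset_iff)
 then show ?thesis
  by (subst lookup_eq_lin) (simp add: lin_of_int)
qed

text \<open>The functionals \<open>d w\<close> read the coefficients off a linear combination of
  irreducibles, which gives uniqueness; \<open>span\<close> gives existence.\<close>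

lemma tgroup_dualI:
 fixes M :: "('a, 'm) tgroup_scheme" (structure)
 assumes M: "comm_group M" and irr: "irr M \<subseteq> carrier M" and d: "dual_system M d"
  and span: "!!x. x \<in> carrier M ==> \<exists>c. keys c \<subseteq> irr M & zlift M (%x. x) c = x"
 shows "tgroup M"
proof -
 interpret comm_group M by fact
 show ?thesis
 proof (unfold_locales)
  show "bij_betw (zlift M (%x. x)) (carrier (free_Abelian_group (irr M))) (carrier M)"
   unfolding bij_betw_def
  proof
   show "inj_on (zlift M (%x. x)) (carrier (free_Abelian_group (irr M)))"
   proof (rule inj_onI, rule poly_mapping_eqI)
    fix c c' w
    assume *: "c \<in> carrier (free_Abelian_group (irr M))" "c' \<in> carrier (free_Abelian_group (irr M))"
     "zlift M (%x. x) c = zlift M (%x. x) c'"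
    show "lookup c w = lookup c' w"
    proof (cases "w \<in> irr M")
     case True
     have e: "add_fun M (d w)" using d True by (simp add: dual_system_def)
     have "(of_int (lookup c w) :: complex) = d w (zlift M (%x. x) c)"
      using * True irr by (subst add_fun_zlift[OF e]) (auto simp: lookup_eq_lin_dual[OF d])
     also have "... = of_int (lookup c' w)"
      using * True irr unfolding *(3) by (subst add_fun_zlift[OF e]) (auto simp: lookup_eq_lin_dual[OF d])
     finally show ?thesis by simp
    next
     case False
     then show ?thesis using * by (auto simp: in_keys_iff subset_iff) metis
    qed
   qed
   show "zlift M (%x. x) ` carrier (free_Abelian_group (irr M)) = carrier M"
    using span irr by (force intro!: zlift_closed)
  qed
 qed (use irr in auto)
qed

context tgroup begin

lemma keys_coords: "x \<in> carrier M ==> keys (coords M x) \<subseteq> irr M"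
 using inv_into_into[of x "zlift M (%x. x)" "carrier (free_Abelian_group (irr M))"] irr_basis
 by (simp add: coords_def bij_betw_def)

lemma zlift_coords: "x \<in> carrier M ==> zlift M (%x. x) (coords M x) = x"
 unfolding coords_def by (rule f_inv_into_f) (use irr_basis in \<open>simp add: bij_betw_def\<close>)

lemma coords_unique: "keys c \<subseteq> irr M ==> coords M (zlift M (%x. x) c) = c"
 unfolding coords_def by (rule inv_into_f_f) (use irr_basis in \<open>auto simp: bij_betw_def\<close>)

lemma coords_irr: "w \<in> irr M ==> coords M w = frag_of w"
 using coords_unique[of "frag_of w"] irr_closed by (auto simp: keys_frag_of zlift_of)


lemma lin_coords:
 assumes "add_fun M e" "x \<in> carrier M"
 shows "lin (coords M x) e = e x"
proof -
 have "e (zlift M (%x. x) (coords M x)) = lin (coords M x) e"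
  using keys_coords[OF assms(2)] irr_closed by (intro add_fun_zlift[OF assms(1)]) auto
 then show ?thesis by (simp add: zlift_coords assms)
qed


lemma lookup_coords:
 assumes "dual_system M d" "x \<in> carrier M" "w \<in> irr M"
 shows "of_int (lookup (coords M x) w) = d w x"
 using assms lookup_eq_lin_dual[OF assms(1) keys_coords[OF assms(2)] assms(3)]
 by (subst (asm) lin_coords) (auto simp: dual_system_def)

lemma pairing_eq_lin: "of_int (pairing M x y) = lin (coords M x) (%w. of_int (lookup (coords M y) w))"
 by (simp add: pairing_def lin_def)

lemma pairing_commute: "pairing M x y = pairing M y x"
proof -
 have *: "pairing M x y = lin (coords M x) (%w. lin (coords M y) (%v. if v = w then 1 else 0))" for x y
  by (simp add: pairing_def lin_def[of "coords M x"] flip: lookup_eq_lin)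
 show ?thesis
  unfolding * by (subst lin_swap) (intro lin_cong, auto)
qed

lemma pairing_irr: "w \<in> irr M ==> pairing M x w = lookup (coords M x) w"
 by (subst pairing_commute) (simp add: pairing_def coords_irr keys_frag_of)

lemma positive_iff:
 "x \<in> positive M \<longleftrightarrow> x \<in> carrier M & (\<forall>w\<in>irr M. 0 \<le> lookup (coords M x) w)"
 by (simp add: positive_def pairing_irr)

end

text \<open>Each coordinate must be a finite combination of the functions \<open>E p\<close>. This
  survives tensor products, whereas mere injectivity does not: on pairs of integers
  \<open>x + y * sqrt 2\<close> is injective, but its tensor square kills every antisymmetric
  tensor.\<close>

definition separates :: "'p set => ('p => 'a => complex) => ('a, 'm) tgroup_scheme => bool" where
 "separates P E M \<longleftrightarrow> (\<forall>w\<in>irr M. \<exists>F a. finite F & F \<subseteq> P &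
   (\<forall>v\<in>irr M. (\<Sum>p\<in>F. a p * E p v) = (if v = w then 1 else 0)))"

lemma (in tgroup) separates_eq:
 assumes s: "separates P E M" and E: "!!p. p \<in> P ==> add_fun M (E p)"
  and x: "x \<in> carrier M" and y: "y \<in> carrier M" and eq: "!!p. p \<in> P ==> E p x = E p y"
 shows "x = y"
proof -
 have "coords M x = coords M y"
 proof (rule poly_mapping_eqI)
  fix w
  show "lookup (coords M x) w = lookup (coords M y) w"
  proof (cases "w \<in> irr M")
   case True
   then obtain F a where F: "finite F" "F \<subseteq> P" "!!v. v \<in> irr M ==> (\<Sum>p\<in>F. a p * E p v) = (if v = w then 1 else 0)"
    using s unfolding separates_def by metis
   have *: "of_int (lookup (coords M z) w) = (\<Sum>p\<in>F. a p * E p z)" if z: "z \<in> carrier M" for z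
   proof -
    have "(\<Sum>p\<in>F. a p * E p z) = lin (coords M z) (%v. \<Sum>p\<in>F. a p * E p v)"
     by (rule lin_coords[OF _ z, symmetric]) (use F E in \<open>auto intro!: add_fun_sum add_fun_mult_left\<close>)
    also have "... = lin (coords M z) (%v. of_int (if v = w then 1 else 0))"
     using keys_coords[OF z] F by (intro lin_cong) auto
    finally show ?thesis by (subst lookup_eq_lin) (simp add: lin_of_int)
   qed
   have "(of_int (lookup (coords M x) w) :: complex) = of_int (lookup (coords M y) w)"
    unfolding *[OF x] *[OF y] using F eq by (intro sum.cong) auto
   then show ?thesis by simp
  next
   case False
   then show ?thesis using keys_coords[OF x] keys_coords[OF y] by (auto simp: in_keys_iff subset_iff) metis
  qed
 qed
 then show ?thesis using zlift_coords x y by metis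
qed


subsection \<open>Tensor products\<close>

lemma carrier_tensor [simp]: "carrier (tensor M N) = {t. keys t \<subseteq> irr M \<times> irr N}"
 by (auto simp: tensor_def)

lemma mult_tensor [simp]: "x \<otimes>\<^bsub>tensor M N\<^esub> y = x + y"
 by (simp add: tensor_def)

lemma one_tensor [simp]: "\<one>\<^bsub>tensor M N\<^esub> = 0"
 by (simp add: tensor_def)

lemma irr_tensor [simp]: "irr (tensor M N) = frag_of ` (irr M \<times> irr N)"
 by (simp add: tensor_def)

lemma comm_group_tensor: "comm_group (tensor M N)"
proof -
 have "comm_group (free_Abelian_group (irr M \<times> irr N))"
  by (rule abelian_free_Abelian_group)
 then show ?thesis
  unfolding comm_group_def comm_monoid_def comm_monoid_axioms_def group_def group_axioms_def monoid_def Units_def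
  by (auto simp: tensor_def)
qed

lemma add_fun_tensor: "add_fun (tensor M N) (%t. lin t u)"
 by (simp add: add_fun_def lin_add)

lemma dual_system_tensor:
 "dual_system (tensor M N) (%w t. lin t (%p. if frag_of p = w then 1 else 0))"
 by (auto simp: dual_system_def add_fun_tensor frag_of_eq)

lemma zlift_tensor:
 assumes "!!b. b \<in> keys c ==> f b \<in> carrier (tensor M N)"
 shows "zlift (tensor M N) f c = frag_extend f c"
proof (rule poly_mapping_eqI)
 fix p
 interpret comm_group "tensor M N" by (rule comm_group_tensor)
 have e: "add_fun (tensor M N) (%t. lookup t p)"
  by (simp add: add_fun_def lookup_add)
 show "lookup (zlift (tensor M N) f c) p = lookup (frag_extend f c) p"
  using add_fun_zlift[OF e assms] by (simp add: lookup_frag_extend)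
qed

lemma tgroup_tensor: "tgroup (tensor M N)"
proof (rule tgroup_dualI[OF comm_group_tensor _ dual_system_tensor])
 show "irr (tensor M N) \<subseteq> carrier (tensor M N)"
  by (auto simp: keys_frag_of)
 fix x assume x: "x \<in> carrier (tensor M N)"
 let ?c = "frag_extend (%p. frag_of (frag_of p)) x"
 have "keys ?c \<subseteq> irr (tensor M N)"
  using x by (intro keys_frag_extend_subset) (auto simp: keys_frag_of)
 moreover from this have "zlift (tensor M N) (%x. x) ?c = frag_extend (%x. x) ?c"
  by (intro zlift_tensor) (auto simp: keys_frag_of dest: subsetD)
 moreover have "frag_extend (%x. x) ?c = x"
  by (rule poly_mapping_eqI) (simp add: lookup_frag_extend lin_extend lookup_eq_lin[of x] when_def
    eq_commute cong: if_cong)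
 ultimately show "\<exists>c. keys c \<subseteq> irr (tensor M N) & zlift (tensor M N) (%x. x) c = x"
  by metis
qed

text \<open>Two expansions of \<open>t\<close> meet here: the coordinates over the irreducibles
  \<open>frag_of p\<close> of the T-group, and the coefficients of the finitely supported function
  \<open>t\<close> itself.\<close>

lemma lookup_coords_tensor:
 assumes "t \<in> carrier (tensor M N)"
 shows "lookup (coords (tensor M N) t) (frag_of p) = lookup t p"
proof (cases "p \<in> irr M \<times> irr N")
 case True
 interpret tgroup "tensor M N" by (rule tgroup_tensor)
 have "(of_int (lookup (coords (tensor M N) t) (frag_of p)) :: complex) = lin t (%q. of_int (if q = p then 1 else 0))"
  using True by (subst lookup_coords[OF dual_system_tensor assms]) (auto simp: frag_of_eq intro!: lin_cong)
 then show ?thesis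
  by (simp only: lin_of_int of_int_eq_iff) (simp add: lookup_eq_lin[of t])
next
 case False
 interpret tgroup "tensor M N" by (rule tgroup_tensor)
 have "frag_of p \<notin> keys (coords (tensor M N) t)"
  using keys_coords[OF assms] False by (auto simp: frag_of_eq)
 moreover have "p \<notin> keys t" using False assms by auto
 ultimately show ?thesis by (simp add: in_keys_iff)
qed

lemma lin_coords_tensor:
 assumes "t \<in> carrier (tensor M N)"
 shows "lin (coords (tensor M N) t) u = lin t (%p. u (frag_of p))"
proof -
 interpret tgroup "tensor M N" by (rule tgroup_tensor)
 have "coords (tensor M N) t = frag_extend (%p. frag_of (frag_of p)) t"
 proof -
  let ?c = "frag_extend (%p. frag_of (frag_of p)) t"
  have k: "keys ?c \<subseteq> irr (tensor M N)"
   using assms by (intro keys_frag_extend_subset) (auto simp: keys_frag_of)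
  have "zlift (tensor M N) (%x. x) ?c = frag_extend (%x. x) ?c"
   using k by (intro zlift_tensor) (auto simp: keys_frag_of dest: subsetD)
  also have "... = t"
   by (rule poly_mapping_eqI) (simp add: lookup_frag_extend lin_extend lookup_eq_lin[of t] when_def
     eq_commute cong: if_cong)
  finally show ?thesis using coords_unique[OF k] by simp
 qed
 then show ?thesis by (simp add: lin_extend)
qed

lemma keys_tens:
 assumes "tgroup M" "tgroup N" "x \<in> carrier M" "y \<in> carrier N"
 shows "keys (tens M N x y) \<subseteq> irr M \<times> irr N"
 unfolding tens_def using tgroup.keys_coords[OF assms(1,3)] tgroup.keys_coords[OF assms(2,4)]
 by (intro keys_frag_extend_subset) (auto simp: keys_frag_of)

lemma lin_tens:
 assumes "tgroup M" "tgroup N" "x \<in> carrier M" "y \<in> carrier N" "add_fun M e" "add_fun N e'"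
 shows "lin (tens M N x y) (%(w, v). e w * e' v) = e x * e' y"
 by (simp add: tens_def lin_extend lin_mult_left lin_mult_right tgroup.lin_coords assms)



text \<open>The Kronecker delta on pairs is a product of deltas, so the coefficients multiply and
  the sum over \<open>F \<times> F'\<close> factors.\<close>

lemma separates_tensor:
 assumes "separates P E M" "separates Q E' N"
 shows "separates (P \<times> Q) (%(p, q) t. lin t (%(w, v). E p w * E' q v)) (tensor M N)"
 unfolding separates_def
proof
 fix t assume "t \<in> irr (tensor M N)"
 then obtain w w' where t: "t = frag_of (w, w')" "w \<in> irr M" "w' \<in> irr N" by auto
 obtain F a where F: "finite F" "F \<subseteq> P" "!!v. v \<in> irr M ==> (\<Sum>p\<in>F. a p * E p v) = (if v = w then 1 else 0)"
  using assms(1) t unfolding separates_def by metis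
 obtain F' a' where F': "finite F'" "F' \<subseteq> Q" "!!v. v \<in> irr N ==> (\<Sum>p\<in>F'. a' p * E' p v) = (if v = w' then 1 else 0)"
  using assms(2) t unfolding separates_def by metis
 have "(\<Sum>p\<in>F \<times> F'. (a (fst p) * a' (snd p)) * (%(p, q) t. lin t (%(w, v). E p w * E' q v)) p (frag_of (v, v'))) = (if frag_of (v, v') = t then 1 else 0)"
  if "v \<in> irr M" "v' \<in> irr N" for v v'
 proof -
  have "(\<Sum>p\<in>F \<times> F'. (a (fst p) * a' (snd p)) * (%(p, q) t. lin t (%(w, v). E p w * E' q v)) p (frag_of (v, v')))
   = (\<Sum>(p, q)\<in>F \<times> F'. (a p * E p v) * (a' q * E' q v'))"
   by (intro sum.cong) (auto simp: mult_ac)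
  also have "... = (\<Sum>p\<in>F. a p * E p v) * (\<Sum>q\<in>F'. a' q * E' q v')"
   by (simp add: sum_product sum.cartesian_product)
  also have "... = (if frag_of (v, v') = t then 1 else 0)"
   using F F' that t by (auto simp: frag_of_eq)
  finally show ?thesis .
 qed
 moreover have "finite (F \<times> F')" "F \<times> F' \<subseteq> P \<times> Q" using F F' by auto
 ultimately show "\<exists>F a. finite F & F \<subseteq> P \<times> Q &
    (\<forall>v\<in>irr (tensor M N). (\<Sum>p\<in>F. a p * (case p of (p, q) => %t. lin t (%(w, v). E p w * E' q v)) v) = (if v = t then 1 else 0))"
  by (intro exI[of _ "F \<times> F'"] exI[of _ "%p. a (fst p) * a' (snd p)"]) auto
qed

section \<open>Matrices\<close>

definition mtr :: "complex mat => complex" where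
 "mtr A = (\<Sum>i<dim_row A. A $$ (i, i))"

lemma mtr_add: "A \<in> carrier_mat n n ==> B \<in> carrier_mat n n ==> mtr (A + B) = mtr A + mtr B"
 by (simp add: mtr_def sum.distrib)

lemma mtr_one [simp]: "mtr (1\<^sub>m n) = of_nat n"
 by (simp add: mtr_def)

lemma mtr_mult_commute:
 assumes "A \<in> carrier_mat n m" "B \<in> carrier_mat m n"
 shows "mtr (A * B) = mtr (B * A)"
proof -
 have "mtr (A * B) = (\<Sum>i<n. \<Sum>j<m. A $$ (i, j) * B $$ (j, i))"
  using assms by (auto simp: mtr_def scalar_prod_def atLeast0LessThan intro!: sum.cong)
 also have "... = (\<Sum>j<m. \<Sum>i<n. B $$ (j, i) * A $$ (i, j))"
  by (subst sum.swap) (simp add: mult.commute)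
 also have "... = mtr (B * A)"
  using assms by (auto simp: mtr_def scalar_prod_def atLeast0LessThan intro!: sum.cong)
 finally show ?thesis .
qed

lemma mat_diff_add_cancel:
 fixes A B :: "complex mat"
 assumes "A \<in> carrier_mat n m" "B \<in> carrier_mat n m"
 shows "A - B + B = A" "B + (A - B) = A"
 by (rule eq_matI; use assms in auto)+

lemma mat_diff_zero:
 fixes A :: "complex mat"
 shows "A \<in> carrier_mat n m ==> A - 0\<^sub>m n m = A"
 by (intro eq_matI) auto

lemma zero_mat_mult_vec:
 fixes v :: "complex vec"
 shows "v \<in> carrier_vec m ==> 0\<^sub>m k m *\<^sub>v v = 0\<^sub>v k"
 by (intro eq_vecI) (auto simp: scalar_prod_def)

lemma mat_mult_zero_vec:
 fixes A :: "complex mat"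
 shows "A \<in> carrier_mat n m ==> A *\<^sub>v 0\<^sub>v m = 0\<^sub>v n"
 by (intro eq_vecI) (auto simp: scalar_prod_def)

lemma mat_mult_unit_vec:
 fixes A :: "complex mat"
 assumes "A \<in> carrier_mat n m" "i < m"
 shows "A *\<^sub>v unit_vec m i = col A i"
 using assms by (intro eq_vecI) auto

lemma mat_eq_mult_vecI:
 fixes A B :: "complex mat"
 assumes "A \<in> carrier_mat n m" "B \<in> carrier_mat n m" "!!v. v \<in> carrier_vec m ==> A *\<^sub>v v = B *\<^sub>v v"
 shows "A = B"
proof (rule mat_col_eqI)
 fix i assume "i < dim_col B"
 then have i: "i < m" using assms by auto
 have "col A i = A *\<^sub>v unit_vec m i" "col B i = B *\<^sub>v unit_vec m i"
  using mat_mult_unit_vec[OF assms(1) i] mat_mult_unit_vec[OF assms(2) i] by simp_all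
 then show "col A i = col B i" using assms(3) by simp
qed (use assms in auto)

text \<open>\<open>S\<close> is assembled from one solution per column. It supplies right inverses
  of surjective matrices and factorizations through an image.\<close>

lemma mat_columns_choice:
 fixes A B :: "complex mat"
 assumes A: "A \<in> carrier_mat k n" and B: "B \<in> carrier_mat k m"
  and ex: "!!i. i < m ==> \<exists>v\<in>carrier_vec n. A *\<^sub>v v = col B i"
 shows "\<exists>S\<in>carrier_mat n m. A * S = B"
proof -
 obtain s where s: "!!i. i < m ==> s i \<in> carrier_vec n & A *\<^sub>v s i = col B i"
  using ex by metis
 define S where "S = mat_of_cols n (map s [0..<m])"
 have S: "S \<in> carrier_mat n m"
  using mat_of_cols_carrier(1)[of n "map s [0..<m]"] by (simp add: S_def)
 have "A * S = B"
 proof (rule mat_col_eqI)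
  fix i assume "i < dim_col B"
  then have i: "i < m" using B by simp
  have "col S i = s i"
   unfolding S_def using i s by (subst col_mat_of_cols) auto
  moreover have "col (A * S) i = A *\<^sub>v col S i"
   using A S i by (intro col_mult2) auto
  ultimately show "col (A * S) i = col B i" using s i by simp
 qed (use A B S in auto)
 with S show ?thesis by blast
qed

text \<open>The dimensions are arguments so that an empty sum is the zero matrix of the correct
  size.\<close>

definition msum :: "nat => nat => 'i set => ('i => complex mat) => complex mat" where
 "msum n m I M = mat n m (%ij. \<Sum>i\<in>I. M i $$ ij)"

lemma msum_carrier [simp]: "msum n m I M \<in> carrier_mat n m"
 by (simp add: msum_def)

lemma mult_msum:
 assumes "A \<in> carrier_mat k n" "!!i. i \<in> I ==> M i \<in> carrier_mat n m"
 shows "A * msum n m I M = msum k m I (%i. A * M i)"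
proof (rule eq_matI)
 fix a b assume "a < dim_row (msum k m I (%i. A * M i))" "b < dim_col (msum k m I (%i. A * M i))"
 then have ab: "a < k" "b < m" by (auto simp: msum_def)
 have "(A * msum n m I M) $$ (a, b) = (\<Sum>j<n. A $$ (a, j) * (\<Sum>i\<in>I. M i $$ (j, b)))"
  using assms(1) ab by (auto simp: msum_def scalar_prod_def atLeast0LessThan intro!: sum.cong)
 also have "... = (\<Sum>i\<in>I. \<Sum>j<n. A $$ (a, j) * M i $$ (j, b))"
  unfolding sum_distrib_left by (rule sum.swap)
 also have "... = (\<Sum>i\<in>I. (A * M i) $$ (a, b))"
 proof (rule sum.cong[OF refl])
  fix i assume "i \<in> I"
  from assms(2)[OF this] show "(\<Sum>j<n. A $$ (a, j) * M i $$ (j, b)) = (A * M i) $$ (a, b)"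
   using ab assms(1) by (auto simp: scalar_prod_def atLeast0LessThan intro!: sum.cong)
 qed
 finally show "(A * msum n m I M) $$ (a, b) = msum k m I (%i. A * M i) $$ (a, b)"
  using ab by (simp add: msum_def)
qed (use assms(1) in \<open>auto simp: msum_def\<close>)

lemma msum_mult:
 assumes "A \<in> carrier_mat m k" "!!i. i \<in> I ==> M i \<in> carrier_mat n m"
 shows "msum n m I M * A = msum n k I (%i. M i * A)"
proof (rule eq_matI)
 fix a b assume "a < dim_row (msum n k I (%i. M i * A))" "b < dim_col (msum n k I (%i. M i * A))"
 then have ab: "a < n" "b < k" by (auto simp: msum_def)
 have "(msum n m I M * A) $$ (a, b) = (\<Sum>j<m. (\<Sum>i\<in>I. M i $$ (a, j)) * A $$ (j, b))"
  using assms(1) ab by (auto simp: msum_def scalar_prod_def atLeast0LessThan intro!: sum.cong)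
 also have "... = (\<Sum>i\<in>I. \<Sum>j<m. M i $$ (a, j) * A $$ (j, b))"
  unfolding sum_distrib_right by (rule sum.swap)
 also have "... = (\<Sum>i\<in>I. (M i * A) $$ (a, b))"
 proof (rule sum.cong[OF refl])
  fix i assume "i \<in> I"
  from assms(2)[OF this] show "(\<Sum>j<m. M i $$ (a, j) * A $$ (j, b)) = (M i * A) $$ (a, b)"
   using ab assms(1) by (auto simp: scalar_prod_def atLeast0LessThan intro!: sum.cong)
 qed
 finally show "(msum n m I M * A) $$ (a, b) = msum n k I (%i. M i * A) $$ (a, b)"
  using ab by (simp add: msum_def)
qed (use assms(1) in \<open>auto simp: msum_def\<close>)

lemma mtr_msum:
 assumes "!!i. i \<in> I ==> M i \<in> carrier_mat n n"
 shows "mtr (msum n n I M) = (\<Sum>i\<in>I. mtr (M i))"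
proof -
 have "mtr (msum n n I M) = (\<Sum>a<n. \<Sum>i\<in>I. M i $$ (a, a))"
  by (auto simp: mtr_def msum_def intro!: sum.cong)
 also have "... = (\<Sum>i\<in>I. \<Sum>a<n. M i $$ (a, a))"
  by (rule sum.swap)
 also have "... = (\<Sum>i\<in>I. mtr (M i))"
  by (rule sum.cong[OF refl]) (use assms in \<open>auto simp: mtr_def\<close>)
 finally show ?thesis .
qed

lemma msum_reindex: "bij_betw h I J ==> msum n m J M = msum n m I (%i. M (h i))"
 by (simp add: msum_def sum.reindex_bij_betw[symmetric])

lemma msum_cong: "(!!i. i \<in> I ==> M i = N i) ==> msum n m I M = msum n m I N"
 by (simp add: msum_def)

subsection \<open>Subspaces\<close>

definition subsp :: "nat => complex vec set => bool" where
 "subsp d W \<longleftrightarrow> W \<subseteq> carrier_vec d & 0\<^sub>v d \<in> W &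
   (\<forall>v\<in>W. \<forall>w\<in>W. v + w \<in> W) & (\<forall>c. \<forall>v\<in>W. c \<cdot>\<^sub>v v \<in> W)"

text \<open>Suppose \<open>d < e\<close> and pad both matrices with zeros to size \<open>e\<close>.
  The left inverse becomes two-sided, but row \<open>d\<close> of the padded \<open>P\<close> is
  zero.\<close>

lemma left_inverse_dim_le:
 fixes P R :: "complex mat"
 assumes P: "P \<in> carrier_mat d e" and R: "R \<in> carrier_mat e d" and RP: "R * P = 1\<^sub>m e"
 shows "e \<le> d"
proof (rule ccontr)
 assume "\<not> e \<le> d"
 then have de: "d < e" by simp
 define P' where "P' = mat e e (%(i, j). if i < d then P $$ (i, j) else 0)"
 define R' where "R' = mat e e (%(i, j). if j < d then R $$ (i, j) else 0)"
 have "R' * P' = R * P"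
 proof (rule eq_matI)
  fix i j assume "i < dim_row (R * P)" "j < dim_col (R * P)"
  then have ij: "i < e" "j < e" using P R by auto
  have "(R' * P') $$ (i, j) = (\<Sum>k<e. (if k < d then R $$ (i, k) else 0) * (if k < d then P $$ (k, j) else 0))"
   using ij by (simp add: R'_def P'_def scalar_prod_def atLeast0LessThan)
  also have "... = (\<Sum>k<d. R $$ (i, k) * P $$ (k, j))"
   using de by (intro sum.mono_neutral_cong_right) auto
  also have "... = (R * P) $$ (i, j)"
   using ij P R by (simp add: scalar_prod_def atLeast0LessThan)
  finally show "(R' * P') $$ (i, j) = (R * P) $$ (i, j)" .
 qed (use P R in \<open>auto simp: R'_def P'_def\<close>)
 then have "P' * R' = 1\<^sub>m e"
  using RP by (intro mat_mult_left_right_inverse[of R' e P']) (auto simp: R'_def P'_def)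
 then have "(P' * R') $$ (d, d) = 1" using de by simp
 moreover have "(P' * R') $$ (d, d) = 0"
  using de by (simp add: R'_def P'_def scalar_prod_def)
 ultimately show False by simp
qed

text \<open>Among the matrices with a left inverse and image inside \<open>W\<close>, one with the
  most columns must reach all of \<open>W\<close>; \<open>left_inverse_dim_le\<close> bounds the
  number of columns. Carrying the left inverse \<open>R\<close> along takes the place of
  bases.\<close>

lemma subsp_parametrization:
 assumes W: "subsp d W"
 shows "\<exists>e P R. P \<in> carrier_mat d e & R \<in> carrier_mat e d & R * P = 1\<^sub>m e &
  (*\<^sub>v) P ` carrier_vec e = W"
proof -
 let ?ok = "%e. \<exists>P R. P \<in> carrier_mat d e & R \<in> carrier_mat e d & R * P = 1\<^sub>m e &
  (*\<^sub>v) P ` carrier_vec e \<subseteq> W"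
 have "?ok 0"
 proof (intro exI conjI)
  show "0\<^sub>m d 0 \<in> carrier_mat d 0" "0\<^sub>m 0 d \<in> carrier_mat 0 d" by auto
  show "0\<^sub>m 0 d * 0\<^sub>m d 0 = (1\<^sub>m 0 :: complex mat)" by (intro eq_matI) auto
  show "(*\<^sub>v) (0\<^sub>m d 0) ` carrier_vec 0 \<subseteq> W"
  proof safe
   fix v :: "complex vec" assume "v \<in> carrier_vec 0"
   then have "0\<^sub>m d 0 *\<^sub>v v = 0\<^sub>v d" by (intro eq_vecI) (auto simp: scalar_prod_def)
   then show "0\<^sub>m d 0 *\<^sub>v v \<in> W" using W by (simp add: subsp_def)
  qed
 qed
 moreover have "\<forall>e. ?ok e --> e \<le> d" using left_inverse_dim_le by blast
 ultimately obtain e where e: "?ok e" and max: "!!e'. ?ok e' ==> e' \<le> e"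
  using Nat.ex_has_greatest_nat[of ?ok 0 d] by metis
 then obtain P R where P: "P \<in> carrier_mat d e" and R: "R \<in> carrier_mat e d" and RP: "R * P = 1\<^sub>m e"
  and im: "(*\<^sub>v) P ` carrier_vec e \<subseteq> W" by blast
 have "W \<subseteq> (*\<^sub>v) P ` carrier_vec e"
 proof (rule ccontr)
  assume "\<not> ?thesis"
  then obtain w where w: "w \<in> W" "w \<notin> (*\<^sub>v) P ` carrier_vec e" by blast
  have wd: "w \<in> carrier_vec d" using w W by (auto simp: subsp_def)
  \<comment> \<open>Subtracting the projection of \<open>w\<close> to the present image makes
    \<open>R\<close> kill \<open>u\<close>, so \<open>u\<close> can serve as a new column.\<close>
  define u where "u = w - P *\<^sub>v (R *\<^sub>v w)"
  have ud: "u \<in> carrier_vec d" using wd P R by (simp add: u_def)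
  have Rw: "R *\<^sub>v w \<in> carrier_vec e" using R wd by simp
  have "u = w + (-1) \<cdot>\<^sub>v (P *\<^sub>v (R *\<^sub>v w))" using wd P R by (auto simp: u_def)
  then have uW: "u \<in> W" using W im w Rw unfolding subsp_def by (metis image_subset_iff)
  have Ru: "R *\<^sub>v u = 0\<^sub>v e"
  proof -
   have "R *\<^sub>v u = R *\<^sub>v w - (R * P) *\<^sub>v (R *\<^sub>v w)"
    unfolding u_def using R P wd Rw by (subst mult_minus_distrib_mat_vec) auto
   then show ?thesis using Rw RP by simp
  qed
  have "u ~= 0\<^sub>v d"
  proof
   assume "u = 0\<^sub>v d"
   have "w = u + P *\<^sub>v (R *\<^sub>v w)" using wd P R by (auto simp: u_def)
   then have "w = P *\<^sub>v (R *\<^sub>v w)" using \<open>u = 0\<^sub>v d\<close> P Rw by simp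
   then show False using w Rw by blast
  qed
  then obtain j where j: "j < d" "u $ j ~= 0" using ud by (metis carrier_vecD eq_vecI index_zero_vec(1) index_zero_vec(2))
  define K where "K k = (\<Sum>i<e. P $$ (j, i) * R $$ (i, k))" for k
  \<comment> \<open>The new row is row \<open>j\<close> of \<open>1 - P * R\<close>, scaled to take
    the value 1 at \<open>u\<close>. It vanishes on the columns of \<open>P\<close> because
    \<open>P * R * P = P\<close>.\<close>
  define f where "f k = ((if k = j then 1 else 0) - (\<Sum>i<e. P $$ (j, i) * R $$ (i, k))) / u $ j" for k
  have fu: "(\<Sum>k<d. f k * u $ k) = 1"
  proof -
   have "(\<Sum>k<d. f k * u $ k) * u $ j = (\<Sum>k<d. f k * u $ j * u $ k)"
    by (subst sum_distrib_right) (simp add: mult_ac)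
   also have "... = (\<Sum>k<d. (if k = j then u $ k else 0) - (\<Sum>i<e. P $$ (j, i) * R $$ (i, k)) * u $ k)"
    using j by (intro sum.cong) (auto simp: f_def K_def[symmetric] field_simps)
   also have "... = u $ j - (\<Sum>k<d. \<Sum>i<e. P $$ (j, i) * R $$ (i, k) * u $ k)"
    using j by (simp add: sum_subtractf sum_distrib_right)
   also have "(\<Sum>k<d. \<Sum>i<e. P $$ (j, i) * R $$ (i, k) * u $ k) = (\<Sum>i<e. P $$ (j, i) * (R *\<^sub>v u) $ i)"
    using R ud by (subst sum.swap) (auto simp: scalar_prod_def atLeast0LessThan sum_distrib_left mult.assoc intro!: sum.cong)
   also have "... = 0" using Ru by simp
   finally show ?thesis using j by simp
  qed
  have fP: "(\<Sum>k<d. f k * P $$ (k, l)) = 0" if l: "l < e" for l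
  proof -
   have "(\<Sum>k<d. f k * P $$ (k, l)) * u $ j = (\<Sum>k<d. f k * u $ j * P $$ (k, l))"
    by (subst sum_distrib_right) (simp add: mult_ac)
   also have "... = (\<Sum>k<d. (if k = j then P $$ (k, l) else 0) - (\<Sum>i<e. P $$ (j, i) * R $$ (i, k)) * P $$ (k, l))"
    using j by (intro sum.cong) (auto simp: f_def K_def[symmetric] field_simps)
   also have "... = P $$ (j, l) - (\<Sum>k<d. \<Sum>i<e. P $$ (j, i) * R $$ (i, k) * P $$ (k, l))"
    using j by (simp add: sum_subtractf sum_distrib_right)
   also have "(\<Sum>k<d. \<Sum>i<e. P $$ (j, i) * R $$ (i, k) * P $$ (k, l)) = (\<Sum>i<e. P $$ (j, i) * (R * P) $$ (i, l))"
    using R P l by (subst sum.swap) (auto simp: scalar_prod_def atLeast0LessThan sum_distrib_left mult.assoc intro!: sum.cong)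
   also have "... = P $$ (j, l)"
    unfolding RP using l by (simp add: if_distrib cong: if_cong)
   finally show ?thesis using j by simp
  qed
  define P' where "P' = mat d (Suc e) (%(i, l). if l < e then P $$ (i, l) else u $ i)"
  define R' where "R' = mat (Suc e) d (%(i, l). if i < e then R $$ (i, l) else f l)"
  have "R' * P' = 1\<^sub>m (Suc e)"
  proof (rule eq_matI)
   fix a b assume "a < dim_row (1\<^sub>m (Suc e) :: complex mat)" "b < dim_col (1\<^sub>m (Suc e) :: complex mat)"
   then have ab: "a < Suc e" "b < Suc e" by auto
   have *: "(R' * P') $$ (a, b) = (\<Sum>k<d. (if a < e then R $$ (a, k) else f k) * (if b < e then P $$ (k, b) else u $ k))"
    using ab by (simp add: R'_def P'_def scalar_prod_def atLeast0LessThan)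
   consider "a < e" "b < e" | "a < e" "b = e" | "a = e" "b < e" | "a = e" "b = e" using ab by linarith
   then show "(R' * P') $$ (a, b) = 1\<^sub>m (Suc e) $$ (a, b)"
   proof cases
    case 1
    then have "(R' * P') $$ (a, b) = (R * P) $$ (a, b)"
     unfolding * using R P by (simp add: scalar_prod_def atLeast0LessThan)
    with 1 show ?thesis unfolding RP by simp
   next
    case 2
    then have "(R' * P') $$ (a, b) = (R *\<^sub>v u) $ a"
     unfolding * using R ud by (simp add: scalar_prod_def atLeast0LessThan)
    with 2 show ?thesis unfolding Ru by simp
   qed (unfold *, auto simp: fP fu)
  qed (auto simp: R'_def P'_def)
  moreover have "(*\<^sub>v) P' ` carrier_vec (Suc e) \<subseteq> W"
  proof safe
   fix v :: "complex vec" assume v: "v \<in> carrier_vec (Suc e)"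
   have "P' *\<^sub>v v = P *\<^sub>v vec_first v e + v $ e \<cdot>\<^sub>v u"
    using P ud v by (intro eq_vecI) (auto simp: P'_def scalar_prod_def vec_first_def)
   then show "P' *\<^sub>v v \<in> W" using W im uW unfolding subsp_def by (metis image_subset_iff vec_first_carrier)
  qed
  ultimately have "?ok (Suc e)" by (intro exI[of _ P'] exI[of _ R']) (auto simp: P'_def R'_def)
  from max[OF this] show False by simp
 qed
 with im P R RP show ?thesis by blast
qed

text \<open>\<open>E = 1 - P * R\<close> is idempotent with kernel \<open>W\<close>, so its image is
  a complement. The dimensions add up because the trace of the identity is the sum of the traces of
  \<open>R * P\<close> and \<open>Q * S\<close>.\<close>

lemma subsp_complement:
 assumes W: "subsp d W"
 shows "\<exists>e e' P R S Q. e + e' = d & P \<in> carrier_mat d e & R \<in> carrier_mat e d &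
  S \<in> carrier_mat d e' & Q \<in> carrier_mat e' d & R * P = 1\<^sub>m e & Q * S = 1\<^sub>m e' &
  Q * P = 0\<^sub>m e' e & P * R + S * Q = 1\<^sub>m d & (*\<^sub>v) P ` carrier_vec e = W"
proof -
 obtain e P R where P: "P \<in> carrier_mat d e" and R: "R \<in> carrier_mat e d" and RP: "R * P = 1\<^sub>m e"
  and im: "(*\<^sub>v) P ` carrier_vec e = W" using subsp_parametrization[OF W] by blast
 define E where "E = 1\<^sub>m d - P * R"
 have E: "E \<in> carrier_mat d d" using P R by (simp add: E_def minus_carrier_mat)
 have PR: "P * R \<in> carrier_mat d d" using P R by simp
 have PRE: "P * R + E = 1\<^sub>m d" using PR unfolding E_def by (intro mat_diff_add_cancel) auto
 have EP: "E * P = 0\<^sub>m d e"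
 proof -
  have "E * P = P - P * R * P" using P R by (simp add: E_def minus_mult_distrib_mat[of _ d d])
  also have "P * R * P = P" using P R RP by (simp add: assoc_mult_mat[of _ d e _ d _ e])
  finally show ?thesis using P by simp
 qed
 have EE: "E * E = E"
 proof -
  have "E * E = E * (1\<^sub>m d - P * R)" by (simp add: E_def)
  also have "... = E * 1\<^sub>m d - E * (P * R)" using E PR by (intro mult_minus_distrib_mat) auto
  also have "E * (P * R) = E * P * R" using E P R by (simp add: assoc_mult_mat[of _ d d _ e _ d])
  also have "E * 1\<^sub>m d - E * P * R = E" unfolding EP using E R by auto
  finally show ?thesis .
 qed
 have "subsp d ((*\<^sub>v) E ` carrier_vec d)"
  unfolding subsp_def
 proof (intro conjI ballI allI)
  show "(*\<^sub>v) E ` carrier_vec d \<subseteq> carrier_vec d" using E by auto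
  show "0\<^sub>v d \<in> (*\<^sub>v) E ` carrier_vec d" using E by (intro image_eqI[of _ _ "0\<^sub>v d"]) auto
  fix v w assume "v \<in> (*\<^sub>v) E ` carrier_vec d" "w \<in> (*\<^sub>v) E ` carrier_vec d"
  then show "v + w \<in> (*\<^sub>v) E ` carrier_vec d"
   using E by (auto simp: mult_add_distrib_mat_vec[symmetric])
 next
  fix c v assume "v \<in> (*\<^sub>v) E ` carrier_vec d"
  then show "c \<cdot>\<^sub>v v \<in> (*\<^sub>v) E ` carrier_vec d"
   using E by (auto simp: mult_mat_vec[symmetric])
 qed
 then obtain e' S Q' where S: "S \<in> carrier_mat d e'" and Q': "Q' \<in> carrier_mat e' d" and QS': "Q' * S = 1\<^sub>m e'"
  and im': "(*\<^sub>v) S ` carrier_vec e' = (*\<^sub>v) E ` carrier_vec d" using subsp_parametrization by blast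
 have ES: "E * S = S"
 proof (rule mat_eq_mult_vecI)
  fix v :: "complex vec" assume v: "v \<in> carrier_vec e'"
  then obtain u where u: "u \<in> carrier_vec d" "S *\<^sub>v v = E *\<^sub>v u" using im' by blast
  have "(E * S) *\<^sub>v v = E *\<^sub>v (E *\<^sub>v u)" using E S v u by simp
  also have "... = (E * E) *\<^sub>v u" using E u by simp
  finally show "(E * S) *\<^sub>v v = S *\<^sub>v v" using EE u by simp
 qed (use E S in auto)
 obtain X where X: "X \<in> carrier_mat e' d" "S * X = E"
 proof -
  have "\<exists>X\<in>carrier_mat e' d. S * X = E"
  proof (rule mat_columns_choice[OF S E])
   fix i assume i: "i < d"
   have "E *\<^sub>v unit_vec d i \<in> (*\<^sub>v) S ` carrier_vec e'" unfolding im' by auto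
   then show "\<exists>v\<in>carrier_vec e'. S *\<^sub>v v = col E i" using mat_mult_unit_vec[OF E i] by auto
  qed
  then show ?thesis using that by blast
 qed
 \<comment> \<open>\<open>Q'\<close> is merely some left inverse of \<open>S\<close>. Composing with
   \<open>E\<close> makes it vanish on the image of \<open>P\<close> and turns \<open>S * Q\<close>
   into \<open>E\<close>.\<close>
 define Q where "Q = Q' * E"
 have Q: "Q \<in> carrier_mat e' d" using Q' E by (simp add: Q_def)
 have QS: "Q * S = 1\<^sub>m e'" using Q' E S ES QS' by (simp add: Q_def assoc_mult_mat[of _ e' d _ d _ e'])
 have QP: "Q * P = 0\<^sub>m e' e" using Q' E P EP by (simp add: Q_def assoc_mult_mat[of _ e' d _ d _ e])
 have SQ: "S * Q = E"
 proof -
  have "Q' * E = X"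
   using Q' S X QS' unfolding X(2)[symmetric]
   by (subst assoc_mult_mat[symmetric, of _ e' d _ e' _ d]) auto
  then show ?thesis using X by (simp add: Q_def)
 qed
 have "complex_of_nat (e + e') = mtr (P * R + S * Q)"
  using P R S Q by (simp add: mtr_add[of _ d] mtr_mult_commute[OF P R] mtr_mult_commute[OF S Q] RP QS)
 then have "complex_of_nat (e + e') = of_nat d" by (simp add: SQ PRE)
 then have "e + e' = d" by (simp only: of_nat_eq_iff)
 then show ?thesis using P R S Q RP QS QP im PRE SQ by blast
qed

section \<open>Representations of finite groups\<close>

lemma is_rep_carrier: "is_rep X \<rho> ==> g \<in> carrier X ==> \<rho> g \<in> carrier_mat (rep_deg X \<rho>) (rep_deg X \<rho>)"
 by (simp add: is_rep_def)

lemma is_rep_mult: "is_rep X \<rho> ==> g \<in> carrier X ==> h \<in> carrier X ==> \<rho> (g \<otimes>\<^bsub>X\<^esub> h) = \<rho> g * \<rho> h"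
 by (simp add: is_rep_def)

lemma is_rep_one: "is_rep X \<rho> ==> \<rho> \<one>\<^bsub>X\<^esub> = 1\<^sub>m (rep_deg X \<rho>)"
 by (simp add: is_rep_def)

lemma is_repI:
 assumes "!!g. g \<in> carrier X ==> \<rho> g \<in> carrier_mat d d" "\<rho> \<one>\<^bsub>X\<^esub> = 1\<^sub>m d"
  "!!g h. g \<in> carrier X ==> h \<in> carrier X ==> \<rho> (g \<otimes>\<^bsub>X\<^esub> h) = \<rho> g * \<rho> h"
 shows "is_rep X \<rho>" "rep_deg X \<rho> = d"
proof -
 show "rep_deg X \<rho> = d" by (simp add: rep_deg_def assms)
 then show "is_rep X \<rho>" using assms by (simp add: is_rep_def)
qed

text \<open>The sequence splits as a sequence of vector spaces, \<open>P * R + S * Q = 1\<close>,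
  and this is enough: cyclicity of the trace and the intertwining relations turn the two halves into
  the outer traces.\<close>

lemma exact_reps_trace:
 assumes "exact_reps X \<rho> \<sigma> \<tau>" "g \<in> carrier X"
 shows "mtr (\<sigma> g) = mtr (\<rho> g) + mtr (\<tau> g)"
proof -
 define m n k where "m = rep_deg X \<rho>" "n = rep_deg X \<sigma>" "k = rep_deg X \<tau>"
 obtain P Q where r: "is_rep X \<rho>" "is_rep X \<sigma>" "is_rep X \<tau>"
  and PQ: "P \<in> intertwiners X \<rho> \<sigma>" "Q \<in> intertwiners X \<sigma> \<tau>"
  and inj: "inj_on ((*\<^sub>v) P) (carrier_vec m)" and ker: "(*\<^sub>v) P ` carrier_vec m = mat_kernel Q"
  and sur: "(*\<^sub>v) Q ` carrier_vec n = carrier_vec k"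
  using assms unfolding exact_reps_def m_n_k_def by blast
 have P: "P \<in> carrier_mat n m" and Q: "Q \<in> carrier_mat k n" and PI: "P * \<rho> g = \<sigma> g * P" and QI: "Q * \<sigma> g = \<tau> g * Q"
  using PQ assms(2) by (auto simp: intertwiners_def m_n_k_def)
 have rg: "\<rho> g \<in> carrier_mat m m" and sg: "\<sigma> g \<in> carrier_mat n n" and tg: "\<tau> g \<in> carrier_mat k k"
  using r assms(2) by (auto simp: is_rep_carrier m_n_k_def)
 have "\<exists>S\<in>carrier_mat n k. Q * S = 1\<^sub>m k"
 proof (rule mat_columns_choice[OF Q])
  fix i assume "i < k"
  then have "col (1\<^sub>m k) i \<in> (*\<^sub>v) Q ` carrier_vec n" unfolding sur by simp
  then show "\<exists>v\<in>carrier_vec n. Q *\<^sub>v v = col (1\<^sub>m k) i" by auto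
 qed simp
 then obtain S where S: "S \<in> carrier_mat n k" and QS: "Q * S = 1\<^sub>m k" by blast
 have SQ: "S * Q \<in> carrier_mat n n" using S Q by simp
 define E where "E = 1\<^sub>m n - S * Q"
 have E: "E \<in> carrier_mat n n" using SQ by (simp add: E_def minus_carrier_mat)
 have QE: "Q * E = 0\<^sub>m k n"
 proof -
  have "Q * E = Q * 1\<^sub>m n - Q * (S * Q)" unfolding E_def using Q SQ by (intro mult_minus_distrib_mat) auto
  also have "Q * (S * Q) = Q * S * Q" using Q S by (simp add: assoc_mult_mat[of _ k n _ k _ n])
  finally show ?thesis using QS Q by simp
 qed
 have "\<exists>R\<in>carrier_mat m n. P * R = E"
 proof (rule mat_columns_choice[OF P E])
  fix i assume i: "i < n"
  have "Q *\<^sub>v col E i = col (Q * E) i" by (rule col_mult2[OF Q E i, symmetric])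
  also have "... = 0\<^sub>v k" using i by (simp add: QE)
  finally have "col E i \<in> mat_kernel Q" using Q E by (intro mat_kernelI[OF Q]) auto
  then show "\<exists>v\<in>carrier_vec m. P *\<^sub>v v = col E i" using ker by (metis image_iff)
 qed
 then obtain R where R: "R \<in> carrier_mat m n" and PR: "P * R = E" by blast
 have QP: "Q * P = 0\<^sub>m k m"
 proof (rule mat_eq_mult_vecI)
  fix v :: "complex vec" assume v: "v \<in> carrier_vec m"
  then have "P *\<^sub>v v \<in> mat_kernel Q" using ker by blast
  then show "(Q * P) *\<^sub>v v = 0\<^sub>m k m *\<^sub>v v" using Q P v by (simp add: mat_kernel[OF Q] zero_mat_mult_vec)
 qed (use Q P in auto)
 have RP: "R * P = 1\<^sub>m m"
 proof (rule mat_eq_mult_vecI)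
  fix v :: "complex vec" assume v: "v \<in> carrier_vec m"
  have "P *\<^sub>v ((R * P) *\<^sub>v v) = (P * (R * P)) *\<^sub>v v"
   using P R v by (intro assoc_mult_mat_vec[symmetric]) auto
  also have "P * (R * P) = P * R * P"
   using P R by (simp add: assoc_mult_mat[of _ n m _ n _ m])
  also have "P * R * P = P"
  proof -
   have "E * P = P - S * (Q * P)" using P S Q SQ by (simp add: E_def minus_mult_distrib_mat[of _ n n] assoc_mult_mat[of _ n k _ n _ m])
   then show ?thesis using PR QP P S by (simp add: mat_diff_zero)
  qed
  also have "P *\<^sub>v v = P *\<^sub>v (1\<^sub>m m *\<^sub>v v)" using v by simp
  finally show "(R * P) *\<^sub>v v = 1\<^sub>m m *\<^sub>v v"
   by (rule inj_onD[OF inj]) (use R P v in auto)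
 qed (use R P in auto)
 have one: "P * R + S * Q = 1\<^sub>m n" using SQ unfolding PR E_def by (intro mat_diff_add_cancel) auto
 have "mtr (\<sigma> g) = mtr (\<sigma> g * (P * R + S * Q))" using sg one by simp
 also have "... = mtr (\<sigma> g * (P * R)) + mtr (\<sigma> g * (S * Q))"
  using sg P R S Q by (subst mult_add_distrib_mat[of _ n n]) (auto intro!: mtr_add[of _ n])
 also have "\<sigma> g * (P * R) = \<sigma> g * P * R" using sg P R by (simp add: assoc_mult_mat[of _ n n _ m _ n])
 also have "... = P * (\<rho> g * R)" unfolding PI[symmetric] using P R rg by (simp add: assoc_mult_mat[of _ n m _ m _ n])
 also have "mtr (P * (\<rho> g * R)) = mtr (\<rho> g * R * P)"
  using rg P R by (intro mtr_mult_commute[of _ n m]) auto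
 also have "\<rho> g * R * P = \<rho> g" using rg R P RP by (simp add: assoc_mult_mat[of _ m m _ n _ m])
 also have "mtr (\<sigma> g * (S * Q)) = mtr (\<sigma> g * S * Q)" using sg S Q by (simp add: assoc_mult_mat[of _ n n _ k _ n])
 also have "... = mtr (Q * (\<sigma> g * S))" using sg S Q by (intro mtr_mult_commute[of _ n k]) auto
 also have "Q * (\<sigma> g * S) = Q * \<sigma> g * S" using sg S Q by (simp add: assoc_mult_mat[of _ k n _ n _ k])
 also have "... = \<tau> g * (Q * S)" unfolding QI using S Q tg by (simp add: assoc_mult_mat[of _ k k _ n _ k])
 finally show ?thesis using tg QS by simp
qed

text \<open>In coordinates adapted to \<open>W\<close> all matrices are block triangular, and the
  diagonal blocks are the two outer representations. The drop in degree drives the induction in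
  \<open>rep_decomposition\<close>.\<close>

lemma exact_reps_subrep:
 assumes r: "is_rep X \<rho>" and W: "subsp (rep_deg X \<rho>) W"
  and inv: "!!g v. g \<in> carrier X ==> v \<in> W ==> \<rho> g *\<^sub>v v \<in> W"
  and nontriv: "W ~= {0\<^sub>v (rep_deg X \<rho>)}" "W ~= carrier_vec (rep_deg X \<rho>)"
  and X: "monoid X"
 shows "\<exists>\<sigma> \<tau>. exact_reps X \<sigma> \<rho> \<tau> & rep_deg X \<sigma> < rep_deg X \<rho> & rep_deg X \<tau> < rep_deg X \<rho>"
proof -
 interpret monoid X by fact
 define d where "d = rep_deg X \<rho>"
 obtain e e' P R S Q where dim: "e + e' = d" and P: "P \<in> carrier_mat d e" and R: "R \<in> carrier_mat e d"
  and S: "S \<in> carrier_mat d e'" and Q: "Q \<in> carrier_mat e' d" and RP: "R * P = 1\<^sub>m e" and QS: "Q * S = 1\<^sub>m e'"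
  and QP: "Q * P = 0\<^sub>m e' e" and one: "P * R + S * Q = 1\<^sub>m d" and im: "(*\<^sub>v) P ` carrier_vec e = W"
  using subsp_complement[OF W] unfolding d_def by blast
 have rc: "\<rho> g \<in> carrier_mat d d" if "g \<in> carrier X" for g using is_rep_carrier[OF r that] by (simp add: d_def)
 \<comment> \<open>Inserting \<open>1 = P * R + S * Q\<close> between two factors is the block form
   of matrix multiplication.\<close>
 have split: "A * B = A * P * (R * B) + A * S * (Q * B)" if A: "A \<in> carrier_mat a d" and B: "B \<in> carrier_mat d b" for A B a b
 proof -
  have "A * B = A * ((P * R + S * Q) * B)" using one B by simp
  also have "... = A * (P * R * B) + A * (S * Q * B)"
   using A B P R S Q by (simp add: add_mult_distrib_mat[of _ d d _ _ b] mult_add_distrib_mat[of _ a d _ b])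
  also have "A * (P * R * B) = A * P * (R * B)" using A B P R by (simp add: assoc_mult_mat[of _ d e _ d _ b] assoc_mult_mat[of _ a d _ e _ b])
  also have "A * (S * Q * B) = A * S * (Q * B)" using A B S Q by (simp add: assoc_mult_mat[of _ d e' _ d _ b] assoc_mult_mat[of _ a d _ e' _ b])
  finally show ?thesis .
 qed
 \<comment> \<open>Invariance of \<open>W\<close> says that this off-diagonal block
   vanishes.\<close>
 have QrP: "Q * (\<rho> g * P) = 0\<^sub>m e' e" if g: "g \<in> carrier X" for g
 proof (rule mat_eq_mult_vecI)
  fix v :: "complex vec" assume v: "v \<in> carrier_vec e"
  have "\<rho> g *\<^sub>v (P *\<^sub>v v) \<in> W" using inv[OF g] v im by blast
  then obtain u where u: "u \<in> carrier_vec e" "\<rho> g *\<^sub>v (P *\<^sub>v v) = P *\<^sub>v u" using im by blast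
  have "(Q * (\<rho> g * P)) *\<^sub>v v = Q *\<^sub>v ((\<rho> g * P) *\<^sub>v v)"
   using Q rc[OF g] P v by (intro assoc_mult_mat_vec) auto
  also have "... = Q *\<^sub>v (P *\<^sub>v u)" using rc[OF g] P v u by simp
  also have "... = (Q * P) *\<^sub>v u" using Q P u by simp
  finally show "(Q * (\<rho> g * P)) *\<^sub>v v = 0\<^sub>m e' e *\<^sub>v v" using QP u v by (simp add: zero_mat_mult_vec)
 qed (use Q rc[OF g] P in auto)
 define \<sigma> where "\<sigma> g = R * (\<rho> g * P)" for g
 define \<tau> where "\<tau> g = Q * (\<rho> g * S)" for g
 have \<sigma>c: "\<sigma> g \<in> carrier_mat e e" if "g \<in> carrier X" for g using R P rc[OF that] by (auto simp: \<sigma>_def)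
 have \<tau>c: "\<tau> g \<in> carrier_mat e' e'" if "g \<in> carrier X" for g using S Q rc[OF that] by (auto simp: \<tau>_def)
 have PI: "P * \<sigma> g = \<rho> g * P" if g: "g \<in> carrier X" for g
 proof -
  have "\<rho> g * P = 1\<^sub>m d * (\<rho> g * P)" using rc[OF g] P by simp
  also have "... = 1\<^sub>m d * P * (R * (\<rho> g * P)) + 1\<^sub>m d * S * (Q * (\<rho> g * P))"
   by (rule split) (use rc[OF g] P in auto)
  finally show ?thesis using P R S rc[OF g] by (simp add: QrP[OF g] \<sigma>_def)
 qed
 have QI: "Q * \<rho> g = \<tau> g * Q" if g: "g \<in> carrier X" for g
 proof -
  have "Q * \<rho> g = Q * \<rho> g * 1\<^sub>m d" using rc[OF g] Q by simp
  also have "... = Q * \<rho> g * P * (R * 1\<^sub>m d) + Q * \<rho> g * S * (Q * 1\<^sub>m d)"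
   by (rule split) (use rc[OF g] Q in auto)
  also have "Q * \<rho> g * P = 0\<^sub>m e' e" using QrP[OF g] Q rc[OF g] P by (simp add: assoc_mult_mat[of _ e' d _ d _ e])
  also have "Q * \<rho> g * S = \<tau> g" using Q rc[OF g] S by (simp add: \<tau>_def assoc_mult_mat[of _ e' d _ d _ e'])
  finally show ?thesis using R Q \<tau>c[OF g] by (simp add: left_mult_zero_mat[of _ e d] left_add_zero_mat[of _ e' d])
 qed
 have rm: "\<rho> (g \<otimes>\<^bsub>X\<^esub> h) = \<rho> g * \<rho> h" if "g \<in> carrier X" "h \<in> carrier X" for g h
  using r that by (rule is_rep_mult)
 have \<sigma>m: "\<sigma> (g \<otimes>\<^bsub>X\<^esub> h) = \<sigma> g * \<sigma> h" if "g \<in> carrier X" "h \<in> carrier X" for g h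
 proof -
  note c = rc[OF that(1)] rc[OF that(2)] \<sigma>c[OF that(1)] \<sigma>c[OF that(2)] P R
  have "\<sigma> (g \<otimes>\<^bsub>X\<^esub> h) = R * (\<rho> g * (\<rho> h * P))"
   using c that by (simp add: \<sigma>_def rm assoc_mult_mat[of _ d d _ d _ e])
  also have "... = R * (\<rho> g * P * \<sigma> h)"
   unfolding PI[OF that(2), symmetric] using c by (simp add: assoc_mult_mat[of "\<rho> g" d d P e _ e])
  also have "... = R * (\<rho> g * P) * \<sigma> h"
   using c by (intro assoc_mult_mat[symmetric, of _ e d _ e _ e]) auto
  finally show ?thesis by (simp add: \<sigma>_def)
 qed
 have \<tau>m: "\<tau> (g \<otimes>\<^bsub>X\<^esub> h) = \<tau> g * \<tau> h" if "g \<in> carrier X" "h \<in> carrier X" for g h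
 proof -
  note c = rc[OF that(1)] rc[OF that(2)] \<tau>c[OF that(1)] \<tau>c[OF that(2)] S Q
  have "\<tau> (g \<otimes>\<^bsub>X\<^esub> h) = Q * (\<rho> g * (\<rho> h * S))"
   using c that by (simp add: \<tau>_def rm assoc_mult_mat[of _ d d _ d _ e'])
  also have "... = Q * \<rho> g * (\<rho> h * S)"
   using c by (intro assoc_mult_mat[symmetric, of _ e' d _ d _ e']) auto
  also have "... = \<tau> g * (Q * (\<rho> h * S))"
   unfolding QI[OF that(1)] using c by (intro assoc_mult_mat[of _ e' e' _ d _ e']) auto
  finally show ?thesis by (simp add: \<tau>_def)
 qed
 have r1: "\<rho> \<one>\<^bsub>X\<^esub> = 1\<^sub>m d" using is_rep_one[OF r] by (simp add: d_def)
 have \<sigma>: "is_rep X \<sigma>" "rep_deg X \<sigma> = e"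
  by (rule is_repI[OF \<sigma>c _ \<sigma>m]; use r1 P RP in \<open>simp add: \<sigma>_def\<close>)+
 have \<tau>: "is_rep X \<tau>" "rep_deg X \<tau> = e'"
  by (rule is_repI[OF \<tau>c _ \<tau>m]; use r1 S QS in \<open>simp add: \<tau>_def\<close>)+
 have "exact_reps X \<sigma> \<rho> \<tau>"
  unfolding exact_reps_def
 proof (intro conjI bexI)
  show "P \<in> intertwiners X \<sigma> \<rho>" using P PI \<sigma> by (simp add: intertwiners_def d_def)
  show "Q \<in> intertwiners X \<rho> \<tau>" using Q QI \<tau> by (simp add: intertwiners_def d_def)
  show "inj_on ((*\<^sub>v) P) (carrier_vec (rep_deg X \<sigma>))"
  proof (rule inj_onI)
   fix u v assume uv: "u \<in> carrier_vec (rep_deg X \<sigma>)" "v \<in> carrier_vec (rep_deg X \<sigma>)" "P *\<^sub>v u = P *\<^sub>v v"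
   then have "(R * P) *\<^sub>v u = (R * P) *\<^sub>v v" using R P by (simp add: \<sigma>)
   then show "u = v" using uv by (simp add: RP \<sigma>)
  qed
  show "(*\<^sub>v) P ` carrier_vec (rep_deg X \<sigma>) = mat_kernel Q"
  proof safe
   fix v :: "complex vec" assume v: "v \<in> carrier_vec (rep_deg X \<sigma>)"
   have "Q *\<^sub>v (P *\<^sub>v v) = (Q * P) *\<^sub>v v" using Q P v by (simp add: \<sigma>)
   then show "P *\<^sub>v v \<in> mat_kernel Q" using P v QP by (intro mat_kernelI[OF Q]) (auto simp: \<sigma>)
  next
   fix v assume v: "v \<in> mat_kernel Q"
   then have vd: "v \<in> carrier_vec d" "Q *\<^sub>v v = 0\<^sub>v e'" using mat_kernelD[OF Q v] by auto
   have "v = (P * R + S * Q) *\<^sub>v v" using one vd by simp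
   also have "... = P *\<^sub>v (R *\<^sub>v v) + S *\<^sub>v (Q *\<^sub>v v)" using P R S Q vd by (simp add: add_mult_distrib_mat_vec[of _ d d])
   finally have "v = P *\<^sub>v (R *\<^sub>v v)" using vd P R S by (simp add: mat_mult_zero_vec[OF S])
   then show "v \<in> (*\<^sub>v) P ` carrier_vec (rep_deg X \<sigma>)" using R vd by (auto simp: \<sigma> intro!: image_eqI)
  qed
  show "(*\<^sub>v) Q ` carrier_vec (rep_deg X \<rho>) = carrier_vec (rep_deg X \<tau>)"
  proof safe
   fix v :: "complex vec" assume "v \<in> carrier_vec (rep_deg X \<tau>)"
   then have "v = Q *\<^sub>v (S *\<^sub>v v)" using Q S QS by (simp add: \<tau> assoc_mult_mat_vec[symmetric, of _ e' d _ e'])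
   then show "v \<in> (*\<^sub>v) Q ` carrier_vec (rep_deg X \<rho>)" using S \<open>v \<in> carrier_vec (rep_deg X \<tau>)\<close>
    by (auto simp: \<tau> d_def[symmetric] intro!: image_eqI[of _ _ "S *\<^sub>v v"])
  qed (use Q in \<open>auto simp: \<tau> d_def[symmetric]\<close>)
 qed (use \<sigma> \<tau> r in auto)
 moreover have "e' ~= 0"
 proof
  assume "e' = 0"
  then have "v = P *\<^sub>v (R *\<^sub>v v)" if "v \<in> carrier_vec d" for v
  proof -
   have "v = (P * R + S * Q) *\<^sub>v v" using one that by simp
   also have "... = P *\<^sub>v (R *\<^sub>v v) + S *\<^sub>v (Q *\<^sub>v v)" using P R S Q that by (simp add: add_mult_distrib_mat_vec[of _ d d])
   also have "S *\<^sub>v (Q *\<^sub>v v) = 0\<^sub>v d" using S Q that \<open>e' = 0\<close> by (intro eq_vecI) (auto simp: scalar_prod_def)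
   finally show ?thesis using P R that by simp
  qed
  then have "carrier_vec d \<subseteq> W" using im R by (metis image_iff mult_mat_vec_carrier subsetI)
  then show False using nontriv(2) W by (auto simp: subsp_def d_def)
 qed
 moreover have "e ~= 0"
 proof
  assume "e = 0"
  then have "P *\<^sub>v v = 0\<^sub>v d" if "v \<in> carrier_vec e" for v
   using P that by (intro eq_vecI) (auto simp: scalar_prod_def)
  then have "W \<subseteq> {0\<^sub>v d}" using im by auto
  then show False using nontriv(1) W by (auto simp: subsp_def d_def)
 qed
 ultimately show ?thesis using dim \<sigma> \<tau> by (intro exI[of _ \<sigma>] exI[of _ \<tau>]) (auto simp: d_def)
qed

subsection \<open>Schur's lemma and orthogonality\<close>

lemma irreducible_rep_subsp:
 assumes "irreducible_rep X \<rho>" "subsp (rep_deg X \<rho>) W" "!!g v. g \<in> carrier X ==> v \<in> W ==> \<rho> g *\<^sub>v v \<in> W"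
 shows "W = {0\<^sub>v (rep_deg X \<rho>)} \<or> W = carrier_vec (rep_deg X \<rho>)"
 using assms unfolding irreducible_rep_def subsp_def by blast

lemma irreducible_repI:
 assumes "is_rep X \<rho>" "rep_deg X \<rho> ~= 0"
  "!!W. subsp (rep_deg X \<rho>) W ==> (!!g v. g \<in> carrier X ==> v \<in> W ==> \<rho> g *\<^sub>v v \<in> W) ==>
   W = {0\<^sub>v (rep_deg X \<rho>)} \<or> W = carrier_vec (rep_deg X \<rho>)"
 shows "irreducible_rep X \<rho>"
 unfolding irreducible_rep_def
proof (intro conjI allI impI assms(1,2), elim conjE, rule assms(3))
qed (simp_all add: subsp_def)

lemma schur_bijective:
 assumes r: "irreducible_rep X \<rho>" and s: "irreducible_rep X \<sigma>" and F: "F \<in> intertwiners X \<rho> \<sigma>"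
  and nz: "F ~= 0\<^sub>m (rep_deg X \<sigma>) (rep_deg X \<rho>)"
 shows "inj_on ((*\<^sub>v) F) (carrier_vec (rep_deg X \<rho>))"
  and "(*\<^sub>v) F ` carrier_vec (rep_deg X \<rho>) = carrier_vec (rep_deg X \<sigma>)"
proof -
 define m n where "m = rep_deg X \<rho>" and "n = rep_deg X \<sigma>"
 have Fc: "F \<in> carrier_mat n m" and FI: "!!g. g \<in> carrier X ==> F * \<rho> g = \<sigma> g * F"
  using F by (auto simp: intertwiners_def m_def n_def)
 have rc: "\<rho> g \<in> carrier_mat m m" and sc: "\<sigma> g \<in> carrier_mat n n" if "g \<in> carrier X" for g
  using r s that by (auto simp: irreducible_rep_def is_rep_carrier m_def n_def)
 have FI': "F *\<^sub>v (\<rho> g *\<^sub>v v) = \<sigma> g *\<^sub>v (F *\<^sub>v v)" if "g \<in> carrier X" "v \<in> carrier_vec m" for g v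
  using FI[OF that(1)] Fc rc[OF that(1)] sc[OF that(1)] that(2) by (metis assoc_mult_mat_vec)
 let ?K = "{v \<in> carrier_vec m. F *\<^sub>v v = 0\<^sub>v n}"
 let ?I = "(*\<^sub>v) F ` carrier_vec m"
 have nzv: "\<exists>v\<in>carrier_vec m. F *\<^sub>v v ~= 0\<^sub>v n"
 proof (rule ccontr)
  assume "\<not> ?thesis"
  then have "F = 0\<^sub>m n m" using Fc by (intro mat_eq_mult_vecI[of _ n m]) (auto simp: zero_mat_mult_vec)
  with nz show False by (simp add: m_def n_def)
 qed
 have "subsp m ?K"
  unfolding subsp_def using Fc by (auto simp: mat_mult_zero_vec mult_add_distrib_mat_vec mult_mat_vec)
 then have "?K = {0\<^sub>v m} \<or> ?K = carrier_vec m"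
 proof (intro irreducible_rep_subsp[OF r, of ?K, folded m_def])
  fix g v assume "g \<in> carrier X" "v \<in> ?K"
  then show "\<rho> g *\<^sub>v v \<in> ?K" using FI'[of g v] rc[of g] sc[of g] by (auto simp: mat_mult_zero_vec)
 qed
 then have K: "?K = {0\<^sub>v m}" using nzv by blast
 show "inj_on ((*\<^sub>v) F) (carrier_vec (rep_deg X \<rho>))"
 proof (rule inj_onI, unfold m_def[symmetric])
  fix u v assume uv: "u \<in> carrier_vec m" "v \<in> carrier_vec m" "F *\<^sub>v u = F *\<^sub>v v"
  have "F *\<^sub>v (u - v) = 0\<^sub>v n" using uv Fc by (simp add: mult_minus_distrib_mat_vec)
  then have "u - v \<in> ?K" using uv by simp
  then have uv0: "u - v = 0\<^sub>v m" using K by blast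
  have "u = (u - v) + v" using uv by auto
  then show "u = v" using uv uv0 by simp
 qed
 have "subsp n ?I"
  unfolding subsp_def
 proof (intro conjI ballI allI)
  show "?I \<subseteq> carrier_vec n" using Fc by auto
  show "0\<^sub>v n \<in> ?I" using mat_mult_zero_vec[OF Fc] by (intro image_eqI[of _ _ "0\<^sub>v m"]) auto
  fix v w assume "v \<in> ?I" "w \<in> ?I"
  then show "v + w \<in> ?I" using Fc by (auto simp: mult_add_distrib_mat_vec[symmetric])
 next
  fix c v assume "v \<in> ?I"
  then show "c \<cdot>\<^sub>v v \<in> ?I" using Fc by (auto simp: mult_mat_vec[symmetric])
 qed
 then have "?I = {0\<^sub>v n} \<or> ?I = carrier_vec n"
 proof (intro irreducible_rep_subsp[OF s, of ?I, folded n_def])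
  fix g v assume "g \<in> carrier X" "v \<in> ?I"
  then show "\<sigma> g *\<^sub>v v \<in> ?I" using rc[of g] by (auto simp: FI'[symmetric])
 qed
 then have "?I = carrier_vec n" using nzv by blast
 then show "(*\<^sub>v) F ` carrier_vec (rep_deg X \<rho>) = carrier_vec (rep_deg X \<sigma>)"
  by (simp add: m_def n_def)
qed

text \<open>Relations in \<open>K0\<close> come from exact sequences alone, so an isomorphism is
  recorded as a sequence whose third term is the zero representation.\<close>

lemma exact_reps_iso:
 assumes r: "is_rep X \<rho>" and s: "is_rep X \<sigma>" and F: "F \<in> intertwiners X \<rho> \<sigma>"
  and inj: "inj_on ((*\<^sub>v) F) (carrier_vec (rep_deg X \<rho>))"
  and sur: "(*\<^sub>v) F ` carrier_vec (rep_deg X \<rho>) = carrier_vec (rep_deg X \<sigma>)"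
 shows "exact_reps X \<rho> \<sigma> (%_. 0\<^sub>m 0 0)"
proof -
 define n where "n = rep_deg X \<sigma>"
 have z: "is_rep X (%_. 0\<^sub>m 0 0)" "rep_deg X (%_. 0\<^sub>m 0 0) = 0"
  by (rule is_repI; auto)+
 have sc: "\<sigma> g \<in> carrier_mat n n" if "g \<in> carrier X" for g
  using s that by (auto simp: is_rep_carrier n_def)
 have Q: "0\<^sub>m 0 n \<in> intertwiners X \<sigma> (%_. 0\<^sub>m 0 0)"
  using sc by (auto simp: intertwiners_def z n_def[symmetric] left_mult_zero_mat[of _ n n])
 have "mat_kernel (0\<^sub>m 0 n :: complex mat) = carrier_vec n"
  by (auto simp: mat_kernel[of _ 0 n] intro!: eq_vecI)
 moreover have "(*\<^sub>v) (0\<^sub>m 0 n) ` carrier_vec n = (carrier_vec 0 :: complex vec set)"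
 proof safe
  fix v :: "complex vec" assume "v \<in> carrier_vec 0"
  then have "v = 0\<^sub>m 0 n *\<^sub>v 0\<^sub>v n" by (intro eq_vecI) auto
  then show "v \<in> (*\<^sub>v) (0\<^sub>m 0 n) ` carrier_vec n" using zero_carrier_vec[of n] by blast
 qed (auto intro: mult_mat_vec_carrier[of _ 0 n])
 ultimately show ?thesis
  unfolding exact_reps_def using r s F inj sur z Q by (intro conjI bexI[of _ F] bexI[OF _ Q]) (auto simp: n_def)
qed

text \<open>If \<open>c\<close> is an eigenvalue of \<open>F\<close>, then \<open>F - c\<close> has
  a kernel and is zero by \<open>schur_bijective\<close>. Algebraic closure of the complex numbers
  enters here.\<close>

lemma schur_scalar:
 assumes r: "irreducible_rep X \<rho>" and F: "F \<in> intertwiners X \<rho> \<rho>"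
 shows "\<exists>c. F = c \<cdot>\<^sub>m 1\<^sub>m (rep_deg X \<rho>)"
proof -
 define n where "n = rep_deg X \<rho>"
 have Fc: "F \<in> carrier_mat n n" and FI: "!!g. g \<in> carrier X ==> F * \<rho> g = \<rho> g * F"
  using F by (auto simp: intertwiners_def n_def)
 have rc: "\<rho> g \<in> carrier_mat n n" if "g \<in> carrier X" for g
  using r that by (auto simp: irreducible_rep_def is_rep_carrier n_def)
 have "n ~= 0" using r by (simp add: irreducible_rep_def n_def)
 then have "degree (char_poly F) ~= 0" using degree_monic_char_poly[OF Fc] by simp
 then obtain c where "poly (char_poly F) c = 0"
  using fundamental_theorem_of_algebra[of "char_poly F"] by (auto simp: constant_degree)
 then have "eigenvalue F c" using eigenvalue_root_char_poly[OF Fc] by simp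
 then obtain v where v: "v \<in> carrier_vec n" "v ~= 0\<^sub>v n" "F *\<^sub>v v = c \<cdot>\<^sub>v v"
  using Fc by (auto simp: eigenvalue_def eigenvector_def)
 define G where "G = F - c \<cdot>\<^sub>m 1\<^sub>m n"
 have Gc: "G \<in> carrier_mat n n" by (simp add: G_def minus_carrier_mat)
 have "G \<in> intertwiners X \<rho> \<rho>"
  unfolding intertwiners_def n_def[symmetric]
 proof (intro CollectI conjI ballI Gc)
  fix g assume g: "g \<in> carrier X"
  have "G * \<rho> g = F * \<rho> g - (c \<cdot>\<^sub>m 1\<^sub>m n) * \<rho> g" unfolding G_def
   using Fc rc[OF g] by (intro minus_mult_distrib_mat) auto
  also have "(c \<cdot>\<^sub>m 1\<^sub>m n) * \<rho> g = \<rho> g * (c \<cdot>\<^sub>m 1\<^sub>m n)"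
   using rc[OF g] by (simp add: mult_smult_distrib[of "\<rho> g" n n "1\<^sub>m n" n] mult_smult_assoc_mat[of _ n n])
  also have "F * \<rho> g - \<rho> g * (c \<cdot>\<^sub>m 1\<^sub>m n) = \<rho> g * G" unfolding G_def FI[OF g]
   using Fc rc[OF g] by (intro mult_minus_distrib_mat[symmetric]) auto
  finally show "G * \<rho> g = \<rho> g * G" .
 qed
 moreover have "G *\<^sub>v v = G *\<^sub>v 0\<^sub>v n"
 proof -
  have "G *\<^sub>v v = F *\<^sub>v v - (c \<cdot>\<^sub>m 1\<^sub>m n) *\<^sub>v v" unfolding G_def
   using Fc v by (intro minus_mult_distrib_mat_vec) auto
  also have "(c \<cdot>\<^sub>m 1\<^sub>m n) *\<^sub>v v = c \<cdot>\<^sub>v v" using v by (intro eq_vecI) auto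
  finally show ?thesis using v mat_mult_zero_vec[OF Gc] by simp
 qed
 then have "\<not> inj_on ((*\<^sub>v) G) (carrier_vec n)" using v zero_carrier_vec[of n] unfolding inj_on_def by blast
 ultimately have "G = 0\<^sub>m n n" using schur_bijective(1)[OF r r] by (auto simp: n_def)
 then have "F = c \<cdot>\<^sub>m 1\<^sub>m n" using mat_diff_add_cancel(1)[of F n n "c \<cdot>\<^sub>m 1\<^sub>m n"] Fc by (simp add: G_def)
 then show ?thesis by (auto simp: n_def)
qed

section \<open>Averaging over a finite group and orthogonality of characters\<close>

locale finite_group = group +
 assumes finite_carrier: "finite (carrier G)"
begin

lemma average_intertwiner:
 assumes r: "is_rep G \<rho>" and s: "is_rep G \<sigma>" and E: "E \<in> carrier_mat (rep_deg G \<sigma>) (rep_deg G \<rho>)"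
 shows "msum (rep_deg G \<sigma>) (rep_deg G \<rho>) (carrier G) (%g. \<sigma> g * E * \<rho> (inv g)) \<in> intertwiners G \<rho> \<sigma>"
 unfolding intertwiners_def
proof (intro CollectI conjI ballI msum_carrier)
 define m n where "m = rep_deg G \<rho>" and "n = rep_deg G \<sigma>"
 have rc: "\<rho> g \<in> carrier_mat m m" and sc: "\<sigma> g \<in> carrier_mat n n" if "g \<in> carrier G" for g
  using r s that by (auto simp: is_rep_carrier m_def n_def)
 have Ec: "E \<in> carrier_mat n m" using E by (simp add: m_def n_def)
 have c: "\<sigma> g * E * \<rho> (inv g) \<in> carrier_mat n m" if "g \<in> carrier G" for g
  using rc sc Ec that by (intro mult_carrier_mat) auto
 fix h assume h: "h \<in> carrier G"
 have bij: "bij_betw (%g. h \<otimes> g) (carrier G) (carrier G)"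
  using h by (intro bij_betwI[of _ _ _ "%g. inv h \<otimes> g"]) (auto simp: m_assoc[symmetric])
 have "msum n m (carrier G) (%g. \<sigma> g * E * \<rho> (inv g)) * \<rho> h
   = msum n m (carrier G) (%g. \<sigma> (h \<otimes> g) * E * \<rho> (inv (h \<otimes> g))) * \<rho> h"
  by (subst msum_reindex[OF bij]) simp
 also have "... = msum n m (carrier G) (%g. \<sigma> (h \<otimes> g) * E * \<rho> (inv (h \<otimes> g)) * \<rho> h)"
  using h c by (intro msum_mult rc) auto
 also have "... = msum n m (carrier G) (%g. \<sigma> h * (\<sigma> g * E * \<rho> (inv g)))"
 proof (rule msum_cong)
  fix g assume g: "g \<in> carrier G"
  have "\<rho> (inv (h \<otimes> g)) * \<rho> h = \<rho> (inv (h \<otimes> g) \<otimes> h)"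
   using g h by (intro is_rep_mult[OF r, symmetric]) auto
  also have "inv (h \<otimes> g) \<otimes> h = inv g" using g h by (simp add: inv_mult_group m_assoc)
  finally have 1: "\<rho> (inv (h \<otimes> g)) * \<rho> h = \<rho> (inv g)" .
  have "\<sigma> (h \<otimes> g) * E * \<rho> (inv (h \<otimes> g)) * \<rho> h = \<sigma> (h \<otimes> g) * E * (\<rho> (inv (h \<otimes> g)) * \<rho> h)"
   using g h rc sc[of "h \<otimes> g"] Ec by (intro assoc_mult_mat[of _ n m _ m _ m] mult_carrier_mat[of _ n n]) auto
  also have "... = \<sigma> h * \<sigma> g * E * \<rho> (inv g)" unfolding 1 using is_rep_mult[OF s h g] by simp
  also have "... = \<sigma> h * (\<sigma> g * E) * \<rho> (inv g)"
   using assoc_mult_mat[OF sc[OF h] sc[OF g] Ec] by simp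
  also have "... = \<sigma> h * (\<sigma> g * E * \<rho> (inv g))"
   using g h rc sc Ec by (intro assoc_mult_mat[of _ n n _ m _ m] mult_carrier_mat[of _ n n]) auto
  finally show "\<sigma> (h \<otimes> g) * E * \<rho> (inv (h \<otimes> g)) * \<rho> h = \<sigma> h * (\<sigma> g * E * \<rho> (inv g))" .
 qed
 also have "... = \<sigma> h * msum n m (carrier G) (%g. \<sigma> g * E * \<rho> (inv g))"
  using h c by (intro mult_msum[symmetric] sc) auto
 finally show "msum (rep_deg G \<sigma>) (rep_deg G \<rho>) (carrier G) (%g. \<sigma> g * E * \<rho> (inv g)) * \<rho> h =
   \<sigma> h * msum (rep_deg G \<sigma>) (rep_deg G \<rho>) (carrier G) (%g. \<sigma> g * E * \<rho> (inv g))"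
  by (simp add: m_def n_def)
qed

definition unit_mat :: "nat => nat => nat => nat => complex mat" where
 "unit_mat n m b c = mat n m (%(i, j). if i = b & j = c then 1 else 0)"

lemma unit_mat_sandwich:
 assumes "A \<in> carrier_mat n n" "B \<in> carrier_mat m m" "a < n" "b < n" "c < m" "d < m"
 shows "(A * unit_mat n m b c * B) $$ (a, d) = A $$ (a, b) * B $$ (c, d)"
proof -
 have "(A * unit_mat n m b c) $$ (a, j) = (if j = c then A $$ (a, b) else 0)" if "j < m" for j
 proof -
  have "(A * unit_mat n m b c) $$ (a, j) = (\<Sum>k<n. A $$ (a, k) * (if k = b & j = c then 1 else 0))"
   using assms that by (auto simp: unit_mat_def scalar_prod_def atLeast0LessThan intro!: sum.cong)
  also have "... = (\<Sum>k<n. if k = b then (if j = c then A $$ (a, k) else 0) else 0)"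
   by (intro sum.cong) auto
  finally show ?thesis using assms by simp
 qed
 moreover have "(A * unit_mat n m b c * B) $$ (a, d) = (\<Sum>j<m. (A * unit_mat n m b c) $$ (a, j) * B $$ (j, d))"
  using assms by (simp add: unit_mat_def scalar_prod_def atLeast0LessThan)
 ultimately have "(A * unit_mat n m b c * B) $$ (a, d) = (\<Sum>j<m. (if j = c then A $$ (a, b) else 0) * B $$ (j, d))"
  by simp
 also have "... = (\<Sum>j<m. if j = c then A $$ (a, b) * B $$ (j, d) else 0)"
  by (intro sum.cong) auto
 finally have "(A * unit_mat n m b c * B) $$ (a, d) = (\<Sum>j<m. if j = c then A $$ (a, b) * B $$ (j, d) else 0)" .
 then show ?thesis using assms by simp
qed

text \<open>Averaging a matrix unit produces sums of products of matrix coefficients, which is how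
  Schur's lemma yields orthogonality.\<close>

lemma average_entry:
 assumes r: "is_rep G \<rho>" and s: "is_rep G \<sigma>"
  and idx: "a < rep_deg G \<sigma>" "b < rep_deg G \<sigma>" "c < rep_deg G \<rho>" "d < rep_deg G \<rho>"
 shows "msum (rep_deg G \<sigma>) (rep_deg G \<rho>) (carrier G)
   (%g. \<sigma> g * unit_mat (rep_deg G \<sigma>) (rep_deg G \<rho>) b c * \<rho> (inv g)) $$ (a, d)
  = (\<Sum>g\<in>carrier G. \<sigma> g $$ (a, b) * \<rho> (inv g) $$ (c, d))"
 unfolding msum_def using idx
 by (auto intro!: sum.cong unit_mat_sandwich is_rep_carrier[OF r] is_rep_carrier[OF s])

lemma mtr_product_sum:
 assumes r: "is_rep G \<rho>" and s: "is_rep G \<sigma>"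
 shows "(\<Sum>g\<in>carrier G. mtr (\<sigma> g) * mtr (\<rho> (inv g)))
  = (\<Sum>a<rep_deg G \<sigma>. \<Sum>c<rep_deg G \<rho>. \<Sum>g\<in>carrier G. \<sigma> g $$ (a, a) * \<rho> (inv g) $$ (c, c))"
proof -
 have "(\<Sum>g\<in>carrier G. mtr (\<sigma> g) * mtr (\<rho> (inv g)))
  = (\<Sum>g\<in>carrier G. \<Sum>a<rep_deg G \<sigma>. \<Sum>c<rep_deg G \<rho>. \<sigma> g $$ (a, a) * \<rho> (inv g) $$ (c, c))"
 proof (rule sum.cong[OF refl])
  fix g assume "g \<in> carrier G"
  then have "dim_row (\<sigma> g) = rep_deg G \<sigma>" "dim_row (\<rho> (inv g)) = rep_deg G \<rho>"
   using is_rep_carrier[OF r, of "inv g"] is_rep_carrier[OF s, of g] by auto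
  then show "mtr (\<sigma> g) * mtr (\<rho> (inv g)) = (\<Sum>a<rep_deg G \<sigma>. \<Sum>c<rep_deg G \<rho>. \<sigma> g $$ (a, a) * \<rho> (inv g) $$ (c, c))"
   by (simp add: mtr_def sum_product)
 qed
 then show ?thesis
  by (simp add: sum.swap[of _ _ "carrier G"])
qed

lemma orthogonality_distinct:
 assumes r: "irreducible_rep G \<rho>" and s: "irreducible_rep G \<sigma>" and ne: "\<not> exact_reps G \<rho> \<sigma> (%_. 0\<^sub>m 0 0)"
 shows "(\<Sum>g\<in>carrier G. mtr (\<sigma> g) * mtr (\<rho> (inv g))) = 0"
proof -
 have rr: "is_rep G \<rho>" "is_rep G \<sigma>" using r s by (auto simp: irreducible_rep_def)
 have "(\<Sum>g\<in>carrier G. \<sigma> g $$ (a, a) * \<rho> (inv g) $$ (c, c)) = 0"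
  if "a < rep_deg G \<sigma>" "c < rep_deg G \<rho>" for a c
 proof -
  let ?F = "msum (rep_deg G \<sigma>) (rep_deg G \<rho>) (carrier G)
   (%g. \<sigma> g * unit_mat (rep_deg G \<sigma>) (rep_deg G \<rho>) a c * \<rho> (inv g))"
  have F: "?F \<in> intertwiners G \<rho> \<sigma>"
   by (rule average_intertwiner[OF rr]) (simp add: unit_mat_def)
  have "?F = 0\<^sub>m (rep_deg G \<sigma>) (rep_deg G \<rho>)"
   using exact_reps_iso[OF rr F] schur_bijective[OF r s F] ne by blast
  then show ?thesis using average_entry[OF rr, of a a c c] that by simp
 qed
 then show ?thesis by (simp add: mtr_product_sum[OF rr])
qed

lemma orthogonality_self:
 assumes r: "irreducible_rep G \<rho>"
 shows "(\<Sum>g\<in>carrier G. mtr (\<rho> g) * mtr (\<rho> (inv g))) = of_nat (card (carrier G))"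
proof -
 define n where "n = rep_deg G \<rho>"
 have rr: "is_rep G \<rho>" and n0: "n ~= 0" using r by (auto simp: irreducible_rep_def n_def)
 have rc: "\<rho> g \<in> carrier_mat n n" if "g \<in> carrier G" for g
  using rr that by (auto simp: is_rep_carrier n_def)
 have "(\<Sum>g\<in>carrier G. \<rho> g $$ (a, a) * \<rho> (inv g) $$ (c, c)) = (if a = c then of_nat (card (carrier G)) / of_nat n else 0)"
  if ac: "a < n" "c < n" for a c
 proof -
  let ?M = "%g. \<rho> g * unit_mat n n a c * \<rho> (inv g)"
  have uc: "unit_mat n n a c \<in> carrier_mat n n" by (simp add: unit_mat_def)
  have "msum n n (carrier G) ?M \<in> intertwiners G \<rho> \<rho>"
   using average_intertwiner[OF rr rr] uc by (simp add: n_def)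
  then obtain k where k: "msum n n (carrier G) ?M = k \<cdot>\<^sub>m 1\<^sub>m n"
   using schur_scalar[OF r] by (auto simp: n_def)
  \<comment> \<open>Taking traces determines \<open>k\<close>: every summand is conjugate to the
    matrix unit, whose trace is 1 or 0.\<close>
  have "mtr (k \<cdot>\<^sub>m 1\<^sub>m n) = (\<Sum>g\<in>carrier G. mtr (?M g))"
   unfolding k[symmetric] using rc uc by (intro mtr_msum mult_carrier_mat) auto
  also have "... = (\<Sum>g\<in>carrier G. if a = c then 1 else 0)"
  proof (rule sum.cong[OF refl])
   fix g assume g: "g \<in> carrier G"
   have "mtr (?M g) = mtr (\<rho> (inv g) * (\<rho> g * unit_mat n n a c))"
    using g rc uc by (intro mtr_mult_commute[of _ n n] mult_carrier_mat[of _ n n]) auto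
   also have "\<rho> (inv g) * (\<rho> g * unit_mat n n a c) = \<rho> (inv g) * \<rho> g * unit_mat n n a c"
    using g rc uc by (intro assoc_mult_mat[symmetric, of _ n n _ n _ n]) auto
   also have "\<rho> (inv g) * \<rho> g = 1\<^sub>m n"
    using g is_rep_mult[OF rr, of "inv g" g] is_rep_one[OF rr] by (simp add: n_def)
   also have "mtr (1\<^sub>m n * unit_mat n n a c) = (\<Sum>i<n. if i = a then (if i = c then 1 else 0) else 0)"
    using uc by (auto simp: mtr_def unit_mat_def intro!: sum.cong)
   finally show "mtr (?M g) = (if a = c then 1 else 0)" using ac by simp
  qed
  finally have "k * of_nat n = (if a = c then of_nat (card (carrier G)) else 0)"
   by (simp add: mtr_def mult.commute)
  then have "k = (if a = c then of_nat (card (carrier G)) / of_nat n else 0)"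
   using n0 by (simp add: field_simps split: if_splits)
  moreover have "msum n n (carrier G) ?M $$ (a, c) = (\<Sum>g\<in>carrier G. \<rho> g $$ (a, a) * \<rho> (inv g) $$ (c, c))"
   using average_entry[OF rr rr] ac by (simp add: n_def)
  ultimately show ?thesis using k ac by (simp split: if_splits)
 qed
 then have "(\<Sum>g\<in>carrier G. mtr (\<rho> g) * mtr (\<rho> (inv g)))
  = (\<Sum>a<n. \<Sum>c<n. if a = c then of_nat (card (carrier G)) / of_nat n else 0)"
  unfolding mtr_product_sum[OF rr rr] n_def[symmetric] by (intro sum.cong) auto
 then show ?thesis using n0 by simp
qed

end

section \<open>Grothendieck groups of finite groups\<close>

lemma comm_group_cong:
 assumes "comm_group N" "carrier M = carrier N" "!!x y. x \<otimes>\<^bsub>M\<^esub> y = x \<otimes>\<^bsub>N\<^esub> y" "\<one>\<^bsub>M\<^esub> = \<one>\<^bsub>N\<^esub>"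
 shows "comm_group M"
proof -
 interpret N: comm_group N by fact
 show ?thesis
  by (rule comm_groupI) (use assms N.l_inv in \<open>auto simp: N.m_assoc intro: N.m_comm\<close>)
qed

lemma sum_Nats: "(!!i. i \<in> I ==> (f i :: complex) \<in> \<nat>) ==> sum f I \<in> \<nat>"
 by (induction I rule: infinite_finite_induct) auto

lemma (in comm_group) zlift_uminus:
 assumes "!!b. b \<in> keys c ==> f b \<in> carrier G"
 shows "zlift G f (- c) = inv (zlift G f c)"
proof -
 have "zlift G f (- c) \<otimes> zlift G f c = \<one>"
  using assms by (subst zlift_add[symmetric]) auto
 then show ?thesis
  using assms by (intro inv_equality[symmetric] zlift_closed) auto
qed

lemma (in comm_group) zlift_diff:
 assumes "!!b. b \<in> keys c \<union> keys d ==> f b \<in> carrier G"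
 shows "zlift G f (c - d) = zlift G f c \<otimes> inv (zlift G f d)"
 using zlift_add[of c "- d" f] zlift_uminus[of d f] assms by auto

text \<open>On the zero space a representation is its own subobject and quotient, so its class
  equals twice itself and vanishes in \<open>K0\<close>.\<close>

lemma exact_reps_deg0:
 assumes "is_rep X \<rho>" "rep_deg X \<rho> = 0"
 shows "exact_reps X \<rho> \<rho> \<rho>"
proof -
 have v0: "carrier_vec 0 = {0\<^sub>v 0 :: complex vec}" by (auto intro!: eq_vecI)
 have 1: "0\<^sub>m 0 0 \<in> intertwiners X \<rho> \<rho>"
  unfolding intertwiners_def assms(2)
 proof (intro CollectI conjI ballI)
  fix g assume "g \<in> carrier X"
  then have "\<rho> g \<in> carrier_mat 0 0" using is_rep_carrier[OF assms(1)] assms(2) by metis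
  then show "0\<^sub>m 0 0 * \<rho> g = \<rho> g * 0\<^sub>m 0 0" by (intro eq_matI) auto
 qed simp
 have ker: "mat_kernel (0\<^sub>m 0 0) = {0\<^sub>v 0 :: complex vec}"
  by (auto simp: mat_kernel[of _ 0 0] v0)
 have z: "0\<^sub>m 0 0 *\<^sub>v 0\<^sub>v 0 = (0\<^sub>v 0 :: complex vec)" by (intro eq_vecI) auto
 have "inj_on ((*\<^sub>v) (0\<^sub>m 0 0)) (carrier_vec 0 :: complex vec set)"
  "(*\<^sub>v) (0\<^sub>m 0 0) ` carrier_vec 0 = mat_kernel (0\<^sub>m 0 0 :: complex mat)"
  "(*\<^sub>v) (0\<^sub>m 0 0) ` carrier_vec 0 = (carrier_vec 0 :: complex vec set)"
  unfolding ker v0 using z by auto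
 then show ?thesis
  unfolding exact_reps_def assms(2) by (intro conjI assms(1) bexI[of _ "0\<^sub>m 0 0"] 1)
qed

text \<open>The character of a class. Every representative gives the same value, by
  \<open>lin_K0_rel\<close>.\<close>

definition kch :: "('x, 'm) monoid_scheme => 'x k0 => 'x => complex" where
 "kch X C g = lin (SOME c. c \<in> C) (%\<rho>. mtr (\<rho> g))"

text \<open>The scalar product of characters, with \<open>\<psi>\<close> at the inverse in place of
  a complex conjugate. It is bilinear, and unitary structures never have to be introduced.\<close>

definition bform :: "('x, 'm) monoid_scheme => ('x => complex) => ('x => complex) => complex" where
 "bform X \<phi> \<psi> = (\<Sum>g\<in>carrier X. \<phi> g * \<psi> (inv\<^bsub>X\<^esub> g)) / of_nat (card (carrier X))"

definition K0_dual :: "('x, 'm) monoid_scheme => 'x k0 => 'x k0 => complex" where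
 "K0_dual X w C = bform X (kch X C) (kch X w)"

lemma bform_lin: "bform X (%g. lin c (%\<rho>. u \<rho> g)) \<psi> = lin c (%\<rho>. bform X (u \<rho>) \<psi>)"
 by (simp add: bform_def divide_inverse lin_mult_right lin_fun_sum)

context finite_group begin

lemma card_carrier_nonzero: "of_nat (card (carrier G)) ~= (0 :: complex)"
 using finite_carrier one_closed by auto

lemma bform_cong:
 "(!!g. g \<in> carrier G ==> \<phi> g = \<phi>' g) ==> (!!g. g \<in> carrier G ==> \<psi> g = \<psi>' g) ==> bform G \<phi> \<psi> = bform G \<phi>' \<psi>'"
 by (simp add: bform_def)

lemma bform_add: "bform G (%g. \<phi> g + \<phi>' g) \<psi> = bform G \<phi> \<psi> + bform G \<phi>' \<psi>"
 by (simp add: bform_def distrib_right sum.distrib add_divide_distrib)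

lemma subgroup_K0_rel: "subgroup (K0_rel G) (free_reps G)"
 unfolding K0_rel_def
proof (rule group.generate_is_subgroup)
 show "{frag_of \<sigma> - frag_of \<rho> - frag_of \<tau> | \<rho> \<sigma> \<tau>. exact_reps G \<rho> \<sigma> \<tau>} \<subseteq> carrier (free_reps G)"
 proof
  fix c assume "c \<in> {frag_of \<sigma> - frag_of \<rho> - frag_of \<tau> | \<rho> \<sigma> \<tau>. exact_reps G \<rho> \<sigma> \<tau>}"
  then obtain \<rho> \<sigma> \<tau> where c: "c = frag_of \<sigma> - frag_of \<rho> - frag_of \<tau>" "exact_reps G \<rho> \<sigma> \<tau>" by blast
  have "keys c \<subseteq> {\<rho>, \<sigma>, \<tau>}"
   unfolding c using keys_diff[of "frag_of \<sigma> - frag_of \<rho>" "frag_of \<tau>"] keys_diff[of "frag_of \<sigma>" "frag_of \<rho>"]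
   by (auto simp: keys_frag_of)
  then show "c \<in> carrier (free_reps G)" using c(2) by (auto simp: exact_reps_def)
 qed
qed simp

lemma K0_rel_closed:
 "0 \<in> K0_rel G" "a \<in> K0_rel G ==> b \<in> K0_rel G ==> a + b \<in> K0_rel G" "a \<in> K0_rel G ==> - a \<in> K0_rel G"
proof -
 interpret R: subgroup "K0_rel G" "free_reps G" by (rule subgroup_K0_rel)
 show "0 \<in> K0_rel G" using R.one_closed by simp
 show "a \<in> K0_rel G ==> b \<in> K0_rel G ==> a + b \<in> K0_rel G" using R.m_closed by simp
 show "- a \<in> K0_rel G" if "a \<in> K0_rel G"
 proof -
  have "a \<in> carrier (free_reps G)" using R.mem_carrier[OF that] .
  then have "inv\<^bsub>free_reps G\<^esub> a = - a" by simp
  then show ?thesis using R.m_inv_closed[OF that] by simp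
 qed
qed

lemma K0_rel_exact: "exact_reps G \<rho> \<sigma> \<tau> ==> frag_of \<sigma> - frag_of \<rho> - frag_of \<tau> \<in> K0_rel G"
 unfolding K0_rel_def by (rule generate.incl) blast

lemma lin_K0_rel:
 assumes "r \<in> K0_rel G" "g \<in> carrier G"
 shows "lin r (%\<rho>. mtr (\<rho> g)) = 0"
 using assms(1) unfolding K0_rel_def
proof (induction rule: generate.induct)
 case (inv h)
 then obtain \<rho> \<sigma> \<tau> where "h = frag_of \<sigma> - frag_of \<rho> - frag_of \<tau>" "exact_reps G \<rho> \<sigma> \<tau>" by blast
 moreover from this have "h \<in> carrier (free_reps G)"
  using subgroup.subset[OF subgroup_K0_rel] K0_rel_exact by blast
 ultimately show ?case using exact_reps_trace[of G \<rho> \<sigma> \<tau> g] assms(2)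
  by (simp add: lin_uminus lin_diff)
qed (auto simp: lin_diff lin_add exact_reps_trace[OF _ assms(2)])

lemma K0_class_altdef: "K0_class G c = (%r. r + c) ` K0_rel G"
 by (auto simp: K0_class_def r_coset_def)

lemma K0_class_self: "c \<in> K0_class G c"
 using K0_rel_closed(1) by (force simp: K0_class_altdef)

lemma K0_class_eq_iff: "K0_class G c = K0_class G d \<longleftrightarrow> c - d \<in> K0_rel G"
proof
 assume "K0_class G c = K0_class G d"
 then have "c \<in> K0_class G d" using K0_class_self by blast
 then show "c - d \<in> K0_rel G" by (auto simp: K0_class_altdef)
next
 assume cd: "c - d \<in> K0_rel G"
 have sub: "K0_class G c \<subseteq> K0_class G d" if "c - d \<in> K0_rel G" for c d
 proof
  fix x assume "x \<in> K0_class G c"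
  then obtain r where "r \<in> K0_rel G" "x = r + c" by (auto simp: K0_class_altdef)
  then show "x \<in> K0_class G d" using K0_rel_closed(2)[OF _ that, of r]
   by (auto simp: K0_class_altdef intro!: image_eqI[of _ _ "r + (c - d)"])
 qed
 show "K0_class G c = K0_class G d" using sub[OF cd] sub[of d c] K0_rel_closed(3)[OF cd] by auto
qed

lemma normal_K0_rel: "K0_rel G \<lhd> free_reps G"
 by (rule comm_group.subgroup_imp_normal[OF abelian_free_Abelian_group subgroup_K0_rel])

lemma carrier_K0: "carrier (K0 G) = K0_class G ` carrier (free_reps G)"
 by (auto simp: K0_def FactGroup_def RCOSETS_def K0_class_def)

lemma one_K0: "\<one>\<^bsub>K0 G\<^esub> = K0_class G 0"
 by (simp add: K0_def FactGroup_def K0_class_altdef)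

lemma mult_K0:
 "c \<in> carrier (free_reps G) ==> d \<in> carrier (free_reps G) ==> K0_class G c \<otimes>\<^bsub>K0 G\<^esub> K0_class G d = K0_class G (c + d)"
 using normal.rcos_sum[OF normal_K0_rel, of c d] by (simp add: K0_def FactGroup_def K0_class_def)

lemma comm_group_K0: "comm_group (K0 G)"
proof (rule comm_group_cong)
 show "comm_group (free_reps G Mod K0_rel G)"
  by (rule comm_group.abelian_FactGroup[OF abelian_free_Abelian_group subgroup_K0_rel])
qed (auto simp: K0_def)

lemma K0_class_closed: "c \<in> carrier (free_reps G) ==> K0_class G c \<in> carrier (K0 G)"
 by (simp add: carrier_K0)

lemma kch_class:
 assumes g: "g \<in> carrier G"
 shows "kch G (K0_class G c) g = lin c (%\<rho>. mtr (\<rho> g))"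
proof -
 have "(SOME d. d \<in> K0_class G c) \<in> K0_class G c" using K0_class_self by (metis someI)
 then obtain r where "r \<in> K0_rel G" "(SOME d. d \<in> K0_class G c) = r + c" by (auto simp: K0_class_altdef)
 then show ?thesis by (simp add: kch_def lin_add lin_K0_rel g)
qed

lemma add_fun_kch: "g \<in> carrier G ==> add_fun (K0 G) (%C. kch G C g)"
proof (rule add_funI)
 fix C D assume "C \<in> carrier (K0 G)" "D \<in> carrier (K0 G)" and g: "g \<in> carrier G"
 then obtain c d where "C = K0_class G c" "D = K0_class G d" "c \<in> carrier (free_reps G)" "d \<in> carrier (free_reps G)"
  unfolding carrier_K0 by blast
 then show "kch G (C \<otimes>\<^bsub>K0 G\<^esub> D) g = kch G C g + kch G D g"
  using g by (simp only: mult_K0 kch_class lin_add)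
qed

lemma irr_K0: "irr (K0 G) = {K0_class G (frag_of \<rho>) | \<rho>. irreducible_rep G \<rho>}"
 by (simp add: K0_def)

lemma irr_K0_closed: "irr (K0 G) \<subseteq> carrier (K0 G)"
 unfolding irr_K0 by (auto simp: irreducible_rep_def keys_frag_of intro!: K0_class_closed)

lemma add_fun_K0_dual: "add_fun (K0 G) (K0_dual G w)"
 unfolding K0_dual_def
 by (rule add_funI) (subst bform_add[symmetric], rule bform_cong, auto simp: add_fun_mult[OF add_fun_kch])

lemma dual_system_K0: "dual_system (K0 G) (K0_dual G)"
 unfolding dual_system_def
proof (intro ballI conjI add_fun_K0_dual)
 fix w v assume "w \<in> irr (K0 G)" "v \<in> irr (K0 G)"
 then obtain \<rho> \<sigma> where *: "w = K0_class G (frag_of \<rho>)" "v = K0_class G (frag_of \<sigma>)"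
  "irreducible_rep G \<rho>" "irreducible_rep G \<sigma>" by (auto simp: irr_K0)
 have eq: "K0_dual G w v = (\<Sum>g\<in>carrier G. kch G v g * kch G w (inv g)) / of_nat (card (carrier G))"
  by (simp add: K0_dual_def bform_def)
 show "K0_dual G w v = (if v = w then 1 else 0)"
 proof (cases "v = w")
  case True
  then have "K0_dual G w v = (\<Sum>g\<in>carrier G. mtr (\<rho> g) * mtr (\<rho> (inv g))) / of_nat (card (carrier G))"
   unfolding eq by (simp add: *(1) kch_class)
  then show ?thesis using True orthogonality_self[OF *(3)] card_carrier_nonzero by simp
 next
  case False
  \<comment> \<open>Otherwise the two classes would agree, the class of the zero representation
    being zero by \<open>exact_reps_deg0\<close>.\<close>
  have "\<not> exact_reps G \<rho> \<sigma> (%_. 0\<^sub>m 0 0)"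
  proof
   assume e: "exact_reps G \<rho> \<sigma> (%_. 0\<^sub>m 0 0)"
   then have z: "is_rep G (%_. 0\<^sub>m 0 0)" by (simp add: exact_reps_def)
   have "exact_reps G (%_. 0\<^sub>m 0 0) (%_. 0\<^sub>m 0 0) (%_. 0\<^sub>m 0 0)"
    by (rule exact_reps_deg0[OF z]) (simp add: rep_deg_def)
   from K0_rel_closed(2)[OF K0_rel_exact[OF e] K0_rel_closed(3)[OF K0_rel_exact[OF this]]]
   have "frag_of \<sigma> - frag_of \<rho> \<in> K0_rel G" by simp
   then show False using False * by (simp add: K0_class_eq_iff)
  qed
  from orthogonality_distinct[OF *(3,4) this] show ?thesis
   using False unfolding eq by (simp add: *(1,2) kch_class)
 qed
qed

text \<open>Jordan-Hoelder by induction on the degree: classes are additive on exact sequences, so a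
  composition series suffices. The sign condition is what later makes multiplicities natural
  numbers.\<close>

lemma rep_decomposition:
 "is_rep G \<rho> ==> \<exists>c. keys c \<subseteq> {\<sigma>. irreducible_rep G \<sigma>} & (\<forall>\<sigma>. 0 \<le> lookup c \<sigma>) &
  K0_class G (frag_of \<rho>) = K0_class G c"
proof (induction "rep_deg G \<rho>" arbitrary: \<rho> rule: less_induct)
 case less
 consider "irreducible_rep G \<rho>" | "rep_deg G \<rho> = 0" | "\<not> irreducible_rep G \<rho>" "rep_deg G \<rho> ~= 0" by blast
 then show ?case
 proof cases
  case 1
  then show ?thesis by (intro exI[of _ "frag_of \<rho>"]) (auto simp: keys_frag_of lookup_frag_of)
 next
  case 2
  from K0_rel_closed(3)[OF K0_rel_exact[OF exact_reps_deg0[OF less.prems 2]]]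
  have "K0_class G (frag_of \<rho>) = K0_class G 0" by (simp add: K0_class_eq_iff)
  then show ?thesis by (intro exI[of _ 0]) auto
 next
  case 3
  then obtain W where W: "subsp (rep_deg G \<rho>) W" "!!g v. g \<in> carrier G ==> v \<in> W ==> \<rho> g *\<^sub>v v \<in> W"
   "W ~= {0\<^sub>v (rep_deg G \<rho>)}" "W ~= carrier_vec (rep_deg G \<rho>)"
   using irreducible_repI[OF less.prems 3(2)] 3(1) by blast
  obtain \<sigma> \<tau> where e: "exact_reps G \<sigma> \<rho> \<tau>" "rep_deg G \<sigma> < rep_deg G \<rho>" "rep_deg G \<tau> < rep_deg G \<rho>"
   using exact_reps_subrep[OF less.prems W] is_monoid by blast
  then have r: "is_rep G \<sigma>" "is_rep G \<tau>" by (auto simp: exact_reps_def)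
  obtain c d where c: "keys c \<subseteq> {\<sigma>. irreducible_rep G \<sigma>}" "\<forall>\<sigma>. 0 \<le> lookup c \<sigma>" "K0_class G (frag_of \<sigma>) = K0_class G c"
   and d: "keys d \<subseteq> {\<sigma>. irreducible_rep G \<sigma>}" "\<forall>\<sigma>. 0 \<le> lookup d \<sigma>" "K0_class G (frag_of \<tau>) = K0_class G d"
   using less.hyps[OF e(2) r(1)] less.hyps[OF e(3) r(2)] by blast
  have "frag_of \<rho> - frag_of \<sigma> - frag_of \<tau> + ((frag_of \<sigma> - c) + (frag_of \<tau> - d)) \<in> K0_rel G"
   using c(3) d(3) e(1) by (intro K0_rel_closed K0_rel_exact) (auto simp: K0_class_eq_iff)
  then have "K0_class G (frag_of \<rho>) = K0_class G (c + d)" by (simp add: K0_class_eq_iff algebra_simps)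
  then show ?thesis using c d keys_add[of c d] by (intro exI[of _ "c + d"]) (auto simp: lookup_add)
 qed
qed

lemma K0_span:
 assumes "C \<in> carrier (K0 G)"
 shows "\<exists>d. keys d \<subseteq> irr (K0 G) & zlift (K0 G) (%x. x) d = C"
proof -
 interpret K: comm_group "K0 G" by (rule comm_group_K0)
 let ?Q = "%c. \<exists>d. keys d \<subseteq> irr (K0 G) & zlift (K0 G) (%x. x) d = K0_class G c"
 \<comment> \<open>Both inductions below, over differences of generators, need this closure; the
   support condition is carried along to keep all classes inside \<open>K0\<close>.\<close>
 have kdiff: "keys (a - b) \<subseteq> S & ?Q (a - b)"
  if S: "S \<subseteq> {\<rho>. is_rep G \<rho>}" and a: "keys a \<subseteq> S & ?Q a" and b: "keys b \<subseteq> S & ?Q b" for S a b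
 proof -
  obtain d d' where d: "keys d \<subseteq> irr (K0 G)" "zlift (K0 G) (%x. x) d = K0_class G a"
   and d': "keys d' \<subseteq> irr (K0 G)" "zlift (K0 G) (%x. x) d' = K0_class G b" using a b by blast
  have ab: "a \<in> carrier (free_reps G)" "b \<in> carrier (free_reps G)" "a - b \<in> carrier (free_reps G)"
   using a b S keys_diff[of a b] by auto
  have "zlift (K0 G) (%x. x) (d - d') = K0_class G a \<otimes>\<^bsub>K0 G\<^esub> inv\<^bsub>K0 G\<^esub> K0_class G b"
   using d d' irr_K0_closed by (subst K.zlift_diff) auto
  also have "K0_class G a = K0_class G (a - b) \<otimes>\<^bsub>K0 G\<^esub> K0_class G b"
   using mult_K0[OF ab(3,2)] by simp
  also have "... \<otimes>\<^bsub>K0 G\<^esub> inv\<^bsub>K0 G\<^esub> K0_class G b = K0_class G (a - b)"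
   using K0_class_closed[OF ab(2)] K0_class_closed[OF ab(3)] by (simp add: K.m_assoc)
  finally show ?thesis using d(1) d'(1) a b keys_diff[of d d'] keys_diff[of a b] by (intro conjI exI[of _ "d - d'"]) auto
 qed
 have zero: "?Q 0" by (intro exI[of _ 0]) (simp add: one_K0)
 have irreps: "?Q c" if "keys c \<subseteq> {\<sigma>. irreducible_rep G \<sigma>}" for c
 proof -
  have "keys c \<subseteq> {\<sigma>. irreducible_rep G \<sigma>} & ?Q c"
   using that
  proof (induction rule: frag_induction)
   case (one \<rho>)
   then have "K0_class G (frag_of \<rho>) \<in> irr (K0 G)" by (auto simp: irr_K0)
   then have "keys (frag_of (K0_class G (frag_of \<rho>))) \<subseteq> irr (K0 G)"
    "zlift (K0 G) (%x. x) (frag_of (K0_class G (frag_of \<rho>))) = K0_class G (frag_of \<rho>)"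
    using irr_K0_closed by (auto simp: keys_frag_of intro!: K.zlift_of)
   then show ?case using one by (intro conjI exI[of _ "frag_of (K0_class G (frag_of \<rho>))"]) (simp_all add: keys_frag_of)
  next
   case (diff a b)
   have "{\<sigma>. irreducible_rep G \<sigma>} \<subseteq> {\<rho>. is_rep G \<rho>}" by (auto simp: irreducible_rep_def)
   from kdiff[OF this diff] show ?case .
  qed (use zero in simp)
  then show ?thesis by blast
 qed
 obtain c where c: "C = K0_class G c" "keys c \<subseteq> {\<rho>. is_rep G \<rho>}"
  using assms by (auto simp: carrier_K0)
 have "keys c \<subseteq> {\<rho>. is_rep G \<rho>} & ?Q c"
  using c(2)
 proof (induction rule: frag_induction)
  case (one \<rho>)
  then obtain c where "keys c \<subseteq> {\<sigma>. irreducible_rep G \<sigma>}" "K0_class G (frag_of \<rho>) = K0_class G c"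
   using rep_decomposition[of \<rho>] by blast
  then show ?case using irreps[of c] one by (simp only: keys_frag_of) simp
 next
  case (diff a b)
  from kdiff[OF subset_refl diff] show ?case .
 qed (use zero in simp)
 then show ?thesis using c by blast
qed

lemma tgroup_K0: "tgroup (K0 G)"
 by (rule tgroup_dualI[OF comm_group_K0 irr_K0_closed dual_system_K0 K0_span])

lemma separates_K0: "separates (carrier G) (%g C. kch G C g) (K0 G)"
 unfolding separates_def
proof
 fix w assume w: "w \<in> irr (K0 G)"
 have "(\<Sum>g\<in>carrier G. (kch G w (inv g) / of_nat (card (carrier G))) * kch G v g) = (if v = w then 1 else 0)"
  if "v \<in> irr (K0 G)" for v
 proof -
  have "(\<Sum>g\<in>carrier G. (kch G w (inv g) / of_nat (card (carrier G))) * kch G v g) = K0_dual G w v"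
   by (simp add: K0_dual_def bform_def sum_divide_distrib mult.commute)
  then show ?thesis using dual_system_K0 w that by (auto simp: dual_system_def)
 qed
 then show "\<exists>F a. finite F & F \<subseteq> carrier G & (\<forall>v\<in>irr (K0 G). (\<Sum>p\<in>F. a p * kch G v p) = (if v = w then 1 else 0))"
  using finite_carrier by (intro exI[of _ "carrier G"] exI[of _ "%g. kch G w (inv g) / of_nat (card (carrier G))"]) auto
qed

text \<open>Coordinates are combinations of character values by \<open>separates_K0\<close>, so
  equalities in \<open>K0\<close> reduce from here on to equalities of characters.\<close>

lemma K0_eqI:
 "C \<in> carrier (K0 G) ==> D \<in> carrier (K0 G) ==> (!!g. g \<in> carrier G ==> kch G C g = kch G D g) ==> C = D"
 by (rule tgroup.separates_eq[OF tgroup_K0 separates_K0]) (auto simp: add_fun_kch)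

lemma kch_one: "g \<in> carrier G ==> kch G \<one>\<^bsub>K0 G\<^esub> g = 0"
 by (simp add: one_K0 kch_class)

lemma rep_class_closed: "is_rep G \<rho> ==> K0_class G (frag_of \<rho>) \<in> carrier (K0 G)"
 by (auto intro!: K0_class_closed simp: keys_frag_of)

lemma K0_dual_rep_Nats:
 assumes r: "is_rep G \<rho>" and w: "w \<in> irr (K0 G)"
 shows "K0_dual G w (K0_class G (frag_of \<rho>)) \<in> \<nat>"
proof -
 obtain c where c: "keys c \<subseteq> {\<sigma>. irreducible_rep G \<sigma>}" "!!\<sigma>. 0 \<le> lookup c \<sigma>"
  "K0_class G (frag_of \<rho>) = K0_class G c" using rep_decomposition[OF r] by blast
 have "K0_dual G w (K0_class G (frag_of \<rho>)) = bform G (%g. lin c (%\<sigma>. kch G (K0_class G (frag_of \<sigma>)) g)) (kch G w)"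
  unfolding K0_dual_def c(3) by (rule bform_cong) (auto simp: kch_class)
 also have "... = lin c (%\<sigma>. K0_dual G w (K0_class G (frag_of \<sigma>)))"
  by (simp add: bform_lin K0_dual_def)
 also have "... \<in> \<nat>"
  unfolding lin_def
 proof (rule sum_Nats)
  fix \<sigma> assume "\<sigma> \<in> keys c"
  then have "K0_class G (frag_of \<sigma>) \<in> irr (K0 G)" using c(1) by (auto simp: irr_K0)
  then have "K0_dual G w (K0_class G (frag_of \<sigma>)) \<in> \<nat>" using dual_system_K0 w by (auto simp: dual_system_def)
  moreover have "(of_int (lookup c \<sigma>) :: complex) \<in> \<nat>"
   using c(2)[of \<sigma>] by (auto elim!: nonneg_int_cases)
  ultimately show "of_int (lookup c \<sigma>) * K0_dual G w (K0_class G (frag_of \<sigma>)) \<in> \<nat>"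
   by (rule Nats_mult[rotated])
 qed
 finally show ?thesis .
qed

lemma K0_dual_self:
 assumes "C \<in> carrier (K0 G)"
 shows "K0_dual G C C = of_int (\<Sum>w\<in>keys (coords (K0 G) C). (lookup (coords (K0 G) C) w)\<^sup>2)"
proof -
 interpret T: tgroup "K0 G" by (rule tgroup_K0)
 have sym: "bform G \<phi> \<psi> = bform G \<psi> \<phi>" for \<phi> \<psi>
 proof -
  have "(\<Sum>g\<in>carrier G. \<phi> g * \<psi> (inv g)) = (\<Sum>g\<in>carrier G. \<psi> g * \<phi> (inv g))"
   by (rule sum.reindex_bij_witness[of _ "%g. inv g" "%g. inv g"]) auto
  then show ?thesis by (simp add: bform_def)
 qed
 have "K0_dual G C C = lin (coords (K0 G) C) (%w. K0_dual G C w)"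
  by (rule T.lin_coords[OF add_fun_K0_dual assms, symmetric])
 also have "... = lin (coords (K0 G) C) (%w. of_int (lookup (coords (K0 G) C) w))"
 proof (rule lin_cong)
  fix w assume "w \<in> keys (coords (K0 G) C)"
  then have "w \<in> irr (K0 G)" using T.keys_coords[OF assms] by blast
  then have "of_int (lookup (coords (K0 G) C) w) = K0_dual G w C"
   by (rule T.lookup_coords[OF dual_system_K0 assms])
  then show "K0_dual G C w = of_int (lookup (coords (K0 G) C) w)"
   by (simp add: K0_dual_def sym)
 qed
 finally show ?thesis by (simp add: lin_def power2_eq_square)
qed

text \<open>The squares of the multiplicities add up to the norm 1, so a single irreducible occurs,
  with coefficient 1 or -1. The class of an actual representation excludes -1.\<close>

lemma irr_K0I:
 assumes r: "is_rep G \<rho>" and n: "bform G (%g. mtr (\<rho> g)) (%g. mtr (\<rho> g)) = 1"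
 shows "K0_class G (frag_of \<rho>) \<in> irr (K0 G)"
proof -
 interpret T: tgroup "K0 G" by (rule tgroup_K0)
 let ?C = "K0_class G (frag_of \<rho>)" and ?c = "coords (K0 G) (K0_class G (frag_of \<rho>))"
 have C: "?C \<in> carrier (K0 G)" by (rule rep_class_closed[OF r])
 have pos: "0 \<le> lookup ?c w" for w
 proof (cases "w \<in> irr (K0 G)")
  case True
  then have "(of_int (lookup ?c w) :: complex) \<in> \<nat>"
   using K0_dual_rep_Nats[OF r] T.lookup_coords[OF dual_system_K0 C] by simp
  then obtain n where "(of_int (lookup ?c w) :: complex) = of_nat n" by (elim Nats_cases)
  then have "(of_int (lookup ?c w) :: complex) = of_int (int n)" by simp
  then show ?thesis by (simp only: of_int_eq_iff)
 next
  case False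
  then have "w \<notin> keys ?c" using T.keys_coords[OF C] by blast
  then show ?thesis by (simp add: in_keys_iff)
 qed
 have "K0_dual G ?C ?C = 1"
  using n unfolding K0_dual_def by (subst bform_cong[of _ "%g. mtr (\<rho> g)" _ "%g. mtr (\<rho> g)"]) (auto simp: kch_class)
 then have "(of_int (\<Sum>w\<in>keys ?c. (lookup ?c w)\<^sup>2) :: complex) = of_int 1"
  unfolding K0_dual_self[OF C] by simp
 then have s1: "(\<Sum>w\<in>keys ?c. (lookup ?c w)\<^sup>2) = 1"
  by (simp only: of_int_eq_iff)
 have ge: "1 \<le> (lookup ?c w)\<^sup>2" if "w \<in> keys ?c" for w
 proof -
  have "1 \<le> lookup ?c w" using that pos[of w] by (simp add: in_keys_iff)
  then show ?thesis by (rule one_le_power)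
 qed
 have "int (card (keys ?c)) \<le> 1"
 proof -
  have "(\<Sum>w\<in>keys ?c. 1) \<le> (\<Sum>w\<in>keys ?c. (lookup ?c w)\<^sup>2)"
   by (intro sum_mono ge)
  then show ?thesis unfolding s1 by simp
 qed
 moreover have "keys ?c ~= {}" using s1 by auto
 ultimately have "card (keys ?c) = 1" by (simp add: card_gt_0_iff Suc_leI le_antisym)
 then obtain w where w: "keys ?c = {w}" by (auto simp: card_1_singleton_iff)
 then have l: "lookup ?c w = 1" using s1 pos[of w] by (simp add: power2_eq_1_iff)
 have "?c = frag_of w"
 proof (rule poly_mapping_eqI)
  fix v
  show "lookup ?c v = lookup (frag_of w) v"
  proof (cases "v = w")
   case False
   then have "v \<notin> keys ?c" using w by simp
   then show ?thesis using False by (simp add: in_keys_iff lookup_frag_of)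
  qed (use l in simp)
 qed
 moreover have wi: "w \<in> irr (K0 G)" using w T.keys_coords[OF C] by auto
 ultimately have "?C = w" using T.zlift_coords[OF C] T.irr_closed by (auto simp: T.zlift_of)
 then show ?thesis using wi by simp
qed

end

subsection \<open>Functoriality and outer tensor products\<close>

lemma finite_group_DirProd:
 assumes "finite_group X" "finite_group Y"
 shows "finite_group (X \<times>\<times> Y)"
proof -
 interpret X: finite_group X by fact
 interpret Y: finite_group Y by fact
 interpret group "X \<times>\<times> Y" by (rule DirProd_group[OF X.group_axioms Y.group_axioms])
 show ?thesis by unfold_locales (use X.finite_carrier Y.finite_carrier in auto)
qed

lemma (in finite_group) K0_cases:
 assumes "C \<in> carrier (K0 G)"
 obtains c where "c \<in> carrier (free_reps G)" "C = K0_class G c" "!!c'. c' \<in> C ==> c' \<in> carrier (free_reps G)"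
  "!!c' g. c' \<in> C ==> g \<in> carrier G ==> lin c' (%\<rho>. mtr (\<rho> g)) = kch G C g"
proof -
 obtain c where c: "c \<in> carrier (free_reps G)" "C = K0_class G c" using assms by (auto simp: carrier_K0)
 show thesis
 proof (rule that[OF c])
  fix c' assume "c' \<in> C"
  then obtain r where r: "r \<in> K0_rel G" "c' = r + c" by (auto simp: c K0_class_altdef)
  have "r \<in> carrier (free_reps G)" using subgroup.mem_carrier[OF subgroup_K0_rel r(1)] .
  then show "c' \<in> carrier (free_reps G)" using c keys_add[of r c] by (auto simp: r)
  show "lin c' (%\<rho>. mtr (\<rho> g)) = kch G C g" if "g \<in> carrier G" for g
   using that r by (simp add: c kch_class lin_add lin_K0_rel)
 qed
qed

text \<open>The definition takes \<open>the_elem\<close> over all representatives of a class. The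
  trace of \<open>F \<rho>\<close> is a fixed combination of the traces of \<open>\<rho>\<close>, so
  the resulting character does not depend on the representative, and \<open>K0_eqI\<close> gives
  well-definedness. This stands in for exactness of the functor.\<close>

lemma K0_map:
 assumes X: "finite_group X" and Y: "finite_group Y"
  and rep: "!!\<rho>. is_rep X \<rho> ==> is_rep Y (F \<rho>)"
  and tr: "!!\<rho> y. is_rep X \<rho> ==> y \<in> carrier Y ==> mtr (F \<rho> y) = (\<Sum>g\<in>carrier X. a y g * mtr (\<rho> g))"
  and C: "C \<in> carrier (K0 X)"
 shows "K0_map X Y F C \<in> carrier (K0 Y)"
  and "y \<in> carrier Y ==> kch Y (K0_map X Y F C) y = (\<Sum>g\<in>carrier X. a y g * kch X C g)"
proof -
 interpret X: finite_group X by fact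
 interpret Y: finite_group Y by fact
 obtain c where c: "c \<in> carrier (free_reps X)" "C = K0_class X c" "!!c'. c' \<in> C ==> c' \<in> carrier (free_reps X)"
  "!!c' g. c' \<in> C ==> g \<in> carrier X ==> lin c' (%\<rho>. mtr (\<rho> g)) = kch X C g"
  using X.K0_cases[OF C] by blast
 let ?F = "%c. frag_extend (%\<rho>. frag_of (F \<rho>)) c"
 have cl: "?F c' \<in> carrier (free_reps Y)" if "c' \<in> C" for c'
  using c(3)[OF that] rep
  by (simp del: Collect_mem_eq, intro keys_frag_extend_subset) (auto simp: keys_frag_of)
 have k: "kch Y (K0_class Y (?F c')) y = (\<Sum>g\<in>carrier X. a y g * kch X C g)" if "c' \<in> C" "y \<in> carrier Y" for c' y
 proof -
  have "kch Y (K0_class Y (?F c')) y = lin c' (%\<rho>. mtr (F \<rho> y))"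
   using that by (simp add: Y.kch_class lin_extend)
  also have "... = lin c' (%\<rho>. \<Sum>g\<in>carrier X. a y g * mtr (\<rho> g))"
   using c(3)[OF that(1)] that(2) by (intro lin_cong tr) auto
  also have "... = (\<Sum>g\<in>carrier X. a y g * lin c' (%\<rho>. mtr (\<rho> g)))"
   by (simp add: lin_fun_sum lin_mult_left)
  finally show ?thesis using c(4)[OF that(1)] by simp
 qed
 have cC: "c \<in> C" unfolding c(2) by (rule X.K0_class_self)
 have eq: "K0_class Y (?F c') = K0_class Y (?F c)" if "c' \<in> C" for c'
  by (rule Y.K0_eqI) (use that cC cl k Y.K0_class_closed in auto)
 have "K0_map X Y F C = K0_class Y (?F c)"
  unfolding K0_map_def by (rule the_elem_image_unique) (use cC in blast, erule eq)
 then show "K0_map X Y F C \<in> carrier (K0 Y)"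
  and "y \<in> carrier Y ==> kch Y (K0_map X Y F C) y = (\<Sum>g\<in>carrier X. a y g * kch X C g)"
  using k[OF cC] Y.K0_class_closed[OF cl[OF cC]] by auto
qed

lemma K0_map_rep:
 assumes X: "finite_group X" and Y: "finite_group Y"
  and rep: "!!\<rho>. is_rep X \<rho> ==> is_rep Y (F \<rho>)"
  and tr: "!!\<rho> y. is_rep X \<rho> ==> y \<in> carrier Y ==> mtr (F \<rho> y) = (\<Sum>g\<in>carrier X. a y g * mtr (\<rho> g))"
  and \<rho>: "is_rep X \<rho>"
 shows "K0_map X Y F (K0_class X (frag_of \<rho>)) = K0_class Y (frag_of (F \<rho>))"
proof -
 interpret X: finite_group X by fact
 interpret Y: finite_group Y by fact
 show ?thesis
  by (rule Y.K0_eqI) (use K0_map[OF X Y rep tr X.rep_class_closed[OF \<rho>]] \<rho> rep tr in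
    \<open>auto simp: Y.rep_class_closed Y.kch_class X.kch_class\<close>)
qed

lemma sum_div_mod:
 fixes f :: "nat => nat => complex"
 shows "(\<Sum>k<m * n. f (k div n) (k mod n)) = (\<Sum>i<m. \<Sum>j<n. f i j)"
proof -
 have "(\<Sum>k<m * n. f (k div n) (k mod n)) = (\<Sum>(i, j)\<in>{..<m} \<times> {..<n}. f i j)"
 proof (rule sum.reindex_bij_witness[of _ "%(i, j). i * n + j" "%k. (k div n, k mod n)"])
  fix k assume "k \<in> {..<m * n}"
  then show "(k div n, k mod n) \<in> {..<m} \<times> {..<n}"
   by (cases "n = 0") (auto simp: less_mult_imp_div_less)
 next
  fix p assume "p \<in> {..<m} \<times> {..<n}"
  then obtain i j where p: "p = (i, j)" "i < m" "j < n" by auto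
  have "i * n + j < Suc i * n" using p by simp
  also have "... \<le> m * n" using p by (intro mult_right_mono) auto
  finally show "(case p of (i, j) => i * n + j) \<in> {..<m * n}" using p by simp
 qed auto
 then show ?thesis by (simp add: sum.cartesian_product)
qed

lemma kron_carrier: "A \<in> carrier_mat m n ==> B \<in> carrier_mat p q ==> kron A B \<in> carrier_mat (m * p) (n * q)"
 by (auto simp: kron_def)

lemma kron_index:
 "A \<in> carrier_mat m n ==> B \<in> carrier_mat p q ==> i < m * p ==> j < n * q ==>
  kron A B $$ (i, j) = A $$ (i div p, j div q) * B $$ (i mod p, j mod q)"
 by (auto simp: kron_def)

lemma kron_mult:
 assumes A: "A \<in> carrier_mat m n" and A': "A' \<in> carrier_mat n k" and B: "B \<in> carrier_mat p q" and B': "B' \<in> carrier_mat q r"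
 shows "kron (A * A') (B * B') = kron A B * kron A' B'"
proof (rule eq_matI)
 fix i j assume "i < dim_row (kron A B * kron A' B')" "j < dim_col (kron A B * kron A' B')"
 then have ij: "i < m * p" "j < k * r" using assms by (auto simp: kron_def)
 then have p: "p ~= 0" and r: "r ~= 0" by (metis mult_is_0 not_less_zero)+
 have b: "i div p < m" "i mod p < p" "j div r < k" "j mod r < r"
  using ij p r by (auto simp: less_mult_imp_div_less)
 have "kron (A * A') (B * B') $$ (i, j) = (A * A') $$ (i div p, j div r) * (B * B') $$ (i mod p, j mod r)"
  using ij assms by (intro kron_index[of _ m k _ p r]) auto
 also have "... = (\<Sum>a<n. A $$ (i div p, a) * A' $$ (a, j div r)) * (\<Sum>b<q. B $$ (i mod p, b) * B' $$ (b, j mod r))"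
  using assms b by (simp add: scalar_prod_def atLeast0LessThan)
 also have "... = (\<Sum>a<n. \<Sum>b<q. (A $$ (i div p, a) * A' $$ (a, j div r)) * (B $$ (i mod p, b) * B' $$ (b, j mod r)))"
  by (rule sum_product)
 also have "... = (\<Sum>l<n * q. (A $$ (i div p, l div q) * A' $$ (l div q, j div r)) * (B $$ (i mod p, l mod q) * B' $$ (l mod q, j mod r)))"
  by (rule sum_div_mod[symmetric])
 also have "... = (\<Sum>l<n * q. kron A B $$ (i, l) * kron A' B' $$ (l, j))"
  using ij by (intro sum.cong) (auto simp: kron_index[OF A B] kron_index[OF A' B'])
 also have "... = (kron A B * kron A' B') $$ (i, j)"
  using ij kron_carrier[OF A B] kron_carrier[OF A' B'] by (simp add: scalar_prod_def atLeast0LessThan)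
 finally show "kron (A * A') (B * B') $$ (i, j) = (kron A B * kron A' B') $$ (i, j)" .
qed (use assms in \<open>auto simp: kron_def\<close>)

lemma kron_one: "kron (1\<^sub>m m) (1\<^sub>m n) = 1\<^sub>m (m * n)"
proof (rule eq_matI)
 fix i j assume "i < dim_row (1\<^sub>m (m * n) :: complex mat)" "j < dim_col (1\<^sub>m (m * n) :: complex mat)"
 then have ij: "i < m * n" "j < m * n" by auto
 then have "n ~= 0" by (metis mult_is_0 not_less_zero)
 then have b: "i div n < m" "i mod n < n" "j div n < m" "j mod n < n"
  using ij by (auto simp: less_mult_imp_div_less)
 have "i = j" if "i div n = j div n" "i mod n = j mod n" using that by (metis div_mult_mod_eq)
 then show "kron (1\<^sub>m m) (1\<^sub>m n) $$ (i, j) = 1\<^sub>m (m * n) $$ (i, j)"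
  using ij b by (subst kron_index[of _ m m _ n n]) auto
qed (auto simp: kron_def)

lemma mtr_kron: "A \<in> carrier_mat m m ==> B \<in> carrier_mat n n ==> mtr (kron A B) = mtr A * mtr B"
proof -
 assume A: "A \<in> carrier_mat m m" and B: "B \<in> carrier_mat n n"
 have "mtr (kron A B) = (\<Sum>k<m * n. A $$ (k div n, k div n) * B $$ (k mod n, k mod n))"
  using A B kron_carrier[OF A B] by (auto simp: mtr_def kron_index[OF A B] intro!: sum.cong)
 also have "... = (\<Sum>i<m. \<Sum>j<n. A $$ (i, i) * B $$ (j, j))"
  by (rule sum_div_mod)
 finally show ?thesis using A B by (simp add: mtr_def sum_product)
qed

lemma is_rep_outer:
 assumes "is_rep X \<sigma>" "is_rep Y \<tau>"
 shows "is_rep (X \<times>\<times> Y) (outer_rep \<sigma> \<tau>)"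
proof (rule is_repI)
 show "outer_rep \<sigma> \<tau> g \<in> carrier_mat (rep_deg X \<sigma> * rep_deg Y \<tau>) (rep_deg X \<sigma> * rep_deg Y \<tau>)"
  if "g \<in> carrier (X \<times>\<times> Y)" for g
  using that assms by (auto simp: outer_rep_def intro!: kron_carrier is_rep_carrier)
 show "outer_rep \<sigma> \<tau> \<one>\<^bsub>X \<times>\<times> Y\<^esub> = 1\<^sub>m (rep_deg X \<sigma> * rep_deg Y \<tau>)"
  using assms by (simp add: outer_rep_def is_rep_one kron_one)
 show "outer_rep \<sigma> \<tau> (g \<otimes>\<^bsub>X \<times>\<times> Y\<^esub> h) = outer_rep \<sigma> \<tau> g * outer_rep \<sigma> \<tau> h"
  if "g \<in> carrier (X \<times>\<times> Y)" "h \<in> carrier (X \<times>\<times> Y)" for g h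
  using that assms
  by (auto simp: outer_rep_def is_rep_mult[OF assms(1)] is_rep_mult[OF assms(2)]
    intro!: kron_mult is_rep_carrier)
qed

lemma mtr_outer:
 "is_rep X \<sigma> ==> is_rep Y \<tau> ==> x \<in> carrier X ==> y \<in> carrier Y ==> mtr (outer_rep \<sigma> \<tau> (x, y)) = mtr (\<sigma> x) * mtr (\<tau> y)"
 by (auto simp: outer_rep_def intro!: mtr_kron is_rep_carrier)

lemma K0_outer:
 assumes X: "finite_group X" and Y: "finite_group Y" and C: "C \<in> carrier (K0 X)" and D: "D \<in> carrier (K0 Y)"
 shows "K0_outer X Y C D \<in> carrier (K0 (X \<times>\<times> Y))"
  and "x \<in> carrier X ==> y \<in> carrier Y ==> kch (X \<times>\<times> Y) (K0_outer X Y C D) (x, y) = kch X C x * kch Y D y"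
proof -
 interpret X: finite_group X by fact
 interpret Y: finite_group Y by fact
 interpret XY: finite_group "X \<times>\<times> Y" by (rule finite_group_DirProd[OF X Y])
 obtain c where c: "c \<in> carrier (free_reps X)" "C = K0_class X c" "!!c'. c' \<in> C ==> c' \<in> carrier (free_reps X)"
  "!!c' g. c' \<in> C ==> g \<in> carrier X ==> lin c' (%\<rho>. mtr (\<rho> g)) = kch X C g"
  using X.K0_cases[OF C] by blast
 obtain d where d: "d \<in> carrier (free_reps Y)" "D = K0_class Y d" "!!c'. c' \<in> D ==> c' \<in> carrier (free_reps Y)"
  "!!c' g. c' \<in> D ==> g \<in> carrier Y ==> lin c' (%\<rho>. mtr (\<rho> g)) = kch Y D g"
  using Y.K0_cases[OF D] by blast
 let ?F = "%c d. frag_extend (%\<sigma>. frag_extend (%\<tau>. frag_of (outer_rep \<sigma> \<tau>)) d) c"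
 have cl: "?F c' d' \<in> carrier (free_reps (X \<times>\<times> Y))" if "c' \<in> C" "d' \<in> D" for c' d'
 proof -
  have "keys (?F c' d') \<subseteq> {\<rho>. is_rep (X \<times>\<times> Y) \<rho>}"
   using c(3)[OF that(1)] d(3)[OF that(2)]
   by (intro keys_frag_extend_subset) (auto simp: keys_frag_of intro!: is_rep_outer)
  then show ?thesis by simp
 qed
 have k: "kch (X \<times>\<times> Y) (K0_class (X \<times>\<times> Y) (?F c' d')) (x, y) = kch X C x * kch Y D y"
  if "c' \<in> C" "d' \<in> D" "x \<in> carrier X" "y \<in> carrier Y" for c' d' x y
 proof -
  have "kch (X \<times>\<times> Y) (K0_class (X \<times>\<times> Y) (?F c' d')) (x, y) = lin c' (%\<sigma>. lin d' (%\<tau>. mtr (outer_rep \<sigma> \<tau> (x, y))))"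
   using that by (simp add: XY.kch_class lin_extend)
  also have "... = lin c' (%\<sigma>. lin d' (%\<tau>. mtr (\<sigma> x) * mtr (\<tau> y)))"
   using c(3)[OF that(1)] d(3)[OF that(2)] that(3,4) by (intro lin_cong mtr_outer) auto
  also have "... = lin c' (%\<sigma>. mtr (\<sigma> x)) * lin d' (%\<tau>. mtr (\<tau> y))"
   by (simp add: lin_mult_left lin_mult_right)
  finally show ?thesis using c(4)[OF that(1,3)] d(4)[OF that(2,4)] by simp
 qed
 have cC: "c \<in> C" "d \<in> D" unfolding c(2) d(2) by (rule X.K0_class_self, rule Y.K0_class_self)
 have eq: "K0_class (X \<times>\<times> Y) (?F c' d') = K0_class (X \<times>\<times> Y) (?F c d)" if "c' \<in> C" "d' \<in> D" for c' d'
  by (rule XY.K0_eqI) (use that cC cl k XY.K0_class_closed in auto)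
 have "K0_outer X Y C D = (%(c, d). K0_class (X \<times>\<times> Y) (?F c d)) (c, d)"
  unfolding K0_outer_def
 proof (rule the_elem_image_unique)
  fix p assume "p \<in> C \<times> D"
  then show "(%(c, d). K0_class (X \<times>\<times> Y) (?F c d)) p = (%(c, d). K0_class (X \<times>\<times> Y) (?F c d)) (c, d)"
   using eq[of "fst p" "snd p"] by (cases p) simp
 qed (use cC in blast)
 then have "K0_outer X Y C D = K0_class (X \<times>\<times> Y) (?F c d)" by simp
 then show "K0_outer X Y C D \<in> carrier (K0 (X \<times>\<times> Y))"
  and "x \<in> carrier X ==> y \<in> carrier Y ==> kch (X \<times>\<times> Y) (K0_outer X Y C D) (x, y) = kch X C x * kch Y D y"
  using k[OF cC] XY.K0_class_closed[OF cl[OF cC]] by auto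
qed

lemma K0_outer_rep:
 assumes X: "finite_group X" and Y: "finite_group Y" and r: "is_rep X \<sigma>" "is_rep Y \<tau>"
 shows "K0_outer X Y (K0_class X (frag_of \<sigma>)) (K0_class Y (frag_of \<tau>)) = K0_class (X \<times>\<times> Y) (frag_of (outer_rep \<sigma> \<tau>))"
proof -
 interpret X: finite_group X by fact
 interpret Y: finite_group Y by fact
 interpret XY: finite_group "X \<times>\<times> Y" by (rule finite_group_DirProd[OF X Y])
 note K = K0_outer[OF X Y X.rep_class_closed[OF r(1)] Y.rep_class_closed[OF r(2)]]
 show ?thesis
  by (rule XY.K0_eqI) (use K is_rep_outer[OF r] mtr_outer[OF r] in
    \<open>auto simp: XY.rep_class_closed XY.kch_class X.kch_class Y.kch_class\<close>)
qed

lemma bform_DirProd: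
 assumes X: "group X" and Y: "group Y"
  and \<phi>: "!!x y. x \<in> carrier X ==> y \<in> carrier Y ==> \<phi> (x, y) = \<phi>1 x * \<phi>2 y"
  and \<psi>: "!!x y. x \<in> carrier X ==> y \<in> carrier Y ==> \<psi> (x, y) = \<psi>1 x * \<psi>2 y"
 shows "bform (X \<times>\<times> Y) \<phi> \<psi> = bform X \<phi>1 \<psi>1 * bform Y \<phi>2 \<psi>2"
proof -
 interpret X: group X by fact
 interpret Y: group Y by fact
 have "(\<Sum>g\<in>carrier (X \<times>\<times> Y). \<phi> g * \<psi> (inv\<^bsub>X \<times>\<times> Y\<^esub> g))
  = (\<Sum>(x, y)\<in>carrier X \<times> carrier Y. (\<phi>1 x * \<psi>1 (inv\<^bsub>X\<^esub> x)) * (\<phi>2 y * \<psi>2 (inv\<^bsub>Y\<^esub> y)))"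
  using \<phi> \<psi> by (intro sum.cong) (auto simp: inv_DirProd[OF X Y])
 also have "... = (\<Sum>x\<in>carrier X. \<phi>1 x * \<psi>1 (inv\<^bsub>X\<^esub> x)) * (\<Sum>y\<in>carrier Y. \<phi>2 y * \<psi>2 (inv\<^bsub>Y\<^esub> y))"
  by (simp add: sum_product sum.cartesian_product)
 finally show ?thesis by (simp add: bform_def card_cartesian_product)
qed

text \<open>Norms of characters multiply under outer products, so the criterion
  \<open>irr_K0I\<close> applies.\<close>

lemma irr_K0_outer:
 assumes X: "finite_group X" and Y: "finite_group Y" and C: "C \<in> irr (K0 X)" and D: "D \<in> irr (K0 Y)"
 shows "K0_outer X Y C D \<in> irr (K0 (X \<times>\<times> Y))"
proof -
 interpret X: finite_group X by fact
 interpret Y: finite_group Y by fact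
 interpret XY: finite_group "X \<times>\<times> Y" by (rule finite_group_DirProd[OF X Y])
 obtain \<sigma> \<tau> where r: "C = K0_class X (frag_of \<sigma>)" "D = K0_class Y (frag_of \<tau>)" "irreducible_rep X \<sigma>" "irreducible_rep Y \<tau>"
  using C D by (auto simp: X.irr_K0 Y.irr_K0)
 then have rr: "is_rep X \<sigma>" "is_rep Y \<tau>" by (auto simp: irreducible_rep_def)
 have "bform X (%x. mtr (\<sigma> x)) (%x. mtr (\<sigma> x)) = 1" "bform Y (%x. mtr (\<tau> x)) (%x. mtr (\<tau> x)) = 1"
  using X.orthogonality_self[OF r(3)] Y.orthogonality_self[OF r(4)] X.card_carrier_nonzero Y.card_carrier_nonzero
  by (simp_all add: bform_def)
 moreover have "bform (X \<times>\<times> Y) (%g. mtr (outer_rep \<sigma> \<tau> g)) (%g. mtr (outer_rep \<sigma> \<tau> g))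
  = bform X (%x. mtr (\<sigma> x)) (%x. mtr (\<sigma> x)) * bform Y (%x. mtr (\<tau> x)) (%x. mtr (\<tau> x))"
  by (rule bform_DirProd[OF X.group_axioms Y.group_axioms]) (simp_all add: mtr_outer[OF rr])
 ultimately have "bform (X \<times>\<times> Y) (%g. mtr (outer_rep \<sigma> \<tau> g)) (%g. mtr (outer_rep \<sigma> \<tau> g)) = 1"
  by simp
 then show ?thesis
  unfolding r K0_outer_rep[OF X Y rr] by (intro XY.irr_K0I is_rep_outer rr)
qed

lemma (in finite_group) kch_conj:
 assumes "C \<in> carrier (K0 G)" "g \<in> carrier G" "h \<in> carrier G"
 shows "kch G C (h \<otimes> g \<otimes> inv h) = kch G C g"
proof -
 obtain c where c: "c \<in> carrier (free_reps G)" "C = K0_class G c" using assms(1) by (auto simp: carrier_K0)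
 have "lin c (%\<rho>. mtr (\<rho> (h \<otimes> g \<otimes> inv h))) = lin c (%\<rho>. mtr (\<rho> g))"
 proof (rule lin_cong)
  fix \<rho> assume "\<rho> \<in> keys c"
  then have r: "is_rep G \<rho>" using c by auto
  define n where "n = rep_deg G \<rho>"
  have rc: "\<rho> g \<in> carrier_mat n n" if "g \<in> carrier G" for g
   using r that by (auto simp: is_rep_carrier n_def)
  have "mtr (\<rho> (h \<otimes> g \<otimes> inv h)) = mtr (\<rho> (h \<otimes> g) * \<rho> (inv h))"
   using is_rep_mult[OF r, of "h \<otimes> g" "inv h"] assms by simp
  also have "... = mtr (\<rho> (inv h) * \<rho> (h \<otimes> g))"
   using rc assms by (intro mtr_mult_commute[of _ n n]) auto
  also have "\<rho> (inv h) * \<rho> (h \<otimes> g) = \<rho> g"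
   using is_rep_mult[OF r, of "inv h" "h \<otimes> g"] assms by (simp add: m_assoc[symmetric])
  finally show "mtr (\<rho> (h \<otimes> g \<otimes> inv h)) = mtr (\<rho> g)" .
 qed
 then show ?thesis using assms c by (simp add: kch_class)
qed

text \<open>With no constituent all coordinates would vanish, and with them the value of the
  character at the identity, which is the degree.\<close>

lemma (in finite_group) exists_constituent:
 assumes r: "is_rep G \<rho>" and d: "rep_deg G \<rho> ~= 0"
 shows "\<exists>C\<in>irr (K0 G). K0_dual G C (K0_class G (frag_of \<rho>)) ~= 0"
proof (rule ccontr)
 interpret T: tgroup "K0 G" by (rule tgroup_K0)
 assume no: "\<not> ?thesis"
 let ?C = "K0_class G (frag_of \<rho>)"
 note C = rep_class_closed[OF r]
 have "lookup (coords (K0 G) ?C) w = 0" for w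
 proof (cases "w \<in> irr (K0 G)")
  case True
  then have "(of_int (lookup (coords (K0 G) ?C) w) :: complex) = 0"
   using no T.lookup_coords[OF dual_system_K0 C True] by auto
  then show ?thesis by simp
 next
  case False
  then have "w \<notin> keys (coords (K0 G) ?C)" using T.keys_coords[OF C] by blast
  then show ?thesis by (simp add: in_keys_iff)
 qed
 then have "coords (K0 G) ?C = 0" by (intro poly_mapping_eqI) simp
 then have "kch G ?C \<one> = 0" using T.lin_coords[OF add_fun_kch[OF one_closed] C] by simp
 then show False using d is_rep_one[OF r] by (simp add: kch_class)
qed

lemma (in group) inv_mult_cancel:
 assumes "a \<in> carrier G" "x \<in> carrier G"
 shows "inv a \<otimes> (a \<otimes> x) = x" "a \<otimes> (inv a \<otimes> x) = x"
 using assms by (simp_all add: m_assoc[symmetric])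

text \<open>Let \<open>C\<close> and \<open>D\<close> be constituents of the restrictions of
  \<open>\<tau>\<close> to the two factors. The matrix \<open>E\<close>, the sum of
  \<open>\<tau>\<close> over \<open>X\<close> weighted by the character of \<open>C\<close> at
  inverses, commutes with all of \<open>\<tau>\<close>, so it is a scalar \<open>e\<close>; its
  trace is a nonzero multiple of the multiplicity of \<open>C\<close>, hence \<open>e\<close> is
  nonzero. The multiplicity of the outer product in \<open>w\<close> comes out as \<open>e\<close>
  times the multiplicity of \<open>D\<close>, divided by the order of \<open>X\<close>, so it does
  not vanish, and two irreducibles that are not orthogonal coincide.\<close>

lemma irr_K0_DirProd:
 assumes X: "finite_group X" and Y: "finite_group Y" and w: "w \<in> irr (K0 (X \<times>\<times> Y))"
 shows "\<exists>C\<in>irr (K0 X). \<exists>D\<in>irr (K0 Y). w = K0_outer X Y C D"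
proof -
 interpret X: finite_group X by fact
 interpret Y: finite_group Y by fact
 interpret XY: finite_group "X \<times>\<times> Y" by (rule finite_group_DirProd[OF X Y])
 obtain \<tau> where t: "w = K0_class (X \<times>\<times> Y) (frag_of \<tau>)" "irreducible_rep (X \<times>\<times> Y) \<tau>"
  using w by (auto simp: XY.irr_K0)
 then have tr: "is_rep (X \<times>\<times> Y) \<tau>" by (simp add: irreducible_rep_def)
 define n where "n = rep_deg (X \<times>\<times> Y) \<tau>"
 have n0: "n ~= 0" using t by (simp add: irreducible_rep_def n_def)
 have tc: "\<tau> (x, y) \<in> carrier_mat n n" if "x \<in> carrier X" "y \<in> carrier Y" for x y
  using is_rep_carrier[OF tr, of "(x, y)"] that by (simp add: n_def)
 have tm: "\<tau> (x \<otimes>\<^bsub>X\<^esub> x', y \<otimes>\<^bsub>Y\<^esub> y') = \<tau> (x, y) * \<tau> (x', y')"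
  if "x \<in> carrier X" "y \<in> carrier Y" "x' \<in> carrier X" "y' \<in> carrier Y" for x y x' y'
  using is_rep_mult[OF tr, of "(x, y)" "(x', y')"] that by simp
 have t1: "\<tau> (\<one>\<^bsub>X\<^esub>, \<one>\<^bsub>Y\<^esub>) = 1\<^sub>m n" using is_rep_one[OF tr] by (simp add: n_def)
 have r1: "is_rep X (%x. \<tau> (x, \<one>\<^bsub>Y\<^esub>))" "rep_deg X (%x. \<tau> (x, \<one>\<^bsub>Y\<^esub>)) = n"
  by (rule is_repI[of _ _ n]; simp add: tc t1 tm[of _ "\<one>\<^bsub>Y\<^esub>" _ "\<one>\<^bsub>Y\<^esub>", simplified])+
 have r2: "is_rep Y (%y. \<tau> (\<one>\<^bsub>X\<^esub>, y))" "rep_deg Y (%y. \<tau> (\<one>\<^bsub>X\<^esub>, y)) = n"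
  by (rule is_repI[of _ _ n]; simp add: tc t1 tm[of "\<one>\<^bsub>X\<^esub>" _ "\<one>\<^bsub>X\<^esub>", simplified])+
 obtain C where C: "C \<in> irr (K0 X)" "K0_dual X C (K0_class X (frag_of (%x. \<tau> (x, \<one>\<^bsub>Y\<^esub>)))) ~= 0"
  using X.exists_constituent[OF r1(1)] r1(2) n0 by auto
 obtain D where D: "D \<in> irr (K0 Y)" "K0_dual Y D (K0_class Y (frag_of (%y. \<tau> (\<one>\<^bsub>X\<^esub>, y)))) ~= 0"
  using Y.exists_constituent[OF r2(1)] r2(2) n0 by auto
 have Cc: "C \<in> carrier (K0 X)" and Dc: "D \<in> carrier (K0 Y)" using C D X.irr_K0_closed Y.irr_K0_closed by auto
 let ?\<chi> = "%x. kch X C (inv\<^bsub>X\<^esub> x)"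
 define E where "E = msum n n (carrier X) (%x. ?\<chi> x \<cdot>\<^sub>m \<tau> (x, \<one>\<^bsub>Y\<^esub>))"
 have Et: "E * \<tau> (a, b) = msum n n (carrier X) (%x. ?\<chi> x \<cdot>\<^sub>m \<tau> (x \<otimes>\<^bsub>X\<^esub> a, b))"
  if ab: "a \<in> carrier X" "b \<in> carrier Y" for a b
 proof -
  have "E * \<tau> (a, b) = msum n n (carrier X) (%x. (?\<chi> x \<cdot>\<^sub>m \<tau> (x, \<one>\<^bsub>Y\<^esub>)) * \<tau> (a, b))"
   unfolding E_def using tc ab by (intro msum_mult) auto
  also have "... = msum n n (carrier X) (%x. ?\<chi> x \<cdot>\<^sub>m \<tau> (x \<otimes>\<^bsub>X\<^esub> a, b))"
  proof (rule msum_cong)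
   fix x assume x: "x \<in> carrier X"
   have "(?\<chi> x \<cdot>\<^sub>m \<tau> (x, \<one>\<^bsub>Y\<^esub>)) * \<tau> (a, b) = ?\<chi> x \<cdot>\<^sub>m (\<tau> (x, \<one>\<^bsub>Y\<^esub>) * \<tau> (a, b))"
    using tc x ab by (intro mult_smult_assoc_mat[of _ n n _ n]) auto
   then show "(?\<chi> x \<cdot>\<^sub>m \<tau> (x, \<one>\<^bsub>Y\<^esub>)) * \<tau> (a, b) = ?\<chi> x \<cdot>\<^sub>m \<tau> (x \<otimes>\<^bsub>X\<^esub> a, b)"
    using tm[of x "\<one>\<^bsub>Y\<^esub>" a b] x ab by simp
  qed
  finally show ?thesis .
 qed
 have tE: "\<tau> (a, b) * E = msum n n (carrier X) (%x. ?\<chi> x \<cdot>\<^sub>m \<tau> (a \<otimes>\<^bsub>X\<^esub> x, b))"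
  if ab: "a \<in> carrier X" "b \<in> carrier Y" for a b
 proof -
  have "\<tau> (a, b) * E = msum n n (carrier X) (%x. \<tau> (a, b) * (?\<chi> x \<cdot>\<^sub>m \<tau> (x, \<one>\<^bsub>Y\<^esub>)))"
   unfolding E_def using tc ab by (intro mult_msum) auto
  also have "... = msum n n (carrier X) (%x. ?\<chi> x \<cdot>\<^sub>m \<tau> (a \<otimes>\<^bsub>X\<^esub> x, b))"
  proof (rule msum_cong)
   fix x assume x: "x \<in> carrier X"
   have "\<tau> (a, b) * (?\<chi> x \<cdot>\<^sub>m \<tau> (x, \<one>\<^bsub>Y\<^esub>)) = ?\<chi> x \<cdot>\<^sub>m (\<tau> (a, b) * \<tau> (x, \<one>\<^bsub>Y\<^esub>))"
    using tc x ab by (intro mult_smult_distrib[of _ n n _ n]) auto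
   then show "\<tau> (a, b) * (?\<chi> x \<cdot>\<^sub>m \<tau> (x, \<one>\<^bsub>Y\<^esub>)) = ?\<chi> x \<cdot>\<^sub>m \<tau> (a \<otimes>\<^bsub>X\<^esub> x, b)"
    using tm[of a b x "\<one>\<^bsub>Y\<^esub>"] x ab by simp
  qed
  finally show ?thesis .
 qed
 have "E \<in> intertwiners (X \<times>\<times> Y) \<tau> \<tau>"
  unfolding intertwiners_def n_def[symmetric]
 proof (intro CollectI conjI ballI)
  show "E \<in> carrier_mat n n" by (simp add: E_def)
  fix g assume "g \<in> carrier (X \<times>\<times> Y)"
  then obtain a b where g: "g = (a, b)" and ab: "a \<in> carrier X" "b \<in> carrier Y" by auto
  have bij: "bij_betw (%x. a \<otimes>\<^bsub>X\<^esub> x \<otimes>\<^bsub>X\<^esub> inv\<^bsub>X\<^esub> a) (carrier X) (carrier X)"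
   using ab by (intro bij_betwI[of _ _ _ "%x. inv\<^bsub>X\<^esub> a \<otimes>\<^bsub>X\<^esub> x \<otimes>\<^bsub>X\<^esub> a"])
    (auto simp: X.m_assoc X.inv_mult_cancel)
  have "E * \<tau> (a, b) = msum n n (carrier X) (%x. ?\<chi> (a \<otimes>\<^bsub>X\<^esub> x \<otimes>\<^bsub>X\<^esub> inv\<^bsub>X\<^esub> a) \<cdot>\<^sub>m \<tau> (a \<otimes>\<^bsub>X\<^esub> x \<otimes>\<^bsub>X\<^esub> inv\<^bsub>X\<^esub> a \<otimes>\<^bsub>X\<^esub> a, b))"
   unfolding Et[OF ab] by (rule msum_reindex[OF bij])
  also have "... = \<tau> (a, b) * E"
   unfolding tE[OF ab]
  proof (rule msum_cong)
   fix x assume x: "x \<in> carrier X"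
   have "inv\<^bsub>X\<^esub> (a \<otimes>\<^bsub>X\<^esub> x \<otimes>\<^bsub>X\<^esub> inv\<^bsub>X\<^esub> a) = a \<otimes>\<^bsub>X\<^esub> inv\<^bsub>X\<^esub> x \<otimes>\<^bsub>X\<^esub> inv\<^bsub>X\<^esub> a"
    using x ab by (simp add: X.inv_mult_group X.m_assoc)
   then have "?\<chi> (a \<otimes>\<^bsub>X\<^esub> x \<otimes>\<^bsub>X\<^esub> inv\<^bsub>X\<^esub> a) = ?\<chi> x" using X.kch_conj[OF Cc, of "inv\<^bsub>X\<^esub> x" a] x ab by simp
   moreover have "a \<otimes>\<^bsub>X\<^esub> x \<otimes>\<^bsub>X\<^esub> inv\<^bsub>X\<^esub> a \<otimes>\<^bsub>X\<^esub> a = a \<otimes>\<^bsub>X\<^esub> x" using x ab by (simp add: X.m_assoc)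
   ultimately show "?\<chi> (a \<otimes>\<^bsub>X\<^esub> x \<otimes>\<^bsub>X\<^esub> inv\<^bsub>X\<^esub> a) \<cdot>\<^sub>m \<tau> (a \<otimes>\<^bsub>X\<^esub> x \<otimes>\<^bsub>X\<^esub> inv\<^bsub>X\<^esub> a \<otimes>\<^bsub>X\<^esub> a, b) = ?\<chi> x \<cdot>\<^sub>m \<tau> (a \<otimes>\<^bsub>X\<^esub> x, b)"
    by simp
  qed
  finally show "E * \<tau> g = \<tau> g * E" by (simp add: g)
 qed
 then obtain e where e: "E = e \<cdot>\<^sub>m 1\<^sub>m n" using schur_scalar[OF t(2)] by (auto simp: n_def)
 \<comment> \<open>The trace of \<open>E * \<tau> (1, y)\<close>, computed in two ways, removes the
   sum over \<open>X\<close> from the double sum that follows.\<close>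
 have key: "e * mtr (\<tau> (\<one>\<^bsub>X\<^esub>, y)) = (\<Sum>x\<in>carrier X. ?\<chi> x * mtr (\<tau> (x, y)))" if y: "y \<in> carrier Y" for y
 proof -
  have ms: "mtr (c \<cdot>\<^sub>m A) = c * mtr A" if "A \<in> carrier_mat n n" for c A
   using that by (simp add: mtr_def sum_distrib_left)
  have "E * \<tau> (\<one>\<^bsub>X\<^esub>, y) = e \<cdot>\<^sub>m \<tau> (\<one>\<^bsub>X\<^esub>, y)"
   unfolding e using tc[of "\<one>\<^bsub>X\<^esub>" y] y by (simp add: mult_smult_assoc_mat[of _ n n _ n])
  then have "e * mtr (\<tau> (\<one>\<^bsub>X\<^esub>, y)) = mtr (E * \<tau> (\<one>\<^bsub>X\<^esub>, y))" using ms tc[of "\<one>\<^bsub>X\<^esub>" y] y by simp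
  also have "... = (\<Sum>x\<in>carrier X. mtr (?\<chi> x \<cdot>\<^sub>m \<tau> (x \<otimes>\<^bsub>X\<^esub> \<one>\<^bsub>X\<^esub>, y)))"
   unfolding Et[OF X.one_closed y] using tc y by (intro mtr_msum) auto
  also have "... = (\<Sum>x\<in>carrier X. ?\<chi> x * mtr (\<tau> (x, y)))"
   using tc y by (intro sum.cong) (auto simp: ms)
  finally show ?thesis .
 qed
 have "e ~= 0"
 proof
  assume "e = 0"
  then have "(\<Sum>x\<in>carrier X. ?\<chi> x * mtr (\<tau> (x, \<one>\<^bsub>Y\<^esub>))) = 0" using key[OF Y.one_closed] by simp
  then show False using C(2) by (simp add: K0_dual_def bform_def X.kch_class mult.commute)
 qed
 have "K0_dual (X \<times>\<times> Y) (K0_outer X Y C D) w = (\<Sum>(x, y)\<in>carrier X \<times> carrier Y. mtr (\<tau> (x, y)) * (kch X C (inv\<^bsub>X\<^esub> x) * kch Y D (inv\<^bsub>Y\<^esub> y))) / of_nat (card (carrier X) * card (carrier Y))"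
 proof -
  have "(\<Sum>g\<in>carrier (X \<times>\<times> Y). kch (X \<times>\<times> Y) w g * kch (X \<times>\<times> Y) (K0_outer X Y C D) (inv\<^bsub>X \<times>\<times> Y\<^esub> g))
   = (\<Sum>(x, y)\<in>carrier X \<times> carrier Y. mtr (\<tau> (x, y)) * (kch X C (inv\<^bsub>X\<^esub> x) * kch Y D (inv\<^bsub>Y\<^esub> y)))"
  proof (rule sum.cong)
   fix g assume "g \<in> carrier X \<times> carrier Y"
   then obtain x y where g: "g = (x, y)" and xy: "x \<in> carrier X" "y \<in> carrier Y" by auto
   have "kch (X \<times>\<times> Y) w (x, y) = mtr (\<tau> (x, y))" unfolding t(1) using xy by (simp add: XY.kch_class)
   moreover have "kch (X \<times>\<times> Y) (K0_outer X Y C D) (inv\<^bsub>X\<^esub> x, inv\<^bsub>Y\<^esub> y) = kch X C (inv\<^bsub>X\<^esub> x) * kch Y D (inv\<^bsub>Y\<^esub> y)"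
    using xy by (intro K0_outer(2)[OF X Y Cc Dc]) auto
   ultimately show "kch (X \<times>\<times> Y) w g * kch (X \<times>\<times> Y) (K0_outer X Y C D) (inv\<^bsub>X \<times>\<times> Y\<^esub> g)
    = (case g of (x, y) => mtr (\<tau> (x, y)) * (kch X C (inv\<^bsub>X\<^esub> x) * kch Y D (inv\<^bsub>Y\<^esub> y)))"
    using xy by (simp add: g inv_DirProd[OF X.group_axioms Y.group_axioms])
  qed simp
  then show ?thesis by (simp add: K0_dual_def bform_def card_cartesian_product)
 qed
 also have "(\<Sum>(x, y)\<in>carrier X \<times> carrier Y. mtr (\<tau> (x, y)) * (kch X C (inv\<^bsub>X\<^esub> x) * kch Y D (inv\<^bsub>Y\<^esub> y)))
  = (\<Sum>y\<in>carrier Y. (\<Sum>x\<in>carrier X. ?\<chi> x * mtr (\<tau> (x, y))) * kch Y D (inv\<^bsub>Y\<^esub> y))"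
  unfolding sum.cartesian_product[symmetric] by (subst sum.swap) (simp add: sum_distrib_left sum_distrib_right mult_ac)
 also have "... = e * (\<Sum>y\<in>carrier Y. mtr (\<tau> (\<one>\<^bsub>X\<^esub>, y)) * kch Y D (inv\<^bsub>Y\<^esub> y))"
  unfolding sum_distrib_left by (intro sum.cong) (auto simp: key[symmetric])
 also have "... / of_nat (card (carrier X) * card (carrier Y)) = e * K0_dual Y D (K0_class Y (frag_of (%y. \<tau> (\<one>\<^bsub>X\<^esub>, y)))) / of_nat (card (carrier X))"
  by (simp add: K0_dual_def bform_def Y.kch_class)
 finally have "K0_dual (X \<times>\<times> Y) (K0_outer X Y C D) w ~= 0"
  using D(2) \<open>e ~= 0\<close> X.card_carrier_nonzero by simp
 moreover have "K0_dual (X \<times>\<times> Y) (K0_outer X Y C D) w = (if w = K0_outer X Y C D then 1 else 0)"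
  using XY.dual_system_K0 w irr_K0_outer[OF X Y C(1) D(1)] by (simp add: dual_system_def)
 ultimately have "w = K0_outer X Y C D" by (simp split: if_splits)
 then show ?thesis using C(1) D(1) by blast
qed

text \<open>\<open>irr_K0_DirProd\<close> makes the outer product map surjective, so the preimage
  chosen by \<open>K0_split\<close> exists. Its evaluation at characters is then known without
  knowing which preimage was chosen.\<close>

lemma K0_split:
 assumes X: "finite_group X" and Y: "finite_group Y" and z: "z \<in> carrier (K0 (X \<times>\<times> Y))"
 shows "keys (K0_split X Y z) \<subseteq> irr (K0 X) \<times> irr (K0 Y)"
  and "x \<in> carrier X ==> y \<in> carrier Y ==>
   lin (K0_split X Y z) (%(C, D). kch X C x * kch Y D y) = kch (X \<times>\<times> Y) z (x, y)"
proof -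
 interpret X: finite_group X by fact
 interpret Y: finite_group Y by fact
 interpret XY: finite_group "X \<times>\<times> Y" by (rule finite_group_DirProd[OF X Y])
 interpret K: tgroup "K0 (X \<times>\<times> Y)" by (rule XY.tgroup_K0)
 let ?f = "zlift (K0 (X \<times>\<times> Y)) (%(C, D). K0_outer X Y C D)" and ?I = "irr (K0 X) \<times> irr (K0 Y)"
 have oc: "(%(C, D). K0_outer X Y C D) p \<in> carrier (K0 (X \<times>\<times> Y))" if "p \<in> ?I" for p
  using that X.irr_K0_closed Y.irr_K0_closed by (auto intro!: K0_outer[OF X Y])
 have kf: "kch (X \<times>\<times> Y) (?f c) (x, y) = lin c (%(C, D). kch X C x * kch Y D y)"
  if c: "keys c \<subseteq> ?I" and xy: "x \<in> carrier X" "y \<in> carrier Y" for c x y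
 proof -
  have "kch (X \<times>\<times> Y) (?f c) (x, y) = lin c (%p. kch (X \<times>\<times> Y) ((%(C, D). K0_outer X Y C D) p) (x, y))"
   using xy c oc by (intro K.add_fun_zlift[OF XY.add_fun_kch]) auto
  also have "... = lin c (%(C, D). kch X C x * kch Y D y)"
   using c xy X.irr_K0_closed Y.irr_K0_closed by (intro lin_cong) (auto intro!: K0_outer(2)[OF X Y])
  finally show ?thesis .
 qed
 have "z \<in> ?f ` carrier (free_Abelian_group ?I)"
 proof -
  obtain C D where CD: "!!w. w \<in> irr (K0 (X \<times>\<times> Y)) ==> C w \<in> irr (K0 X) & D w \<in> irr (K0 Y) & w = K0_outer X Y (C w) (D w)"
   using irr_K0_DirProd[OF X Y] by metis
  let ?c = "coords (K0 (X \<times>\<times> Y)) z"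
  let ?d = "frag_extend (%w. frag_of (C w, D w)) ?c"
  have kd: "keys ?d \<subseteq> ?I"
   using K.keys_coords[OF z] CD by (intro keys_frag_extend_subset) (auto simp: keys_frag_of)
  have "?f ?d = z"
  proof (rule XY.K0_eqI)
   show "?f ?d \<in> carrier (K0 (X \<times>\<times> Y))" using kd oc by (intro K.zlift_closed) auto
   fix g assume "g \<in> carrier (X \<times>\<times> Y)"
   then obtain x y where g: "g = (x, y)" and xy: "x \<in> carrier X" "y \<in> carrier Y" by auto
   have "kch (X \<times>\<times> Y) (?f ?d) (x, y) = lin ?c (%w. kch X (C w) x * kch Y (D w) y)"
    by (simp add: kf[OF kd xy] lin_extend)
   also have "... = lin ?c (%w. kch (X \<times>\<times> Y) w (x, y))"
   proof (rule lin_cong)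
    fix w assume "w \<in> keys ?c"
    then have "w \<in> irr (K0 (X \<times>\<times> Y))" using K.keys_coords[OF z] by blast
    note w = CD[OF this]
    have "kch (X \<times>\<times> Y) (K0_outer X Y (C w) (D w)) (x, y) = kch X (C w) x * kch Y (D w) y"
     using w X.irr_K0_closed Y.irr_K0_closed xy by (intro K0_outer(2)[OF X Y]) auto
    then show "kch X (C w) x * kch Y (D w) y = kch (X \<times>\<times> Y) w (x, y)" using w by simp
   qed
   also have "... = kch (X \<times>\<times> Y) z (x, y)"
    using xy z by (intro K.lin_coords XY.add_fun_kch) auto
   finally show "kch (X \<times>\<times> Y) (?f ?d) g = kch (X \<times>\<times> Y) z g" by (simp add: g)
  qed (rule z)
  then show ?thesis using kd by (intro image_eqI[of _ _ ?d]) auto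
 qed
 then have 1: "K0_split X Y z \<in> carrier (free_Abelian_group ?I)" and 2: "?f (K0_split X Y z) = z"
  unfolding K0_split_def by (rule inv_into_into, rule f_inv_into_f)
 then show "keys (K0_split X Y z) \<subseteq> ?I" by simp
 then show "lin (K0_split X Y z) (%(C, D). kch X C x * kch Y D y) = kch (X \<times>\<times> Y) z (x, y)"
  if "x \<in> carrier X" "y \<in> carrier Y" using kf[OF _ that] 2 by metis
qed

subsection \<open>Restriction and induction\<close>

lemma is_rep_res:
 assumes \<iota>: "\<iota> \<in> hom K X" "\<iota> \<one>\<^bsub>K\<^esub> = \<one>\<^bsub>X\<^esub>" and r: "is_rep X \<rho>"
 shows "is_rep K (res_rep \<iota> \<rho>)"
 by (rule is_repI[of _ _ "rep_deg X \<rho>"])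
  (use hom_in_carrier[OF \<iota>(1)] \<iota> r in \<open>auto simp: res_rep_def hom_mult is_rep_carrier is_rep_one is_rep_mult\<close>)

lemma K0_res:
 assumes X: "finite_group X" and K: "finite_group K" and \<iota>: "\<iota> \<in> hom K X" and C: "C \<in> carrier (K0 X)"
 shows "K0_map X K (res_rep \<iota>) C \<in> carrier (K0 K)"
  and "y \<in> carrier K ==> kch K (K0_map X K (res_rep \<iota>) C) y = kch X C (\<iota> y)"
proof -
 interpret X: finite_group X by fact
 interpret K: finite_group K by fact
 interpret h: group_hom K X \<iota> by unfold_locales (rule \<iota>)
 have delta: "(\<Sum>g\<in>carrier X. (if g = \<iota> y then 1 else 0) * \<phi> g) = \<phi> (\<iota> y)" if "y \<in> carrier K" for y and \<phi> :: "'a => complex"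
 proof -
  have "(\<Sum>g\<in>carrier X. (if g = \<iota> y then 1 else 0) * \<phi> g) = (\<Sum>g\<in>carrier X. if g = \<iota> y then \<phi> g else 0)"
   by (intro sum.cong) auto
  then show ?thesis using that X.finite_carrier by simp
 qed
 have tr: "mtr (res_rep \<iota> \<rho> y) = (\<Sum>g\<in>carrier X. (if g = \<iota> y then 1 else 0) * mtr (\<rho> g))" if "y \<in> carrier K" for \<rho> y
  using delta[OF that, of "%g. mtr (\<rho> g)"] by (simp add: res_rep_def)
 note * = K0_map[OF X K is_rep_res[OF \<iota> h.hom_one] tr C]
 show "K0_map X K (res_rep \<iota>) C \<in> carrier (K0 K)" by (rule *(1))
 show "kch K (K0_map X K (res_rep \<iota>) C) y = kch X C (\<iota> y)" if "y \<in> carrier K"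
  using *(2)[OF _ _ that] delta[OF that] by simp
qed

text \<open>Producing one transversal justifies the choice made in the definition. Cosets are traded
  for the condition \<open>inv t \<otimes> g \<in> U\<close>, which matches the blocks of
  \<open>ind_rep\<close>.\<close>

lemma left_transversal:
 fixes X :: "('x, 'm) monoid_scheme" (structure)
 assumes X: "finite_group X" and U: "subgroup U X"
 shows "distinct (left_transversal X U)" "set (left_transversal X U) \<subseteq> carrier X"
  and "g \<in> carrier X ==> \<exists>!t. t \<in> set (left_transversal X U) & inv t \<otimes> g \<in> U"
proof -
 interpret X: finite_group X by fact
 interpret U: subgroup U X by fact
 have lc: "g \<in> t <#\<^bsub>X\<^esub> U \<longleftrightarrow> inv t \<otimes> g \<in> U" if "g \<in> carrier X" "t \<in> carrier X" for g t
 proof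
  assume "g \<in> t <#\<^bsub>X\<^esub> U"
  then show "inv t \<otimes> g \<in> U" using that by (auto simp: l_coset_def X.inv_mult_cancel)
 next
  assume "inv t \<otimes> g \<in> U"
  moreover have "g = t \<otimes> (inv t \<otimes> g)" using that by (simp add: X.inv_mult_cancel)
  ultimately show "g \<in> t <#\<^bsub>X\<^esub> U" unfolding l_coset_def by blast
 qed
 let ?P = "%g t. t \<in> carrier X & inv t \<otimes> g \<in> U"
 \<comment> \<open>The predicate depends only on the coset of \<open>g\<close>, so the choice
   operator returns the same element throughout a coset.\<close>
 define h where "h g = (SOME t. ?P g t)" for g
 have h: "?P g (h g)" if "g \<in> carrier X" for g
  unfolding h_def by (rule someI[of "?P g" g]) (use that in simp)
 have eq: "h g = h g'" if "g \<in> carrier X" "g' \<in> carrier X" "inv g \<otimes> g' \<in> U" for g g'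
 proof -
  have "?P g t = ?P g' t" for t
  proof (cases "t \<in> carrier X")
   case t: True
   have 1: "inv t \<otimes> g' = (inv t \<otimes> g) \<otimes> (inv g \<otimes> g')"
    using that t by (simp add: X.m_assoc X.inv_mult_cancel)
   have 2: "inv t \<otimes> g = (inv t \<otimes> g') \<otimes> inv (inv g \<otimes> g')"
    using that t by (simp add: X.m_assoc X.inv_mult_cancel X.inv_mult_group)
   have "inv t \<otimes> g \<in> U \<longleftrightarrow> inv t \<otimes> g' \<in> U"
   proof
    assume "inv t \<otimes> g \<in> U"
    from U.m_closed[OF this that(3)] show "inv t \<otimes> g' \<in> U" by (subst 1)
   next
    assume "inv t \<otimes> g' \<in> U"
    from U.m_closed[OF this U.m_inv_closed[OF that(3)]] show "inv t \<otimes> g \<in> U" by (subst 2)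
   qed
   then show ?thesis using t by simp
  qed simp
  then show ?thesis by (simp add: h_def)
 qed
 have ex1: "\<exists>!t. t \<in> h ` carrier X & g \<in> t <#\<^bsub>X\<^esub> U" if g: "g \<in> carrier X" for g
 proof (rule ex1I[of _ "h g"])
  show "h g \<in> h ` carrier X & g \<in> h g <#\<^bsub>X\<^esub> U" using h[OF g] lc[OF g] g by auto
  fix t assume t: "t \<in> h ` carrier X & g \<in> t <#\<^bsub>X\<^esub> U"
  then obtain g' where g': "g' \<in> carrier X" "t = h g'" by auto
  have tc: "t \<in> carrier X" and tg': "inv t \<otimes> g' \<in> U" using h[OF g'(1)] g'(2) by auto
  have tg: "inv t \<otimes> g \<in> U" using t lc[OF g tc] by simp
  have "inv g' \<otimes> g = inv (inv t \<otimes> g') \<otimes> (inv t \<otimes> g)"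
   using g g' tc by (simp add: X.inv_mult_group X.m_assoc X.inv_mult_cancel)
  also have "... \<in> U" using tg tg' by auto
  finally show "t = h g" using eq[OF g'(1) g] g'(2) by simp
 qed
 obtain ts where ts: "set ts = h ` carrier X" "distinct ts"
  using finite_distinct_list[of "h ` carrier X"] X.finite_carrier by blast
 have "distinct ts & set ts \<subseteq> carrier X & (\<forall>g\<in>carrier X. \<exists>!t. t \<in> set ts & g \<in> t <#\<^bsub>X\<^esub> U)"
  using ts h ex1 by auto
 from someI[of "%ts. distinct ts & set ts \<subseteq> carrier X & (\<forall>g\<in>carrier X. \<exists>!t. t \<in> set ts & g \<in> t <#\<^bsub>X\<^esub> U)", OF this]
 have T: "distinct (left_transversal X U)" "set (left_transversal X U) \<subseteq> carrier X"
  "!!g. g \<in> carrier X ==> \<exists>!t. t \<in> set (left_transversal X U) & g \<in> t <#\<^bsub>X\<^esub> U"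
  unfolding left_transversal_def by auto
 then show "distinct (left_transversal X U)" "set (left_transversal X U) \<subseteq> carrier X" by auto
 show "\<exists>!t. t \<in> set (left_transversal X U) & inv t \<otimes> g \<in> U" if "g \<in> carrier X"
 proof -
  have "(t \<in> set (left_transversal X U) & g \<in> t <#\<^bsub>X\<^esub> U) = (t \<in> set (left_transversal X U) & inv t \<otimes> g \<in> U)" for t
   using lc[OF that, of t] T(2) by blast
  then show ?thesis using T(3)[OF that] by simp
 qed
qed

text \<open>Induction runs along an embedding rather than from a subset, since a product of two
  wreath products is not literally contained in the larger one.\<close>

locale inclusion = X: finite_group X + K: finite_group K
 for X :: "('x, 'm) monoid_scheme" (structure) and K :: "('y, 'n) monoid_scheme" +
 fixes \<iota> :: "'y => 'x"
 assumes \<iota>_hom: "\<iota> \<in> hom K X" and \<iota>_inj: "inj_on \<iota> (carrier K)"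
begin

abbreviation U where "U \<equiv> \<iota> ` carrier K"
abbreviation T where "T \<equiv> set (left_transversal X U)"

sublocale h: group_hom K X \<iota>
 by unfold_locales (rule \<iota>_hom)

lemma subgroup_U: "subgroup U X"
 by (rule h.img_is_subgroup)

lemmas trans = left_transversal[OF X.finite_group_axioms subgroup_U]

lemma T_closed: "t \<in> T ==> t \<in> carrier X"
 using trans(2) by blast

lemma T_unique: "t \<in> T ==> t' \<in> T ==> inv t \<otimes> t' \<in> U ==> t = t'"
proof -
 assume *: "t \<in> T" "t' \<in> T" "inv t \<otimes> t' \<in> U"
 have "inv t' \<otimes> t' \<in> U"
  using subgroup.one_closed[OF subgroup_U] X.l_inv[OF T_closed[OF *(2)]] by simp
 with trans(3)[OF T_closed[OF *(2)]] * show "t = t'" by blast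
qed

abbreviation pre where "pre x \<equiv> inv_into (carrier K) \<iota> x"

lemma pre: "x \<in> U ==> pre x \<in> carrier K" "x \<in> U ==> \<iota> (pre x) = x" "y \<in> carrier K ==> pre (\<iota> y) = y"
 using inv_into_into[of x \<iota> "carrier K"] f_inv_into_f[of x \<iota> "carrier K"] inv_into_f_f[OF \<iota>_inj] by auto

text \<open>With extension by zero, the block of \<open>ind_rep\<close> at \<open>(i, j)\<close> is
  \<open>ext \<sigma>\<close> at \<open>inv (tt i) \<otimes> g \<otimes> tt j\<close>.\<close>

definition ext :: "('y => complex mat) => 'x => complex mat" where
 "ext \<sigma> x = (if x \<in> U then \<sigma> (pre x) else 0\<^sub>m (rep_deg K \<sigma>) (rep_deg K \<sigma>))"

context
 fixes \<sigma> assumes \<sigma>: "is_rep K \<sigma>"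
begin

lemma ext_carrier: "ext \<sigma> x \<in> carrier_mat (rep_deg K \<sigma>) (rep_deg K \<sigma>)"
 using is_rep_carrier[OF \<sigma> pre(1)] by (simp add: ext_def)

text \<open>One factor in \<open>U\<close> is enough, because multiplication by \<open>u\<close>
  does not change whether \<open>x\<close> lies in \<open>U\<close>.\<close>

lemma ext_mult:
 assumes "x \<in> carrier X" "u \<in> U"
 shows "ext \<sigma> (x \<otimes> u) = ext \<sigma> x * ext \<sigma> u"
proof (cases "x \<in> U")
 case True
 have "pre (x \<otimes> u) = pre x \<otimes>\<^bsub>K\<^esub> pre u"
 proof -
  have c: "pre x \<otimes>\<^bsub>K\<^esub> pre u \<in> carrier K" using pre(1)[OF True] pre(1)[OF assms(2)] by simp
  have e: "\<iota> (pre x \<otimes>\<^bsub>K\<^esub> pre u) = x \<otimes> u"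
   using pre(1,2)[OF True] pre(1,2)[OF assms(2)] by simp
  show ?thesis using pre(3)[OF c] unfolding e .
 qed
 then show ?thesis
  using True assms subgroup.m_closed[OF subgroup_U True assms(2)] is_rep_mult[OF \<sigma>] pre(1)
  by (simp add: ext_def)
next
 case False
 have "x \<otimes> u \<notin> U"
 proof
  assume "x \<otimes> u \<in> U"
  then have "(x \<otimes> u) \<otimes> inv u \<in> U"
   using subgroup.m_closed[OF subgroup_U] subgroup.m_inv_closed[OF subgroup_U assms(2)] by blast
  then show False using False assms subgroup.mem_carrier[OF subgroup_U assms(2)] by (simp add: X.m_assoc)
 qed
 then show ?thesis using False ext_carrier[of u] by (simp add: ext_def)
qed

abbreviation N where "N \<equiv> length (left_transversal X U)"
abbreviation deg where "deg \<equiv> rep_deg K \<sigma>"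
abbreviation tt where "tt i \<equiv> left_transversal X U ! i"

lemma ind_rep_index:
 assumes "i < N * deg" "j < N * deg"
 shows "ind_rep X K \<iota> \<sigma> g $$ (i, j) = ext \<sigma> (inv (tt (i div deg)) \<otimes> g \<otimes> tt (j div deg)) $$ (i mod deg, j mod deg)"
proof -
 have "deg ~= 0" using assms by (metis mult_0_right not_less_zero)
 then show ?thesis using assms by (auto simp: ind_rep_def Let_def ext_def)
qed

lemma ind_rep_carrier: "ind_rep X K \<iota> \<sigma> g \<in> carrier_mat (N * deg) (N * deg)"
 by (simp add: ind_rep_def Let_def)

lemma is_rep_ind: "is_rep X (ind_rep X K \<iota> \<sigma>)"
proof (rule is_repI(1)[OF ind_rep_carrier])
 have tc: "tt i \<in> carrier X" "tt i \<in> T" if "i < N" for i using that T_closed by auto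
 have lt: "i div deg < N" "i mod deg < deg" if "i < N * deg" for i
 proof -
  have "deg ~= 0" using that by (metis mult_0_right not_less_zero)
  then show "i div deg < N" "i mod deg < deg" using that by (auto simp: less_mult_imp_div_less)
 qed
 have e1: "ext \<sigma> \<one> = 1\<^sub>m deg"
  using pre(3)[of "\<one>\<^bsub>K\<^esub>"] is_rep_one[OF \<sigma>] subgroup.one_closed[OF subgroup_U] by (simp add: ext_def)
 show "ind_rep X K \<iota> \<sigma> \<one> = 1\<^sub>m (N * deg)"
 proof (rule eq_matI)
  fix i j assume "i < dim_row (1\<^sub>m (N * deg) :: complex mat)" "j < dim_col (1\<^sub>m (N * deg) :: complex mat)"
  then have ij: "i < N * deg" "j < N * deg" by auto
  note l = lt[OF ij(1)] lt[OF ij(2)]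
  have "ind_rep X K \<iota> \<sigma> \<one> $$ (i, j) = ext \<sigma> (inv tt (i div deg) \<otimes> tt (j div deg)) $$ (i mod deg, j mod deg)"
   using ij l tc by (simp add: ind_rep_index)
  also have "... = (if i = j then 1 else 0)"
  proof (cases "i div deg = j div deg")
   case True
   then have "(i mod deg = j mod deg) = (i = j)" by (metis div_mult_mod_eq)
   then show ?thesis using True tc(1)[OF l(3)] l e1 by simp
  next
   case False
   then have "tt (i div deg) ~= tt (j div deg)" using trans(1) l by (simp add: nth_eq_iff_index_eq)
   then have "inv tt (i div deg) \<otimes> tt (j div deg) \<notin> U" using T_unique tc l by blast
   then show ?thesis using False l by (auto simp: ext_def)
  qed
  finally show "ind_rep X K \<iota> \<sigma> \<one> $$ (i, j) = 1\<^sub>m (N * deg) $$ (i, j)" using ij by simp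
 qed (use ind_rep_carrier[of "\<one>"] in auto)
 fix g h assume g: "g \<in> carrier X" and h: "h \<in> carrier X"
 show "ind_rep X K \<iota> \<sigma> (g \<otimes> h) = ind_rep X K \<iota> \<sigma> g * ind_rep X K \<iota> \<sigma> h"
 proof (rule eq_matI)
  fix i k assume "i < dim_row (ind_rep X K \<iota> \<sigma> g * ind_rep X K \<iota> \<sigma> h)" "k < dim_col (ind_rep X K \<iota> \<sigma> g * ind_rep X K \<iota> \<sigma> h)"
  then have ik: "i < N * deg" "k < N * deg" using ind_rep_carrier[of g] ind_rep_carrier[of h] by auto
  note l = lt[OF ik(1)] lt[OF ik(2)]
  define a where "a = tt (i div deg)"
  define b where "b = tt (k div deg)"
  have ab: "a \<in> carrier X" "b \<in> carrier X" using tc l by (auto simp: a_def b_def)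
  \<comment> \<open>Each block column has a single nonzero block, at the representative
    \<open>t\<close> of the coset of \<open>h \<otimes> b\<close>, so the sum over blocks
    collapses.\<close>
  obtain t where t: "t \<in> T" "inv t \<otimes> (h \<otimes> b) \<in> U" "!!t'. t' \<in> T ==> inv t' \<otimes> (h \<otimes> b) \<in> U ==> t' = t"
   using trans(3)[OF X.m_closed[OF h ab(2)]] by blast
  then obtain j0 where j0: "j0 < N" "t = tt j0" using t(1) unfolding in_set_conv_nth by blast
  have tX: "t \<in> carrier X" by (rule T_closed[OF t(1)])
  let ?f = "%j l. ext \<sigma> (inv a \<otimes> g \<otimes> tt j) $$ (i mod deg, l) * ext \<sigma> (inv tt j \<otimes> h \<otimes> b) $$ (l, k mod deg)"
  have "(ind_rep X K \<iota> \<sigma> g * ind_rep X K \<iota> \<sigma> h) $$ (i, k)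
   = (\<Sum>j<N * deg. ind_rep X K \<iota> \<sigma> g $$ (i, j) * ind_rep X K \<iota> \<sigma> h $$ (j, k))"
   using ik ind_rep_carrier[of g] ind_rep_carrier[of h] by (simp add: scalar_prod_def atLeast0LessThan)
  also have "... = (\<Sum>j<N * deg. ?f (j div deg) (j mod deg))"
   using ik by (intro sum.cong) (auto simp: ind_rep_index a_def b_def)
  also have "... = (\<Sum>j<N. \<Sum>l<deg. ?f j l)" by (rule sum_div_mod)
  also have "... = (\<Sum>j<N. if j = j0 then \<Sum>l<deg. ?f j l else 0)"
  proof (rule sum.cong[OF refl])
   fix j assume j: "j \<in> {..<N}"
   show "(\<Sum>l<deg. ?f j l) = (if j = j0 then \<Sum>l<deg. ?f j l else 0)"
   proof (cases "j = j0")
    case False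
    then have "tt j ~= t" using trans(1) j j0 by (simp add: nth_eq_iff_index_eq)
    then have "inv tt j \<otimes> (h \<otimes> b) \<notin> U" using t(3) tc(2) j by blast
    then have "inv tt j \<otimes> h \<otimes> b \<notin> U" using tc(1)[of j] j h ab by (simp add: X.m_assoc)
    then show ?thesis using False l by (simp add: ext_def)
   qed simp
  qed
  also have "... = (\<Sum>l<deg. ext \<sigma> (inv a \<otimes> g \<otimes> t) $$ (i mod deg, l) * ext \<sigma> (inv t \<otimes> (h \<otimes> b)) $$ (l, k mod deg))"
   using j0 tX h ab by (simp add: X.m_assoc)
  also have "... = (ext \<sigma> (inv a \<otimes> g \<otimes> t) * ext \<sigma> (inv t \<otimes> (h \<otimes> b))) $$ (i mod deg, k mod deg)"
   using l ext_carrier[of "inv a \<otimes> g \<otimes> t"] ext_carrier[of "inv t \<otimes> (h \<otimes> b)"]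
   by (simp add: scalar_prod_def atLeast0LessThan)
  also have "... = ext \<sigma> ((inv a \<otimes> g \<otimes> t) \<otimes> (inv t \<otimes> (h \<otimes> b))) $$ (i mod deg, k mod deg)"
   using ab g tX t(2) by (subst ext_mult) auto
  also have "(inv a \<otimes> g \<otimes> t) \<otimes> (inv t \<otimes> (h \<otimes> b)) = inv a \<otimes> (g \<otimes> h) \<otimes> b"
   using ab g h tX by (simp add: X.m_assoc X.inv_mult_cancel)
  also have "ext \<sigma> ... $$ (i mod deg, k mod deg) = ind_rep X K \<iota> \<sigma> (g \<otimes> h) $$ (i, k)"
   using ik by (simp add: ind_rep_index a_def b_def)
  finally show "ind_rep X K \<iota> \<sigma> (g \<otimes> h) $$ (i, k) = (ind_rep X K \<iota> \<sigma> g * ind_rep X K \<iota> \<sigma> h) $$ (i, k)" by simp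
 qed (use ind_rep_carrier[of g] ind_rep_carrier[of h] ind_rep_carrier[of "g \<otimes> h"] in auto)
qed

lemma mtr_ind_rep:
 "mtr (ind_rep X K \<iota> \<sigma> g) = (\<Sum>t\<in>T. if inv t \<otimes> g \<otimes> t \<in> U then mtr (\<sigma> (pre (inv t \<otimes> g \<otimes> t))) else 0)"
proof -
 have "mtr (ind_rep X K \<iota> \<sigma> g) = (\<Sum>i<N * deg. ext \<sigma> (inv (tt (i div deg)) \<otimes> g \<otimes> tt (i div deg)) $$ (i mod deg, i mod deg))"
  using ind_rep_carrier[of g] by (auto simp: mtr_def ind_rep_index intro!: sum.cong)
 also have "... = (\<Sum>i<N. \<Sum>j<deg. ext \<sigma> (inv (tt i) \<otimes> g \<otimes> tt i) $$ (j, j))"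
  by (rule sum_div_mod)
 also have "... = (\<Sum>i<N. mtr (ext \<sigma> (inv (tt i) \<otimes> g \<otimes> tt i)))"
 proof (rule sum.cong[OF refl])
  fix i
  show "(\<Sum>j<deg. ext \<sigma> (inv (tt i) \<otimes> g \<otimes> tt i) $$ (j, j)) = mtr (ext \<sigma> (inv (tt i) \<otimes> g \<otimes> tt i))"
   using ext_carrier[of "inv (tt i) \<otimes> g \<otimes> tt i"] by (simp add: mtr_def)
 qed
 also have "... = (\<Sum>t\<in>T. mtr (ext \<sigma> (inv t \<otimes> g \<otimes> t)))"
  using bij_betw_nth[OF trans(1) refl refl] by (rule sum.reindex_bij_betw)
 also have "... = (\<Sum>t\<in>T. if inv t \<otimes> g \<otimes> t \<in> U then mtr (\<sigma> (pre (inv t \<otimes> g \<otimes> t))) else 0)"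
  by (intro sum.cong) (auto simp: ext_def mtr_def)
 finally show ?thesis .
qed

end

definition ind_fun :: "('y => complex) => 'x => complex" where
 "ind_fun \<phi> g = (\<Sum>t\<in>T. if inv t \<otimes> g \<otimes> t \<in> U then \<phi> (pre (inv t \<otimes> g \<otimes> t)) else 0)"

text \<open>Brings the Frobenius formula into the shape that \<open>K0_map\<close> expects, with
  coefficients independent of \<open>\<phi>\<close>.\<close>

lemma ind_fun_kernel:
 assumes "g \<in> carrier X"
 shows "ind_fun \<phi> g = (\<Sum>h\<in>carrier K. (\<Sum>t\<in>T. if inv t \<otimes> g \<otimes> t = \<iota> h then 1 else 0) * \<phi> h)"
proof -
 have "(if x \<in> U then \<phi> (pre x) else 0) = (\<Sum>h\<in>carrier K. (if x = \<iota> h then 1 else 0) * \<phi> h)" for x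
 proof (cases "x \<in> U")
  case True
  have "(\<Sum>h\<in>carrier K. (if x = \<iota> h then 1 else 0) * \<phi> h) = (\<Sum>h\<in>carrier K. if h = pre x then \<phi> h else 0)"
   using True pre by (intro sum.cong) auto
  then show ?thesis using True pre(1)[OF True] K.finite_carrier by simp
 next
  case False
  then have "(if x = \<iota> h then 1 else 0) * \<phi> h = 0" if "h \<in> carrier K" for h using that by auto
  then show ?thesis using False by (simp add: sum.neutral)
 qed
 then have "ind_fun \<phi> g = (\<Sum>t\<in>T. \<Sum>h\<in>carrier K. (if inv t \<otimes> g \<otimes> t = \<iota> h then 1 else 0) * \<phi> h)"
  by (simp add: ind_fun_def)
 also have "... = (\<Sum>h\<in>carrier K. \<Sum>t\<in>T. (if inv t \<otimes> g \<otimes> t = \<iota> h then 1 else 0) * \<phi> h)"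
  by (rule sum.swap)
 finally show ?thesis by (simp add: sum_distrib_right)
qed

lemma mtr_ind_rep_kernel:
 "is_rep K \<sigma> ==> g \<in> carrier X ==>
  mtr (ind_rep X K \<iota> \<sigma> g) = (\<Sum>h\<in>carrier K. (\<Sum>t\<in>T. if inv t \<otimes> g \<otimes> t = \<iota> h then 1 else 0) * mtr (\<sigma> h))"
 using ind_fun_kernel[of g "%h. mtr (\<sigma> h)"] by (simp add: mtr_ind_rep ind_fun_def)

lemma K0_ind:
 assumes "C \<in> carrier (K0 K)"
 shows "K0_map K X (ind_rep X K \<iota>) C \<in> carrier (K0 X)"
  and "g \<in> carrier X ==> kch X (K0_map K X (ind_rep X K \<iota>) C) g = ind_fun (kch K C) g"
proof -
 note * = K0_map[OF K.finite_group_axioms X.finite_group_axioms is_rep_ind mtr_ind_rep_kernel assms]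
 show "K0_map K X (ind_rep X K \<iota>) C \<in> carrier (K0 X)" by (rule *(1))
 show "kch X (K0_map K X (ind_rep X K \<iota>) C) g = ind_fun (kch K C) g" if "g \<in> carrier X"
  using *(2)[OF _ _ _ that] ind_fun_kernel[OF that] by simp
qed

lemma K0_ind_rep:
 "is_rep K \<sigma> ==> K0_map K X (ind_rep X K \<iota>) (K0_class K (frag_of \<sigma>)) = K0_class X (frag_of (ind_rep X K \<iota> \<sigma>))"
 by (rule K0_map_rep[OF K.finite_group_axioms X.finite_group_axioms is_rep_ind mtr_ind_rep_kernel])

lemma card_transversal: "card (carrier X) = card T * card (carrier K)"
proof -
 have "bij_betw (%(t, h). t \<otimes> \<iota> h) (T \<times> carrier K) (carrier X)"
  unfolding bij_betw_def
 proof
  show "inj_on (%(t, h). t \<otimes> \<iota> h) (T \<times> carrier K)"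
  proof (rule inj_onI, clarify)
   fix t h t' h' assume *: "t \<in> T" "h \<in> carrier K" "t' \<in> T" "h' \<in> carrier K" "t \<otimes> \<iota> h = t' \<otimes> \<iota> h'"
   have tc: "t \<in> carrier X" "t' \<in> carrier X" using * T_closed by auto
   have "inv t \<otimes> t' = inv t \<otimes> ((t' \<otimes> \<iota> h') \<otimes> inv \<iota> h')"
    using tc * by (simp add: X.m_assoc)
   also have "... = \<iota> (h \<otimes>\<^bsub>K\<^esub> inv\<^bsub>K\<^esub> h')"
    unfolding *(5)[symmetric] using tc *(1-4) by (simp add: X.m_assoc X.inv_mult_cancel)
   also have "... \<in> U" using *(2,4) by (intro imageI) simp
   finally have tt: "t = t'" using T_unique * by blast
   then have "\<iota> h = \<iota> h'" using * tc by simp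
   then show "t = t' & h = h'" using tt inj_onD[OF \<iota>_inj] * by blast
  qed
  show "(%(t, h). t \<otimes> \<iota> h) ` (T \<times> carrier K) = carrier X"
  proof (intro equalityI subsetI)
   fix g assume g: "g \<in> carrier X"
   then obtain t where t: "t \<in> T" "inv t \<otimes> g \<in> U" using trans(3) by blast
   then obtain h where h: "h \<in> carrier K" "inv t \<otimes> g = \<iota> h" by auto
   then have "t \<otimes> \<iota> h = g" using t T_closed g by (simp add: X.inv_mult_cancel flip: h(2))
   then show "g \<in> (%(t, h). t \<otimes> \<iota> h) ` (T \<times> carrier K)" using t h by (auto intro!: image_eqI[of _ _ "(t, h)"])
  qed (use T_closed in auto)
 qed
 then have "card (T \<times> carrier K) = card (carrier X)" by (rule bij_betw_same_card)
 then show ?thesis by (simp add: card_cartesian_product)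
qed

text \<open>The character of \<open>D\<close> is invariant under conjugation, so each representative
  \<open>t\<close> contributes the same sum over \<open>X\<close>; the number of representatives
  cancels by \<open>card_transversal\<close>.\<close>

lemma frobenius_reciprocity:
 assumes D: "D \<in> carrier (K0 X)"
 shows "bform X (ind_fun \<phi>) (kch X D) = bform K \<phi> (%h. kch X D (\<iota> h))"
proof -
 define F where "F x = (if x \<in> U then \<phi> (pre x) else 0) * kch X D (inv x)" for x
 have "(\<Sum>g\<in>carrier X. ind_fun \<phi> g * kch X D (inv g)) = (\<Sum>g\<in>carrier X. \<Sum>t\<in>T. F (inv t \<otimes> g \<otimes> t))"
  unfolding ind_fun_def sum_distrib_right
 proof (intro sum.cong refl)
  fix g t assume g: "g \<in> carrier X" and "t \<in> T"
  then have t: "t \<in> carrier X" using T_closed by blast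
  have "inv (inv t \<otimes> g \<otimes> t) = inv t \<otimes> inv g \<otimes> inv (inv t)"
   using g t by (simp add: X.inv_mult_group X.m_assoc)
  then have "kch X D (inv (inv t \<otimes> g \<otimes> t)) = kch X D (inv g)"
   using X.kch_conj[OF D, of "inv g" "inv t"] g t by simp
  then show "(if inv t \<otimes> g \<otimes> t \<in> U then \<phi> (pre (inv t \<otimes> g \<otimes> t)) else 0) * kch X D (inv g) = F (inv t \<otimes> g \<otimes> t)"
   by (simp add: F_def)
 qed
 also have "... = (\<Sum>t\<in>T. \<Sum>g\<in>carrier X. F (inv t \<otimes> g \<otimes> t))" by (rule sum.swap)
 also have "... = (\<Sum>t\<in>T. \<Sum>x\<in>carrier X. F x)"
 proof (rule sum.cong[OF refl])
  fix t assume "t \<in> T"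
  then have t: "t \<in> carrier X" using T_closed by blast
  show "(\<Sum>g\<in>carrier X. F (inv t \<otimes> g \<otimes> t)) = (\<Sum>x\<in>carrier X. F x)"
   using t by (intro sum.reindex_bij_witness[of _ "%x. t \<otimes> x \<otimes> inv t" "%g. inv t \<otimes> g \<otimes> t"])
    (auto simp: X.m_assoc X.inv_mult_cancel)
 qed
 also have "(\<Sum>x\<in>carrier X. F x) = (\<Sum>x\<in>U. F x)"
  using X.finite_carrier by (intro sum.mono_neutral_right) (auto simp: F_def)
 also have "... = (\<Sum>h\<in>carrier K. F (\<iota> h))"
  by (rule sum.reindex[OF \<iota>_inj, unfolded o_def])
 also have "... = (\<Sum>h\<in>carrier K. \<phi> h * kch X D (\<iota> (inv\<^bsub>K\<^esub> h)))"
  by (intro sum.cong) (auto simp: F_def pre)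
 finally have "(\<Sum>g\<in>carrier X. ind_fun \<phi> g * kch X D (inv g)) = of_nat (card T) * (\<Sum>h\<in>carrier K. \<phi> h * kch X D (\<iota> (inv\<^bsub>K\<^esub> h)))"
  by simp
 moreover have "card T ~= 0" using card_transversal X.card_carrier_nonzero by (metis mult_is_0 of_nat_0)
 ultimately show ?thesis by (simp add: bform_def card_transversal)
qed

end

section \<open>Wreath products\<close>

declare One_nat_def [simp del] (* keeps the index sets {1..n} in this form *)

lemma carrier_wreath: "(p, f) \<in> carrier (wreath n G) \<longleftrightarrow> p permutes {1..n} & f \<in> (\<Pi>\<^sub>E i\<in>{1..n}. carrier G)"
 by (simp add: wreath_def sym_group_carrier)

lemma mult_wreath: "(p, f) \<otimes>\<^bsub>wreath n G\<^esub> (q, g) = (p \<circ> q, \<lambda>i\<in>{1..n}. f i \<otimes>\<^bsub>G\<^esub> g (inv_into UNIV p i))"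
 by (simp add: wreath_def)

lemma one_wreath: "\<one>\<^bsub>wreath n G\<^esub> = (id, \<lambda>i\<in>{1..n}. \<one>\<^bsub>G\<^esub>)"
 by (simp add: wreath_def)

lemma permutes_inv_into_mem: "p permutes S ==> inv_into UNIV p i \<in> S \<longleftrightarrow> i \<in> S"
 by (rule permutes_in_image[OF permutes_inv])

lemma group_wreath:
 assumes "group G" shows "group (wreath n G)"
proof (rule groupI)
 interpret group G by fact
 show "\<one>\<^bsub>wreath n G\<^esub> \<in> carrier (wreath n G)"
  by (simp add: one_wreath carrier_wreath permutes_id)
 fix x assume x: "x \<in> carrier (wreath n G)"
 obtain p f where xp: "x = (p, f)" by (cases x)
 have p: "p permutes {1..n}" and f: "f \<in> (\<Pi>\<^sub>E i\<in>{1..n}. carrier G)" using x by (simp_all add: xp carrier_wreath)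
 have fc: "f i \<in> carrier G" if "i \<in> {1..n}" for i using f that by blast
 note pinv = permutes_inv_into_mem[OF p]
 show "\<one>\<^bsub>wreath n G\<^esub> \<otimes>\<^bsub>wreath n G\<^esub> x = x"
  unfolding xp one_wreath mult_wreath using f fc by (auto simp: fun_eq_iff PiE_iff extensional_def)
 have "(inv_into UNIV p, \<lambda>i\<in>{1..n}. inv\<^bsub>G\<^esub> (f (p i))) \<otimes>\<^bsub>wreath n G\<^esub> x = \<one>\<^bsub>wreath n G\<^esub>"
  unfolding xp one_wreath mult_wreath using fc permutes_in_image[OF p]
  by (auto simp: fun_eq_iff permutes_inverses[OF p] permutes_inv_inv[OF p])
 moreover have "(inv_into UNIV p, \<lambda>i\<in>{1..n}. inv\<^bsub>G\<^esub> (f (p i))) \<in> carrier (wreath n G)"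
  using fc permutes_in_image[OF p] permutes_inv[OF p] by (auto simp: carrier_wreath)
 ultimately show "\<exists>y\<in>carrier (wreath n G). y \<otimes>\<^bsub>wreath n G\<^esub> x = \<one>\<^bsub>wreath n G\<^esub>" by blast
 fix y assume y: "y \<in> carrier (wreath n G)"
 obtain q g where yq: "y = (q, g)" by (cases y)
 have q: "q permutes {1..n}" and g: "g \<in> (\<Pi>\<^sub>E i\<in>{1..n}. carrier G)" using y by (simp_all add: yq carrier_wreath)
 have gc: "g i \<in> carrier G" if "i \<in> {1..n}" for i using g that by blast
 note qinv = permutes_inv_into_mem[OF q]
 show "x \<otimes>\<^bsub>wreath n G\<^esub> y \<in> carrier (wreath n G)"
  unfolding xp yq mult_wreath carrier_wreath using permutes_compose[OF q p] fc gc pinv by auto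
 fix z assume z: "z \<in> carrier (wreath n G)"
 obtain r h where zr: "z = (r, h)" by (cases z)
 have "h \<in> (\<Pi>\<^sub>E i\<in>{1..n}. carrier G)" using z by (simp_all add: zr carrier_wreath)
 then have hc: "h i \<in> carrier G" if "i \<in> {1..n}" for i using that by blast
 have "inv_into UNIV (p \<circ> q) i = inv_into UNIV q (inv_into UNIV p i)" for i
  using o_inv_distrib[OF permutes_bij[OF p] permutes_bij[OF q]] by simp
 then show "x \<otimes>\<^bsub>wreath n G\<^esub> y \<otimes>\<^bsub>wreath n G\<^esub> z = x \<otimes>\<^bsub>wreath n G\<^esub> (y \<otimes>\<^bsub>wreath n G\<^esub> z)"
  unfolding xp yq zr mult_wreath using fc gc hc pinv qinv by (auto simp: fun_eq_iff m_assoc)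
qed

lemma finite_group_wreath:
 assumes "finite_group G" shows "finite_group (wreath n G)"
proof -
 interpret finite_group G by fact
 interpret W: group "wreath n G" by (rule group_wreath[OF group_axioms])
 have "finite {p. p permutes {1..n}}" by (rule finite_permutations) simp
 moreover have "finite (\<Pi>\<^sub>E i\<in>{1..n}. carrier G)" using finite_carrier by (intro finite_PiE) auto
 moreover have "carrier (wreath n G) = {p. p permutes {1..n}} \<times> (\<Pi>\<^sub>E i\<in>{1..n}. carrier G)"
  using carrier_wreath[of _ _ n G] by auto
 ultimately show ?thesis by unfold_locales simp
qed

text \<open>
 An element \<open>(p, f)\<close> of a wreath product is a permutation of \<open>{1..n}\<close> whose arrows \<open>i \<rightarrow> p i\<close> carry
 the labels \<open>f (p i)\<close>.  \<open>presents\<close> transports this picture along an injection \<open>b\<close> to an arbitrary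
 finite set, with permutation \<open>r\<close> and label \<open>d j\<close> on the arrow \<open>j \<rightarrow> r j\<close>.
\<close>

definition presents ::
  "('g, 'm) monoid_scheme => nat => (nat => nat) => (nat => nat) => (nat => 'g) => 'g wreath => bool" where
 "presents G n b r d g \<longleftrightarrow> g \<in> carrier (wreath n G) & inj_on b {1..n} &
   (\<forall>i\<in>{1..n}. r (b i) = b (fst g i) & d (b i) = snd g (fst g i))"

lemma presents_unique:
 assumes "presents G n b r d g" "presents G n b r d g'"
 shows "g = g'"
proof -
 obtain p f q h where g: "g = (p, f)" "g' = (q, h)" by (cases g, cases g')
 have p: "p permutes {1..n}" "q permutes {1..n}" and f: "f \<in> (\<Pi>\<^sub>E i\<in>{1..n}. carrier G)" "h \<in> (\<Pi>\<^sub>E i\<in>{1..n}. carrier G)"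
  and b: "inj_on b {1..n}" and e: "!!i. i \<in> {1..n} ==> b (p i) = b (q i)" "!!i. i \<in> {1..n} ==> f (p i) = h (q i)"
  using assms by (simp_all add: presents_def g carrier_wreath)
 have pq: "p i = q i" if "i \<in> {1..n}" for i
  using inj_onD[OF b e(1)[OF that]] that permutes_in_image[OF p(1)] permutes_in_image[OF p(2)] by simp
 have "p = q"
 proof
  fix i show "p i = q i" using pq p by (cases "i \<in> {1..n}") (auto simp: permutes_def)
 qed
 moreover have "f = h"
 proof (rule PiE_ext[OF f])
  fix i assume i: "i \<in> {1..n}"
  then have "inv_into UNIV p i \<in> {1..n}" using permutes_inv_into_mem[OF p(1)] by simp
  from e(2)[OF this] pq[OF this] show "f i = h i" by (simp add: permutes_inverses[OF p(1)])
 qed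
 ultimately show ?thesis by (simp add: g)
qed

lemma presents_exists:
 assumes b: "inj_on b {1..n}" and r: "bij_betw r (b ` {1..n}) (b ` {1..n})" and d: "!!j. j \<in> b ` {1..n} ==> d j \<in> carrier G"
 shows "\<exists>g. presents G n b r d g"
proof -
 define c where "c = inv_into {1..n} b"
 define p where "p i = (if i \<in> {1..n} then c (r (b i)) else i)" for i
 have cb: "c (b i) = i" if "i \<in> {1..n}" for i unfolding c_def by (rule inv_into_f_f[OF b that])
 have bc: "b (c j) = j" "c j \<in> {1..n}" if "j \<in> b ` {1..n}" for j
  unfolding c_def using that by (rule f_inv_into_f, rule inv_into_into)
 have rV: "r (b i) \<in> b ` {1..n}" if "i \<in> {1..n}" for i using r that by (auto simp: bij_betw_def)
 have bp: "b (p i) = r (b i)" if "i \<in> {1..n}" for i using that bc(1)[OF rV[OF that]] by (simp add: p_def)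
 have "inj_on p {1..n}"
 proof (rule inj_onI)
  fix i j assume ij: "i \<in> {1..n}" "j \<in> {1..n}" "p i = p j"
  then have "r (b i) = r (b j)" using bp[OF ij(1)] bp[OF ij(2)] by simp
  then have "b i = b j" using inj_onD[OF bij_betw_imp_inj_on[OF r]] ij by blast
  then show "i = j" using inj_onD[OF b] ij by blast
 qed
 moreover have "p ` {1..n} \<subseteq> {1..n}" using bc(2)[OF rV] by (auto simp: p_def)
 ultimately have "bij_betw p {1..n} {1..n}" by (simp add: bij_betw_def endo_inj_surj)
 then have p: "p permutes {1..n}" by (rule bij_imp_permutes) (simp add: p_def del: atLeastAtMost_iff)
 \<comment> \<open>The label of the arrow into \<open>i\<close> is stored at index \<open>i\<close>,
   so \<open>d\<close> is read at the source of that arrow.\<close>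
 define f where "f = (\<lambda>i\<in>{1..n}. d (b (inv_into UNIV p i)))"
 have "f \<in> (\<Pi>\<^sub>E i\<in>{1..n}. carrier G)" using d permutes_inv_into_mem[OF p] by (auto simp: f_def)
 moreover have "d (b i) = f (p i)" if "i \<in> {1..n}" for i
  using that permutes_in_image[OF p, of i] by (simp add: f_def permutes_inverses[OF p])
 ultimately have "presents G n b r d (p, f)" using b bp p by (auto simp: presents_def carrier_wreath)
 then show ?thesis by blast
qed

lemma presents_self:
 assumes "(p, f) \<in> carrier (wreath n G)"
 shows "presents G n (%i. i) p (%i. f (p i)) (p, f)"
 using assms by (auto simp: presents_def)

lemma presents_cong:
 assumes "presents G n b r d g" "!!i. i \<in> {1..n} ==> b i = b' i"
  "!!j. j \<in> b ` {1..n} ==> r j = r' j" "!!j. j \<in> b ` {1..n} ==> d j = d' j"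
 shows "presents G n b' r' d' g"
proof -
 have g: "fst g i \<in> {1..n}" if "i \<in> {1..n}" for i
  using assms(1) permutes_in_image[of "fst g" "{1..n}" i] that
  by (cases g) (simp add: presents_def carrier_wreath)
 have "inj_on b {1..n} = inj_on b' {1..n}" by (rule inj_on_cong) (rule assms(2))
 then have "inj_on b' {1..n}" using assms(1) by (simp add: presents_def)
 moreover have "r' (b' i) = b' (fst g i) & d' (b' i) = snd g (fst g i)" if "i \<in> {1..n}" for i
 proof -
  have "b i \<in> b ` {1..n}" using that by blast
  moreover have "r (b i) = b (fst g i) & d (b i) = snd g (fst g i)"
   using assms(1) that unfolding presents_def by blast
  ultimately show ?thesis using assms(3,4)[of "b i"] assms(2)[OF that] assms(2)[OF g[OF that]] by simp
 qed
 ultimately show ?thesis using assms(1) by (simp add: presents_def)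
qed

lemma presents_bij:
 assumes "presents G n b r d g"
 shows "bij_betw r (b ` {1..n}) (b ` {1..n})" "j \<in> b ` {1..n} ==> d j \<in> carrier G"
proof -
 obtain p f where g: "g = (p, f)" by (cases g)
 have p: "p permutes {1..n}" and f: "f \<in> (\<Pi>\<^sub>E i\<in>{1..n}. carrier G)"
  and b: "inj_on b {1..n}" and e: "!!i. i \<in> {1..n} ==> r (b i) = b (p i)" "!!i. i \<in> {1..n} ==> d (b i) = f (p i)"
  using assms by (simp_all add: presents_def g carrier_wreath)
 have "r ` b ` {1..n} = b ` p ` {1..n}" unfolding image_image by (rule image_cong[OF refl e(1)])
 then have im: "r ` b ` {1..n} = b ` {1..n}" by (simp add: permutes_image[OF p])
 then show "bij_betw r (b ` {1..n}) (b ` {1..n})"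
  by (simp add: bij_betw_def eq_card_imp_inj_on)
 assume "j \<in> b ` {1..n}"
 then obtain i where i: "i \<in> {1..n}" "j = b i" by blast
 have "p i \<in> {1..n}" using permutes_in_image[OF p] i by simp
 then show "d j \<in> carrier G" using e(2)[OF i(1)] f i(2) by auto
qed

text \<open>A change of numbering together with a gauge transformation \<open>f\<close> of the
  labels is conjugation by the wreath product element \<open>s\<close> that records both.\<close>

lemma presents_conj:
 assumes G: "group G"
  and g: "presents G n b r d g" and g': "presents G n b' r d' g'"
  and s: "s \<in> carrier (wreath n G)" and bs: "!!i. i \<in> {1..n} ==> b (fst s i) = b' i"
  and fs: "!!i. i \<in> {1..n} ==> snd s i = f (b i)"
  and gauge: "!!j. j \<in> b ` {1..n} ==> f (r j) \<otimes>\<^bsub>G\<^esub> d' j = d j \<otimes>\<^bsub>G\<^esub> f j"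
 shows "g \<otimes>\<^bsub>wreath n G\<^esub> s = s \<otimes>\<^bsub>wreath n G\<^esub> g'"
proof -
 obtain p F where gp: "g = (p, F)" by (cases g)
 obtain p' F' where gp': "g' = (p', F')" by (cases g')
 obtain q h where sq: "s = (q, h)" by (cases s)
 have p: "p permutes {1..n}" and b: "inj_on b {1..n}"
  and e: "!!i. i \<in> {1..n} ==> r (b i) = b (p i)" "!!i. i \<in> {1..n} ==> d (b i) = F (p i)"
  using g by (simp_all add: presents_def gp carrier_wreath)
 have p': "p' permutes {1..n}"
  and e': "!!i. i \<in> {1..n} ==> r (b' i) = b' (p' i)" "!!i. i \<in> {1..n} ==> d' (b' i) = F' (p' i)"
  using g' by (simp_all add: presents_def gp' carrier_wreath)
 have q: "q permutes {1..n}" using s by (simp add: sq carrier_wreath)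
 have bq: "!!i. i \<in> {1..n} ==> b (q i) = b' i" and hb: "!!i. i \<in> {1..n} ==> h i = f (b i)" using bs fs by (simp_all add: sq)
 note im = permutes_in_image[OF p] permutes_in_image[OF p'] permutes_in_image[OF q]
 have pq: "p (q i) = q (p' i)" if i: "i \<in> {1..n}" for i
 proof (rule inj_onD[OF b])
  show "b (p (q i)) = b (q (p' i))"
   using e(1)[of "q i"] e'(1)[OF i] bq[OF i] bq[of "p' i"] im i by simp
 qed (use im i in simp_all)
 have "p \<circ> q = q \<circ> p'"
 proof
  fix i show "(p \<circ> q) i = (q \<circ> p') i"
   using pq p p' q by (cases "i \<in> {1..n}") (auto simp: permutes_def)
 qed
 moreover have "F i \<otimes>\<^bsub>G\<^esub> h (inv_into UNIV p i) = h i \<otimes>\<^bsub>G\<^esub> F' (inv_into UNIV q i)" if i: "i \<in> {1..n}" for i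
 proof -
  define k where "k = inv_into UNIV p' (inv_into UNIV q i)"
  have k: "k \<in> {1..n}" using i by (simp add: k_def permutes_inv_into_mem[OF p'] permutes_inv_into_mem[OF q] del: atLeastAtMost_iff)
  have qk: "q k \<in> {1..n}" and p'k: "p' k \<in> {1..n}" using im k by simp_all
  have iq: "inv_into UNIV q i = p' k" by (simp add: k_def permutes_inverses[OF p'])
  then have i1: "i = q (p' k)" using permutes_inverses(1)[OF q, of i] by simp
  then have i2: "i = p (q k)" using pq[OF k] by simp
  then have ip: "inv_into UNIV p i = q k" by (simp add: permutes_inverses[OF p])
  have "F i = d (b' k)" using e(2)[OF qk] bq[OF k] i2 by simp
  moreover have "h (q k) = f (b' k)" using hb[OF qk] bq[OF k] by simp
  moreover have "h i = f (r (b' k))" using hb[OF i] i1 bq[OF p'k] e'(1)[OF k] by simp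
  moreover have "F' (p' k) = d' (b' k)" using e'(2)[OF k] by simp
  moreover have "b' k \<in> b ` {1..n}" unfolding bq[OF k, symmetric] using qk by (rule imageI)
  ultimately show ?thesis using gauge[of "b' k"] ip iq by simp
 qed
 ultimately show ?thesis by (auto simp: gp gp' sq mult_wreath fun_eq_iff)
qed

text \<open>Two numberings of \<open>V\<close> present conjugate elements, so the choice of
  \<open>g\<close> is harmless by \<open>kch_presents_gauge\<close>; \<open>hat_presents\<close> is
  the rule that evaluates the definition.\<close>

definition hat :: "('g, 'm) monoid_scheme => 'g repgrp => nat set => (nat => nat) => (nat => 'g) => complex" where
 "hat G x V r d = kch (wreath (card V) G) (x (card V))
   (SOME g. \<exists>b. b ` {1..card V} = V & presents G (card V) b r d g)"

text \<open>Finite support is left out because \<open>hat\<close> sees a single degree;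
  \<open>hat_ind_pair\<close> evaluates products without first deciding whether their support is
  finite.\<close>

definition RG :: "('g, 'm) monoid_scheme => 'g repgrp set" where
 "RG G = {x. \<forall>n. x n \<in> carrier (KW n G)}"

lemma kch_presents_gauge:
 assumes G: "finite_group G" and C: "C \<in> carrier (KW n G)"
  and g: "presents G n b r d g" and g': "presents G n b' r d' g'" and im: "b ` {1..n} = b' ` {1..n}"
  and f: "!!j. j \<in> b ` {1..n} ==> f j \<in> carrier G"
  and gauge: "!!j. j \<in> b ` {1..n} ==> f (r j) \<otimes>\<^bsub>G\<^esub> d' j = d j \<otimes>\<^bsub>G\<^esub> f j"
 shows "kch (wreath n G) C g = kch (wreath n G) C g'"
proof -
 interpret G: finite_group G by fact
 interpret W: finite_group "wreath n G" by (rule finite_group_wreath[OF G])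
 have b: "inj_on b {1..n}" and b': "inj_on b' {1..n}" using g g' by (simp_all add: presents_def)
 define q where "q i = (if i \<in> {1..n} then inv_into {1..n} b (b' i) else i)" for i
 have bq: "b (q i) = b' i" "q i \<in> {1..n}" if "i \<in> {1..n}" for i
 proof -
  have "b' i \<in> b ` {1..n}" using that im by blast
  then show "b (q i) = b' i" "q i \<in> {1..n}"
   using that inv_into_into[of "b' i" b "{1..n}"] by (simp_all add: q_def f_inv_into_f del: atLeastAtMost_iff)
 qed
 have "inj_on q {1..n}"
 proof (rule inj_onI)
  fix i j assume "i \<in> {1..n}" "j \<in> {1..n}" "q i = q j"
  then show "i = j" using bq(1)[of i] bq(1)[of j] inj_onD[OF b', of i j] by simp
 qed
 moreover have "q ` {1..n} \<subseteq> {1..n}" using bq(2) by blast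
 ultimately have "bij_betw q {1..n} {1..n}" by (simp add: bij_betw_def endo_inj_surj)
 then have q: "q permutes {1..n}" by (rule bij_imp_permutes) (simp add: q_def del: atLeastAtMost_iff)
 define s where "s = (q, \<lambda>i\<in>{1..n}. f (b i))"
 have s: "s \<in> carrier (wreath n G)" using q f by (auto simp: s_def carrier_wreath)
 have "g \<otimes>\<^bsub>wreath n G\<^esub> s = s \<otimes>\<^bsub>wreath n G\<^esub> g'"
  by (rule presents_conj[OF G.group_axioms g g' s _ _ gauge]) (use bq in \<open>auto simp: s_def\<close>)
 moreover have gc: "g \<in> carrier (wreath n G)" "g' \<in> carrier (wreath n G)" using g g' by (simp_all add: presents_def)
 ultimately have "s \<otimes>\<^bsub>wreath n G\<^esub> g' \<otimes>\<^bsub>wreath n G\<^esub> inv\<^bsub>wreath n G\<^esub> s = g"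
  using s by (simp add: W.inv_solve_right')
 then show ?thesis using W.kch_conj[OF C gc(2) s] by simp
qed

lemma hat_presents:
 assumes G: "finite_group G" and x: "x \<in> RG G" and g: "presents G n b r d g" and V: "b ` {1..n} = V"
 shows "hat G x V r d = kch (wreath n G) (x n) g"
proof -
 interpret G: finite_group G by fact
 have n: "card V = n" using g V by (auto simp: presents_def card_image)
 have "\<exists>g. \<exists>b. b ` {1..n} = V & presents G n b r d g" using g V by blast
 from someI_ex[OF this] obtain b' where b': "b' ` {1..n} = V" "presents G n b' r d (SOME g. \<exists>b. b ` {1..n} = V & presents G n b r d g)"
  by (elim exE conjE)
 have "kch (wreath n G) (x n) (SOME g. \<exists>b. b ` {1..n} = V & presents G n b r d g) = kch (wreath n G) (x n) g"
 proof (rule kch_presents_gauge[OF G _ b'(2) g, where f = "%_. \<one>\<^bsub>G\<^esub>"])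
  show "\<one>\<^bsub>G\<^esub> \<otimes>\<^bsub>G\<^esub> d j = d j \<otimes>\<^bsub>G\<^esub> \<one>\<^bsub>G\<^esub>" if "j \<in> b' ` {1..n}" for j
   using presents_bij(2)[OF g] that b' V by simp
 qed (use x b' V in \<open>auto simp: RG_def\<close>)
 then show ?thesis by (simp add: hat_def n)
qed

definition point :: "('g, 'm) monoid_scheme => nat set => (nat => nat) => (nat => 'g) => bool" where
 "point G V r d \<longleftrightarrow> finite V & bij_betw r V V & (\<forall>j\<in>V. d j \<in> carrier G)"

lemma point_presents:
 assumes "point G V r d"
 obtains b g where "b ` {1..card V} = V" "inj_on b {1..card V}" "presents G (card V) b r d g"
proof -
 have "finite V" using assms by (simp add: point_def)
 then obtain b where "bij_betw b {1..card V} V" using ex_bij_betw_nat_finite_1 by blast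
 then have b: "inj_on b {1..card V}" "b ` {1..card V} = V" by (auto simp: bij_betw_def)
 have "\<exists>g. presents G (card V) b r d g"
  by (rule presents_exists[OF b(1)]) (use assms b(2) in \<open>simp_all add: point_def\<close>)
 then obtain g where "presents G (card V) b r d g" by blast
 with b show thesis by (intro that[of b g])
qed

lemma presents_point: "presents G n b r d g ==> point G (b ` {1..n}) r d"
 by (simp add: point_def presents_bij)

lemma hat_cong:
 assumes G: "finite_group G" and x: "x \<in> RG G" and pt: "point G V r d"
  and "!!j. j \<in> V ==> r j = r' j" "!!j. j \<in> V ==> d j = d' j"
 shows "hat G x V r d = hat G x V r' d'"
proof -
 obtain b g where b: "b ` {1..card V} = V" "inj_on b {1..card V}" "presents G (card V) b r d g" by (rule point_presents[OF pt])
 have "presents G (card V) b r' d' g" by (rule presents_cong[OF b(3)]) (use assms b in auto)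
 then show ?thesis using hat_presents[OF G x b(3,1)] hat_presents[OF G x _ b(1)] by simp
qed

text \<open>Gauge transformations over \<open>G\<close> are conjugations in the wreath product. They
  absorb the choice of coset representatives and later the inner automorphisms of
  \<open>H\<close>.\<close>

lemma hat_gauge:
 assumes G: "finite_group G" and x: "x \<in> RG G" and pt: "point G V r d" "point G V r d'"
  and f: "!!j. j \<in> V ==> f j \<in> carrier G"
  and gauge: "!!j. j \<in> V ==> f (r j) \<otimes>\<^bsub>G\<^esub> d' j = d j \<otimes>\<^bsub>G\<^esub> f j"
 shows "hat G x V r d = hat G x V r d'"
proof -
 obtain b g where b: "b ` {1..card V} = V" "inj_on b {1..card V}" "presents G (card V) b r d g" by (rule point_presents[OF pt(1)])
 obtain b' g' where b': "b' ` {1..card V} = V" "inj_on b' {1..card V}" "presents G (card V) b' r d' g'" by (rule point_presents[OF pt(2)])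
 show ?thesis
  unfolding hat_presents[OF G x b(3,1)] hat_presents[OF G x b'(3,1)]
  by (rule kch_presents_gauge[OF G _ b(3) b'(3)]) (use x b b' f gauge in \<open>auto simp: RG_def\<close>)
qed


subsection \<open>Products of wreath products\<close>

lemma wreath_emb_simps:
 "fst (wreath_emb k l ((p, f), (q, h))) i = (if i \<le> k then p i else q (i - k) + k)"
 "i \<in> {1..k + l} ==> snd (wreath_emb k l ((p, f), (q, h))) i = (if i \<le> k then f i else h (i - k))"
 by (simp_all add: wreath_emb_def)

lemma wreath_emb_closed:
 assumes "g1 \<in> carrier (wreath k G)" "g2 \<in> carrier (wreath l G)"
 shows "wreath_emb k l (g1, g2) \<in> carrier (wreath (k + l) G)"
proof -
 obtain p f where g1: "g1 = (p, f)" by (cases g1)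
 obtain q h where g2: "g2 = (q, h)" by (cases g2)
 have p: "p permutes {1..k}" and f: "f \<in> (\<Pi>\<^sub>E i\<in>{1..k}. carrier G)" using assms(1) by (simp_all add: g1 carrier_wreath)
 have q: "q permutes {1..l}" and h: "h \<in> (\<Pi>\<^sub>E i\<in>{1..l}. carrier G)" using assms(2) by (simp_all add: g2 carrier_wreath)
 define P where "P i = (if i \<le> k then p i else q (i - k) + k)" for i
 have pk: "p i \<le> k" if "i \<le> k" for i
  using that permutes_in_image[OF p, of i] permutes_not_in[OF p, of i] by (cases "i = 0") auto
 have p1: "1 \<le> p i" if "1 \<le> i" "i \<le> k" for i using that permutes_in_image[OF p, of i] by auto
 have q1: "1 \<le> q (i - k)" "q (i - k) \<le> l" if "\<not> i \<le> k" "i \<le> k + l" for i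
  using that permutes_in_image[OF q, of "i - k"] by auto
 have "inj_on P {1..k + l}"
 proof (rule inj_onI)
  fix i j assume ij: "i \<in> {1..k + l}" "j \<in> {1..k + l}" "P i = P j"
  have *: "p a ~= q (c - k) + k" if "a \<le> k" "\<not> c \<le> k" "c \<le> k + l" for a c
   using pk[OF that(1)] q1(1)[OF that(2,3)] by linarith
  consider "i \<le> k" "j \<le> k" | "\<not> i \<le> k" "\<not> j \<le> k" | "i \<le> k" "\<not> j \<le> k" | "\<not> i \<le> k" "j \<le> k" by linarith
  then show "i = j"
  proof cases
   case 1
   then have "p i = p j" using ij by (simp add: P_def)
   then show ?thesis using permutes_inj[OF p] by (simp add: inj_eq)
  next
   case 2
   then have "q (i - k) = q (j - k)" using ij by (simp add: P_def)
   then have "i - k = j - k" using permutes_inj[OF q] by (simp add: inj_eq)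
   then show ?thesis using 2 by linarith
  next
   case 3
   then show ?thesis using *[of i j] ij by (simp add: P_def)
  next
   case 4
   then show ?thesis using *[of j i] ij by (simp add: P_def)
  qed
 qed
 moreover have "P ` {1..k + l} \<subseteq> {1..k + l}"
 proof (rule image_subsetI)
  fix i assume i: "i \<in> {1..k + l}"
  show "P i \<in> {1..k + l}"
  proof (cases "i \<le> k")
   case True
   then show ?thesis using i pk[of i] p1[of i] by (simp add: P_def)
  next
   case False
   then show ?thesis using i q1[of i] by (simp add: P_def)
  qed
 qed
 ultimately have "bij_betw P {1..k + l} {1..k + l}" by (simp add: bij_betw_def endo_inj_surj)
 moreover have "P i = i" if "i \<notin> {1..k + l}" for i
 proof (cases "i = 0")
  case True
  then show ?thesis using permutes_not_in[OF p, of 0] by (simp add: P_def)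
 next
  case False
  then have "\<not> i \<le> k" "i - k \<notin> {1..l}" using that by auto
  then show ?thesis using permutes_not_in[OF q, of "i - k"] by (simp add: P_def)
 qed
 ultimately have "P permutes {1..k + l}" by (rule bij_imp_permutes)
 moreover have "(\<lambda>i\<in>{1..k + l}. if i \<le> k then f i else h (i - k)) \<in> (\<Pi>\<^sub>E i\<in>{1..k + l}. carrier G)"
 proof (rule restrict_PiE_iff[THEN iffD2], rule ballI)
  fix i assume i: "i \<in> {1..k + l}"
  show "(if i \<le> k then f i else h (i - k)) \<in> carrier G"
  proof (cases "i \<le> k")
   case True
   then show ?thesis using i PiE_mem[OF f, of i] by simp
  next
   case False
   then have "i - k \<in> {1..l}" using i by auto
   then show ?thesis using False PiE_mem[OF h, of "i - k"] by simp
  qed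
 qed
 moreover have "wreath_emb k l (g1, g2) = (P, \<lambda>i\<in>{1..k + l}. if i \<le> k then f i else h (i - k))"
  by (simp add: wreath_emb_def g1 g2 P_def fun_eq_iff)
 ultimately show ?thesis by (simp add: carrier_wreath)
qed

lemma wreath_emb_presents:
 assumes 1: "presents G k b1 r d g1" and 2: "presents G l b2 r d g2" and dis: "b1 ` {1..k} \<inter> b2 ` {1..l} = {}"
 shows "presents G (k + l) (%i. if i \<le> k then b1 i else b2 (i - k)) r d (wreath_emb k l (g1, g2))"
proof -
 let ?b = "%i. if i \<le> k then b1 i else b2 (i - k)"
 obtain p f where g1: "g1 = (p, f)" by (cases g1)
 obtain q h where g2: "g2 = (q, h)" by (cases g2)
 have p: "p permutes {1..k}" and b1: "inj_on b1 {1..k}"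
  and e1: "!!i. i \<in> {1..k} ==> r (b1 i) = b1 (p i)" "!!i. i \<in> {1..k} ==> d (b1 i) = f (p i)"
  using 1 by (simp_all add: presents_def g1 carrier_wreath)
 have q: "q permutes {1..l}" and b2: "inj_on b2 {1..l}"
  and e2: "!!i. i \<in> {1..l} ==> r (b2 i) = b2 (q i)" "!!i. i \<in> {1..l} ==> d (b2 i) = h (q i)"
  using 2 by (simp_all add: presents_def g2 carrier_wreath)
 have ne: "b1 i ~= b2 j" if "i \<in> {1..k}" "j \<in> {1..l}" for i j
  using dis that by blast
 show ?thesis
  unfolding presents_def
 proof (intro conjI ballI)
  show "wreath_emb k l (g1, g2) \<in> carrier (wreath (k + l) G)"
   using 1 2 by (intro wreath_emb_closed) (simp_all add: presents_def)
  show "inj_on ?b {1..k + l}"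
  proof (rule inj_onI)
   fix i j assume ij: "i \<in> {1..k + l}" "j \<in> {1..k + l}" "?b i = ?b j"
   consider "i \<le> k" "j \<le> k" | "\<not> i \<le> k" "\<not> j \<le> k" | "i \<le> k" "\<not> j \<le> k" | "\<not> i \<le> k" "j \<le> k" by linarith
   then show "i = j"
   proof cases
    case 1
    then show ?thesis using ij inj_onD[OF b1, of i j] by simp
   next
    case 2
    moreover have "i - k \<in> {1..l}" "j - k \<in> {1..l}" using 2 ij by auto
    ultimately have "i - k = j - k" using ij inj_onD[OF b2, of "i - k" "j - k"] by simp
    then show ?thesis using \<open>\<not> i \<le> k\<close> \<open>\<not> j \<le> k\<close> by linarith
   next
    case 3
    then have "i \<in> {1..k}" "j - k \<in> {1..l}" using ij by auto
    then show ?thesis using 3 ij ne[of i "j - k"] by simp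
   next
    case 4
    then have "j \<in> {1..k}" "i - k \<in> {1..l}" using ij by auto
    then show ?thesis using 4 ij ne[of j "i - k"] by simp
   qed
  qed
  fix i assume i: "i \<in> {1..k + l}"
  let ?g = "wreath_emb k l (g1, g2)"
  have "r (?b i) = ?b (fst ?g i) & d (?b i) = snd ?g (fst ?g i)"
  proof (cases "i \<le> k")
   case True
   then have ik: "i \<in> {1..k}" using i by auto
   then have "p i \<in> {1..k}" using permutes_in_image[OF p] by blast
   then show ?thesis using True e1[OF ik] by (simp add: g1 g2 wreath_emb_simps)
  next
   case False
   then have il: "i - k \<in> {1..l}" using i by auto
   then have "q (i - k) \<in> {1..l}" using permutes_in_image[OF q] by blast
   then show ?thesis using False e2[OF il] by (simp add: g1 g2 wreath_emb_simps)
  qed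
  then show "r (?b i) = ?b (fst ?g i)" "d (?b i) = snd ?g (fst ?g i)" by auto
 qed
qed

lemma wreath_emb_mult:
 assumes "g1 \<in> carrier (wreath k G)" "g2 \<in> carrier (wreath l G)" "h1 \<in> carrier (wreath k G)" "h2 \<in> carrier (wreath l G)"
 shows "wreath_emb k l (g1 \<otimes>\<^bsub>wreath k G\<^esub> h1, g2 \<otimes>\<^bsub>wreath l G\<^esub> h2)
  = wreath_emb k l (g1, g2) \<otimes>\<^bsub>wreath (k + l) G\<^esub> wreath_emb k l (h1, h2)"
proof -
 obtain p f p' f' where g1: "g1 = (p, f)" "h1 = (p', f')" by (cases g1, cases h1)
 obtain q h q' h' where g2: "g2 = (q, h)" "h2 = (q', h')" by (cases g2, cases h2)
 have p: "p permutes {1..k}" "p' permutes {1..k}" using assms by (simp_all add: g1 carrier_wreath)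
 have q: "q permutes {1..l}" "q' permutes {1..l}" using assms by (simp_all add: g2 carrier_wreath)
 \<comment> \<open>Index 0 satisfies \<open>i \<le> k\<close> although it lies outside
   \<open>{1..k}\<close>, and \<open>p\<close> fixes it. Together with \<open>q0\<close> this keeps
   the two ranges of indices apart.\<close>
 have pk: "p i \<le> k" if "i \<le> k" "p permutes {1..k}" for i and p :: "nat => nat"
  using that(1) permutes_in_image[OF that(2), of i] permutes_not_in[OF that(2), of i] by (cases "i = 0") auto
 have q0: "q (i - k) ~= 0" if "\<not> i \<le> k" "q permutes {1..l}" for i and q :: "nat => nat"
 proof
  assume "q (i - k) = 0"
  moreover have "q 0 = 0" using permutes_not_in[OF that(2), of 0] by simp
  ultimately have "i - k = 0" using permutes_inj[OF that(2)] by (metis injD)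
  then show False using that by simp
 qed
 define P where "P i = (if i \<le> k then p i else q (i - k) + k)" for i
 have P: "P permutes {1..k + l}"
  using wreath_emb_closed[OF assms(1,2)] by (simp add: g1 g2 wreath_emb_def carrier_wreath P_def[abs_def])
 have Pinv: "inv_into UNIV P i = (if i \<le> k then inv_into UNIV p i else inv_into UNIV q (i - k) + k)" for i
 proof -
  have "P (if i \<le> k then inv_into UNIV p i else inv_into UNIV q (i - k) + k) = i"
  proof (cases "i \<le> k")
   case True
   then show ?thesis using pk[OF True permutes_inv[OF p(1)]] by (simp add: P_def permutes_inverses[OF p(1)])
  next
   case False
   then show ?thesis using q0[OF False permutes_inv[OF q(1)]] by (simp add: P_def permutes_inverses[OF q(1)])
  qed
  then show ?thesis by (simp only: permutes_inv_eq[OF P])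
 qed
 have "(%i. if i \<le> k then (p \<circ> p') i else (q \<circ> q') (i - k) + k) = P \<circ> (%i. if i \<le> k then p' i else q' (i - k) + k)"
 proof
  fix i
  show "(if i \<le> k then (p \<circ> p') i else (q \<circ> q') (i - k) + k) = (P \<circ> (%i. if i \<le> k then p' i else q' (i - k) + k)) i"
   using pk[OF _ p(2), of i] q0[OF _ q(2), of i] by (cases "i \<le> k") (simp_all add: P_def)
 qed
 moreover have "(if i \<le> k then (\<lambda>i\<in>{1..k}. f i \<otimes>\<^bsub>G\<^esub> f' (inv_into UNIV p i)) i else (\<lambda>i\<in>{1..l}. h i \<otimes>\<^bsub>G\<^esub> h' (inv_into UNIV q i)) (i - k))
  = (\<lambda>i\<in>{1..k + l}. if i \<le> k then f i else h (i - k)) i \<otimes>\<^bsub>G\<^esub> (\<lambda>i\<in>{1..k + l}. if i \<le> k then f' i else h' (i - k)) (inv_into UNIV P i)"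
  if i: "i \<in> {1..k + l}" for i
 proof -
  have Pi: "inv_into UNIV P i \<in> {1..k + l}" using permutes_inv_into_mem[OF P] i by blast
  show ?thesis
  proof (cases "i \<le> k")
   case True
   then show ?thesis using i Pi pk[OF True permutes_inv[OF p(1)]] by (simp add: Pinv)
  next
   case False
   then show ?thesis using i Pi q0[OF False permutes_inv[OF q(1)]] by (auto simp add: Pinv)
  qed
 qed
 ultimately show ?thesis
  by (simp add: g1 g2 mult_wreath wreath_emb_def P_def[abs_def] cong: restrict_cong)
qed

lemma wreath_emb_inj: "inj_on (wreath_emb k l) (carrier (wreath k G) \<times> carrier (wreath l G))"
proof (rule inj_onI)
 fix x y assume xy: "x \<in> carrier (wreath k G) \<times> carrier (wreath l G)" "y \<in> carrier (wreath k G) \<times> carrier (wreath l G)"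
  and exy: "wreath_emb k l x = wreath_emb k l y"
 obtain p f q h where x: "x = ((p, f), (q, h))" by (cases x; cases "fst x"; cases "snd x") auto
 obtain p' f' q' h' where y: "y = ((p', f'), (q', h'))" by (cases y; cases "fst y"; cases "snd y") auto
 have 1: "(p, f) \<in> carrier (wreath k G)" "(q, h) \<in> carrier (wreath l G)"
  "(p', f') \<in> carrier (wreath k G)" "(q', h') \<in> carrier (wreath l G)"
  using xy by (simp_all add: x y)
 have e: "wreath_emb k l ((p, f), (q, h)) = wreath_emb k l ((p', f'), (q', h'))" using exy by (simp add: x y)
 have P: "(if i \<le> k then p i else q (i - k) + k) = (if i \<le> k then p' i else q' (i - k) + k)" for i
  using fun_cong[OF arg_cong[OF e, of fst], of i] by (simp add: wreath_emb_simps)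
 have F: "(if i \<le> k then f i else h (i - k)) = (if i \<le> k then f' i else h' (i - k))" if "i \<in> {1..k + l}" for i
  using fun_cong[OF arg_cong[OF e, of snd], of i] that by (simp only: wreath_emb_simps)
 note perm = 1[unfolded carrier_wreath]
 have "p i = p' i" for i
  using P[of i] perm permutes_not_in[of p "{1..k}" i] permutes_not_in[of p' "{1..k}" i] by (cases "i \<le> k") auto
 moreover have "q i = q' i" for i
  using P[of "i + k"] perm permutes_not_in[of q "{1..l}" i] permutes_not_in[of q' "{1..l}" i] by (cases "i = 0") auto
 moreover have "f = f'"
 proof (rule PiE_ext)
  show "f \<in> (\<Pi>\<^sub>E i\<in>{1..k}. carrier G)" "f' \<in> (\<Pi>\<^sub>E i\<in>{1..k}. carrier G)" using perm by auto
  fix i assume "i \<in> {1..k}"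
  then show "f i = f' i" using F[of i] by simp
 qed
 moreover have "h = h'"
 proof (rule PiE_ext)
  show "h \<in> (\<Pi>\<^sub>E i\<in>{1..l}. carrier G)" "h' \<in> (\<Pi>\<^sub>E i\<in>{1..l}. carrier G)" using perm by auto
  fix i assume "i \<in> {1..l}"
  then show "h i = h' i" using F[of "i + k"] by simp
 qed
 ultimately show "x = y" by (auto simp: x y)
qed

text \<open>\<open>K\<close> is \<open>G\<close> with its carrier replaced, so the choice
  \<open>H = carrier G\<close> gives back \<open>G\<close> itself by
  \<open>carrier_update_self\<close>, and the axioms of R(G) come from that instance. Normality of
  \<open>H\<close> enters with \<open>conj_mem_iff\<close>.\<close>

locale subgroup_pair = G: finite_group G for G :: "('g, 'm) monoid_scheme" (structure) +
 fixes H :: "'g set"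
 assumes H: "subgroup H G"
begin

abbreviation K where "K \<equiv> G\<lparr>carrier := H\<rparr>"
abbreviation WP where "WP k l \<equiv> wreath k K \<times>\<times> wreath l G"

lemma H_sub: "x \<in> H ==> x \<in> carrier G"
 using subgroup.mem_carrier[OF H] .

lemma H_closed: "x \<in> H ==> y \<in> H ==> x \<otimes> y \<in> H" "x \<in> H ==> inv x \<in> H" "\<one> \<in> H"
 using subgroup.m_closed[OF H] subgroup.m_inv_closed[OF H] subgroup.one_closed[OF H] by auto

lemma finite_group_K: "finite_group K"
proof -
 interpret K: group K by (rule G.subgroup_imp_group[OF H])
 show ?thesis
  by unfold_locales (use finite_subset[OF subgroup.subset[OF H] G.finite_carrier] in simp)
qed

lemma wreath_K_sub: "g \<in> carrier (wreath n K) ==> g \<in> carrier (wreath n G)"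
proof (cases g)
 fix p f assume g: "g \<in> carrier (wreath n K)" "g = (p, f)"
 then have "p permutes {1..n}" "f \<in> (\<Pi>\<^sub>E i\<in>{1..n}. H)" by (simp_all add: carrier_wreath)
 moreover from this(2) have "f \<in> (\<Pi>\<^sub>E i\<in>{1..n}. carrier G)"
  by (rule subsetD[OF PiE_mono, rotated]) (rule subgroup.subset[OF H])
 ultimately show ?thesis by (simp add: g carrier_wreath)
qed

lemma mult_wreath_K: "g \<otimes>\<^bsub>wreath n K\<^esub> h = g \<otimes>\<^bsub>wreath n G\<^esub> h"
 by (cases g, cases h) (simp add: mult_wreath)

lemma presents_K_imp: "presents K n b r d g ==> presents G n b r d g"
 by (simp add: presents_def wreath_K_sub)

lemma inclusion_emb: "inclusion (wreath (k + l) G) (WP k l) (wreath_emb k l)"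
proof -
 interpret W: finite_group "wreath (k + l) G" by (rule finite_group_wreath[OF G.finite_group_axioms])
 interpret D: finite_group "WP k l"
  by (intro finite_group_DirProd finite_group_wreath G.finite_group_axioms finite_group_K)
 show ?thesis
 proof unfold_locales
  show "wreath_emb k l \<in> hom (WP k l) (wreath (k + l) G)"
  proof (rule homI)
   fix g assume "g \<in> carrier (WP k l)"
   then show "wreath_emb k l g \<in> carrier (wreath (k + l) G)"
    by (cases g) (simp add: wreath_emb_closed wreath_K_sub)
  next
   fix g h assume "g \<in> carrier (WP k l)" "h \<in> carrier (WP k l)"
   then show "wreath_emb k l (g \<otimes>\<^bsub>WP k l\<^esub> h) = wreath_emb k l g \<otimes>\<^bsub>wreath (k + l) G\<^esub> wreath_emb k l h"
    by (cases g, cases h) (simp add: mult_wreath_K wreath_emb_mult wreath_K_sub)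
  qed
  show "inj_on (wreath_emb k l) (carrier (WP k l))"
   by (rule inj_on_subset[OF wreath_emb_inj[of k l G]]) (auto simp: wreath_K_sub)
 qed
qed

text \<open>Both halves come from \<open>presents_exists\<close>; uniqueness of presentations then
  identifies their block sum with \<open>u\<close>.\<close>

lemma emb_split:
 assumes u: "presents G (k + l) b r d u" and S: "r ` b ` {1..k} = b ` {1..k}" and d: "!!j. j \<in> b ` {1..k} ==> d j \<in> H"
 shows "\<exists>u1 u2. u = wreath_emb k l (u1, u2) & presents K k b r d u1 & presents G l (%i. b (i + k)) r d u2"
proof -
 have b: "inj_on b {1..k + l}" using u by (simp add: presents_def)
 note bij = presents_bij[OF u]
 have im: "(%i. b (i + k)) ` {1..l} = b ` {1..k + l} - b ` {1..k}"
 proof -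
  have "(%i. b (i + k)) ` {1..l} = b ` (%i. i + k) ` {1..l}" by (rule image_image[symmetric])
  also have "(%i. i + k) ` {1..l} = {1..k + l} - {1..k}" by (auto simp: image_iff intro: bexI[of _ "_ - k"])
  also have "b ` ({1..k + l} - {1..k}) = b ` {1..k + l} - b ` {1..k}"
   by (rule inj_on_image_set_diff[OF b]) auto
  finally show ?thesis .
 qed
 have injr: "inj_on r (b ` {1..k + l})" using bij(1) by (rule bij_betw_imp_inj_on)
 have 1: "bij_betw r (b ` {1..k}) (b ` {1..k})"
  using S inj_on_subset[OF injr, of "b ` {1..k}"] by (simp add: bij_betw_def image_mono)
 have "r ` (b ` {1..k + l} - b ` {1..k}) = b ` {1..k + l} - b ` {1..k}"
  using inj_on_image_set_diff[OF injr, of "b ` {1..k + l}" "b ` {1..k}"] S bij(1)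
  by (simp add: bij_betw_def image_mono)
 then have 2: "bij_betw r ((%i. b (i + k)) ` {1..l}) ((%i. b (i + k)) ` {1..l})"
  unfolding im using inj_on_subset[OF injr, of "b ` {1..k + l} - b ` {1..k}"] by (simp add: bij_betw_def)
 have "\<exists>g. presents K k b r d g"
  by (rule presents_exists[OF inj_on_subset[OF b] 1]) (use d in auto)
 then obtain u1 where u1: "presents K k b r d u1" by (elim exE)
 have "\<exists>g. presents G l (%i. b (i + k)) r d g"
 proof (rule presents_exists[OF _ 2])
  show "inj_on (%i. b (i + k)) {1..l}"
   using comp_inj_on[of "%i. i + k" "{1..l}" b] inj_on_subset[OF b, of "(%i. i + k) ` {1..l}"] by (auto simp: o_def)
  show "d j \<in> carrier G" if "j \<in> (%i. b (i + k)) ` {1..l}" for j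
   using that bij(2) unfolding im by simp
 qed
 then obtain u2 where u2: "presents G l (%i. b (i + k)) r d u2" by (elim exE)
 have "presents G (k + l) (%i. if i \<le> k then b i else b (i - k + k)) r d (wreath_emb k l (u1, u2))"
  by (rule wreath_emb_presents[OF presents_K_imp[OF u1] u2]) (auto simp: im)
 moreover have "(%i. if i \<le> k then b i else b (i - k + k)) = b" by (simp add: fun_eq_iff)
 ultimately have "u = wreath_emb k l (u1, u2)" using presents_unique[OF u] by simp
 then show ?thesis using u1 u2 by blast
qed

lemma emb_stable:
 assumes u: "presents G (k + l) b r d (wreath_emb k l (u1, u2))" and u1: "u1 \<in> carrier (wreath k K)" and u2: "u2 \<in> carrier (wreath l G)"
 shows "r ` b ` {1..k} = b ` {1..k}" "j \<in> b ` {1..k} ==> d j \<in> H"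
proof -
 obtain p f where g1: "u1 = (p, f)" by (cases u1)
 obtain q h where g2: "u2 = (q, h)" by (cases u2)
 have p: "p permutes {1..k}" and f: "f \<in> (\<Pi>\<^sub>E i\<in>{1..k}. H)" using u1 by (simp_all add: g1 carrier_wreath)
 have e: "r (b i) = b (p i)" "d (b i) = f (p i)" "p i \<in> {1..k}" if i: "i \<in> {1..k}" for i
 proof -
  have i': "i \<in> {1..k + l}" "i \<le> k" using i by auto
  show pi: "p i \<in> {1..k}" using permutes_in_image[OF p] i by blast
  then have pi': "p i \<in> {1..k + l}" "p i \<le> k" by auto
  have "r (b i) = b (fst (wreath_emb k l (u1, u2)) i) & d (b i) = snd (wreath_emb k l (u1, u2)) (fst (wreath_emb k l (u1, u2)) i)"
   using u i'(1) unfolding presents_def by blast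
  then show "r (b i) = b (p i)" "d (b i) = f (p i)"
   using i' pi' by (simp_all add: g1 g2 wreath_emb_simps)
 qed
 have "r ` b ` {1..k} = (%i. b (p i)) ` {1..k}" unfolding image_image by (rule image_cong[OF refl e(1)])
 also have "... = b ` p ` {1..k}" by (simp add: image_image)
 finally show "r ` b ` {1..k} = b ` {1..k}" by (simp add: permutes_image[OF p])
 assume "j \<in> b ` {1..k}"
 then obtain i where i: "i \<in> {1..k}" "j = b i" by blast
 then show "d j \<in> H" using e(2,3)[OF i(1)] PiE_mem[OF f] by simp
qed

text \<open>Decides which terms of the Frobenius formula survive.\<close>

lemma emb_image_iff:
 assumes u: "presents G (k + l) b r d u"
 shows "u \<in> wreath_emb k l ` carrier (WP k l) \<longleftrightarrow>
  r ` b ` {1..k} = b ` {1..k} & (\<forall>j\<in>b ` {1..k}. d j \<in> H)"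
proof
 assume "u \<in> wreath_emb k l ` carrier (WP k l)"
 then obtain u1 u2 where "u = wreath_emb k l (u1, u2)" "u1 \<in> carrier (wreath k K)" "u2 \<in> carrier (wreath l G)" by auto
 then show "r ` b ` {1..k} = b ` {1..k} & (\<forall>j\<in>b ` {1..k}. d j \<in> H)"
  using emb_stable[of k l b r d u1 u2] u by simp
next
 assume "r ` b ` {1..k} = b ` {1..k} & (\<forall>j\<in>b ` {1..k}. d j \<in> H)"
 then obtain u1 u2 where "u = wreath_emb k l (u1, u2)" "presents K k b r d u1" "presents G l (%i. b (i + k)) r d u2"
  using emb_split[OF u] by blast
 then show "u \<in> wreath_emb k l ` carrier (WP k l)" by (auto simp: presents_def)
qed

lemma emb_image_raw:
 assumes u: "(q, h) \<in> carrier (wreath (k + l) G)"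
 shows "(q, h) \<in> wreath_emb k l ` carrier (WP k l) \<longleftrightarrow> q ` {1..k} = {1..k} & (\<forall>i\<in>{1..k}. h i \<in> H)"
proof -
 have "(\<forall>j\<in>{1..k}. h (q j) \<in> H) \<longleftrightarrow> (\<forall>j\<in>q ` {1..k}. h j \<in> H)" by simp
 moreover have "(q, h) \<in> wreath_emb k l ` carrier (WP k l) \<longleftrightarrow> q ` {1..k} = {1..k} & (\<forall>j\<in>{1..k}. h (q j) \<in> H)"
  using emb_image_iff[OF presents_self[OF u]] by (simp only: image_ident)
 ultimately show ?thesis by (cases "q ` {1..k} = {1..k}") (simp_all only: simp_thms)
qed

abbreviation L where "L \<equiv> set (left_transversal G H)"

text \<open>Cosets of \<open>H\<close> are handled as elements of the transversal \<open>L\<close>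
  from here on; this is the projection to them.\<close>

definition rp :: "'g => 'g" where
 "rp x = (THE t. t \<in> L & inv t \<otimes> x \<in> H)"

lemmas L_trans = left_transversal[OF G.finite_group_axioms H]

lemma L_sub: "t \<in> L ==> t \<in> carrier G"
 using L_trans(2) by blast

lemma rp: assumes "x \<in> carrier G" shows "rp x \<in> L" "inv (rp x) \<otimes> x \<in> H"
 using theI'[OF L_trans(3)[OF assms]] unfolding rp_def by auto

lemma rp_unique: "x \<in> carrier G ==> t \<in> L ==> inv t \<otimes> x \<in> H ==> rp x = t"
 unfolding rp_def by (rule the1_equality[OF L_trans(3)]) auto

lemma rp_L: "t \<in> L ==> rp t = t"
 using L_sub H_closed(3) by (intro rp_unique) auto

lemma rp_eq_iff:
 assumes "x \<in> carrier G" "y \<in> carrier G"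
 shows "rp x = rp y \<longleftrightarrow> inv x \<otimes> y \<in> H"
proof
 assume e: "rp x = rp y"
 have c: "rp x \<in> carrier G" using rp(1)[OF assms(1)] L_sub by blast
 have "inv (inv (rp x) \<otimes> x) \<otimes> (inv (rp x) \<otimes> y) \<in> H"
  using H_closed(1)[OF H_closed(2)[OF rp(2)[OF assms(1)]] rp(2)[OF assms(2), folded e]] .
 also have "inv (inv (rp x) \<otimes> x) \<otimes> (inv (rp x) \<otimes> y) = inv x \<otimes> y"
  using assms c by (simp add: G.inv_mult_group G.m_assoc G.inv_mult_cancel)
 finally show "inv x \<otimes> y \<in> H" .
next
 assume h: "inv x \<otimes> y \<in> H"
 have c: "rp x \<in> carrier G" using rp(1)[OF assms(1)] L_sub by blast
 have "(inv (rp x) \<otimes> x) \<otimes> (inv x \<otimes> y) \<in> H" using rp(2)[OF assms(1)] h by (rule H_closed)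
 also have "(inv (rp x) \<otimes> x) \<otimes> (inv x \<otimes> y) = inv (rp x) \<otimes> y"
  using assms c by (simp add: G.m_assoc G.inv_mult_cancel)
 finally have "rp y = rp x" by (rule rp_unique[OF assms(2) rp(1)[OF assms(1)]])
 then show "rp x = rp y" by simp
qed

end

lemma restrict_eq_iff: "(\<lambda>j\<in>A. f j) = (\<lambda>j\<in>A. g j) \<longleftrightarrow> (\<forall>j\<in>A. f j = g j)"
proof
 assume e: "(\<lambda>j\<in>A. f j) = (\<lambda>j\<in>A. g j)"
 show "\<forall>j\<in>A. f j = g j"
 proof
  fix j assume "j \<in> A"
  then show "f j = g j" using fun_cong[OF e, of j] by simp
 qed
qed (auto intro: restrict_ext)

lemma exists_permutes_onto:
 assumes A: "A \<subseteq> {1..k + l}" and c: "card A = k"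
 shows "\<exists>p. p permutes {1..k + l} & p ` {1..k} = A"
proof -
 have fA: "finite A" using A finite_subset by blast
 obtain f where f: "bij_betw f {1..k} A" using ex_bij_betw_nat_finite_1[OF fA] c by blast
 have "card ({1..k + l} - A) = card ({1..k + l} - {1..k})"
  using A c by (simp add: card_Diff_subset fA)
 then obtain g where g: "bij_betw g ({1..k + l} - {1..k}) ({1..k + l} - A)"
  using finite_same_card_bij[of "{1..k + l} - {1..k}" "{1..k + l} - A"] by auto
 define p where "p i = (if i \<in> {1..k} then f i else if i \<in> {1..k + l} then g i else i)" for i
 have 1: "bij_betw p {1..k} A"
  using f by (rule bij_betw_cong[THEN iffD1, rotated]) (simp add: p_def)
 have 2: "bij_betw p ({1..k + l} - {1..k}) ({1..k + l} - A)"
  using g by (rule bij_betw_cong[THEN iffD1, rotated]) (simp add: p_def)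
 have "bij_betw p ({1..k} \<union> ({1..k + l} - {1..k})) (A \<union> ({1..k + l} - A))"
  by (rule bij_betw_combine[OF 1 2]) auto
 moreover have "{1..k} \<union> ({1..k + l} - {1..k}) = {1..k + l}" "A \<union> ({1..k + l} - A) = {1..k + l}" using A by auto
 ultimately have "bij_betw p {1..k + l} {1..k + l}" by simp
 then have "p permutes {1..k + l}"
  by (rule bij_imp_permutes) (auto simp: p_def)
 then show ?thesis using 1 by (auto simp: bij_betw_def)
qed

section \<open>Cosets in wreath products and the Frobenius formula at points\<close>

context subgroup_pair begin

text \<open>Conjugating the product subgroup by \<open>s\<close> moves its first block to this
  subset of \<open>V\<close>.\<close>

definition coset_set :: "(nat => nat) => nat => 'g wreath => nat set" where
 "coset_set b k s = b ` fst s ` {1..k}"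

definition coset_lab :: "nat => (nat => nat) => nat => 'g wreath => nat => 'g" where
 "coset_lab n b k s = (\<lambda>j\<in>coset_set b k s. rp (snd s (inv_into {1..n} b j)))"

text \<open>
 The cosets of \<open>S\<^sub>k[H] \<times> S\<^sub>l[G]\<close> in \<open>S\<^sub>k\<^sub>+\<^sub>l[G]\<close> correspond to the \<open>k\<close>-element subsets together with a
 labelling by cosets of \<open>H\<close>.
\<close>

lemma coset_invariants_eq_iff:
 assumes b: "inj_on b {1..k + l}" and s: "s \<in> carrier (wreath (k + l) G)" and t: "t \<in> carrier (wreath (k + l) G)"
 shows "coset_set b k s = coset_set b k t & coset_lab (k + l) b k s = coset_lab (k + l) b k t \<longleftrightarrow>
  inv\<^bsub>wreath (k + l) G\<^esub> t \<otimes>\<^bsub>wreath (k + l) G\<^esub> s \<in> wreath_emb k l ` carrier (WP k l)"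
proof -
 interpret W: finite_group "wreath (k + l) G" by (rule finite_group_wreath[OF G.finite_group_axioms])
 \<comment> \<open>Writing \<open>s\<close> as \<open>t\<close> times \<open>u\<close> expresses the
   invariants of \<open>s\<close> through those of \<open>t\<close>, and their equality becomes the
   membership criterion \<open>emb_image_raw\<close> for \<open>u\<close>.\<close>
 define u where "u = inv\<^bsub>wreath (k + l) G\<^esub> t \<otimes>\<^bsub>wreath (k + l) G\<^esub> s"
 have uW: "u \<in> carrier (wreath (k + l) G)" using s t by (simp add: u_def)
 have stu: "s = t \<otimes>\<^bsub>wreath (k + l) G\<^esub> u" using s t by (simp add: u_def W.inv_mult_cancel)
 obtain p F where tp: "t = (p, F)" by (cases t)
 obtain q h where uq: "u = (q, h)" by (cases u)
 have p: "p permutes {1..k + l}" and F: "F \<in> (\<Pi>\<^sub>E i\<in>{1..k + l}. carrier G)" using t by (simp_all add: tp carrier_wreath)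
 have q: "q permutes {1..k + l}" and h: "h \<in> (\<Pi>\<^sub>E i\<in>{1..k + l}. carrier G)" using uW by (simp_all add: uq carrier_wreath)
 have s1: "fst s = p \<circ> q" by (simp add: stu tp uq mult_wreath)
 have s2: "snd s (p m) = F (p m) \<otimes> h m" if "m \<in> {1..k + l}" for m
 proof -
  have "p m \<in> {1..k + l}" using permutes_in_image[OF p] that by blast
  then show ?thesis by (simp add: stu tp uq mult_wreath permutes_inverses[OF p] del: atLeastAtMost_iff)
 qed
 have k: "{1..k} \<subseteq> {1..k + l}" by auto
 have pc: "p m \<in> {1..k + l}" if "m \<in> {1..k}" for m using permutes_in_image[OF p] that k by blast
 have bi: "inv_into {1..k + l} b (b i) = i" if "i \<in> {1..k + l}" for i by (rule inv_into_f_f[OF b that])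
 have St: "coset_set b k t = b ` p ` {1..k}" by (simp add: coset_set_def tp)
 have Ss: "coset_set b k s = b ` p ` q ` {1..k}" by (simp add: coset_set_def s1 image_comp o_assoc)
 have iU: "u \<in> wreath_emb k l ` carrier (WP k l) \<longleftrightarrow> q ` {1..k} = {1..k} & (\<forall>i\<in>{1..k}. h i \<in> H)"
  using emb_image_raw[of q h k l] uW by (simp only: uq)
 have Seq: "coset_set b k s = coset_set b k t \<longleftrightarrow> q ` {1..k} = {1..k}"
 proof -
  have "inj_on (b \<circ> p) {1..k + l}"
   by (rule comp_inj_on) (use permutes_inj_on[OF p] b permutes_image[OF p] in simp_all)
  moreover have "q ` {1..k} \<subseteq> {1..k + l}" using permutes_in_image[OF q] k by blast
  ultimately have "(b \<circ> p) ` q ` {1..k} = (b \<circ> p) ` {1..k} \<longleftrightarrow> q ` {1..k} = {1..k}"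
   using k by (intro inj_on_image_eq_iff)
  then show ?thesis unfolding Ss St by (simp only: image_comp o_assoc)
 qed
 have Leq: "coset_lab (k + l) b k s = coset_lab (k + l) b k t \<longleftrightarrow> (\<forall>i\<in>{1..k}. h i \<in> H)"
  if e: "coset_set b k s = coset_set b k t"
 proof -
  have "coset_lab (k + l) b k s = coset_lab (k + l) b k t \<longleftrightarrow>
    (\<forall>j\<in>b ` p ` {1..k}. rp (snd s (inv_into {1..k + l} b j)) = rp (snd t (inv_into {1..k + l} b j)))"
   unfolding coset_lab_def e St by (rule restrict_eq_iff)
  also have "... \<longleftrightarrow> (\<forall>m\<in>{1..k}. rp (F (p m) \<otimes> h m) = rp (F (p m)))"
   unfolding ball_simps(9)
  proof (rule ball_cong[OF refl])
   fix m assume m: "m \<in> {1..k}"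
   then have m': "m \<in> {1..k + l}" using k by blast
   have 1: "snd s (inv_into {1..k + l} b (b (p m))) = F (p m) \<otimes> h m" by (simp only: bi[OF pc[OF m]] s2[OF m'])
   have 2: "snd t (inv_into {1..k + l} b (b (p m))) = F (p m)" by (simp only: bi[OF pc[OF m]] tp snd_conv)
   show "(rp (snd s (inv_into {1..k + l} b (b (p m)))) = rp (snd t (inv_into {1..k + l} b (b (p m)))))
    = (rp (F (p m) \<otimes> h m) = rp (F (p m)))" unfolding 1 2 by (rule refl)
  qed
  also have "... \<longleftrightarrow> (\<forall>i\<in>{1..k}. h i \<in> H)"
  proof (rule ball_cong[OF refl])
   fix m assume m: "m \<in> {1..k}"
   have c: "F (p m) \<in> carrier G" "h m \<in> carrier G" using PiE_mem[OF F pc[OF m]] PiE_mem[OF h, of m] m k by auto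
   have "rp (F (p m) \<otimes> h m) = rp (F (p m)) \<longleftrightarrow> rp (F (p m)) = rp (F (p m) \<otimes> h m)" by auto
   then show "(rp (F (p m) \<otimes> h m) = rp (F (p m))) = (h m \<in> H)"
    using rp_eq_iff[of "F (p m)" "F (p m) \<otimes> h m"] c by (simp add: G.inv_mult_cancel)
  qed
  finally show ?thesis .
 qed
 show ?thesis unfolding u_def[symmetric] iU using Seq Leq by blast
qed

definition coset_index :: "nat set => nat => (nat set \<times> (nat => 'g)) set" where
 "coset_index V k = (SIGMA S:{S. S \<subseteq> V & card S = k}. S \<rightarrow>\<^sub>E L)"

lemma coset_invariants_mem:
 assumes b: "inj_on b {1..k + l}" and s: "s \<in> carrier (wreath (k + l) G)"
 shows "(coset_set b k s, coset_lab (k + l) b k s) \<in> coset_index (b ` {1..k + l}) k"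
proof -
 obtain p F where tp: "s = (p, F)" by (cases s)
 have p: "p permutes {1..k + l}" and F: "F \<in> (\<Pi>\<^sub>E i\<in>{1..k + l}. carrier G)" using s by (simp_all add: tp carrier_wreath)
 have pk: "p ` {1..k} \<subseteq> {1..k + l}" using permutes_image[OF p] image_mono[of "{1..k}" "{1..k + l}" p] by simp
 have 1: "coset_set b k s \<subseteq> b ` {1..k + l}" using pk by (simp add: coset_set_def tp image_mono)
 have 2: "card (coset_set b k s) = k"
  using card_image[OF inj_on_subset[OF b pk]] card_image[OF permutes_inj_on[OF p], of "{1..k}"]
  by (simp add: coset_set_def tp)
 have 3: "coset_lab (k + l) b k s \<in> coset_set b k s \<rightarrow>\<^sub>E L"
 proof (unfold coset_lab_def, rule restrict_PiE_iff[THEN iffD2], rule ballI)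
  fix j assume "j \<in> coset_set b k s"
  then have "j \<in> b ` {1..k + l}" using 1 by blast
  then have "inv_into {1..k + l} b j \<in> {1..k + l}" by (rule inv_into_into)
  then show "rp (snd s (inv_into {1..k + l} b j)) \<in> L" using PiE_mem[OF F] by (intro rp(1)) (simp add: tp)
 qed
 show ?thesis using 1 2 3 by (simp add: coset_index_def)
qed

lemma coset_invariants_onto:
 assumes b: "inj_on b {1..k + l}" and i: "(S, \<tau>) \<in> coset_index (b ` {1..k + l}) k"
 shows "\<exists>s\<in>carrier (wreath (k + l) G). coset_set b k s = S & coset_lab (k + l) b k s = \<tau>"
proof -
 have S: "S \<subseteq> b ` {1..k + l}" "card S = k" and \<tau>: "\<tau> \<in> S \<rightarrow>\<^sub>E L" using i by (auto simp: coset_index_def)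
 define A where "A = {m\<in>{1..k + l}. b m \<in> S}"
 have bA: "b ` A = S" using S(1) by (auto simp: A_def)
 have A: "A \<subseteq> {1..k + l}" by (auto simp: A_def)
 have "card A = k" using card_image[OF inj_on_subset[OF b A]] bA S(2) by simp
 then obtain p where p: "p permutes {1..k + l}" "p ` {1..k} = A" using exists_permutes_onto[OF A] by blast
 \<comment> \<open>Labels off \<open>S\<close> do not affect the invariants, so they are set to the
   identity.\<close>
 define F where "F = (\<lambda>m\<in>{1..k + l}. if b m \<in> S then \<tau> (b m) else \<one>)"
 have "F \<in> (\<Pi>\<^sub>E i\<in>{1..k + l}. carrier G)"
  unfolding F_def
 proof (rule restrict_PiE_iff[THEN iffD2], rule ballI)
  fix m
  show "(if b m \<in> S then \<tau> (b m) else \<one>) \<in> carrier G" using L_sub[OF PiE_mem[OF \<tau>, of "b m"]] by simp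
 qed
 then have s: "(p, F) \<in> carrier (wreath (k + l) G)" using p by (simp add: carrier_wreath)
 have cs: "coset_set b k (p, F) = S" by (simp add: coset_set_def p bA)
 moreover have "coset_lab (k + l) b k (p, F) = \<tau>"
 proof (rule PiE_ext[OF _ \<tau>])
  show "coset_lab (k + l) b k (p, F) \<in> S \<rightarrow>\<^sub>E L"
   using coset_invariants_mem[OF b s] by (simp add: coset_index_def cs)
  fix j assume j: "j \<in> S"
  then have "j \<in> b ` {1..k + l}" using S by blast
  then have "inv_into {1..k + l} b j \<in> {1..k + l}" "b (inv_into {1..k + l} b j) = j"
   by (rule inv_into_into, rule f_inv_into_f)
  moreover from this have "F (inv_into {1..k + l} b j) = \<tau> j" using j by (simp add: F_def del: atLeastAtMost_iff)
  moreover have "coset_lab (k + l) b k (p, F) j = rp (F (inv_into {1..k + l} b j))"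
   using j by (simp add: coset_lab_def cs)
  ultimately show "coset_lab (k + l) b k (p, F) j = \<tau> j" using rp_L[OF PiE_mem[OF \<tau> j]] by simp
 qed
 ultimately show ?thesis using s by (intro bexI[of _ "(p, F)"] conjI)
qed

lemma coset_invariants_bij:
 assumes b: "inj_on b {1..k + l}"
 shows "bij_betw (%t. (coset_set b k t, coset_lab (k + l) b k t))
  (set (left_transversal (wreath (k + l) G) (wreath_emb k l ` carrier (WP k l))))
  (coset_index (b ` {1..k + l}) k)"
proof -
 interpret I: inclusion "wreath (k + l) G" "WP k l" "wreath_emb k l" by (rule inclusion_emb)
 show ?thesis
  unfolding bij_betw_def
 proof
  show "inj_on (%t. (coset_set b k t, coset_lab (k + l) b k t)) I.T"
  proof (rule inj_onI)
   fix s t assume st: "s \<in> I.T" "t \<in> I.T"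
    "(coset_set b k s, coset_lab (k + l) b k s) = (coset_set b k t, coset_lab (k + l) b k t)"
   have "inv\<^bsub>wreath (k + l) G\<^esub> t \<otimes>\<^bsub>wreath (k + l) G\<^esub> s \<in> I.U"
    using coset_invariants_eq_iff[OF b I.T_closed[OF st(1)] I.T_closed[OF st(2)]] st(3) by simp
   then show "s = t" using I.T_unique[OF st(2,1)] by simp
  qed
  show "(%t. (coset_set b k t, coset_lab (k + l) b k t)) ` I.T = coset_index (b ` {1..k + l}) k"
  proof (intro equalityI subsetI)
   fix x assume "x \<in> coset_index (b ` {1..k + l}) k"
   moreover obtain S \<tau> where x: "x = (S, \<tau>)" by (cases x)
   ultimately obtain s where s: "s \<in> carrier (wreath (k + l) G)" "coset_set b k s = S" "coset_lab (k + l) b k s = \<tau>"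
    using coset_invariants_onto[OF b] by blast
   obtain t where t: "t \<in> I.T" "inv\<^bsub>wreath (k + l) G\<^esub> t \<otimes>\<^bsub>wreath (k + l) G\<^esub> s \<in> I.U"
    using I.trans(3)[OF s(1)] by (elim ex1E conjE)
   then have "(coset_set b k t, coset_lab (k + l) b k t) = x"
    using coset_invariants_eq_iff[OF b s(1) I.T_closed[OF t(1)]] s x by simp
   then show "x \<in> (%t. (coset_set b k t, coset_lab (k + l) b k t)) ` I.T" using t(1) by (rule image_eqI[OF sym])
  next
   fix x assume "x \<in> (%t. (coset_set b k t, coset_lab (k + l) b k t)) ` I.T"
   then obtain t where "t \<in> I.T" "x = (coset_set b k t, coset_lab (k + l) b k t)" by (elim imageE)
   then show "x \<in> coset_index (b ` {1..k + l}) k" using coset_invariants_mem[OF b I.T_closed] by simp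
  qed
 qed
qed

text \<open>The gauge transform of \<open>d\<close> by \<open>\<tau>\<close>: the labels that remain
  after conjugation by an element with labels \<open>\<tau>\<close>.\<close>

definition twist :: "(nat => nat) => (nat => 'g) => (nat => 'g) => nat => 'g" where
 "twist r d \<tau> j = inv (\<tau> (r j)) \<otimes> d j \<otimes> \<tau> j"

lemma twist_closed: "\<tau> (r j) \<in> carrier G ==> \<tau> j \<in> carrier G ==> d j \<in> carrier G ==> twist r d \<tau> j \<in> carrier G"
 by (simp add: twist_def)

lemma twist_gauge:
 "\<tau> (r j) \<in> carrier G ==> \<tau> j \<in> carrier G ==> d j \<in> carrier G ==> \<tau> (r j) \<otimes> twist r d \<tau> j = d j \<otimes> \<tau> j"
 by (simp add: twist_def G.m_assoc G.inv_mult_cancel)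

text \<open>The condition says that \<open>d j\<close> carries the coset of \<open>\<tau> j\<close>
  to the coset of \<open>\<tau> (r j)\<close>. For stable \<open>S\<close> these are the coset
  labellings fixed by the action of \<open>(r, d)\<close>, as in the character of an induced
  representation.\<close>

definition labs :: "nat set => (nat => nat) => (nat => 'g) => (nat => 'g) set" where
 "labs S r d = {\<tau> \<in> S \<rightarrow>\<^sub>E L. \<forall>j\<in>S. twist r d \<tau> j \<in> H}"

text \<open>The value at \<open>(S, r, d)\<close> of the induction of \<open>x\<close> from the
  wreath product of \<open>H\<close> to that of \<open>G\<close> on the same set, the case in which
  the second factor has size 0.\<close>

definition ihat :: "'g repgrp => nat set => (nat => nat) => (nat => 'g) => complex" where
 "ihat x S r d = (\<Sum>\<tau>\<in>labs S r d. hat K x S r (twist r d \<tau>))"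

text \<open>The Frobenius formula, with the transversal reindexed by pairs of a subset
  \<open>S\<close> and a coset labelling \<open>\<tau>\<close>. A term contributes only if
  \<open>S\<close> is stable and the twisted labels on \<open>S\<close> lie in \<open>H\<close>. It
  then depends on the pair alone: on \<open>S\<close> the labels of the representative differ from
  \<open>\<tau>\<close> by a gauge transformation over \<open>H\<close>, and off \<open>S\<close>
  every gauge transformation over \<open>G\<close> is allowed.\<close>

lemma ind_fun_hat:
 assumes x: "x \<in> RG K" and y: "y \<in> RG G" and g: "presents G (k + l) b r d g" and V: "b ` {1..k + l} = V"
 shows "inclusion.ind_fun (wreath (k + l) G) (WP k l) (wreath_emb k l)
   (%(u, v). kch (wreath k K) (x k) u * kch (wreath l G) (y l) v) g
  = (\<Sum>S | S \<subseteq> V & card S = k & r ` S = S. ihat x S r d * hat G y (V - S) r d)"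
proof -
 interpret I: inclusion "wreath (k + l) G" "WP k l" "wreath_emb k l" by (rule inclusion_emb)
 let ?W = "wreath (k + l) G"
 let ?\<phi> = "%(u, v). kch (wreath k K) (x k) u * kch (wreath l G) (y l) v"
 have b: "inj_on b {1..k + l}" and gW: "g \<in> carrier ?W" using g by (simp_all add: presents_def)
 have pt: "point G V r d" using presents_point[OF g] V by simp
 have fV: "finite V" and rV: "bij_betw r V V" and dV: "!!j. j \<in> V ==> d j \<in> carrier G" using pt by (auto simp: point_def)
 have rm: "r j \<in> V" if "j \<in> V" for j using bij_betw_imp_surj_on[OF rV] that by blast
 \<comment> \<open>The contribution of a pair, written without reference to a representative of the
   coset.\<close>
 define Q where "Q S \<tau> = (if r ` S = S & (\<forall>j\<in>S. twist r d \<tau> j \<in> H) then hat K x S r (twist r d \<tau>) * hat G y (V - S) r d else 0)" for S \<tau>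
 have trm: "(if inv\<^bsub>?W\<^esub> t \<otimes>\<^bsub>?W\<^esub> g \<otimes>\<^bsub>?W\<^esub> t \<in> I.U then ?\<phi> (I.pre (inv\<^bsub>?W\<^esub> t \<otimes>\<^bsub>?W\<^esub> g \<otimes>\<^bsub>?W\<^esub> t)) else 0)
   = Q (coset_set b k t) (coset_lab (k + l) b k t)" if "t \<in> I.T" for t
 proof -
  have t: "t \<in> carrier ?W" using I.T_closed[OF that] .
  obtain p F where tp: "t = (p, F)" by (cases t)
  have p: "p permutes {1..k + l}" and F: "F \<in> (\<Pi>\<^sub>E i\<in>{1..k + l}. carrier G)" using t by (simp_all add: tp carrier_wreath)
  \<comment> \<open>The labels of \<open>t\<close>, transported from indices to elements of
    \<open>V\<close>.\<close>
  define f where "f j = F (inv_into {1..k + l} b j)" for j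
  have fb: "f (b i) = F i" if "i \<in> {1..k + l}" for i unfolding f_def by (simp only: inv_into_f_f[OF b that])
  have fc: "f j \<in> carrier G" if "j \<in> V" for j
  proof -
   have "inv_into {1..k + l} b j \<in> {1..k + l}" by (rule inv_into_into) (use that V in simp)
   then show ?thesis using PiE_mem[OF F] by (simp add: f_def)
  qed
  have imV: "(b \<circ> p) ` {1..k + l} = V" using V by (simp only: image_comp[symmetric] permutes_image[OF p])
  have bp: "inj_on (b \<circ> p) {1..k + l}"
   by (rule comp_inj_on) (use permutes_inj_on[OF p] b permutes_image[OF p] in simp_all)
  let ?d = "twist r d f"
  have dc: "?d j \<in> carrier G" if "j \<in> V" for j using that rm fc dV by (intro twist_closed) auto
  have "\<exists>g'. presents G (k + l) (b \<circ> p) r ?d g'"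
   by (rule presents_exists[OF bp]; unfold imV) (rule rV, erule dc)
  then obtain g' where g': "presents G (k + l) (b \<circ> p) r ?d g'" by (elim exE)
  \<comment> \<open>Conjugation by \<open>t\<close> keeps \<open>r\<close>, changes the numbering to
    \<open>b \<circ> p\<close> and gauges the labels by \<open>f\<close>.\<close>
  have "g \<otimes>\<^bsub>?W\<^esub> t = t \<otimes>\<^bsub>?W\<^esub> g'"
  proof (rule presents_conj[OF G.group_axioms g g' t, where f = f])
   show "f (r j) \<otimes> ?d j = d j \<otimes> f j" if "j \<in> b ` {1..k + l}" for j
    using that fc dV rm V by (intro twist_gauge) auto
  qed (simp_all add: tp fb del: atLeastAtMost_iff)
  moreover have g'W: "g' \<in> carrier ?W" using g' by (simp add: presents_def)
  ultimately have conj: "inv\<^bsub>?W\<^esub> t \<otimes>\<^bsub>?W\<^esub> g \<otimes>\<^bsub>?W\<^esub> t = g'" using t gW by (simp add: I.X.m_assoc I.X.inv_mult_cancel)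
  define S where "S = coset_set b k t"
  define \<tau> where "\<tau> = coset_lab (k + l) b k t"
  have Sbp: "(b \<circ> p) ` {1..k} = S" by (simp add: S_def coset_set_def tp image_comp)
  have SV: "S \<subseteq> V" unfolding Sbp[symmetric] imV[symmetric] by (rule image_mono) auto
  have \<tau>f: "\<tau> j = rp (f j)" if "j \<in> S" for j using that by (simp add: \<tau>_def coset_lab_def S_def f_def tp)
  \<comment> \<open>What is left of the label of \<open>t\<close> in \<open>H\<close> after the
    coset representative \<open>\<tau> j\<close> has been split off.\<close>
  define \<kappa> where "\<kappa> j = inv (\<tau> j) \<otimes> f j" for j
  have \<tau>c: "\<tau> j \<in> carrier G" if "j \<in> S" for j using L_sub[OF rp(1)[OF fc]] that SV by (auto simp: \<tau>f)
  have \<kappa>H: "\<kappa> j \<in> H" if "j \<in> S" for j using rp(2)[OF fc] that SV by (auto simp: \<kappa>_def \<tau>f)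
  have \<kappa>c: "\<kappa> j \<in> carrier G" if "j \<in> S" for j using H_sub[OF \<kappa>H[OF that]] .
  have \<kappa>: "?d j = inv (\<kappa> (r j)) \<otimes> twist r d \<tau> j \<otimes> \<kappa> j" "twist r d \<tau> j = \<kappa> (r j) \<otimes> ?d j \<otimes> inv (\<kappa> j)"
   if "j \<in> S" "r j \<in> S" for j
  proof -
   have "j \<in> V" "r j \<in> V" using that SV by auto
   note c = \<tau>c[OF that(1)] \<tau>c[OF that(2)] fc[OF this(1)] fc[OF this(2)] dV[OF this(1)]
   show "?d j = inv (\<kappa> (r j)) \<otimes> twist r d \<tau> j \<otimes> \<kappa> j" "twist r d \<tau> j = \<kappa> (r j) \<otimes> ?d j \<otimes> inv (\<kappa> j)"
    using c by (simp_all add: twist_def \<kappa>_def G.m_assoc G.inv_mult_group G.inv_mult_cancel)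
  qed
  have Hiff: "(\<forall>j\<in>S. ?d j \<in> H) \<longleftrightarrow> (\<forall>j\<in>S. twist r d \<tau> j \<in> H)" if rS: "r ` S = S"
  proof (rule ball_cong[OF refl])
   fix j assume j: "j \<in> S"
   then have rj: "r j \<in> S" using rS by blast
   show "?d j \<in> H \<longleftrightarrow> twist r d \<tau> j \<in> H"
   proof
    assume "?d j \<in> H"
    then show "twist r d \<tau> j \<in> H" unfolding \<kappa>(2)[OF j rj]
     by (intro H_closed(1) H_closed(2)[OF \<kappa>H[OF j]] \<kappa>H[OF rj])
   next
    assume "twist r d \<tau> j \<in> H"
    then show "?d j \<in> H" unfolding \<kappa>(1)[OF j rj]
     by (intro H_closed(1) H_closed(2)[OF \<kappa>H[OF rj]] \<kappa>H[OF j])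
   qed
  qed
  have "g' \<in> I.U \<longleftrightarrow> r ` S = S & (\<forall>j\<in>S. ?d j \<in> H)"
   using emb_image_iff[OF g'] unfolding Sbp .
  then have cond: "g' \<in> I.U \<longleftrightarrow> r ` S = S & (\<forall>j\<in>S. twist r d \<tau> j \<in> H)"
   by (cases "r ` S = S") (simp_all only: Hiff simp_thms)
  show ?thesis
  proof (cases "g' \<in> I.U")
   case False
   then have "Q S \<tau> = 0" unfolding Q_def using cond by (intro if_not_P) blast
   then show ?thesis by (simp only: conj False S_def[symmetric] \<tau>_def[symmetric] if_False)
  next
   case True
   then have rS: "r ` S = S" and tH: "!!j. j \<in> S ==> twist r d \<tau> j \<in> H" using cond by auto
   have dH: "!!j. j \<in> S ==> ?d j \<in> H" using Hiff[OF rS] tH by blast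
   obtain u1 u2 where u: "g' = wreath_emb k l (u1, u2)" "presents K k (b \<circ> p) r ?d u1" "presents G l (%i. (b \<circ> p) (i + k)) r ?d u2"
    using emb_split[OF g'] rS dH unfolding Sbp by blast
   have im2: "(%i. (b \<circ> p) (i + k)) ` {1..l} = V - S"
   proof -
    have "(%i. (b \<circ> p) (i + k)) ` {1..l} = (b \<circ> p) ` (%i. i + k) ` {1..l}" by (rule image_image[symmetric])
    also have "(%i. i + k) ` {1..l} = {1..k + l} - {1..k}" by (auto simp: image_iff intro: bexI[of _ "_ - k"])
    also have "(b \<circ> p) ` ({1..k + l} - {1..k}) = (b \<circ> p) ` {1..k + l} - (b \<circ> p) ` {1..k}"
     by (rule inj_on_image_set_diff[OF bp]) auto
    finally show ?thesis by (simp only: imV Sbp)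
   qed
   have "(u1, u2) \<in> carrier (WP k l)" using u by (simp add: presents_def)
   then have pre: "I.pre g' = (u1, u2)" unfolding u(1) by (rule I.pre(3))
   have ptS: "point K S r ?d" using presents_point[OF u(2)] unfolding Sbp .
   have relabel: "point N W r e'" if "point N W r e" "!!j. j \<in> W ==> e' j \<in> carrier N" for N :: "('g, 'm) monoid_scheme" and W e e'
    using that unfolding point_def by blast
   have ptS': "point K S r (twist r d \<tau>)" by (rule relabel[OF ptS]) (simp add: tH)
   have ptV: "point G (V - S) r ?d" using presents_point[OF u(3)] unfolding im2 .
   have ptV': "point G (V - S) r d" by (rule relabel[OF ptV]) (rule dV, erule DiffD1)
   have "kch (wreath k K) (x k) u1 = hat K x S r ?d"
    by (rule hat_presents[OF finite_group_K x u(2) Sbp, symmetric])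
   also have "... = hat K x S r (twist r d \<tau>)"
   proof (rule hat_gauge[OF finite_group_K x ptS' ptS, where f = \<kappa>, symmetric])
    fix j assume j: "j \<in> S"
    then have rj: "r j \<in> S" using rS by blast
    show "\<kappa> (r j) \<otimes>\<^bsub>K\<^esub> ?d j = twist r d \<tau> j \<otimes>\<^bsub>K\<^esub> \<kappa> j"
     using \<kappa>c[OF j] \<kappa>c[OF rj] H_sub[OF tH[OF j]] by (simp add: \<kappa>(1)[OF j rj] G.m_assoc G.inv_mult_cancel)
    show "\<kappa> j \<in> carrier K" using \<kappa>H[OF j] by simp
   qed
   finally have 1: "kch (wreath k K) (x k) u1 = hat K x S r (twist r d \<tau>)" .
   have "kch (wreath l G) (y l) u2 = hat G y (V - S) r ?d"
    by (rule hat_presents[OF G.finite_group_axioms y u(3) im2, symmetric])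
   also have "... = hat G y (V - S) r d"
   proof (rule hat_gauge[OF G.finite_group_axioms y ptV' ptV, where f = f, symmetric])
    fix j assume j: "j \<in> V - S"
    then show "f j \<in> carrier G" using fc by blast
    show "f (r j) \<otimes> ?d j = d j \<otimes> f j" using j fc dV rm by (intro twist_gauge) auto
   qed
   finally have 2: "kch (wreath l G) (y l) u2 = hat G y (V - S) r d" .
   have "Q S \<tau> = hat K x S r (twist r d \<tau>) * hat G y (V - S) r d"
    unfolding Q_def using True cond by (intro if_P) blast
   then show ?thesis by (simp only: conj True pre 1 2 S_def[symmetric] \<tau>_def[symmetric] if_True prod.case)
  qed
 qed
 have "I.ind_fun ?\<phi> g = (\<Sum>t\<in>I.T. Q (coset_set b k t) (coset_lab (k + l) b k t))"
  unfolding I.ind_fun_def by (rule sum.cong[OF refl trm])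
 also have "... = (\<Sum>(S, \<tau>)\<in>coset_index V k. Q S \<tau>)"
  using sum.reindex_bij_betw[OF coset_invariants_bij[OF b], of "%(S, \<tau>). Q S \<tau>"] by (simp only: V prod.case)
 also have "... = (\<Sum>S | S \<subseteq> V & card S = k. \<Sum>\<tau>\<in>S \<rightarrow>\<^sub>E L. Q S \<tau>)"
  unfolding coset_index_def
 proof (rule sum.Sigma[symmetric])
  show "finite {S. S \<subseteq> V & card S = k}" using fV by simp
  show "\<forall>S\<in>{S. S \<subseteq> V & card S = k}. finite (S \<rightarrow>\<^sub>E L)"
   using finite_subset[OF _ fV] by (auto intro: finite_PiE)
 qed
 also have "... = (\<Sum>S | S \<subseteq> V & card S = k. if r ` S = S then ihat x S r d * hat G y (V - S) r d else 0)"
 proof (rule sum.cong[OF refl])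
  fix S assume "S \<in> {S. S \<subseteq> V & card S = k}"
  then have fS: "finite (S \<rightarrow>\<^sub>E L)" using finite_subset[OF _ fV] by (auto intro: finite_PiE)
  show "(\<Sum>\<tau>\<in>S \<rightarrow>\<^sub>E L. Q S \<tau>) = (if r ` S = S then ihat x S r d * hat G y (V - S) r d else 0)"
  proof (cases "r ` S = S")
   case True
   have "(\<Sum>\<tau>\<in>S \<rightarrow>\<^sub>E L. Q S \<tau>) = (\<Sum>\<tau>\<in>labs S r d. hat K x S r (twist r d \<tau>) * hat G y (V - S) r d)"
    unfolding labs_def by (rule sum.mono_neutral_cong_right[OF fS]) (use True in \<open>auto simp: Q_def\<close>)
   then show ?thesis using True by (simp add: ihat_def sum_distrib_right)
  qed (simp add: Q_def)
 qed
 also have "... = (\<Sum>S | S \<subseteq> V & card S = k & r ` S = S. ihat x S r d * hat G y (V - S) r d)"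
  by (rule sum.mono_neutral_cong_right) (use fV in auto)
 finally show ?thesis .
qed

end

section \<open>The T-group of all representations of wreath products\<close>

lemma (in finite_group) bform_sym: "bform G \<phi> \<psi> = bform G \<psi> \<phi>"
proof -
 have "(\<Sum>g\<in>carrier G. \<phi> g * \<psi> (inv g)) = (\<Sum>g\<in>carrier G. \<psi> g * \<phi> (inv g))"
  by (rule sum.reindex_bij_witness[of _ "%g. inv g" "%g. inv g"]) auto
 then show ?thesis by (simp add: bform_def)
qed

lemma (in finite_group) irr_K0_not_one: "C \<in> irr (K0 G) ==> C ~= \<one>\<^bsub>K0 G\<^esub>"
proof
 assume C: "C \<in> irr (K0 G)" "C = \<one>\<^bsub>K0 G\<^esub>"
 interpret K: comm_group "K0 G" by (rule comm_group_K0)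
 have "K0_dual G C C = 1" using dual_system_K0 C(1) by (simp add: dual_system_def)
 moreover have "K0_dual G C \<one>\<^bsub>K0 G\<^esub> = 0" by (rule K.add_fun_one[OF add_fun_K0_dual])
 ultimately show False using C(2) by simp
qed

lemma R_inj_same: "R_inj G n C n = C"
 by (simp add: R_inj_def)

lemma R_inj_other: "m ~= n ==> R_inj G n C m = \<one>\<^bsub>KW m G\<^esub>"
 by (simp add: R_inj_def)

text \<open>\<open>R_group G\<close> and its extension \<open>R_psh G\<close> share these fields but
  have different record types; the locale treats both at once.\<close>

locale rep_tgroup = finite_group G for G :: "('g, 'm) monoid_scheme" +
 fixes M :: "('g repgrp, 'z) graded_tgroup_scheme"
 assumes carrier_M: "carrier M = {x. (\<forall>n. x n \<in> carrier (KW n G)) & finite {n. x n ~= \<one>\<^bsub>KW n G\<^esub>}}"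
  and mult_M: "!!x y. x \<otimes>\<^bsub>M\<^esub> y = (%n. x n \<otimes>\<^bsub>KW n G\<^esub> y n)"
  and one_M: "\<one>\<^bsub>M\<^esub> = (%n. \<one>\<^bsub>KW n G\<^esub>)"
  and irr_M: "irr M = (\<Union>n. R_inj G n ` irr (KW n G))"
  and grade_M: "grade M = (%n. R_inj G n ` carrier (KW n G))"
begin

lemma finite_group_W: "finite_group (wreath n G)"
 by (rule finite_group_wreath) unfold_locales

lemma comm_group_W: "comm_group (KW n G)"
 by (rule finite_group.comm_group_K0[OF finite_group_W])

lemma M_comp: "x \<in> carrier M ==> x n \<in> carrier (KW n G)"
 by (simp add: carrier_M)

lemma M_RG: "x \<in> carrier M ==> x \<in> RG G"
 by (simp add: carrier_M RG_def)

lemma comm_group_M: "comm_group M"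
proof (rule comm_groupI)
 fix x y assume x: "x \<in> carrier M" and y: "y \<in> carrier M"
 interpret W: comm_group "KW n G" for n by (rule comm_group_W)
 have "{n. x n \<otimes>\<^bsub>KW n G\<^esub> y n ~= \<one>\<^bsub>KW n G\<^esub>}
   \<subseteq> {n. x n ~= \<one>\<^bsub>KW n G\<^esub>} \<union> {n. y n ~= \<one>\<^bsub>KW n G\<^esub>}" by auto
 moreover have "finite ({n. x n ~= \<one>\<^bsub>KW n G\<^esub>} \<union> {n. y n ~= \<one>\<^bsub>KW n G\<^esub>})"
  using x y by (simp add: carrier_M)
 ultimately have "finite {n. x n \<otimes>\<^bsub>KW n G\<^esub> y n ~= \<one>\<^bsub>KW n G\<^esub>}" by (rule finite_subset)
 then show "x \<otimes>\<^bsub>M\<^esub> y \<in> carrier M" using x y by (simp add: carrier_M mult_M)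
 show "x \<otimes>\<^bsub>M\<^esub> y = y \<otimes>\<^bsub>M\<^esub> x" using x y by (simp add: mult_M fun_eq_iff W.m_comm M_comp)
 fix z assume z: "z \<in> carrier M"
 show "x \<otimes>\<^bsub>M\<^esub> y \<otimes>\<^bsub>M\<^esub> z = x \<otimes>\<^bsub>M\<^esub> (y \<otimes>\<^bsub>M\<^esub> z)" using x y z by (simp add: mult_M fun_eq_iff W.m_assoc M_comp)
next
 interpret W: comm_group "KW n G" for n by (rule comm_group_W)
 show "\<one>\<^bsub>M\<^esub> \<in> carrier M" by (simp add: carrier_M one_M)
 fix x assume x: "x \<in> carrier M"
 show "\<one>\<^bsub>M\<^esub> \<otimes>\<^bsub>M\<^esub> x = x" using x by (simp add: mult_M one_M fun_eq_iff M_comp)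
 have "inv\<^bsub>KW n G\<^esub> x n = \<one>\<^bsub>KW n G\<^esub> \<longleftrightarrow> x n = \<one>\<^bsub>KW n G\<^esub>" for n
  using M_comp[OF x, of n] by simp
 then have "(%n. inv\<^bsub>KW n G\<^esub> x n) \<in> carrier M" using x by (simp add: carrier_M)
 moreover have "(%n. inv\<^bsub>KW n G\<^esub> x n) \<otimes>\<^bsub>M\<^esub> x = \<one>\<^bsub>M\<^esub>"
  using x by (simp add: mult_M one_M fun_eq_iff M_comp)
 ultimately show "\<exists>y\<in>carrier M. y \<otimes>\<^bsub>M\<^esub> x = \<one>\<^bsub>M\<^esub>" by blast
qed

sublocale M: comm_group M by (rule comm_group_M)

definition ev :: "nat \<times> 'g wreath => 'g repgrp => complex" where
 "ev p x = kch (wreath (fst p) G) (x (fst p)) (snd p)"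

abbreviation Pts where "Pts \<equiv> SIGMA n:UNIV. carrier (wreath n G)"

lemma add_fun_comp: "add_fun (KW n G) e ==> add_fun M (%x. e (x n))"
 by (simp add: add_fun_def mult_M M_comp)

lemma add_fun_ev: "p \<in> Pts ==> add_fun M (ev p)"
 unfolding ev_def by (rule add_fun_comp, rule finite_group.add_fun_kch[OF finite_group_W]) auto

lemma M_eqI:
 assumes "x \<in> carrier M" "y \<in> carrier M" "!!p. p \<in> Pts ==> ev p x = ev p y"
 shows "x = y"
proof
 fix n
 show "x n = y n"
 proof (rule finite_group.K0_eqI[OF finite_group_W])
  fix g assume "g \<in> carrier (wreath n G)"
  then show "kch (wreath n G) (x n) g = kch (wreath n G) (y n) g" using assms(3)[of "(n, g)"] by (simp add: ev_def)
 qed (use assms in \<open>auto intro: M_comp\<close>)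
qed

lemma R_inj_closed: "C \<in> carrier (KW n G) ==> R_inj G n C \<in> carrier M"
proof -
 assume C: "C \<in> carrier (KW n G)"
 have "m = n" if "R_inj G n C m ~= \<one>\<^bsub>KW m G\<^esub>" for m
  using that by (rule contrapos_np) (rule R_inj_other)
 then have "{m. R_inj G n C m ~= \<one>\<^bsub>KW m G\<^esub>} \<subseteq> {n}" by blast
 then have fin: "finite {m. R_inj G n C m ~= \<one>\<^bsub>KW m G\<^esub>}" by (rule finite_subset) simp
 have "R_inj G n C m \<in> carrier (KW m G)" for m
 proof (cases "m = n")
  case True
  then show ?thesis using C by (simp add: R_inj_same)
 next
  case False
  interpret W: comm_group "KW m G" by (rule comm_group_W)
  show ?thesis unfolding R_inj_other[OF False] by (rule W.one_closed)
 qed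
 with fin show ?thesis by (simp add: carrier_M)
qed

lemma ev_R_inj: "p \<in> Pts ==> ev p (R_inj G n C) = (if fst p = n then kch (wreath n G) C (snd p) else 0)"
 using finite_group.kch_one[OF finite_group_W] by (auto simp: ev_def R_inj_def)

lemma irr_M_closed: "irr M \<subseteq> carrier M"
 unfolding irr_M using finite_group.irr_K0_closed[OF finite_group_W] R_inj_closed by blast


lemma irr_M_cases:
 assumes "w \<in> irr M" obtains n C where "C \<in> irr (KW n G)" "C \<in> carrier (KW n G)" "w = R_inj G n C"
 using assms finite_group.irr_K0_closed[OF finite_group_W] unfolding irr_M by blast

lemma irr_MI: "C \<in> irr (KW n G) ==> R_inj G n C \<in> irr M"
 unfolding irr_M by blast

lemma R_inj_eq_iff:
 assumes "C \<in> irr (KW n G)" "D \<in> irr (KW m G)"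
 shows "R_inj G n C = R_inj G m D \<longleftrightarrow> n = m & C = D"
proof
 assume e: "R_inj G n C = R_inj G m D"
 have "C ~= \<one>\<^bsub>KW n G\<^esub>" using finite_group.irr_K0_not_one[OF finite_group_W assms(1)] .
 then have "n = m" using fun_cong[OF e, of n] by (auto simp: R_inj_def split: if_splits)
 then show "n = m & C = D" using fun_cong[OF e, of n] by (simp add: R_inj_def)
qed auto

text \<open>The degree is unique because an irreducible class is never the zero class, see
  \<open>R_inj_eq_iff\<close>.\<close>

definition deg_of :: "'g repgrp => nat" where
 "deg_of w = (THE n. \<exists>C\<in>irr (KW n G). w = R_inj G n C)"

lemma deg_of: "C \<in> irr (KW n G) ==> deg_of (R_inj G n C) = n"
 unfolding deg_of_def by (rule the_equality) (auto simp: R_inj_eq_iff)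

definition rdual :: "'g repgrp => 'g repgrp => complex" where
 "rdual w x = K0_dual (wreath (deg_of w) G) (w (deg_of w)) (x (deg_of w))"

lemma rdual_R_inj: "C \<in> irr (KW n G) ==> rdual (R_inj G n C) x = K0_dual (wreath n G) C (x n)"
 unfolding rdual_def by (simp only: deg_of R_inj_same)

lemma dual_system_M: "dual_system M rdual"
 unfolding dual_system_def
proof (intro ballI conjI)
 fix w assume "w \<in> irr M"
 then obtain n C where w: "C \<in> irr (KW n G)" "w = R_inj G n C" by (rule irr_M_cases)
 interpret W: finite_group "wreath n G" by (rule finite_group_W)
 interpret K: comm_group "KW n G" by (rule comm_group_W)
 show "add_fun M (rdual w)" unfolding w(2) rdual_R_inj[OF w(1)] by (rule add_fun_comp, rule W.add_fun_K0_dual)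
 fix v assume "v \<in> irr M"
 then obtain m D where v: "D \<in> irr (KW m G)" "v = R_inj G m D" by (rule irr_M_cases)
 show "rdual w v = (if v = w then 1 else 0)"
 proof (cases "m = n")
  case True
  have "rdual w v = K0_dual (wreath n G) C D"
   unfolding w(2) v(2) rdual_R_inj[OF w(1)] True by (simp only: R_inj_same)
  moreover have "v = w \<longleftrightarrow> D = C" using True v w R_inj_eq_iff[OF v(1) w(1)] by simp
  moreover have "D \<in> irr (KW n G)" using v(1) True by simp
  ultimately show ?thesis using W.dual_system_K0 w(1) by (simp add: dual_system_def)
 next
  case False
  then have "n ~= m" by simp
  have "rdual w v = 0"
   unfolding w(2) v(2) rdual_R_inj[OF w(1)] R_inj_other[OF \<open>n ~= m\<close>] by (rule K.add_fun_one[OF W.add_fun_K0_dual])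
  then show ?thesis using False v w R_inj_eq_iff[OF v(1) w(1)] by simp
 qed
qed

lemma M_span:
 assumes "x \<in> carrier M"
 shows "\<exists>c. keys c \<subseteq> irr M & zlift M (%x. x) c = x"
proof -
 let ?Sp = "%x. \<exists>c. keys c \<subseteq> irr M & zlift M (%x. x) c = x"
 have mult: "?Sp (x \<otimes>\<^bsub>M\<^esub> y)" if spx: "?Sp x" and spy: "?Sp y" for x y
 proof -
  obtain c where c: "keys c \<subseteq> irr M" "zlift M (%x. x) c = x" using spx by (elim exE conjE)
  obtain d where d: "keys d \<subseteq> irr M" "zlift M (%x. x) d = y" using spy by (elim exE conjE)
  have cc: "b \<in> carrier M" if "b \<in> keys c" for b using subsetD[OF irr_M_closed subsetD[OF c(1) that]] .
  have dc: "b \<in> carrier M" if "b \<in> keys d" for b using subsetD[OF irr_M_closed subsetD[OF d(1) that]] .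
  have "zlift M (%x. x) (c + d) = zlift M (%x. x) c \<otimes>\<^bsub>M\<^esub> zlift M (%x. x) d"
   by (rule M.zlift_add) (erule UnE, erule cc, erule dc)
  then have "zlift M (%x. x) (c + d) = x \<otimes>\<^bsub>M\<^esub> y" by (simp only: c(2) d(2))
  moreover have "keys (c + d) \<subseteq> irr M"
   by (rule subset_trans[OF keys_add Un_least[OF c(1) d(1)]])
  ultimately show ?thesis by (intro exI[of _ "c + d"] conjI)
 qed
 have inj: "?Sp (R_inj G n C)" if C: "C \<in> carrier (KW n G)" for n C
 proof -
  interpret W: finite_group "wreath n G" by (rule finite_group_W)
  interpret K: comm_group "KW n G" by (rule comm_group_W)
  obtain c where c: "keys c \<subseteq> irr (KW n G)" "zlift (KW n G) (%x. x) c = C"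
   using W.K0_span[OF C] by blast
  let ?d = "frag_extend (%w. frag_of (R_inj G n w)) c"
  have kd: "keys ?d \<subseteq> irr M"
   using c(1) by (intro keys_frag_extend_subset) (auto simp: keys_frag_of intro: irr_MI)
  have dc: "b \<in> carrier M" if "b \<in> keys ?d" for b
   by (rule subsetD[OF irr_M_closed subsetD[OF kd that]])
  have "zlift M (%x. x) ?d = R_inj G n C"
  proof (rule M_eqI)
   show "zlift M (%x. x) ?d \<in> carrier M" by (rule M.zlift_closed) (rule dc)
   show "R_inj G n C \<in> carrier M" by (rule R_inj_closed[OF C])
   fix p assume p: "p \<in> Pts"
   have "ev p (zlift M (%x. x) ?d) = lin ?d (ev p)"
    by (rule M.add_fun_zlift[OF add_fun_ev[OF p]]) (rule dc)
   also have "... = lin c (%w. ev p (R_inj G n w))" by (simp add: lin_extend)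
   also have "... = (if fst p = n then lin c (%w. kch (wreath n G) w (snd p)) else 0)"
    by (simp add: ev_R_inj[OF p])
   also have "... = ev p (R_inj G n C)"
   proof (cases "fst p = n")
    case True
    then have "snd p \<in> carrier (wreath n G)" using p by auto
    then have k: "snd p \<in> carrier (wreath n G)" .
    have sub: "b \<in> carrier (KW n G)" if "b \<in> keys c" for b
     using that c(1) W.irr_K0_closed by blast
    have "kch (wreath n G) (zlift (KW n G) (%x. x) c) (snd p) = lin c (%w. kch (wreath n G) w (snd p))"
     by (rule K.add_fun_zlift[OF W.add_fun_kch[OF k] sub])
    then show ?thesis using True unfolding c(2) by (simp add: ev_R_inj[OF p])
   qed (simp add: ev_R_inj[OF p])
   finally show "ev p (zlift M (%x. x) ?d) = ev p (R_inj G n C)" .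
  qed
  with kd show ?thesis by (intro exI[of _ ?d] conjI)
 qed
 \<comment> \<open>Induction on a finite set of degrees outside of which \<open>x\<close> vanishes,
   splitting off one homogeneous component at a time.\<close>
 have fin: "?Sp x" if "finite F" "x \<in> carrier M" "!!n. n \<notin> F ==> x n = \<one>\<^bsub>KW n G\<^esub>" for F x
  using that
 proof (induction F arbitrary: x rule: finite_induct)
  case empty
  have "x = \<one>\<^bsub>M\<^esub>" unfolding one_M by (rule ext, rule empty.prems(2)) simp
  then have "keys 0 \<subseteq> irr M & zlift M (%x. x) 0 = x" by (simp add: zlift_def)
  then show ?case by (rule exI[of _ 0])
 next
  case (insert n F)
  interpret W: comm_group "KW m G" for m by (rule comm_group_W)
  let ?y = "%m. if m = n then \<one>\<^bsub>KW m G\<^esub> else x m"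
  have "finite {m. x m ~= \<one>\<^bsub>KW m G\<^esub>}" using insert.prems(1) by (simp add: carrier_M)
  then have "finite {m. ?y m ~= \<one>\<^bsub>KW m G\<^esub>}" by (rule rev_finite_subset) auto
  then have y: "?y \<in> carrier M" using insert.prems(1) by (simp add: carrier_M)
  have "?y m = \<one>\<^bsub>KW m G\<^esub>" if "m \<notin> F" for m
  proof (cases "m = n")
   case False
   then show ?thesis using insert.prems(2)[of m] that by simp
  qed simp
  then have "?Sp ?y" by (rule insert.IH[OF y])
  with inj[OF M_comp[OF insert.prems(1)]] have sp: "?Sp (R_inj G n (x n) \<otimes>\<^bsub>M\<^esub> ?y)" by (rule mult)
  have e: "R_inj G n (x n) \<otimes>\<^bsub>M\<^esub> ?y = x"
  proof
   fix m
   show "(R_inj G n (x n) \<otimes>\<^bsub>M\<^esub> ?y) m = x m"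
    using M_comp[OF insert.prems(1), of m] by (cases "m = n") (simp_all add: mult_M R_inj_same R_inj_other)
  qed
  show ?case using sp unfolding e .
 qed
 have "finite {n. x n ~= \<one>\<^bsub>KW n G\<^esub>}" using assms by (simp add: carrier_M)
 then show ?thesis by (rule fin[OF _ assms]) simp
qed

sublocale T: tgroup M
 using comm_group_M irr_M_closed dual_system_M M_span by (rule tgroup_dualI)

lemma separates_M: "separates Pts ev M"
 unfolding separates_def
proof
 fix w assume "w \<in> irr M"
 then obtain n C where w: "C \<in> irr (KW n G)" "w = R_inj G n C" by (rule irr_M_cases)
 interpret W: finite_group "wreath n G" by (rule finite_group_W)
 let ?a = "%p. kch (wreath n G) C (inv\<^bsub>wreath n G\<^esub> (snd p)) / of_nat (card (carrier (wreath n G)))"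
 have d: "(\<Sum>p\<in>{n} \<times> carrier (wreath n G). ?a p * ev p v) = (if v = w then 1 else 0)" if v: "v \<in> irr M" for v
 proof -
  have "(\<Sum>p\<in>{n} \<times> carrier (wreath n G). ?a p * ev p v)
   = (\<Sum>g\<in>carrier (wreath n G). kch (wreath n G) C (inv\<^bsub>wreath n G\<^esub> g) / of_nat (card (carrier (wreath n G))) * kch (wreath n G) (v n) g)"
   by (rule sum.reindex_bij_witness[of _ "%g. (n, g)" snd]) (auto simp: ev_def)
  also have "... = rdual w v"
   by (simp add: w(2) rdual_R_inj[OF w(1)] K0_dual_def bform_def sum_divide_distrib mult.commute)
  finally show ?thesis using dual_system_M v \<open>w \<in> irr M\<close> by (simp add: dual_system_def)
 qed
 have f: "finite ({n} \<times> carrier (wreath n G))" "{n} \<times> carrier (wreath n G) \<subseteq> Pts" using W.finite_carrier by auto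
 show "\<exists>F a. finite F & F \<subseteq> Pts & (\<forall>v\<in>irr M. (\<Sum>p\<in>F. a p * ev p v) = (if v = w then 1 else 0))"
  apply (rule exI[of _ "{n} \<times> carrier (wreath n G)"])
  apply (rule exI[of _ ?a])
  using f d by simp
qed

end

section \<open>The grading\<close>

context rep_tgroup
begin

lemma grade_iff: "x \<in> grade M n \<longleftrightarrow> x \<in> carrier M & (\<forall>m. m ~= n --> x m = \<one>\<^bsub>KW m G\<^esub>)"
proof
 assume "x \<in> grade M n"
 then obtain C where "C \<in> carrier (KW n G)" "x = R_inj G n C" by (auto simp: grade_M)
 then show "x \<in> carrier M & (\<forall>m. m ~= n --> x m = \<one>\<^bsub>KW m G\<^esub>)"
  using R_inj_closed by (simp add: R_inj_def)
next
 assume x: "x \<in> carrier M & (\<forall>m. m ~= n --> x m = \<one>\<^bsub>KW m G\<^esub>)"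
 then have "x = R_inj G n (x n)" by (auto simp: R_inj_def fun_eq_iff)
 then show "x \<in> grade M n" using x M_comp[of x n] unfolding grade_M by blast
qed

lemma R_inj_grade: "C \<in> irr (KW n G) ==> R_inj G n C \<in> grade M m \<longleftrightarrow> m = n"
proof -
 assume C: "C \<in> irr (KW n G)"
 have "C ~= \<one>\<^bsub>KW n G\<^esub>" using finite_group.irr_K0_not_one[OF finite_group_W C] .
 moreover have "R_inj G n C \<in> carrier M" using irr_MI[OF C] irr_M_closed by blast
 ultimately show ?thesis unfolding grade_iff by (auto simp: R_inj_def)
qed

lemma graded_tgroup_M: "graded_tgroup M"
proof -
 interpret W: comm_group "KW n G" for n by (rule comm_group_W)
 have sg: "subgroup (grade M n) M" for n
 proof (rule M.subgroupI)
  show "grade M n \<subseteq> carrier M" by (auto simp: grade_iff)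
  have "\<one>\<^bsub>M\<^esub> \<in> grade M n" unfolding grade_iff by (simp add: one_M) (simp add: one_M[symmetric])
  then show "grade M n ~= {}" by blast
  fix x assume x: "x \<in> grade M n"
  have ic: "inv\<^bsub>M\<^esub> x \<in> carrier M" using x by (simp add: grade_iff)
  have "(inv\<^bsub>M\<^esub> x) m = \<one>\<^bsub>KW m G\<^esub>" if "m ~= n" for m
  proof -
   have "(inv\<^bsub>M\<^esub> x \<otimes>\<^bsub>M\<^esub> x) m = \<one>\<^bsub>M\<^esub> m" using x by (simp add: grade_iff)
   then show ?thesis using x that M_comp[OF ic, of m] by (simp add: mult_M one_M grade_iff)
  qed
  then show "inv\<^bsub>M\<^esub> x \<in> grade M n" using ic by (simp add: grade_iff)
  fix y assume y: "y \<in> grade M n"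
  show "x \<otimes>\<^bsub>M\<^esub> y \<in> grade M n"
   using x y M.m_closed[of x y] by (simp add: grade_iff) (simp add: mult_M)
 qed
 have gr: "group (M\<lparr>carrier := grade M n\<rparr>)" for n
  by (rule M.subgroup_imp_group[OF sg])
 let ?D = "carrier (sum_group UNIV (%n. M\<lparr>carrier := grade M n\<rparr>))"
 have D: "y \<in> ?D \<longleftrightarrow> (\<forall>n. y n \<in> grade M n) & finite {n. y n ~= \<one>\<^bsub>M\<^esub>}" for y
  using carrier_sum_group[of UNIV "%n. M\<lparr>carrier := grade M n\<rparr>"] gr by (simp add: PiE_UNIV_domain Pi_iff)
 \<comment> \<open>Only the factor \<open>y n\<close> can be nonzero in degree \<open>n\<close>, so
   the inverse of the direct sum map just reads off components.\<close>
 have comp: "gfinprod M y UNIV \<in> carrier M & gfinprod M y UNIV = (%n. y n n)" if y: "y \<in> ?D" for y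
 proof -
  let ?F = "{n. y n ~= \<one>\<^bsub>M\<^esub>}"
  have yc: "y n \<in> carrier M" for n using y by (simp add: D grade_iff)
  have fin: "finite ?F" using y by (simp add: D)
  have eq: "gfinprod M y UNIV = finprod M y ?F" using fin by (simp add: gfinprod_def)
  have c1: "gfinprod M y UNIV \<in> carrier M" unfolding eq using yc by (intro M.finprod_closed) auto
  have "{n. y n n ~= \<one>\<^bsub>KW n G\<^esub>} \<subseteq> ?F" by (auto simp: one_M)
  then have "finite {n. y n n ~= \<one>\<^bsub>KW n G\<^esub>}" using fin by (rule finite_subset)
  then have c2: "(%n. y n n) \<in> carrier M" using M_comp[OF yc] by (simp add: carrier_M)
  have "gfinprod M y UNIV = (%n. y n n)"
  proof (rule M_eqI[OF c1 c2])
   fix p assume p: "p \<in> Pts"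
   have "ev p (gfinprod M y UNIV) = (\<Sum>n\<in>?F. ev p (y n))"
    unfolding eq using yc by (intro M.add_fun_finprod[OF add_fun_ev[OF p]]) auto
   also have "... = (\<Sum>n\<in>?F. if n = fst p then ev p (y n) else 0)"
   proof (rule sum.cong[OF refl])
    fix n
    show "ev p (y n) = (if n = fst p then ev p (y n) else 0)"
    proof (cases "n = fst p")
     case False
     then have "y n (fst p) = \<one>\<^bsub>KW (fst p) G\<^esub>" using y by (simp add: D grade_iff)
     then show ?thesis using False p finite_group.kch_one[OF finite_group_W, of "snd p" "fst p"] by (auto simp: ev_def)
    qed simp
   qed
   also have "... = (if fst p \<in> ?F then ev p (y (fst p)) else 0)" using fin by (rule sum.delta)
   also have "... = ev p (%n. y n n)"
   proof (cases "fst p \<in> ?F")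
    case False
    then have "ev p (y (fst p)) = 0" using M.add_fun_one[OF add_fun_ev[OF p]] by simp
    then show ?thesis using False by (simp add: ev_def)
   qed (simp add: ev_def)
   finally show "ev p (gfinprod M y UNIV) = ev p (%n. y n n)" .
  qed
  with c1 show ?thesis by simp
 qed
 show ?thesis
 proof (intro graded_tgroup.intro graded_tgroup_axioms.intro)
  show "tgroup M" by (rule T.tgroup_axioms)
  show "subgroup (grade M n) M" for n by (rule sg)
  show "bij_betw (%x. gfinprod M x UNIV) ?D (carrier M)"
  proof (rule bij_betw_byWitness[where f' = "%x n. R_inj G n (x n)"])
   show "\<forall>y\<in>?D. (%n. R_inj G n ((gfinprod M y UNIV) n)) = y"
   proof
    fix y assume y: "y \<in> ?D"
    have "R_inj G n (y n n) = y n" for n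
     using y unfolding D grade_iff by (auto simp: R_inj_def fun_eq_iff)
    then show "(%n. R_inj G n ((gfinprod M y UNIV) n)) = y" using comp[OF y] by simp
   qed
   have inD: "(%n. R_inj G n (x n)) \<in> ?D" if x: "x \<in> carrier M" for x
   proof -
    have "{n. R_inj G n (x n) ~= \<one>\<^bsub>M\<^esub>} \<subseteq> {n. x n ~= \<one>\<^bsub>KW n G\<^esub>}"
     by (auto simp: R_inj_def one_M fun_eq_iff split: if_splits)
    then have "finite {n. R_inj G n (x n) ~= \<one>\<^bsub>M\<^esub>}"
     by (rule finite_subset) (use x in \<open>simp add: carrier_M\<close>)
    moreover have "R_inj G n (x n) \<in> grade M n" for n using M_comp[OF x, of n] unfolding grade_M by (rule imageI)
    ultimately show ?thesis unfolding D by simp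
   qed
   show "\<forall>x\<in>carrier M. gfinprod M (%n. R_inj G n (x n)) UNIV = x"
    using comp[OF inD] by (simp add: R_inj_def)
   show "(%x. gfinprod M x UNIV) ` ?D \<subseteq> carrier M" using comp by blast
   show "(%x n. R_inj G n (x n)) ` carrier M \<subseteq> ?D" using inD by blast
  qed
  show "\<exists>n. w \<in> grade M n" if "w \<in> irr M" for w
   using that R_inj_grade by (elim irr_M_cases) blast
 qed
qed

end

lemma rep_tgroup_fields:
 assumes G: "finite_group G"
  and "carrier M = carrier (R_group G)" "!!x y. x \<otimes>\<^bsub>M\<^esub> y = x \<otimes>\<^bsub>R_group G\<^esub> y" "\<one>\<^bsub>M\<^esub> = \<one>\<^bsub>R_group G\<^esub>"
  "irr M = irr (R_group G)" "grade M = grade (R_group G)"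
 shows "rep_tgroup G M"
proof -
 interpret G: finite_group G by fact
 have gr: "group (KW n G)" for n
  using finite_group.comm_group_K0[OF finite_group_wreath[OF G]] by (rule comm_group.axioms)
 show ?thesis
  by unfold_locales (simp_all add: assms R_group_def Let_def carrier_sum_group gr PiE_UNIV_domain Pi_iff restrict_def)
qed

lemma rep_tgroup_R_group: "finite_group G ==> rep_tgroup G (R_group G)"
 by (rule rep_tgroup_fields) auto

lemma R_psh_simps:
 "carrier (R_psh G) = carrier (R_group G)" "x \<otimes>\<^bsub>R_psh G\<^esub> y = x \<otimes>\<^bsub>R_group G\<^esub> y" "\<one>\<^bsub>R_psh G\<^esub> = \<one>\<^bsub>R_group G\<^esub>"
 "irr (R_psh G) = irr (R_group G)" "grade (R_psh G) = grade (R_group G)"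
 "psh_mult (R_psh G) = ind_map G G" "psh_comult (R_psh G) = res_map G G"
 "psh_unit (R_psh G) = R_unit G" "psh_counit (R_psh G) = R_counit G"
 by (simp_all add: R_psh_def graded_tgroup.extend_def psh.fields_def)

lemma rep_tgroup_R_psh: "finite_group G ==> rep_tgroup G (R_psh G)"
 by (rule rep_tgroup_fields) (auto simp: R_psh_simps)

section \<open>Induction and restriction evaluated at points\<close>

text \<open>For a permutation \<open>r\<close> of a finite set these are the unions of
  cycles.\<close>

definition stab :: "(nat => nat) => nat set => nat set set" where
 "stab r V = {S. S \<subseteq> V & r ` S = S}"

lemma finite_stab: "finite V ==> finite (stab r V)"
 unfolding stab_def by (rule finite_subset[of _ "Pow V"]) auto

lemma stab_sub: "S \<in> stab r V ==> S \<subseteq> V"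
 by (simp add: stab_def)

lemma point_stab:
 assumes pt: "point G V r d" and S: "S \<in> stab r V"
 shows "point G S r d" "point G (V - S) r d" "V - S \<in> stab r V"
proof -
 have V: "finite V" "bij_betw r V V" "\<forall>j\<in>V. d j \<in> carrier G" using pt by (simp_all add: point_def)
 have sub: "S \<subseteq> V" and im: "r ` S = S" using S by (simp_all add: stab_def)
 have inj: "inj_on r V" and imV: "r ` V = V" using V(2) by (simp_all add: bij_betw_def)
 have d: "r ` (V - S) = V - S" using inj_on_image_set_diff[OF inj Diff_subset sub] im imV by (simp add: double_diff sub)
 show "point G S r d" using V sub im inj_on_subset[OF inj sub] by (auto simp: point_def bij_betw_def intro: finite_subset)
 show "point G (V - S) r d" using V d inj_on_subset[OF inj Diff_subset] by (auto simp: point_def bij_betw_def)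
 show "V - S \<in> stab r V" using d by (simp add: stab_def)
qed

text \<open>Places \<open>g\<close> on the indices above \<open>N\<close> without disturbing data
  prescribed up to \<open>N\<close>, so that several group elements can be presented on disjoint
  blocks by one common pair \<open>(r, d)\<close>.\<close>

lemma shift_presents:
 assumes g: "g \<in> carrier (wreath n G)"
 shows "\<exists>r d. presents G n (%i. i + N) r d g & (\<forall>j\<le>N. r j = r0 j & d j = d0 j)"
proof -
 let ?r = "%j. if j \<le> N then r0 j else fst g (j - N) + N"
 let ?d = "%j. if j \<le> N then d0 j else snd g (fst g (j - N))"
 have "presents G n (%i. i + N) ?r ?d g" using g by (simp add: presents_def)
 then show ?thesis by (intro exI[of _ ?r] exI[of _ ?d] conjI) auto
qed

lemma image_shift: "(%i. i + N) ` {1..n} = {N + 1..N + n}" for n N :: nat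
 by (simp add: image_add_atLeastAtMost' add.commute)

lemma emb_index_image:
 fixes k l :: nat
 shows "(%i. if i \<le> k then b1 i else b2 (i - k)) ` {1..k + l} = b1 ` {1..k} \<union> b2 ` {1..l}" (is "?f ` _ = _")
proof -
 have e: "{1..k + l} = {1..k} \<union> (%i. i + k) ` {1..l}" unfolding image_shift by auto
 have "?f ` {1..k} = b1 ` {1..k}" by (rule image_cong) auto
 moreover have "?f ` (%i. i + k) ` {1..l} = b2 ` {1..l}" unfolding image_image by (rule image_cong) auto
 ultimately show ?thesis unfolding e image_Un by simp
qed

lemma (in inclusion) ind_fun_cong: "(!!h. h \<in> carrier K ==> \<phi> h = \<psi> h) ==> ind_fun \<phi> g = ind_fun \<psi> g"
 unfolding ind_fun_def by (rule sum.cong[OF refl]) (simp add: pre(1))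

lemma (in inclusion) ind_fun_zero: "(!!h. h \<in> carrier K ==> \<phi> h = 0) ==> ind_fun \<phi> g = 0"
 using ind_fun_cong[of \<phi> "%_. 0" g] by (simp add: ind_fun_def)

context rep_tgroup begin

lemma add_fun_hat: assumes "point G V r d" shows "add_fun M (%x. hat G x V r d)"
proof -
 obtain b g where b: "b ` {1..card V} = V" "inj_on b {1..card V}" "presents G (card V) b r d g"
  by (rule point_presents[OF assms])
 have e: "hat G x V r d = ev (card V, g) x" if "x \<in> carrier M" for x
  using hat_presents[OF finite_group_axioms M_RG[OF that] b(3,1)] by (simp add: ev_def)
 have "(card V, g) \<in> Pts" using b(3) by (simp add: presents_def)
 from add_fun_ev[OF this] show ?thesis by (simp add: add_fun_def e)
qed

text \<open>Every element of a wreath product presents itself on \<open>{1..n}\<close>, so points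
  account for all character values.\<close>

lemma hat_eqI:
 assumes x: "x \<in> carrier M" and y: "y \<in> carrier M" and eq: "!!V r d. point G V r d ==> hat G x V r d = hat G y V r d"
 shows "x = y"
proof (rule M_eqI[OF x y])
 fix p assume "p \<in> Pts"
 then obtain n q f where p: "p = (n, (q, f))" "(q, f) \<in> carrier (wreath n G)" by (cases p) auto
 have P: "presents G n (%i. i) q (%i. f (q i)) (q, f)" by (rule presents_self[OF p(2)])
 have im: "(%i. i) ` {1..n} = {1..n}" by simp
 show "ev p x = ev p y"
  using eq[OF presents_point[OF P]]
  unfolding im hat_presents[OF finite_group_axioms M_RG[OF x] P im] hat_presents[OF finite_group_axioms M_RG[OF y] P im]
  by (simp add: ev_def p)
qed

end

section \<open>The action of R(H) on R(G) by induction\<close>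

locale rep_pair = subgroup_pair G H + A: rep_tgroup "G\<lparr>carrier := H\<rparr>" A + M: rep_tgroup G M
 for G :: "('g, 'm) monoid_scheme" (structure) and H :: "'g set"
  and A :: "('g repgrp, 'y) graded_tgroup_scheme" and M :: "('g repgrp, 'z) graded_tgroup_scheme"
begin

abbreviation AM where "AM \<equiv> tensor A M"

lemma inclusion_emb': "k \<le> n ==> inclusion (wreath n G) (WP k (n - k)) (wreath_emb k (n - k))"
 using inclusion_emb[of k "n - k"] by simp

lemma irr_pair: "p \<in> irr A \<times> irr M ==> fst p \<in> carrier A & snd p \<in> carrier M"
 using A.irr_M_closed M.irr_M_closed by auto

lemma lin_AM_cong:
 assumes "t \<in> carrier AM" "!!w v. w \<in> irr A ==> v \<in> irr M ==> w \<in> carrier A ==> v \<in> carrier M ==> f w v = f' w v"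
 shows "lin t (%(w, v). f w v) = lin t (%(w, v). f' w v)"
proof (rule lin_cong)
 fix p assume "p \<in> keys t"
 then have p: "p \<in> irr A \<times> irr M" using assms(1) by auto
 then show "(case p of (w, v) => f w v) = (case p of (w, v) => f' w v)"
  using assms(2)[of "fst p" "snd p"] irr_pair[OF p] by (cases p) auto
qed

abbreviation ind_outer where
 "ind_outer n k C D \<equiv> K0_map (WP k (n - k)) (wreath n G) (ind_rep (wreath n G) (WP k (n - k)) (wreath_emb k (n - k)))
   (K0_outer (wreath k K) (wreath (n - k) G) C D)"

text \<open>\<open>ind_map\<close> uses this on irreducibles and extends linearly; having it on
  arbitrary pairs makes the evaluation formula additive in both arguments.\<close>

definition ind_pair :: "'g repgrp => 'g repgrp => 'g repgrp" where
 "ind_pair x y = (%n. finprod (KW n G) (%k. ind_outer n k (x k) (y (n - k))) {..n})"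

lemma ind_map_eq: "ind_map K G t = zlift (R_group G) (%(x, y). ind_pair x y) t"
 unfolding ind_map_def ind_pair_def ..

lemma kch_ind_outer:
 assumes k: "k \<le> n" and C: "C \<in> carrier (KW k K)" and D: "D \<in> carrier (KW (n - k) G)"
 shows "ind_outer n k C D \<in> carrier (KW n G)"
  and "g \<in> carrier (wreath n G) \<Longrightarrow> kch (wreath n G) (ind_outer n k C D) g = inclusion.ind_fun (wreath n G) (WP k (n - k)) (wreath_emb k (n - k))
   (%(u, v). kch (wreath k K) C u * kch (wreath (n - k) G) D v) g"
proof -
 interpret I: inclusion "wreath n G" "WP k (n - k)" "wreath_emb k (n - k)" by (rule inclusion_emb'[OF k])
 note O = K0_outer[OF A.finite_group_W M.finite_group_W C D]
 show "(ind_outer n k C D) \<in> carrier (KW n G)" by (rule I.K0_ind(1)[OF O(1)])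
 assume g: "g \<in> carrier (wreath n G)"
 have "kch (wreath n G) (ind_outer n k C D) g = I.ind_fun (kch (WP k (n - k)) (K0_outer (wreath k K) (wreath (n - k) G) C D)) g"
  by (rule I.K0_ind(2)[OF O(1) g])
 also have "... = I.ind_fun (%(u, v). kch (wreath k K) C u * kch (wreath (n - k) G) D v) g"
  by (rule I.ind_fun_cong) (use O(2) in \<open>auto simp: DirProd_def\<close>)
 finally show "kch (wreath n G) (ind_outer n k C D) g = I.ind_fun (%(u, v). kch (wreath k K) C u * kch (wreath (n - k) G) D v) g" .
qed

abbreviation indf where
 "indf n k x y \<equiv> inclusion.ind_fun (wreath n G) (WP k (n - k)) (wreath_emb k (n - k))
   (%(u, v). kch (wreath k K) (x k) u * kch (wreath (n - k) G) (y (n - k)) v)"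

lemma ind_pair:
 assumes x: "x \<in> carrier A" and y: "y \<in> carrier M"
 shows ind_pair_closed: "ind_pair x y n \<in> carrier (KW n G)"
  and kch_ind_pair: "g \<in> carrier (wreath n G) ==> kch (wreath n G) (ind_pair x y n) g = (\<Sum>k\<le>n. indf n k x y g)"
proof -
 let ?T = "%k. ind_outer n k (x k) (y (n - k))"
 interpret W: comm_group "KW n G" by (rule M.comm_group_W)
 note T = kch_ind_outer[OF _ A.M_comp[OF x] M.M_comp[OF y]]
 have Tc: "?T \<in> {..n} \<rightarrow> carrier (KW n G)" using T(1) by auto
 show "ind_pair x y n \<in> carrier (KW n G)" unfolding ind_pair_def by (rule W.finprod_closed[OF Tc])
 assume g: "g \<in> carrier (wreath n G)"
 have "kch (wreath n G) (ind_pair x y n) g = (\<Sum>k\<le>n. kch (wreath n G) (?T k) g)" unfolding ind_pair_def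
  by (rule W.add_fun_finprod[OF finite_group.add_fun_kch[OF M.finite_group_W g] Tc])
 also have "... = (\<Sum>k\<le>n. indf n k x y g)" by (rule sum.cong[OF refl]) (use T(2) g in simp)
 finally show "kch (wreath n G) (ind_pair x y n) g = (\<Sum>k\<le>n. indf n k x y g)" .
qed

lemma kch_grade:
 "x \<in> grade A a ==> k ~= a ==> u \<in> carrier (wreath k K) ==> kch (wreath k K) (x k) u = 0"
 "y \<in> grade M b ==> k ~= b ==> v \<in> carrier (wreath k G) ==> kch (wreath k G) (y k) v = 0"
 using finite_group.kch_one[OF A.finite_group_W] finite_group.kch_one[OF M.finite_group_W]
 by (simp_all add: A.grade_iff M.grade_iff)

lemma indf_grade:
 assumes x: "x \<in> grade A a" and y: "y \<in> grade M b" and k: "k \<le> n" and ne: "k ~= a \<or> n - k ~= b"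
 shows "indf n k x y g = 0"
proof -
 interpret I: inclusion "wreath n G" "WP k (n - k)" "wreath_emb k (n - k)" by (rule inclusion_emb'[OF k])
 show ?thesis
 proof (rule I.ind_fun_zero)
  fix h assume h: "h \<in> carrier (WP k (n - k))"
  then have h': "fst h \<in> carrier (wreath k K)" "snd h \<in> carrier (wreath (n - k) G)" by (auto simp: DirProd_def)
  show "(case h of (u, v) => kch (wreath k K) (x k) u * kch (wreath (n - k) G) (y (n - k)) v) = 0"
   using ne kch_grade(1)[OF x _ h'(1)] kch_grade(2)[OF y _ h'(2)] by (auto simp: case_prod_beta)
 qed
qed

lemma grade_carrier: "x \<in> grade A a ==> x \<in> carrier A" "y \<in> grade M b ==> y \<in> carrier M"
 by (simp_all add: A.grade_iff M.grade_iff)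

lemma ind_pair_grade:
 assumes x: "x \<in> grade A a" and y: "y \<in> grade M b"
 shows "ind_pair x y \<in> grade M (a + b)"
proof -
 note c = grade_carrier(1)[OF x] grade_carrier(2)[OF y]
 have o: "ind_pair x y n = \<one>\<^bsub>KW n G\<^esub>" if n: "n ~= a + b" for n
 proof (rule finite_group.K0_eqI[OF M.finite_group_W ind_pair_closed[OF c]])
  interpret W: comm_group "KW n G" by (rule M.comm_group_W)
  show "\<one>\<^bsub>KW n G\<^esub> \<in> carrier (KW n G)" by simp
  fix g assume g: "g \<in> carrier (wreath n G)"
  have "(\<Sum>k\<le>n. indf n k x y g) = 0"
  proof (rule sum.neutral, rule ballI)
   fix k assume "k \<in> {..n}"
   then have k: "k \<le> n" by simp
   then have ne: "k ~= a \<or> n - k ~= b" using n by auto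
   show "indf n k x y g = 0" by (rule indf_grade[OF x y k ne])
  qed
  then show "kch (wreath n G) (ind_pair x y n) g = kch (wreath n G) \<one>\<^bsub>KW n G\<^esub> g"
   using kch_ind_pair[OF c g] finite_group.kch_one[OF M.finite_group_W g] by simp
 qed
 have "{n. ind_pair x y n ~= \<one>\<^bsub>KW n G\<^esub>} \<subseteq> {a + b}" using o by blast
 then have "finite {n. ind_pair x y n ~= \<one>\<^bsub>KW n G\<^esub>}" by (rule finite_subset) simp
 then have "ind_pair x y \<in> carrier M" using ind_pair_closed[OF c] by (simp add: M.carrier_M)
 then show ?thesis using o by (simp add: M.grade_iff)
qed

lemma ind_pair_irr_closed: "w \<in> irr A ==> v \<in> irr M ==> ind_pair w v \<in> carrier M"
proof -
 assume w: "w \<in> irr A" and v: "v \<in> irr M"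
 obtain a C where C: "C \<in> irr (KW a K)" "w = R_inj K a C" by (rule A.irr_M_cases[OF w])
 obtain b D where D: "D \<in> irr (KW b G)" "v = R_inj G b D" by (rule M.irr_M_cases[OF v])
 have "w \<in> grade A a" "v \<in> grade M b" using A.R_inj_grade[OF C(1)] M.R_inj_grade[OF D(1)] C(2) D(2) by simp_all
 then show ?thesis using ind_pair_grade grade_carrier(2) by blast
qed

text \<open>In degree \<open>a + b\<close> only the summand with \<open>k = a\<close> contributes.
  The second claim supplies an actual representation, which is the source of positivity.\<close>

lemma ind_pair_irr:
 assumes C: "C \<in> irr (KW a K)" and D: "D \<in> irr (KW b G)"
 shows kch_ind_pair_irr: "g \<in> carrier (wreath (a + b) G) ==> kch (wreath (a + b) G) (ind_pair (R_inj K a C) (R_inj G b D) (a + b)) g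
   = inclusion.ind_fun (wreath (a + b) G) (WP a b) (wreath_emb a b) (%(u, v). kch (wreath a K) C u * kch (wreath b G) D v) g"
  and "\<exists>\<rho>. is_rep (wreath (a + b) G) \<rho> & ind_pair (R_inj K a C) (R_inj G b D) (a + b) = K0_class (wreath (a + b) G) (frag_of \<rho>)"
proof -
 let ?w = "R_inj K a C" and ?v = "R_inj G b D"
 interpret WA: finite_group "wreath a K" by (rule A.finite_group_W)
 interpret WB: finite_group "wreath b G" by (rule M.finite_group_W)
 interpret X: finite_group "wreath (a + b) G" by (rule M.finite_group_W)
 interpret I: inclusion "wreath (a + b) G" "WP a b" "wreath_emb a b" by (rule inclusion_emb)
 have w: "?w \<in> grade A a" and v: "?v \<in> grade M b" using A.R_inj_grade[OF C] M.R_inj_grade[OF D] by simp_all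
 note c = grade_carrier(1)[OF w] grade_carrier(2)[OF v]
 show kc: "kch (wreath (a + b) G) (ind_pair ?w ?v (a + b)) g = I.ind_fun (%(u, v). kch (wreath a K) C u * kch (wreath b G) D v) g"
  if g: "g \<in> carrier (wreath (a + b) G)" for g
 proof -
  have "kch (wreath (a + b) G) (ind_pair ?w ?v (a + b)) g = (\<Sum>k\<le>a + b. indf (a + b) k ?w ?v g)" by (rule kch_ind_pair[OF c g])
  also have "... = indf (a + b) a ?w ?v g + (\<Sum>k\<in>{..a + b} - {a}. indf (a + b) k ?w ?v g)"
   by (rule sum.remove) auto
  also have "(\<Sum>k\<in>{..a + b} - {a}. indf (a + b) k ?w ?v g) = 0" by (rule sum.neutral) (use indf_grade[OF w v] in auto)
  finally show ?thesis by (simp add: R_inj_same)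
 qed
 obtain \<sigma> where \<sigma>: "C = K0_class (wreath a K) (frag_of \<sigma>)" "is_rep (wreath a K) \<sigma>" using C unfolding WA.irr_K0 by (auto simp: irreducible_rep_def)
 obtain \<tau> where \<tau>: "D = K0_class (wreath b G) (frag_of \<tau>)" "is_rep (wreath b G) \<tau>" using D unfolding WB.irr_K0 by (auto simp: irreducible_rep_def)
 let ?\<rho> = "ind_rep (wreath (a + b) G) (WP a b) (wreath_emb a b) (outer_rep \<sigma> \<tau>)"
 have o: "is_rep (WP a b) (outer_rep \<sigma> \<tau>)" by (rule is_rep_outer[OF \<sigma>(2) \<tau>(2)])
 have r: "is_rep (wreath (a + b) G) ?\<rho>" by (rule I.is_rep_ind[OF o])
 have Cc: "C \<in> carrier (KW a K)" and Dc: "D \<in> carrier (KW b G)"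
  using C D WA.irr_K0_closed WB.irr_K0_closed by blast+
 have "ind_pair ?w ?v (a + b) = K0_class (wreath (a + b) G) (frag_of ?\<rho>)"
 proof (rule X.K0_eqI[OF ind_pair_closed[OF c] X.rep_class_closed[OF r]])
  fix g assume g: "g \<in> carrier (wreath (a + b) G)"
  have "K0_class (wreath (a + b) G) (frag_of ?\<rho>) = K0_map (WP a b) (wreath (a + b) G)
    (ind_rep (wreath (a + b) G) (WP a b) (wreath_emb a b)) (K0_outer (wreath a K) (wreath b G) C D)"
   unfolding \<sigma>(1) \<tau>(1) K0_outer_rep[OF A.finite_group_W M.finite_group_W \<sigma>(2) \<tau>(2)] by (rule I.K0_ind_rep[OF o, symmetric])
  then have "kch (wreath (a + b) G) (K0_class (wreath (a + b) G) (frag_of ?\<rho>)) g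
   = I.ind_fun (%(u, v). kch (wreath a K) C u * kch (wreath b G) D v) g"
   using kch_ind_outer(2)[of a "a + b" C D g] Cc Dc g by simp
  then show "kch (wreath (a + b) G) (ind_pair ?w ?v (a + b)) g = kch (wreath (a + b) G) (K0_class (wreath (a + b) G) (frag_of ?\<rho>)) g"
   using kc[OF g] by simp
 qed
 with r show "\<exists>\<rho>. is_rep (wreath (a + b) G) \<rho> & ind_pair ?w ?v (a + b) = K0_class (wreath (a + b) G) (frag_of \<rho>)" by blast
qed

text \<open>\<open>ind_map\<close> is built with the operations of \<open>R_group G\<close>, while
  \<open>M\<close> may be the extended record.\<close>

lemma R_group_M: "carrier (R_group G) = carrier M" "add_fun (R_group G) e \<longleftrightarrow> add_fun M e"
proof -
 interpret R: rep_tgroup G "R_group G" by (rule rep_tgroup_R_group[OF G.finite_group_axioms])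
 show "carrier (R_group G) = carrier M" by (simp only: R.carrier_M M.carrier_M)
 then show "add_fun (R_group G) e \<longleftrightarrow> add_fun M e" by (simp only: add_fun_def R.mult_M M.mult_M)
qed

lemma ind_map_closed: assumes "t \<in> carrier AM" shows "ind_map K G t \<in> carrier M"
proof -
 interpret R: rep_tgroup G "R_group G" by (rule rep_tgroup_R_group[OF G.finite_group_axioms])
 have "(%(x, y). ind_pair x y) b \<in> carrier (R_group G)" if "b \<in> keys t" for b
  using that assms ind_pair_irr_closed unfolding R_group_M by (cases b) auto
 then have "zlift (R_group G) (%(x, y). ind_pair x y) t \<in> carrier (R_group G)" by (rule R.M.zlift_closed)
 then show ?thesis unfolding R_group_M ind_map_eq .
qed

lemma add_fun_ind_map:
 assumes e: "add_fun M e" and t: "t \<in> carrier AM"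
 shows "e (ind_map K G t) = lin t (%(w, v). e (ind_pair w v))"
proof -
 interpret R: rep_tgroup G "R_group G" by (rule rep_tgroup_R_group[OF G.finite_group_axioms])
 have c: "(%(x, y). ind_pair x y) b \<in> carrier (R_group G)" if "b \<in> keys t" for b
  using that t ind_pair_irr_closed unfolding R_group_M by (cases b) auto
 have e': "add_fun (R_group G) e" using e by (simp only: R_group_M)
 show ?thesis unfolding ind_map_eq using R.M.add_fun_zlift[OF e', of t "%(x, y). ind_pair x y", OF c] by (simp add: case_prod_unfold)
qed

lemma ind_map_hom: "ind_map K G \<in> hom AM M"
proof (rule homI)
 fix t u assume t: "t \<in> carrier AM" and u: "u \<in> carrier AM"
 have tu: "t + u \<in> carrier AM" using t u keys_add[of t u] by auto
 have "ind_map K G (t + u) = ind_map K G t \<otimes>\<^bsub>M\<^esub> ind_map K G u"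
 proof (rule M.M_eqI[OF ind_map_closed[OF tu]])
  show "ind_map K G t \<otimes>\<^bsub>M\<^esub> ind_map K G u \<in> carrier M" by (rule M.M.m_closed[OF ind_map_closed[OF t] ind_map_closed[OF u]])
  fix p assume "p \<in> M.Pts"
  then have e: "add_fun M (M.ev p)" by (rule M.add_fun_ev)
  show "M.ev p (ind_map K G (t + u)) = M.ev p (ind_map K G t \<otimes>\<^bsub>M\<^esub> ind_map K G u)"
   unfolding add_fun_mult[OF e ind_map_closed[OF t] ind_map_closed[OF u]]
    add_fun_ind_map[OF e t] add_fun_ind_map[OF e u] add_fun_ind_map[OF e tu] by (rule lin_add)
 qed
 then show "ind_map K G (t \<otimes>\<^bsub>AM\<^esub> u) = ind_map K G t \<otimes>\<^bsub>M\<^esub> ind_map K G u" by simp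
qed (rule ind_map_closed)

lemma ind_map_graded: "graded_map AM M (ind_map K G)"
 unfolding graded_map_def
proof (intro allI subsetI)
 fix n z assume "z \<in> ind_map K G ` grade AM n"
 then obtain t where t: "t \<in> grade AM n" "z = ind_map K G t" by blast
 have tc: "t \<in> carrier AM" using t(1) by (simp add: tensor_def)
 have tg: "\<exists>k l. k + l = n & fst p \<in> grade A k & snd p \<in> grade M l" if "p \<in> keys t" for p
 proof -
  have "\<forall>(w, v)\<in>keys t. \<exists>k l. k + l = n & w \<in> grade A k & v \<in> grade M l" using t(1) by (simp add: tensor_def)
  from bspec[OF this that] show ?thesis by (simp add: case_prod_unfold)
 qed
 have "z m = \<one>\<^bsub>KW m G\<^esub>" if m: "m ~= n" for m
 proof (rule finite_group.K0_eqI[OF M.finite_group_W])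
  interpret W: comm_group "KW m G" by (rule M.comm_group_W)
  show "\<one>\<^bsub>KW m G\<^esub> \<in> carrier (KW m G)" by simp
  show "z m \<in> carrier (KW m G)" unfolding t(2) by (rule M.M_comp[OF ind_map_closed[OF tc]])
  fix g assume g: "g \<in> carrier (wreath m G)"
  have e: "add_fun M (%x. kch (wreath m G) (x m) g)" by (rule M.add_fun_comp, rule finite_group.add_fun_kch[OF M.finite_group_W g])
  have "kch (wreath m G) (z m) g = lin t (%p. kch (wreath m G) (ind_pair (fst p) (snd p) m) g)"
   unfolding t(2) add_fun_ind_map[OF e tc] by (simp add: case_prod_unfold)
  also have "... = lin t (%p. 0)"
  proof (rule lin_cong)
   fix p assume "p \<in> keys t"
   then obtain k l where kl: "k + l = n" "fst p \<in> grade A k" "snd p \<in> grade M l" using tg by blast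
   have "ind_pair (fst p) (snd p) m = \<one>\<^bsub>KW m G\<^esub>"
    using ind_pair_grade[OF kl(2,3)] m kl(1) by (simp add: M.grade_iff)
   then show "kch (wreath m G) (ind_pair (fst p) (snd p) m) g = 0" using finite_group.kch_one[OF M.finite_group_W g] by simp
  qed
  finally show "kch (wreath m G) (z m) g = kch (wreath m G) \<one>\<^bsub>KW m G\<^esub> g"
   using finite_group.kch_one[OF M.finite_group_W g] by simp
 qed
 then show "z \<in> grade M n" using ind_map_closed[OF tc] t(2) by (simp add: M.grade_iff)
qed

lemma point_twist:
 "point G S r d ==> \<tau> \<in> labs S r d ==> point K S r (twist r d \<tau>)"
 by (simp add: point_def labs_def)

lemma add_fun_ihat: "point G S r d ==> add_fun A (%x. ihat x S r d)"
 unfolding ihat_def by (rule add_fun_sum, rule A.add_fun_hat, rule point_twist)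

text \<open>\<open>ind_fun_hat\<close> treats subsets of one size \<open>k\<close>; summing over the
  degrees \<open>k\<close> removes the restriction on the size.\<close>

lemma hat_ind_pair:
 assumes x: "x \<in> carrier A" and y: "y \<in> carrier M" and pt: "point G V r d"
 shows "hat G (ind_pair x y) V r d = (\<Sum>S\<in>stab r V. ihat x S r d * hat G y (V - S) r d)"
proof -
 let ?n = "card V"
 obtain b g where b: "b ` {1..?n} = V" "inj_on b {1..?n}" "presents G ?n b r d g" by (rule point_presents[OF pt])
 have RG: "ind_pair x y \<in> RG G" unfolding RG_def using ind_pair_closed[OF x y] by simp
 have g: "g \<in> carrier (wreath ?n G)" using b(3) by (simp add: presents_def)
 have fV: "finite V" using pt by (simp add: point_def)
 let ?F = "%S. ihat x S r d * hat G y (V - S) r d"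
 have "hat G (ind_pair x y) V r d = (\<Sum>k\<le>?n. indf ?n k x y g)"
  using hat_presents[OF G.finite_group_axioms RG b(3,1)] kch_ind_pair[OF x y g] by simp
 also have "... = (\<Sum>k\<in>{..?n}. sum ?F {S \<in> stab r V. card S = k})"
 proof (rule sum.cong[OF refl])
  fix k assume "k \<in> {..?n}"
  then have k: "k + (?n - k) = ?n" by simp
  have P: "presents G (k + (?n - k)) b r d g" and B: "b ` {1..k + (?n - k)} = V" unfolding k by (rule b)+
  have "indf ?n k x y g = (\<Sum>S | S \<subseteq> V & card S = k & r ` S = S. ?F S)"
   using ind_fun_hat[OF A.M_RG[OF x] M.M_RG[OF y] P B] unfolding k .
  also have "{S. S \<subseteq> V & card S = k & r ` S = S} = {S \<in> stab r V. card S = k}" by (auto simp: stab_def)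
  finally show "indf ?n k x y g = sum ?F {S \<in> stab r V. card S = k}" .
 qed
 also have "... = sum ?F (stab r V)"
  by (rule sum.group[OF finite_stab[OF fV] finite_atMost]) (auto simp: stab_def intro: card_mono[OF fV])
 finally show ?thesis .
qed

lemma ind_map_eval:
 assumes t: "t \<in> carrier AM" and pt: "point G V r d"
 shows "hat G (ind_map K G t) V r d = (\<Sum>S\<in>stab r V. lin t (%(w, v). ihat w S r d * hat G v (V - S) r d))"
proof -
 have "hat G (ind_map K G t) V r d = lin t (%(w, v). hat G (ind_pair w v) V r d)"
  by (rule add_fun_ind_map[OF M.add_fun_hat[OF pt] t])
 also have "... = lin t (%(w, v). \<Sum>S\<in>stab r V. ihat w S r d * hat G v (V - S) r d)"
  by (rule lin_AM_cong[OF t]) (rule hat_ind_pair[OF _ _ pt])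
 finally show ?thesis by (simp add: case_prod_unfold lin_fun_sum)
qed

text \<open>The action is a convolution over stable subsets. Together with \<open>res_eval\<close>
  this carries the proofs of the module axioms.\<close>

lemma act_eval:
 assumes x: "x \<in> carrier A" and y: "y \<in> carrier M" and pt: "point G V r d"
 shows "hat G (ind_map K G (tens A M x y)) V r d = (\<Sum>S\<in>stab r V. ihat x S r d * hat G y (V - S) r d)"
proof -
 have t: "tens A M x y \<in> carrier AM" using keys_tens[OF A.T.tgroup_axioms M.T.tgroup_axioms x y] by simp
 show ?thesis unfolding ind_map_eval[OF t pt]
  by (rule sum.cong[OF refl], rule lin_tens[OF A.T.tgroup_axioms M.T.tgroup_axioms x y])
   (rule add_fun_ihat, rule point_stab(1)[OF pt], assumption, rule M.add_fun_hat, rule point_stab(2)[OF pt], assumption)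
qed

end

section \<open>Equality tests in tensor products, and restriction\<close>

context rep_pair begin

lemma tensor_eqI_raw:
 assumes t: "t \<in> carrier AM" and t': "t' \<in> carrier AM"
  and eq: "!!a b g h. g \<in> carrier (wreath a K) ==> h \<in> carrier (wreath b G) ==>
   lin t (%(w, v). kch (wreath a K) (w a) g * kch (wreath b G) (v b) h)
   = lin t' (%(w, v). kch (wreath a K) (w a) g * kch (wreath b G) (v b) h)"
 shows "t = t'"
proof (rule tgroup.separates_eq[OF tgroup_tensor separates_tensor[OF A.separates_M M.separates_M] _ t t'])
 fix p assume "p \<in> A.Pts \<times> M.Pts"
 then obtain a g b h where p: "p = ((a, g), (b, h))" "g \<in> carrier (wreath a K)" "h \<in> carrier (wreath b G)" by auto
 show "add_fun AM ((case p of (p, q) => %t. lin t (%(w, v). A.ev p w * M.ev q v)))"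
  by (simp add: case_prod_beta add_fun_tensor)
 show "(case p of (p, q) => %t. lin t (%(w, v). A.ev p w * M.ev q v)) t = (case p of (p, q) => %t. lin t (%(w, v). A.ev p w * M.ev q v)) t'"
  using eq[OF p(2,3)] by (simp add: p(1) A.ev_def M.ev_def)
qed

lemma raw_hat:
 assumes "presents G n b r d g" "b ` {1..n} = V" "x \<in> carrier M"
 shows "kch (wreath n G) (x n) g = hat G x V r d"
 using hat_presents[OF G.finite_group_axioms M.M_RG[OF assms(3)] assms(1,2)] by simp

lemma raw_hat_K:
 assumes "presents K n b r d g" "b ` {1..n} = V" "x \<in> carrier A"
 shows "kch (wreath n K) (x n) g = hat K x V r d"
 using hat_presents[OF finite_group_K A.M_RG[OF assms(3)] assms(1,2)] by simp

abbreviation E2 where "E2 V1 V2 r d t \<equiv> lin t (%(w, v). hat K w V1 r d * hat G v V2 r d)"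

text \<open>Two group elements can be placed on adjacent blocks by \<open>shift_presents\<close>, so
  testing at disjoint sets with a common \<open>r\<close> and \<open>d\<close> is enough. These are
  exactly the arguments at which \<open>res_eval\<close> applies.\<close>

lemma tensor_eqI:
 assumes t: "t \<in> carrier AM" and t': "t' \<in> carrier AM"
  and eq: "!!V1 V2 r d. V1 \<inter> V2 = {} ==> point K V1 r d ==> point G V2 r d ==>
   E2 V1 V2 r d t = E2 V1 V2 r d t'"
 shows "t = t'"
proof (rule tensor_eqI_raw[OF t t'])
 fix a b g h assume g: "g \<in> carrier (wreath a K)" and h: "h \<in> carrier (wreath b G)"
 obtain r0 d0 where 1: "presents K a (%i. i + 0) r0 d0 g" using shift_presents[OF g, of 0] by blast
 obtain r d where 2: "presents G b (%i. i + a) r d h" "\<forall>j\<le>a. r j = r0 j & d j = d0 j" using shift_presents[OF h, of a r0 d0] by blast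
 have 3: "presents K a (%i. i + 0) r d g" by (rule presents_cong[OF 1]) (use 2(2) in auto)
 note V1 = image_shift[of 0 a] and V2 = image_shift[of a b]
 have dis: "{0 + 1..0 + a} \<inter> {a + 1..a + b} = {}" by auto
 have e: "lin s (%(w, v). kch (wreath a K) (w a) g * kch (wreath b G) (v b) h)
  = lin s (%(w, v). hat K w {0 + 1..0 + a} r d * hat G v {a + 1..a + b} r d)" if "s \<in> carrier AM" for s
  by (rule lin_AM_cong[OF that]) (simp only: raw_hat_K[OF 3 V1] raw_hat[OF 2(1) V2])
 show "lin t (%(w, v). kch (wreath a K) (w a) g * kch (wreath b G) (v b) h)
   = lin t' (%(w, v). kch (wreath a K) (w a) g * kch (wreath b G) (v b) h)"
  unfolding e[OF t] e[OF t']
  by (rule eq[OF dis presents_point[OF 3, unfolded V1] presents_point[OF 2(1), unfolded V2]])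
qed

text \<open>The same device with three adjacent blocks, for coassociativity; the nesting follows
  that of the tensor product.\<close>

lemma tensor3_eqI:
 assumes t: "t \<in> carrier (tensor A AM)" and t': "t' \<in> carrier (tensor A AM)"
  and eq: "!!V1 V2 V3 r d. V1 \<inter> V2 = {} ==> V1 \<inter> V3 = {} ==> V2 \<inter> V3 = {} ==>
   point K V1 r d ==> point K V2 r d ==> point G V3 r d ==>
   lin t (%(w, s). hat K w V1 r d * lin s (%(u, v). hat K u V2 r d * hat G v V3 r d))
   = lin t' (%(w, s). hat K w V1 r d * lin s (%(u, v). hat K u V2 r d * hat G v V3 r d))"
 shows "t = t'"
proof (rule tgroup.separates_eq[OF tgroup_tensor separates_tensor[OF A.separates_M separates_tensor[OF A.separates_M M.separates_M]] _ t t'])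
 let ?E = "%(p, q) t. lin t (%(w, s). A.ev p w * (case q of (p, q) => %t. lin t (%(w, v). A.ev p w * M.ev q v)) s)"
 fix p assume "p \<in> A.Pts \<times> A.Pts \<times> M.Pts"
 then obtain a g b h c k where p: "p = ((a, g), (b, h), (c, k))" "g \<in> carrier (wreath a K)" "h \<in> carrier (wreath b K)" "k \<in> carrier (wreath c G)" by auto
 show "add_fun (tensor A AM) (?E p)" by (simp add: case_prod_beta add_fun_tensor)
 obtain r0 d0 where 1: "presents K a (%i. i + 0) r0 d0 g" using shift_presents[OF p(2), of 0] by blast
 obtain r1 d1 where 2: "presents K b (%i. i + a) r1 d1 h" "\<forall>j\<le>a. r1 j = r0 j & d1 j = d0 j" using shift_presents[OF p(3), of a r0 d0] by blast
 obtain r d where 3: "presents G c (%i. i + (a + b)) r d k" "\<forall>j\<le>a + b. r j = r1 j & d j = d1 j" using shift_presents[OF p(4), of "a + b" r1 d1] by blast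
 have 4: "presents K a (%i. i + 0) r d g" by (rule presents_cong[OF 1]) (use 2(2) 3(2) in auto)
 have 5: "presents K b (%i. i + a) r d h" by (rule presents_cong[OF 2(1)]) (use 3(2) in auto)
 note V1 = image_shift[of 0 a] and V2 = image_shift[of a b] and V3 = image_shift[of "a + b" c]
 let ?V1 = "{0 + 1..0 + a}" and ?V2 = "{a + 1..a + b}" and ?V3 = "{a + b + 1..a + b + c}"
 have dis: "?V1 \<inter> ?V2 = {}" "?V1 \<inter> ?V3 = {}" "?V2 \<inter> ?V3 = {}" by auto
 have e: "?E p s = lin s (%(w, s). hat K w ?V1 r d * lin s (%(u, v). hat K u ?V2 r d * hat G v ?V3 r d))"
  if s: "s \<in> carrier (tensor A AM)" for s
 proof -
  have "?E p s = lin s (%(w, s). A.ev (a, g) w * lin s (%(u, v). A.ev (b, h) u * M.ev (c, k) v))" by (simp add: p(1))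
  also have "... = lin s (%(w, s). hat K w ?V1 r d * lin s (%(u, v). hat K u ?V2 r d * hat G v ?V3 r d))"
  proof (rule lin_cong)
   fix q assume "q \<in> keys s"
   then have "q \<in> irr A \<times> irr AM" using s by auto
   then obtain w u v where q: "q = (w, frag_of (u, v))" "w \<in> irr A" "u \<in> irr A" "v \<in> irr M" by auto
   have c: "w \<in> carrier A" "u \<in> carrier A" "v \<in> carrier M" using q A.irr_M_closed M.irr_M_closed by auto
   show "(case q of (w, s) => A.ev (a, g) w * lin s (%(u, v). A.ev (b, h) u * M.ev (c, k) v))
    = (case q of (w, s) => hat K w ?V1 r d * lin s (%(u, v). hat K u ?V2 r d * hat G v ?V3 r d))"
    using raw_hat_K[OF 4 V1 c(1)] raw_hat_K[OF 5 V2 c(2)] raw_hat[OF 3(1) V3 c(3)]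
    by (simp add: q(1) A.ev_def M.ev_def)
  qed
  finally show ?thesis .
 qed
 show "?E p t = ?E p t'" unfolding e[OF t] e[OF t']
  by (rule eq[OF dis presents_point[OF 4, unfolded V1] presents_point[OF 5, unfolded V2] presents_point[OF 3(1), unfolded V3]])
qed

abbreviation res_part where
 "res_part x n k \<equiv> K0_split (wreath k K) (wreath (n - k) G)
   (K0_map (wreath n G) (WP k (n - k)) (res_rep (wreath_emb k (n - k))) (x n))"

lemma res_part:
 assumes x: "x \<in> carrier M" and k: "k \<le> n"
 shows "keys (res_part x n k) \<subseteq> irr (KW k K) \<times> irr (KW (n - k) G)"
  and "g \<in> carrier (wreath k K) ==> h \<in> carrier (wreath (n - k) G) ==>
   lin (res_part x n k) (%(C, D). kch (wreath k K) C g * kch (wreath (n - k) G) D h) = kch (wreath n G) (x n) (wreath_emb k (n - k) (g, h))"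
proof -
 interpret I: inclusion "wreath n G" "WP k (n - k)" "wreath_emb k (n - k)" by (rule inclusion_emb'[OF k])
 note R = K0_res[OF M.finite_group_W finite_group_DirProd[OF A.finite_group_W M.finite_group_W] I.\<iota>_hom M.M_comp[OF x]]
 note S = K0_split[OF A.finite_group_W M.finite_group_W R(1)]
 show "keys (res_part x n k) \<subseteq> irr (KW k K) \<times> irr (KW (n - k) G)" by (rule S(1))
 assume "g \<in> carrier (wreath k K)" "h \<in> carrier (wreath (n - k) G)"
 then show "lin (res_part x n k) (%(C, D). kch (wreath k K) C g * kch (wreath (n - k) G) D h) = kch (wreath n G) (x n) (wreath_emb k (n - k) (g, h))"
  using S(2) R(2)[of "(g, h)"] by simp
qed

lemma res_map_eq:
 "res_map K G x = (\<Sum>n | x n ~= \<one>\<^bsub>KW n G\<^esub>. \<Sum>k\<le>n.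
   frag_extend (%p. frag_of (R_inj K k (fst p), R_inj G (n - k) (snd p))) (res_part x n k))"
 by (simp add: res_map_def case_prod_unfold)

lemma keys_res_map:
 assumes x: "x \<in> carrier M" and p: "p \<in> keys (res_map K G x)"
 shows "\<exists>n k C D. x n ~= \<one>\<^bsub>KW n G\<^esub> & k \<le> n & C \<in> irr (KW k K) & D \<in> irr (KW (n - k) G)
  & p = (R_inj K k C, R_inj G (n - k) D)"
proof -
 let ?S = "{p. \<exists>n k C D. x n ~= \<one>\<^bsub>KW n G\<^esub> & k \<le> n & C \<in> irr (KW k K) & D \<in> irr (KW (n - k) G)
  & p = (R_inj K k C, R_inj G (n - k) D)}"
 have "keys (res_map K G x) \<subseteq> ?S" unfolding res_map_eq
 proof (intro keys_sum_subset keys_frag_extend_subset)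
  fix n k q assume n: "n \<in> {n. x n ~= \<one>\<^bsub>KW n G\<^esub>}" and k: "k \<in> {..n}" and q: "q \<in> keys (res_part x n k)"
  have k': "k \<le> n" using k by simp
  have "q \<in> irr (KW k K) \<times> irr (KW (n - k) G)" by (rule subsetD[OF res_part(1)[OF x k'] q])
  then have "fst q \<in> irr (KW k K)" "snd q \<in> irr (KW (n - k) G)" by auto
  with n k' have "(R_inj K k (fst q), R_inj G (n - k) (snd q)) \<in> ?S" by blast
  then show "keys (frag_of (R_inj K k (fst q), R_inj G (n - k) (snd q))) \<subseteq> ?S" by (simp add: keys_frag_of)
 qed
 then show ?thesis using p by blast
qed

lemma res_map_closed: "x \<in> carrier M ==> res_map K G x \<in> carrier AM"
proof -
 assume x: "x \<in> carrier M"
 have "p \<in> irr A \<times> irr M" if p: "p \<in> keys (res_map K G x)" for p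
 proof -
  obtain n k C D where "C \<in> irr (KW k K)" "D \<in> irr (KW (n - k) G)" "p = (R_inj K k C, R_inj G (n - k) D)"
   using keys_res_map[OF x p] by blast
  then show ?thesis using A.irr_MI M.irr_MI by simp
 qed
 then show ?thesis by auto
qed

lemma res_map_graded: "graded_map M AM (res_map K G)"
 unfolding graded_map_def
proof (intro allI subsetI)
 fix n z assume "z \<in> res_map K G ` grade M n"
 then obtain x where x: "x \<in> grade M n" "z = res_map K G x" by blast
 have xc: "x \<in> carrier M" using x(1) by (simp add: M.grade_iff)
 have "\<exists>k l. k + l = n & fst p \<in> grade A k & snd p \<in> grade M l" if p: "p \<in> keys z" for p
 proof -
  obtain m k C D where m: "x m ~= \<one>\<^bsub>KW m G\<^esub>" "k \<le> m" "C \<in> irr (KW k K)" "D \<in> irr (KW (m - k) G)"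
   "p = (R_inj K k C, R_inj G (m - k) D)"
   using keys_res_map[OF xc] p unfolding x(2) by blast
  have "m = n" using m(1) x(1) by (auto simp: M.grade_iff)
  moreover have "fst p \<in> grade A k" "snd p \<in> grade M (m - k)"
   using A.R_inj_grade[OF m(3)] M.R_inj_grade[OF m(4)] unfolding m(5) by simp_all
  ultimately show ?thesis using m(2) by (intro exI[of _ k] exI[of _ "m - k"]) simp
 qed
 then have "\<forall>(w, v)\<in>keys z. \<exists>k l. k + l = n & w \<in> grade A k & v \<in> grade M l" by auto
 moreover have "z \<in> carrier AM" unfolding x(2) by (rule res_map_closed[OF xc])
 ultimately show "z \<in> grade AM n" by (simp add: tensor_def)
qed

text \<open>In the double sum defining \<open>res_map\<close> only the summand with
  \<open>n = a + b\<close> and \<open>k = a\<close> lives in degrees \<open>a\<close> and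
  \<open>b\<close>.\<close>

lemma res_raw:
 assumes x: "x \<in> carrier M" and g: "g \<in> carrier (wreath a K)" and h: "h \<in> carrier (wreath b G)"
 shows "lin (res_map K G x) (%(w, v). kch (wreath a K) (w a) g * kch (wreath b G) (v b) h) = kch (wreath (a + b) G) (x (a + b)) (wreath_emb a b (g, h))"
proof -
 let ?N = "{n. x n ~= \<one>\<^bsub>KW n G\<^esub>}"
 let ?F = "kch (wreath (a + b) G) (x (a + b)) (wreath_emb a b (g, h))"
 have fN: "finite ?N" using x by (simp add: M.carrier_M)
 have part: "lin (res_part x n k) (%p. kch (wreath a K) (R_inj K k (fst p) a) g * kch (wreath b G) (R_inj G (n - k) (snd p) b) h)
  = (if n = a + b then if k = a then ?F else 0 else 0)" if k: "k \<le> n" for n k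
 proof (cases "k = a & n - k = b")
  case True
  then have n: "n = a + b" "k = a" using k by auto
  have "lin (res_part x (a + b) a) (%p. kch (wreath a K) (R_inj K a (fst p) a) g * kch (wreath b G) (R_inj G (a + b - a) (snd p) b) h)
   = lin (res_part x (a + b) a) (%(C, D). kch (wreath a K) C g * kch (wreath (a + b - a) G) D h)"
   by (simp add: R_inj_same case_prod_unfold)
  also have "... = kch (wreath (a + b) G) (x (a + b)) (wreath_emb a (a + b - a) (g, h))"
   by (rule res_part(2)[OF x]) (use g h in simp_all)
  finally show ?thesis unfolding n by simp
 next
  case False
  have z: "kch (wreath a K) (R_inj K k C a) g * kch (wreath b G) (R_inj G (n - k) D b) h = 0" for C D
  proof (cases "a = k")
   case True
   then have "b ~= n - k" using False by auto
   then show ?thesis using finite_group.kch_one[OF M.finite_group_W h] by (simp add: R_inj_other)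
  next
   case False
   then show ?thesis using finite_group.kch_one[OF A.finite_group_W g] by (simp add: R_inj_other)
  qed
  have "\<not> (n = a + b & k = a)" using False by auto
  then show ?thesis unfolding z by auto
 qed
 have "lin (res_map K G x) (%(w, v). kch (wreath a K) (w a) g * kch (wreath b G) (v b) h)
  = (\<Sum>n\<in>?N. \<Sum>k\<le>n. lin (res_part x n k) (%p. kch (wreath a K) (R_inj K k (fst p) a) g * kch (wreath b G) (R_inj G (n - k) (snd p) b) h))"
  unfolding res_map_eq by (simp add: lin_sum lin_extend)
 also have "... = (\<Sum>n\<in>?N. \<Sum>k\<le>n. if n = a + b then if k = a then ?F else 0 else 0)"
  by (intro sum.cong refl part) simp
 also have "... = (\<Sum>n\<in>?N. if n = a + b then ?F else 0)" by (rule sum.cong[OF refl]) (simp add: sum.delta)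
 also have "... = (if a + b \<in> ?N then ?F else 0)" using fN by (rule sum.delta)
 also have "... = ?F"
 proof (cases "a + b \<in> ?N")
  \<comment> \<open>The outer sum skips this degree, but then the right side is a character value of
    the zero class.\<close>
  case False
  have e: "wreath_emb a b (g, h) \<in> carrier (wreath (a + b) G)" by (rule wreath_emb_closed[OF wreath_K_sub[OF g] h])
  then show ?thesis using False finite_group.kch_one[OF M.finite_group_W e] by simp
 qed simp
 finally show ?thesis .
qed

lemma res_eval:
 assumes x: "x \<in> carrier M" and p1: "point K V1 r d" and p2: "point G V2 r d" and dis: "V1 \<inter> V2 = {}"
 shows "E2 V1 V2 r d (res_map K G x) = hat G x (V1 \<union> V2) r d"
proof -
 let ?a = "card V1" and ?b = "card V2"
 obtain b1 g1 where 1: "b1 ` {1..?a} = V1" "inj_on b1 {1..?a}" "presents K ?a b1 r d g1" by (rule point_presents[OF p1])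
 obtain b2 g2 where 2: "b2 ` {1..?b} = V2" "inj_on b2 {1..?b}" "presents G ?b b2 r d g2" by (rule point_presents[OF p2])
 have g1: "g1 \<in> carrier (wreath ?a K)" and g2: "g2 \<in> carrier (wreath ?b G)" using 1(3) 2(3) by (simp_all add: presents_def)
 have dis': "b1 ` {1..?a} \<inter> b2 ` {1..?b} = {}" using dis 1(1) 2(1) by simp
 note E = wreath_emb_presents[OF presents_K_imp[OF 1(3)] 2(3) dis']
 have im: "(%i. if i \<le> ?a then b1 i else b2 (i - ?a)) ` {1..?a + ?b} = V1 \<union> V2" unfolding emb_index_image 1(1) 2(1) ..
 have "E2 V1 V2 r d (res_map K G x)
  = lin (res_map K G x) (%(w, v). kch (wreath ?a K) (w ?a) g1 * kch (wreath ?b G) (v ?b) g2)"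
  by (rule lin_AM_cong[OF res_map_closed[OF x]]) (simp only: raw_hat_K[OF 1(3,1)] raw_hat[OF 2(3,1)])
 also have "... = kch (wreath (?a + ?b) G) (x (?a + ?b)) (wreath_emb ?a ?b (g1, g2))" by (rule res_raw[OF x g1 g2])
 also have "... = hat G x (V1 \<union> V2) r d" by (rule raw_hat[OF E im x])
 finally show ?thesis .
qed

lemma res_map_hom: "res_map K G \<in> hom M AM"
proof (rule homI)
 fix x y assume x: "x \<in> carrier M" and y: "y \<in> carrier M"
 have s: "res_map K G x + res_map K G y \<in> carrier AM"
  using res_map_closed[OF x] res_map_closed[OF y] keys_add[of "res_map K G x" "res_map K G y"] by auto
 have "res_map K G (x \<otimes>\<^bsub>M\<^esub> y) = res_map K G x + res_map K G y"
 proof (rule tensor_eqI_raw[OF res_map_closed[OF M.M.m_closed[OF x y]] s])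
  fix a b g h assume g: "g \<in> carrier (wreath a K)" and h: "h \<in> carrier (wreath b G)"
  have e: "wreath_emb a b (g, h) \<in> carrier (wreath (a + b) G)" by (rule wreath_emb_closed[OF wreath_K_sub[OF g] h])
  have "kch (wreath (a + b) G) ((x \<otimes>\<^bsub>M\<^esub> y) (a + b)) (wreath_emb a b (g, h))
   = kch (wreath (a + b) G) (x (a + b)) (wreath_emb a b (g, h)) + kch (wreath (a + b) G) (y (a + b)) (wreath_emb a b (g, h))"
   by (rule add_fun_mult[OF M.add_fun_comp[OF finite_group.add_fun_kch[OF M.finite_group_W e]] x y])
  then show "lin (res_map K G (x \<otimes>\<^bsub>M\<^esub> y)) (%(w, v). kch (wreath a K) (w a) g * kch (wreath b G) (v b) h)
   = lin (res_map K G x + res_map K G y) (%(w, v). kch (wreath a K) (w a) g * kch (wreath b G) (v b) h)"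
   unfolding lin_add res_raw[OF M.M.m_closed[OF x y] g h] res_raw[OF x g h] res_raw[OF y g h] .
 qed
 then show "res_map K G (x \<otimes>\<^bsub>M\<^esub> y) = res_map K G x \<otimes>\<^bsub>AM\<^esub> res_map K G y" by simp
qed (rule res_map_closed)

section \<open>Adjointness\<close>

text \<open>Frobenius reciprocity on irreducibles: the scalar product with the restriction of
  \<open>u\<close> factors over the two wreath products and reads off a coefficient. Being a
  multiplicity in an actual representation it is also a natural number, which gives positivity of
  induction and of restriction.\<close>

lemma rdual_ind_pair:
 assumes w: "w \<in> irr A" and v: "v \<in> irr M" and u: "u \<in> irr M"
 shows "M.rdual u (ind_pair w v) = of_int (lookup (res_map K G u) (w, v))"
  and "M.rdual u (ind_pair w v) \<in> \<nat>"
proof -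
 obtain a C where C: "C \<in> irr (KW a K)" "w = R_inj K a C" by (rule A.irr_M_cases[OF w])
 obtain b D where D: "D \<in> irr (KW b G)" "v = R_inj G b D" by (rule M.irr_M_cases[OF v])
 obtain n E where E: "E \<in> irr (KW n G)" "E \<in> carrier (KW n G)" "u = R_inj G n E" by (rule M.irr_M_cases[OF u])
 let ?W = "WP a b" and ?X = "wreath (a + b) G" and ?\<iota> = "wreath_emb a b"
 interpret WA: finite_group "wreath a K" by (rule A.finite_group_W)
 interpret WB: finite_group "wreath b G" by (rule M.finite_group_W)
 interpret X: finite_group ?X by (rule M.finite_group_W)
 interpret W: finite_group ?W by (rule finite_group_DirProd[OF A.finite_group_W M.finite_group_W])
 interpret I: inclusion ?X ?W ?\<iota> by (rule inclusion_emb)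
 have uc: "u \<in> carrier M" using u M.irr_M_closed by blast
 have rd: "M.rdual u (ind_pair w v) = K0_dual (wreath n G) E (ind_pair w v n)" unfolding E(3) by (rule M.rdual_R_inj[OF E(1)])
 let ?\<phi> = "%(g, h). kch (wreath a K) C g * kch (wreath b G) D h"
 have wg: "w \<in> grade A a" "v \<in> grade M b" using A.R_inj_grade[OF C(1)] M.R_inj_grade[OF D(1)] C(2) D(2) by simp_all
 have zero: "ind_pair w v n = \<one>\<^bsub>KW n G\<^esub>" if "n ~= a + b"
  using ind_pair_grade[OF wg] that by (simp add: M.grade_iff)
 have zero': "K0_dual (wreath n G) E \<one>\<^bsub>KW n G\<^esub> = 0"
 proof -
  interpret Kn: comm_group "KW n G" by (rule M.comm_group_W)
  show ?thesis by (rule Kn.add_fun_one[OF finite_group.add_fun_K0_dual[OF M.finite_group_W]])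
 qed
 have uab: "u (a + b) \<in> carrier (K0 ?X)" by (rule M.M_comp[OF uc])
 \<comment> \<open>Moves the multiplicity to degree \<open>a + b\<close>, where reciprocity applies;
   if \<open>u\<close> has another degree, both sides vanish.\<close>
 have lhs: "M.rdual u (ind_pair w v) = bform ?X (kch ?X (ind_pair w v (a + b))) (kch ?X (u (a + b)))"
 proof (cases "n = a + b")
  case True
  have "u (a + b) = E" unfolding E(3) True by (rule R_inj_same)
  then show ?thesis unfolding rd K0_dual_def True by simp
 next
  case False
  then have "u (a + b) = \<one>\<^bsub>K0 ?X\<^esub>" unfolding E(3) by (intro R_inj_other) simp
  then have "bform ?X (kch ?X (ind_pair w v (a + b))) (kch ?X (u (a + b))) = bform ?X (kch ?X (ind_pair w v (a + b))) (%_. 0)"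
   by (intro X.bform_cong) (simp_all add: X.kch_one)
  then show ?thesis unfolding rd zero[OF False] zero' by (simp add: bform_def)
 qed
 have "bform ?X (kch ?X (ind_pair w v (a + b))) (kch ?X (u (a + b))) = bform ?X (I.ind_fun ?\<phi>) (kch ?X (u (a + b)))"
  by (rule X.bform_cong) (simp_all add: C(2) D(2) kch_ind_pair_irr[OF C(1) D(1)])
 also have "... = bform ?W ?\<phi> (%h. kch ?X (u (a + b)) (?\<iota> h))" by (rule I.frobenius_reciprocity[OF uab])
 also have "... = bform ?W (%h. kch ?X (u (a + b)) (?\<iota> h)) ?\<phi>" by (rule W.bform_sym)
 also have "... = bform ?W (%q. lin (res_map K G u) (%p. kch (wreath a K) (fst p a) (fst q) * kch (wreath b G) (snd p b) (snd q))) ?\<phi>"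
 proof (rule W.bform_cong[OF _ refl])
  fix q assume "q \<in> carrier ?W"
  then have q: "fst q \<in> carrier (wreath a K)" "snd q \<in> carrier (wreath b G)" by (auto simp: DirProd_def)
  show "kch ?X (u (a + b)) (?\<iota> q) = lin (res_map K G u) (%p. kch (wreath a K) (fst p a) (fst q) * kch (wreath b G) (snd p b) (snd q))"
   using res_raw[OF uc q] by (simp add: case_prod_unfold)
 qed
 also have "... = lin (res_map K G u) (%p. bform ?W (%q. kch (wreath a K) (fst p a) (fst q) * kch (wreath b G) (snd p b) (snd q)) ?\<phi>)"
  by (rule bform_lin)
 also have "... = lin (res_map K G u) (%p. K0_dual (wreath a K) C (fst p a) * K0_dual (wreath b G) D (snd p b))"
  unfolding K0_dual_def by (rule lin_cong) (rule bform_DirProd[OF WA.is_group WB.is_group], simp_all)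
 also have "... = lin (res_map K G u) (%p. if p = (w, v) then 1 else 0)"
 proof (rule lin_cong)
  fix p assume "p \<in> keys (res_map K G u)"
  then have p: "fst p \<in> irr A" "snd p \<in> irr M" using res_map_closed[OF uc] by auto
  have "K0_dual (wreath a K) C (fst p a) = A.rdual w (fst p)" unfolding C(2) by (rule A.rdual_R_inj[OF C(1), symmetric])
  moreover have "K0_dual (wreath b G) D (snd p b) = M.rdual v (snd p)" unfolding D(2) by (rule M.rdual_R_inj[OF D(1), symmetric])
  ultimately show "K0_dual (wreath a K) C (fst p a) * K0_dual (wreath b G) D (snd p b) = (if p = (w, v) then 1 else 0)"
   using A.dual_system_M M.dual_system_M p w v by (cases p) (simp add: dual_system_def)
 qed
 also have "... = of_int (lin (res_map K G u) (%p. if p = (w, v) then 1 else 0))"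
  by (subst lin_of_int[symmetric]) (rule lin_cong, simp)
 also have "... = of_int (lookup (res_map K G u) (w, v))" by (simp only: lookup_eq_lin)
 finally show "M.rdual u (ind_pair w v) = of_int (lookup (res_map K G u) (w, v))" unfolding lhs .
 show "M.rdual u (ind_pair w v) \<in> \<nat>"
 proof (cases "n = a + b")
  case True
  obtain \<rho> where \<rho>: "is_rep ?X \<rho>" "ind_pair w v (a + b) = K0_class ?X (frag_of \<rho>)"
   using ind_pair_irr(2)[OF C(1) D(1)] unfolding C(2) D(2) by blast
  have "E \<in> irr (K0 ?X)" using E(1) True by simp
  from X.K0_dual_rep_Nats[OF \<rho>(1) this] show ?thesis unfolding rd True \<rho>(2) .
 next
  case False
  show ?thesis unfolding rd zero[OF False] zero' by simp
 qed
qed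

lemma lookup_coords_ind:
 assumes t: "t \<in> carrier AM" and u: "u \<in> irr M"
 shows "lookup (coords M (ind_map K G t)) u = lin t (%p. lookup (res_map K G u) p)"
proof -
 have "(of_int (lookup (coords M (ind_map K G t)) u) :: complex) = M.rdual u (ind_map K G t)"
  by (rule M.T.lookup_coords[OF M.dual_system_M ind_map_closed[OF t] u])
 also have "... = lin t (%(w, v). M.rdual u (ind_pair w v))"
  by (rule add_fun_ind_map[OF _ t]) (use M.dual_system_M u in \<open>simp add: dual_system_def\<close>)
 also have "... = lin t (%(w, v). of_int (lookup (res_map K G u) (w, v)))"
  by (rule lin_AM_cong[OF t]) (rule rdual_ind_pair(1)[OF _ _ u])
 also have "... = of_int (lin t (%p. lookup (res_map K G u) p))"
  by (simp add: lin_of_int case_prod_unfold)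
 finally show ?thesis by (simp only: of_int_eq_iff)
qed

lemma lookup_res_nonneg:
 assumes u: "u \<in> irr M" shows "0 \<le> lookup (res_map K G u) p"
proof (cases "p \<in> irr A \<times> irr M")
 case True
 then have p: "fst p \<in> irr A" "snd p \<in> irr M" by auto
 obtain n where "M.rdual u (ind_pair (fst p) (snd p)) = of_nat n" using rdual_ind_pair(2)[OF p u] by (rule Nats_cases)
 then have "(of_int (lookup (res_map K G u) p) :: complex) = of_int (int n)"
  using rdual_ind_pair(1)[OF p u] by simp
 then show ?thesis by (simp only: of_int_eq_iff)
next
 case False
 then have "p \<notin> keys (res_map K G u)" using res_map_closed u M.irr_M_closed by auto
 then show ?thesis by (simp add: in_keys_iff)
qed

lemma lin_nonneg: "(!!b. b \<in> keys c ==> 0 \<le> lookup c b * u b) ==> (0::int) \<le> lin c u"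
 unfolding lin_def by (rule sum_nonneg) simp

lemma ind_map_positive: "positive_map AM M (ind_map K G)"
 unfolding positive_map_def
proof
 fix z assume "z \<in> ind_map K G ` positive AM"
 then obtain t where t: "t \<in> positive AM" "z = ind_map K G t" by blast
 note pos = tgroup.positive_iff[OF tgroup_tensor, of t A M]
 have tc: "t \<in> carrier AM" using t(1) pos by blast
 have tl: "0 \<le> lookup t p" if "p \<in> keys t" for p
 proof -
  have "frag_of p \<in> irr AM" using that tc by auto
  then have "0 \<le> lookup (coords AM t) (frag_of p)" using t(1) pos by blast
  then show ?thesis unfolding lookup_coords_tensor[OF tc] .
 qed
 have "0 \<le> lookup (coords M z) u" if u: "u \<in> irr M" for u
  unfolding t(2) lookup_coords_ind[OF tc u] by (rule lin_nonneg) (simp add: tl lookup_res_nonneg[OF u])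
 then show "z \<in> positive M" unfolding M.T.positive_iff t(2) using ind_map_closed[OF tc] by simp
qed

lemma lookup_res:
 assumes x: "x \<in> carrier M"
 shows "lookup (res_map K G x) p = lin (coords M x) (%u. lookup (res_map K G u) p)"
proof -
 have "add_fun M (%u. lookup (res_map K G u) p)"
  using hom_mult[OF res_map_hom] by (simp add: add_fun_def lookup_add)
 from M.T.lin_coords[OF this x] show ?thesis by simp
qed

lemma res_map_positive: "positive_map M AM (res_map K G)"
 unfolding positive_map_def
proof
 fix z assume "z \<in> res_map K G ` positive M"
 then obtain x where x: "x \<in> positive M" "z = res_map K G x" by blast
 have xc: "x \<in> carrier M" and xl: "!!u. u \<in> irr M ==> 0 \<le> lookup (coords M x) u"
  using x(1) unfolding M.T.positive_iff by simp_all
 have zc: "z \<in> carrier AM" unfolding x(2) by (rule res_map_closed[OF xc])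
 have zp: "0 \<le> lookup z p" for p unfolding x(2) lookup_res[OF xc]
 proof (rule lin_nonneg)
  fix u assume "u \<in> keys (coords M x)"
  then have "u \<in> irr M" using M.T.keys_coords[OF xc] by blast
  then show "0 \<le> lookup (coords M x) u * lookup (res_map K G u) p" using xl lookup_res_nonneg by simp
 qed
 have "0 \<le> lookup (coords AM z) w" if w: "w \<in> irr AM" for w
 proof -
  obtain p where p: "w = frag_of p" using w by auto
  show ?thesis unfolding p lookup_coords_tensor[OF zc] by (rule zp)
 qed
 then show "z \<in> positive AM" unfolding tgroup.positive_iff[OF tgroup_tensor] using zc by simp
qed

text \<open>In coordinates both pairings are the same double sum over the multiplicities of
  \<open>rdual_ind_pair\<close>, taken in the two orders.\<close>

lemma ind_res_adjoint: "adjoint_maps AM M (ind_map K G) (res_map K G)"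
 unfolding adjoint_maps_def
proof (intro ballI)
 fix t y assume t: "t \<in> carrier AM" and y: "y \<in> carrier M"
 have "pairing M (ind_map K G t) y = pairing M y (ind_map K G t)" by (rule M.T.pairing_commute)
 also have "... = lin (coords M y) (%u. lookup (coords M (ind_map K G t)) u)"
 proof -
  have "of_int (pairing M y (ind_map K G t)) = lin (coords M y) (%u. of_int (lookup (coords M (ind_map K G t)) u) :: int)"
   by (rule M.T.pairing_eq_lin)
  then show ?thesis by simp
 qed
 also have "... = lin (coords M y) (%u. lin t (%p. lookup (res_map K G u) p))"
  by (rule lin_cong) (use lookup_coords_ind[OF t] M.T.keys_coords[OF y] in auto)
 also have "... = lin t (%p. lookup (res_map K G y) p)" unfolding lookup_res[OF y] by (rule lin_swap)
 also have "... = lin (coords AM t) (%w. lookup (coords AM (res_map K G y)) w)"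
  unfolding lin_coords_tensor[OF t] lookup_coords_tensor[OF res_map_closed[OF y]] ..
 also have "... = pairing AM t (res_map K G y)"
 proof -
  have "of_int (pairing AM t (res_map K G y)) = lin (coords AM t) (%u. of_int (lookup (coords AM (res_map K G y)) u) :: int)"
   by (rule tgroup.pairing_eq_lin[OF tgroup_tensor])
  then show ?thesis by simp
 qed
 finally show "pairing M (ind_map K G t) y = pairing AM t (res_map K G y)" .
qed

lemma lin_res_tensor_map:
 assumes x: "x \<in> carrier M" and N: "tgroup N" and N': "tgroup N'"
  and f: "!!w. w \<in> carrier A ==> f w \<in> carrier N" and f': "!!v. v \<in> carrier M ==> f' v \<in> carrier N'"
  and e: "add_fun N e" and e': "add_fun N' e'"
 shows "lin (tensor_map N N' f f' (res_map K G x)) (%(w, v). e w * e' v) = lin (res_map K G x) (%(w, v). e (f w) * e' (f' v))"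
proof -
 have "lin (tensor_map N N' f f' (res_map K G x)) (%(w, v). e w * e' v)
  = lin (res_map K G x) (%(a, b). lin (tens N N' (f a) (f' b)) (%(w, v). e w * e' v))"
  by (simp add: tensor_map_def lin_extend case_prod_unfold)
 also have "... = lin (res_map K G x) (%(w, v). e (f w) * e' (f' v))"
  by (rule lin_AM_cong[OF res_map_closed[OF x]]) (rule lin_tens[OF N N' f f' e e'])
 finally show ?thesis .
qed

lemma tensor_map_closed:
 assumes x: "x \<in> carrier M" and N: "tgroup N" and N': "tgroup N'"
  and f: "!!w. w \<in> carrier A ==> f w \<in> carrier N" and f': "!!v. v \<in> carrier M ==> f' v \<in> carrier N'"
 shows "keys (tensor_map N N' f f' (res_map K G x)) \<subseteq> irr N \<times> irr N'"
 unfolding tensor_map_def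
proof (rule keys_frag_extend_subset)
 fix p assume "p \<in> keys (res_map K G x)"
 then have "p \<in> irr A \<times> irr M" using res_map_closed[OF x] by auto
 from irr_pair[OF this] show "keys (case p of (x, y) => tens N N' (f x) (f' y)) \<subseteq> irr N \<times> irr N'"
  using keys_tens[OF N N' f f'] by (simp add: case_prod_beta)
qed

end

section \<open>The unit, the counit and the product on R(G)\<close>

text \<open>Collapses \<open>K\<close> to \<open>G\<close> when the subgroup is all of
  \<open>G\<close>, so that results about pairs specialize to the algebra R(G).\<close>

lemma carrier_update_self: "(G :: ('g, 'm) monoid_scheme)\<lparr>carrier := carrier G\<rparr> = G"
 by (rule monoid.equality) simp_all

context subgroup_pair begin

lemma card_L_mult: "card (carrier G) = card L * card H"
proof -
 interpret F: finite_group K by (rule finite_group_K)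
 interpret I: inclusion G K "%x. x"
  by unfold_locales (auto simp: hom_def H_sub)
 show ?thesis using I.card_transversal by simp
qed

text \<open>\<open>L\<close> represents left cosets and \<open>rcosets\<close> consists of right
  cosets; both numbers are the order of \<open>G\<close> divided by that of
  \<open>H\<close>.\<close>

lemma card_L: "card L = card (rcosets H)"
proof -
 have "H \<subseteq> carrier G" by (rule subsetI) (rule H_sub)
 then have "finite H" using G.finite_carrier by (rule finite_subset)
 then have "card H ~= 0" using H_closed(3) by auto
 moreover have "card (rcosets H) * card H = card L * card H"
  using G.lagrange[OF H] card_L_mult by (simp add: Coset.order_def)
 ultimately show ?thesis by simp
qed

lemma labs_full:
 assumes HG: "H = carrier G" and pt: "point G S r d"
 shows "\<exists>\<tau>. labs S r d = {\<tau>} & (\<forall>j\<in>S. \<tau> j \<in> carrier G)"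
proof -
 have one: "n = 1" if "m = n * m" "m ~= 0" for m n :: nat using that by simp
 have "card (carrier G) ~= 0" using G.finite_carrier G.one_closed by auto
 with card_L_mult[unfolded HG] have "card L = 1" unfolding HG by (rule one)
 then obtain t where t: "L = {t}" by (rule card_1_singletonE)
 have tc: "t \<in> carrier G" by (rule L_sub) (simp add: t)
 have rj: "r j \<in> S" if "j \<in> S" for j using pt that by (auto simp: point_def bij_betw_def)
 have "labs S r d = {\<lambda>j\<in>S. t}"
 proof
  show "labs S r d \<subseteq> {\<lambda>j\<in>S. t}"
  proof
   fix \<tau> assume "\<tau> \<in> labs S r d"
   then have "\<tau> \<in> S \<rightarrow>\<^sub>E {t}" by (simp add: labs_def t)
   then have "\<tau> j = (\<lambda>j\<in>S. t) j" for j by (cases "j \<in> S") (auto simp: PiE_iff extensional_def)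
   then show "\<tau> \<in> {\<lambda>j\<in>S. t}" by (simp add: fun_eq_iff)
  qed
  have "twist r d (\<lambda>j\<in>S. t) j \<in> H" if "j \<in> S" for j
   unfolding HG by (rule twist_closed) (use that rj[OF that] tc pt in \<open>simp_all add: point_def\<close>)
  then show "{\<lambda>j\<in>S. t} \<subseteq> labs S r d" by (simp add: labs_def t)
 qed
 then show ?thesis using tc by auto
qed

text \<open>With a single coset there is one labelling, and twisting by it is a gauge transformation
  over \<open>G\<close>.\<close>

lemma ihat_full:
 assumes HG: "H = carrier G" and x: "x \<in> RG G" and pt: "point G S r d"
 shows "ihat x S r d = hat G x S r d"
proof -
 obtain \<tau> where \<tau>: "labs S r d = {\<tau>}" "\<forall>j\<in>S. \<tau> j \<in> carrier G" using labs_full[OF HG pt] by blast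
 have rj: "r j \<in> S" if "j \<in> S" for j using pt that by (auto simp: point_def bij_betw_def)
 have dc: "d j \<in> carrier G" if "j \<in> S" for j using pt that by (simp add: point_def)
 have tw: "twist r d \<tau> j \<in> carrier G" if "j \<in> S" for j
  by (rule twist_closed) (use that rj[OF that] \<tau>(2) dc[OF that] in simp_all)
 have pt': "point G S r (twist r d \<tau>)" using pt tw by (simp add: point_def)
 have g: "hat G x S r d = hat G x S r (twist r d \<tau>)"
  by (rule hat_gauge[OF G.finite_group_axioms x pt pt', of \<tau>]) (use \<tau>(2) rj dc in \<open>simp_all add: twist_gauge\<close>)
 have "ihat x S r d = hat K x S r (twist r d \<tau>)" unfolding ihat_def \<tau>(1) by simp
 also have "... = hat G x S r (twist r d \<tau>)" by (simp only: HG carrier_update_self)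
 finally show ?thesis unfolding g .
qed

end

section \<open>R(G) as the case H = G, its unit and its counit\<close>

context rep_tgroup begin

lemma self_subgroup_pair: "subgroup_pair G (carrier G)"
 by (rule subgroup_pair.intro[OF finite_group_axioms], rule subgroup_pair_axioms.intro, rule subgroup_self)

lemma self_pair: "rep_pair G (carrier G) M M"
 by (rule rep_pair.intro[OF self_subgroup_pair]) (simp_all only: carrier_update_self rep_tgroup_axioms)

lemmas prod_closed = rep_pair.ind_map_closed[OF self_pair, unfolded carrier_update_self]
 and comult_closed = rep_pair.res_map_closed[OF self_pair, unfolded carrier_update_self]
 and tensor_eqI_self = rep_pair.tensor_eqI[OF self_pair, unfolded carrier_update_self]
 and comult_eval = rep_pair.res_eval[OF self_pair, unfolded carrier_update_self]
 and lin_MM_cong = rep_pair.lin_AM_cong[OF self_pair, unfolded carrier_update_self]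
 and lin_comult_tensor_map = rep_pair.lin_res_tensor_map[OF self_pair, unfolded carrier_update_self]
 and comult_tensor_map_closed = rep_pair.tensor_map_closed[OF self_pair, unfolded carrier_update_self]

abbreviation gprod where "gprod x y \<equiv> ind_map G G (tens M M x y)"

lemma tens_closed: "x \<in> carrier M ==> y \<in> carrier M ==> tens M M x y \<in> carrier (tensor M M)"
 using keys_tens[OF T.tgroup_axioms T.tgroup_axioms] by simp

lemma gprod_closed: "x \<in> carrier M ==> y \<in> carrier M ==> gprod x y \<in> carrier M"
 by (rule prod_closed[OF tens_closed])

lemma gprod_eval:
 assumes x: "x \<in> carrier M" and y: "y \<in> carrier M" and pt: "point G V r d"
 shows "hat G (gprod x y) V r d = (\<Sum>S\<in>stab r V. hat G x S r d * hat G y (V - S) r d)"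
proof -
 have "hat G (gprod x y) V r d = (\<Sum>S\<in>stab r V. subgroup_pair.ihat G (carrier G) x S r d * hat G y (V - S) r d)"
  using rep_pair.act_eval[OF self_pair x y pt] unfolding carrier_update_self .
 also have "... = (\<Sum>S\<in>stab r V. hat G x S r d * hat G y (V - S) r d)"
  by (rule sum.cong[OF refl]) (simp only: subgroup_pair.ihat_full[OF self_subgroup_pair refl M_RG[OF x] point_stab(1)[OF pt]])
 finally show ?thesis .
qed

lemma carrier_wreath_0: "carrier (wreath 0 G) = {\<one>\<^bsub>wreath 0 G\<^esub>}"
proof -
 have "g = \<one>\<^bsub>wreath 0 G\<^esub>" if "g \<in> carrier (wreath 0 G)" for g
 proof -
  obtain p f where g: "g = (p, f)" by (cases g)
  have "p permutes {}" "f \<in> {} \<rightarrow>\<^sub>E carrier G" using that carrier_wreath[of p f 0 G] unfolding g by simp_all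
  then have "p = id" "f = (%_. undefined)" by simp_all
  then show ?thesis unfolding g one_wreath by (auto simp: fun_eq_iff)
 qed
 moreover interpret W: finite_group "wreath 0 G" by (rule finite_group_W)
 have "\<one>\<^bsub>wreath 0 G\<^esub> \<in> carrier (wreath 0 G)" by (rule W.one_closed)
 ultimately show ?thesis by blast
qed

definition trivial_class where "trivial_class = K0_class (wreath 0 G) (frag_of (%_. 1\<^sub>m 1))"

lemma is_rep_trivial: "is_rep (wreath 0 G) (%_. 1\<^sub>m 1)"
 by (simp add: is_rep_def rep_deg_def)

lemma mtr_trivial: "mtr (1\<^sub>m 1) = 1"
 by (simp add: mtr_def)

lemma trivial_class:
 shows trivial_class_closed: "trivial_class \<in> carrier (KW 0 G)"
  and trivial_class_irr: "trivial_class \<in> irr (KW 0 G)"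
  and kch_trivial_class: "kch (wreath 0 G) trivial_class \<one>\<^bsub>wreath 0 G\<^esub> = 1"
proof -
 interpret W: finite_group "wreath 0 G" by (rule finite_group_W)
 show "trivial_class \<in> carrier (KW 0 G)" unfolding trivial_class_def by (rule W.rep_class_closed[OF is_rep_trivial])
 show "trivial_class \<in> irr (KW 0 G)" unfolding trivial_class_def
  by (rule W.irr_K0I[OF is_rep_trivial]) (simp add: bform_def carrier_wreath_0 mtr_trivial)
 show "kch (wreath 0 G) trivial_class \<one>\<^bsub>wreath 0 G\<^esub> = 1" unfolding trivial_class_def
  using W.kch_class[OF W.one_closed, of "frag_of (%_. 1\<^sub>m 1)"] by (simp add: mtr_trivial)
qed

lemma R_unit_eq: "R_unit G z = R_inj G 0 (trivial_class [^]\<^bsub>KW 0 G\<^esub> z)"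
 by (simp add: R_unit_def trivial_class_def)

lemma kch_trivial_power:
 "trivial_class [^]\<^bsub>KW 0 G\<^esub> (z :: int) \<in> carrier (KW 0 G)"
 "kch (wreath 0 G) (trivial_class [^]\<^bsub>KW 0 G\<^esub> (z :: int)) \<one>\<^bsub>wreath 0 G\<^esub> = of_int z"
proof -
 interpret W: finite_group "wreath 0 G" by (rule finite_group_W)
 interpret K: comm_group "KW 0 G" by (rule comm_group_W)
 show "trivial_class [^]\<^bsub>KW 0 G\<^esub> z \<in> carrier (KW 0 G)" by (rule K.int_pow_closed[OF trivial_class_closed])
 show "kch (wreath 0 G) (trivial_class [^]\<^bsub>KW 0 G\<^esub> z) \<one>\<^bsub>wreath 0 G\<^esub> = of_int z"
  using K.add_fun_int_pow[OF W.add_fun_kch[OF W.one_closed] trivial_class_closed, of z] kch_trivial_class by simp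
qed

lemma R_unit_closed: "R_unit G z \<in> carrier M"
 unfolding R_unit_eq by (rule R_inj_closed[OF kch_trivial_power(1)])

lemma hat_empty:
 assumes x: "x \<in> carrier M" shows "hat G x {} r d = kch (wreath 0 G) (x 0) \<one>\<^bsub>wreath 0 G\<^esub>"
proof -
 have "\<one>\<^bsub>wreath 0 G\<^esub> \<in> carrier (wreath 0 G)" by (simp add: carrier_wreath_0)
 then have P: "presents G 0 (%i. i) r d \<one>\<^bsub>wreath 0 G\<^esub>" by (simp add: presents_def)
 show ?thesis by (rule hat_presents[OF finite_group_axioms M_RG[OF x] P]) simp
qed

lemma hat_unit:
 assumes pt: "point G V r d" shows "hat G (R_unit G z) V r d = (if V = {} then of_int z else 0)"
proof (cases "V = {}")
 case True
 have "hat G (R_unit G z) {} r d = of_int z" unfolding hat_empty[OF R_unit_closed] unfolding R_unit_eq R_inj_same by (rule kch_trivial_power(2))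
 then show ?thesis using True by simp
next
 case False
 obtain b g where b: "b ` {1..card V} = V" "inj_on b {1..card V}" "presents G (card V) b r d g" by (rule point_presents[OF pt])
 have g: "g \<in> carrier (wreath (card V) G)" using b(3) by (simp add: presents_def)
 have "card V ~= 0" using False pt by (simp add: point_def)
 then have "R_unit G z (card V) = \<one>\<^bsub>KW (card V) G\<^esub>" unfolding R_unit_eq by (rule R_inj_other)
 then show ?thesis using False hat_presents[OF finite_group_axioms M_RG[OF R_unit_closed] b(3,1), of z] finite_group.kch_one[OF finite_group_W g] by simp
qed

lemma point_empty: "point G {} r d"
 by (simp add: point_def bij_betw_def)

lemma R_unit_inj: "inj (R_unit G)"
proof (rule injI)
 fix y z assume e: "R_unit G y = R_unit G z"
 have h: "hat G (R_unit G z) {} id undefined = of_int z" for z unfolding hat_unit[OF point_empty] by simp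
 have "(of_int y :: complex) = of_int z" unfolding h[symmetric] e ..
 then show "y = z" by (simp only: of_int_eq_iff)
qed

text \<open>A class over the trivial group is determined by its virtual degree, which is the integer
  \<open>z\<close>.\<close>

lemma degree_0_unit:
 assumes C: "C \<in> carrier (KW 0 G)" shows "\<exists>z. R_inj G 0 C = R_unit G z"
proof -
 interpret W: finite_group "wreath 0 G" by (rule finite_group_W)
 obtain c where c: "c \<in> carrier (free_reps (wreath 0 G))" "C = K0_class (wreath 0 G) c"
  using C unfolding W.carrier_K0 by blast
 let ?z = "lin c (%\<rho>. int (rep_deg (wreath 0 G) \<rho>))"
 have "kch (wreath 0 G) C \<one>\<^bsub>wreath 0 G\<^esub> = lin c (%\<rho>. mtr (\<rho> \<one>\<^bsub>wreath 0 G\<^esub>))"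
  unfolding c(2) by (rule W.kch_class[OF W.one_closed])
 also have "... = lin c (%\<rho>. of_int (int (rep_deg (wreath 0 G) \<rho>)))"
 proof (rule lin_cong)
  fix \<rho> assume "\<rho> \<in> keys c"
  then have "is_rep (wreath 0 G) \<rho>" using c(1) by auto
  then have "\<rho> \<one>\<^bsub>wreath 0 G\<^esub> = 1\<^sub>m (rep_deg (wreath 0 G) \<rho>)" by (simp add: is_rep_def)
  then show "mtr (\<rho> \<one>\<^bsub>wreath 0 G\<^esub>) = of_int (int (rep_deg (wreath 0 G) \<rho>))" by (simp add: mtr_def)
 qed
 also have "... = of_int ?z" by (rule lin_of_int)
 finally have k: "kch (wreath 0 G) C \<one>\<^bsub>wreath 0 G\<^esub> = of_int ?z" .
 have "C = trivial_class [^]\<^bsub>KW 0 G\<^esub> ?z"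
  by (rule W.K0_eqI[OF C kch_trivial_power(1)]) (simp add: carrier_wreath_0 k kch_trivial_power(2))
 then show ?thesis unfolding R_unit_eq by blast
qed

lemma unit_counit:
 assumes x: "x \<in> carrier M" shows "R_unit G (R_counit G x) = R_inj G 0 (x 0)"
proof -
 obtain z where "R_inj G 0 (x 0) = R_unit G z" using degree_0_unit[OF M_comp[OF x]] by blast
 then show ?thesis unfolding R_counit_def by (intro f_inv_into_f) simp
qed

text \<open>Degree 0 is seen by the empty point, so counit axioms are the cases with an empty set in
  the evaluation formulas.\<close>

lemma counit_eval:
 assumes x: "x \<in> carrier M" shows "hat G x {} r d = of_int (R_counit G x)"
proof -
 have "of_int (R_counit G x) = hat G (R_inj G 0 (x 0)) {} r d"
  unfolding unit_counit[OF x, symmetric] hat_unit[OF point_empty] by simp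
 also have "... = kch (wreath 0 G) (x 0) \<one>\<^bsub>wreath 0 G\<^esub>"
  unfolding hat_empty[OF R_inj_closed[OF M_comp[OF x]]] by (simp only: R_inj_same)
 finally show ?thesis unfolding hat_empty[OF x] by (rule sym)
qed

lemma counit_unit: "R_counit G (R_unit G z) = z"
proof -
 have "R_inj G 0 (R_unit G z 0) = R_unit G z" unfolding R_unit_eq R_inj_same ..
 then show ?thesis unfolding R_counit_def using inv_f_f[OF R_unit_inj] by simp
qed

lemma unit_add: "R_unit G (y + z) = R_unit G y \<otimes>\<^bsub>M\<^esub> R_unit G z"
proof (rule hat_eqI[OF R_unit_closed M.m_closed[OF R_unit_closed R_unit_closed]])
 fix V r d assume pt: "point G V r d"
 show "hat G (R_unit G (y + z)) V r d = hat G (R_unit G y \<otimes>\<^bsub>M\<^esub> R_unit G z) V r d"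
  unfolding add_fun_mult[OF add_fun_hat[OF pt] R_unit_closed R_unit_closed] hat_unit[OF pt] by simp
qed

lemma unit_power: "R_unit G z = R_unit G 1 [^]\<^bsub>M\<^esub> z"
proof (rule hat_eqI[OF R_unit_closed M.int_pow_closed[OF R_unit_closed]])
 fix V r d assume pt: "point G V r d"
 show "hat G (R_unit G z) V r d = hat G (R_unit G 1 [^]\<^bsub>M\<^esub> z) V r d"
  unfolding M.add_fun_int_pow[OF add_fun_hat[OF pt] R_unit_closed] hat_unit[OF pt] by simp
qed

lemma unit_hom: "R_unit G \<in> hom int_tgroup M"
 by (rule homI) (simp_all add: int_tgroup_def R_unit_closed unit_add)

lemma counit_add: "x \<in> carrier M ==> y \<in> carrier M ==> R_counit G (x \<otimes>\<^bsub>M\<^esub> y) = R_counit G x + R_counit G y"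
proof -
 assume x: "x \<in> carrier M" and y: "y \<in> carrier M"
 have "(of_int (R_counit G (x \<otimes>\<^bsub>M\<^esub> y)) :: complex) = of_int (R_counit G x + R_counit G y)"
  unfolding of_int_add counit_eval[OF M.m_closed[OF x y], of id undefined, symmetric] counit_eval[OF x, of id undefined, symmetric] counit_eval[OF y, of id undefined, symmetric]
  by (rule add_fun_mult[OF add_fun_hat[OF point_empty] x y])
 then show ?thesis by (simp only: of_int_eq_iff)
qed

lemma counit_hom: "R_counit G \<in> hom M int_tgroup"
 by (rule homI) (simp_all add: int_tgroup_def counit_add)

lemma unit_graded: "graded_map int_tgroup M (R_unit G)"
 unfolding graded_map_def
proof (intro allI subsetI)
 fix n x assume "x \<in> R_unit G ` grade int_tgroup n"
 then obtain z where z: "z \<in> grade int_tgroup n" "x = R_unit G z" by blast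
 show "x \<in> grade M n"
 proof (cases "n = 0")
  case True
  then show ?thesis unfolding z(2) grade_M R_unit_eq by (auto intro: kch_trivial_power(1))
 next
  case False
  then have "z = 0" using z(1) by (simp add: int_tgroup_def)
  moreover have "R_unit G 0 = \<one>\<^bsub>M\<^esub>" using unit_power[of 0] by simp
  ultimately show ?thesis using subgroup.one_closed[OF graded_tgroup.grade_subgroup[OF graded_tgroup_M]] unfolding z(2) by simp
 qed
qed

lemma counit_graded: "graded_map M int_tgroup (R_counit G)"
 unfolding graded_map_def
proof (intro allI subsetI)
 fix n z assume "z \<in> R_counit G ` grade M n"
 then obtain x where x: "x \<in> grade M n" "z = R_counit G x" by blast
 show "z \<in> grade int_tgroup n"
 proof (cases "n = 0")
  case True
  then show ?thesis by (simp add: int_tgroup_def)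
 next
  case False
  have xc: "x \<in> carrier M" and x0: "x 0 = \<one>\<^bsub>KW 0 G\<^esub>" using x(1) False by (simp_all add: grade_iff)
  have "(of_int z :: complex) = kch (wreath 0 G) (x 0) \<one>\<^bsub>wreath 0 G\<^esub>"
   unfolding x(2) by (rule trans[OF counit_eval[OF xc, symmetric] hat_empty[OF xc]])
  also have "... = 0" unfolding x0 by (rule finite_group.kch_one[OF finite_group_W]) (simp add: carrier_wreath_0)
  finally show ?thesis using False by (simp add: int_tgroup_def)
 qed
qed

lemma unit_irr: "R_unit G 1 \<in> irr M"
proof -
 interpret K: comm_group "KW 0 G" by (rule comm_group_W)
 have "trivial_class [^]\<^bsub>KW 0 G\<^esub> (1::int) = trivial_class" using trivial_class_closed by (rule K.int_pow_1)
 then show ?thesis unfolding R_unit_eq using irr_MI[OF trivial_class_irr] by simp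
qed

lemma lookup_coords_unit:
 assumes w: "w \<in> irr M"
 shows "lookup (coords M (R_unit G z)) w = (if w = R_unit G 1 then z else 0)"
proof -
 have "(of_int (lookup (coords M (R_unit G z)) w) :: complex) = rdual w (R_unit G z)"
  by (rule T.lookup_coords[OF dual_system_M R_unit_closed w])
 also have "... = of_int z * rdual w (R_unit G 1)"
  unfolding unit_power[of z] by (rule M.add_fun_int_pow[OF _ R_unit_closed]) (use dual_system_M w in \<open>simp add: dual_system_def\<close>)
 also have "... = of_int (if w = R_unit G 1 then z else 0)"
  using dual_system_M w unit_irr by (auto simp: dual_system_def)
 finally show ?thesis by (simp only: of_int_eq_iff)
qed

text \<open>The wreath product of degree 0 is trivial, so a multiplicity there is a character value.
  Positivity of the counit and its adjointness to the unit follow.\<close>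

lemma lookup_coords_at_unit:
 assumes x: "x \<in> carrier M"
 shows "lookup (coords M x) (R_unit G 1) = R_counit G x"
proof -
 interpret W: finite_group "wreath 0 G" by (rule finite_group_W)
 interpret K: comm_group "KW 0 G" by (rule comm_group_W)
 have u: "R_unit G 1 = R_inj G 0 trivial_class" by (simp only: R_unit_eq K.int_pow_1[OF trivial_class_closed])
 have "(of_int (lookup (coords M x) (R_unit G 1)) :: complex) = rdual (R_unit G 1) x"
  by (rule T.lookup_coords[OF dual_system_M x unit_irr])
 also have "... = K0_dual (wreath 0 G) trivial_class (x 0)" unfolding u by (rule rdual_R_inj[OF trivial_class_irr])
 also have "... = hat G x {} id undefined"
 proof -
  have one: "(\<Sum>g\<in>{a}. f g * h g) / of_nat (card {a}) = f a * h a" for f h :: "'g wreath => complex" and a by simp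
  show ?thesis unfolding hat_empty[OF x] K0_dual_def bform_def carrier_wreath_0 one W.inv_one kch_trivial_class by (rule mult_1_right)
 qed
 also have "... = of_int (R_counit G x)" by (rule counit_eval[OF x])
 finally show ?thesis by (simp only: of_int_eq_iff)
qed

end

section \<open>The T-group of integers\<close>

lemma comm_group_int: "comm_group int_tgroup"
proof (rule comm_groupI)
 fix x assume "x \<in> carrier int_tgroup"
 show "\<exists>y\<in>carrier int_tgroup. y \<otimes>\<^bsub>int_tgroup\<^esub> x = \<one>\<^bsub>int_tgroup\<^esub>" by (rule bexI[of _ "- x"]) (simp_all add: int_tgroup_def)
qed (simp_all add: int_tgroup_def)

lemma dual_system_int: "dual_system int_tgroup (%w x. of_int x)"
 by (simp add: dual_system_def int_tgroup_def add_fun_def)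

lemma tgroup_int: "tgroup int_tgroup"
proof (rule tgroup_dualI[OF comm_group_int _ dual_system_int])
 interpret I: comm_group int_tgroup by (rule comm_group_int)
 fix x assume "x \<in> carrier int_tgroup"
 have "add_fun int_tgroup (%x. x)" by (simp add: add_fun_def int_tgroup_def)
 from I.add_fun_zlift[OF this, of "frag_cmul x (frag_of 1)" "%x. x"]
 have "zlift int_tgroup (%x. x) (frag_cmul x (frag_of 1)) = x" by (simp add: lin_cmul int_tgroup_def)
 moreover have "keys (frag_cmul x (frag_of 1)) \<subseteq> irr int_tgroup"
  using keys_cmul[of x "frag_of 1"] by (simp add: int_tgroup_def keys_frag_of)
 ultimately show "\<exists>c. keys c \<subseteq> irr int_tgroup & zlift int_tgroup (%x. x) c = x" by (intro exI[of _ "frag_cmul x (frag_of 1)"] conjI)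
qed (simp add: int_tgroup_def)

lemma lookup_coords_int: "lookup (coords int_tgroup z) 1 = z"
proof -
 have "(of_int (lookup (coords int_tgroup z) 1) :: complex) = of_int z"
  by (rule tgroup.lookup_coords[OF tgroup_int dual_system_int]) (simp_all add: int_tgroup_def)
 then show ?thesis by (simp only: of_int_eq_iff)
qed

lemma pairing_int: "pairing int_tgroup y z = y * z"
proof -
 have k: "keys (coords int_tgroup y) \<subseteq> {1}"
  using tgroup.keys_coords[OF tgroup_int, of y] by (simp add: int_tgroup_def)
 have "of_int (pairing int_tgroup y z) = (lin (coords int_tgroup y) (%w. of_int (lookup (coords int_tgroup z) w)) :: int)"
  by (rule tgroup.pairing_eq_lin[OF tgroup_int])
 also have "... = (\<Sum>w\<in>{1}. of_int (lookup (coords int_tgroup y) w) * of_int (lookup (coords int_tgroup z) w))"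
  by (rule lin_superset[OF _ k]) simp
 also have "... = y * z" by (simp add: lookup_coords_int)
 finally show ?thesis by (simp only: id_apply of_int_eq_id)
qed

lemma positive_int: "z \<in> positive int_tgroup \<longleftrightarrow> 0 \<le> z"
proof -
 have "irr int_tgroup = {1}" "carrier int_tgroup = UNIV" by (simp_all add: int_tgroup_def)
 then show ?thesis unfolding tgroup.positive_iff[OF tgroup_int] by (simp add: lookup_coords_int)
qed

context rep_tgroup begin

lemma unit_positive: "positive_map int_tgroup M (R_unit G)"
 unfolding positive_map_def
 by (auto simp: T.positive_iff positive_int R_unit_closed lookup_coords_unit)

lemma counit_positive: "positive_map M int_tgroup (R_counit G)"
 unfolding positive_map_def
proof
 fix z assume "z \<in> R_counit G ` positive M"
 then obtain x where x: "x \<in> positive M" "z = R_counit G x" by blast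
 then have "x \<in> carrier M" "0 \<le> lookup (coords M x) (R_unit G 1)" unfolding T.positive_iff using unit_irr by simp_all
 then show "z \<in> positive int_tgroup" unfolding positive_int x(2) using lookup_coords_at_unit by simp
qed

lemma unit_counit_adjoint: "adjoint_maps int_tgroup M (R_unit G) (R_counit G)"
 unfolding adjoint_maps_def
proof (intro ballI)
 fix z y assume y: "y \<in> carrier M"
 have "pairing M (R_unit G z) y = pairing M y (R_unit G z)" by (rule T.pairing_commute)
 also have "of_int ... = (lin (coords M y) (%w. of_int (lookup (coords M (R_unit G z)) w)) :: int)" by (rule T.pairing_eq_lin)
 also have "... = lin (coords M y) (%w. z * (if w = R_unit G 1 then 1 else 0))"
  by (rule lin_cong) (use T.keys_coords[OF y] in \<open>auto simp: lookup_coords_unit\<close>)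
 also have "... = z * lookup (coords M y) (R_unit G 1)" by (simp only: lin_mult_left lookup_eq_lin)
 finally show "pairing M (R_unit G z) y = pairing int_tgroup z (R_counit G y)"
  by (simp add: pairing_int lookup_coords_at_unit[OF y])
qed

end

section \<open>Sums over stable subsets and labellings\<close>

text \<open>Nested stable sets \<open>S \<subseteq> U\<close> and pairs of disjoint ones correspond
  through \<open>U = S \<union> T\<close>. This is associativity of convolution.\<close>

lemma stab_sum_assoc:
 fixes f :: "nat set => nat set => complex"
 assumes V: "finite V" and inj: "inj_on r V"
 shows "(\<Sum>S\<in>stab r V. \<Sum>T\<in>stab r (V - S). f S T) = (\<Sum>U\<in>stab r V. \<Sum>S\<in>stab r U. f S (U - S))"
proof -
 have finV: "finite U" if "U \<subseteq> V" for U by (rule finite_subset[OF that V])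
 have 1: "\<forall>S\<in>stab r V. finite (stab r (V - S))" using finV by (auto intro: finite_stab)
 have 2: "\<forall>U\<in>stab r V. finite (stab r U)" using finV stab_sub by (auto intro: finite_stab)
 have diff: "r ` (U - S) = U - S" if "U \<subseteq> V" "S \<subseteq> U" "r ` U = U" "r ` S = S" for U S
 proof -
  have "inj_on r U" by (rule inj_on_subset[OF inj that(1)])
  from inj_on_image_set_diff[OF this Diff_subset that(2)] that show ?thesis by (simp add: double_diff)
 qed
 have "(\<Sum>S\<in>stab r V. \<Sum>T\<in>stab r (V - S). f S T) = (\<Sum>(S, T)\<in>(SIGMA S:stab r V. stab r (V - S)). f S T)"
  by (rule sum.Sigma[OF finite_stab[OF V] 1])
 also have "... = (\<Sum>(U, S)\<in>(SIGMA U:stab r V. stab r U). f S (U - S))"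
 proof (rule sum.reindex_bij_witness[of _ "%(U, S). (S, U - S)" "%(S, T). (S \<union> T, S)"])
  fix a assume "a \<in> (SIGMA S:stab r V. stab r (V - S))"
  then obtain S T where a: "a = (S, T)" "S \<subseteq> V" "r ` S = S" "T \<subseteq> V - S" "r ` T = T" by (auto simp: stab_def)
  have e: "S \<union> T - S = T" using a(4) by blast
  show "(case case a of (S, T) => (S \<union> T, S) of (U, S) => (S, U - S)) = a" using e by (simp add: a(1))
  show "(case a of (S, T) => (S \<union> T, S)) \<in> (SIGMA U:stab r V. stab r U)" using a(2-5) by (auto simp: a(1) stab_def image_Un)
  show "(case case a of (S, T) => (S \<union> T, S) of (U, S) => f S (U - S)) = (case a of (S, T) => f S T)" using e by (simp add: a(1))
 next
  fix b assume "b \<in> (SIGMA U:stab r V. stab r U)"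
  then obtain U S where b: "b = (U, S)" "U \<subseteq> V" "r ` U = U" "S \<subseteq> U" "r ` S = S" by (auto simp: stab_def)
  have e: "S \<union> (U - S) = U" using b(4) by blast
  show "(case case b of (U, S) => (S, U - S) of (S, T) => (S \<union> T, S)) = b" using e by (simp add: b(1))
  have "U - S \<subseteq> V - S" "S \<subseteq> V" using b(2,4) by auto
  then show "(case b of (U, S) => (S, U - S)) \<in> (SIGMA S:stab r V. stab r (V - S))"
   using diff[OF b(2,4,3,5)] b(5) by (simp add: b(1) stab_def)
 qed
 also have "... = (\<Sum>U\<in>stab r V. \<Sum>S\<in>stab r U. f S (U - S))"
  by (rule sum.Sigma[OF finite_stab[OF V] 2, symmetric])
 finally show ?thesis .
qed

text \<open>Intersecting with the two stable parts cuts a stable set into stable pieces, because an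
  injective \<open>r\<close> respects intersections. The bialgebra identity rests on this.\<close>

lemma stab_sum_union:
 fixes f :: "nat set => complex"
 assumes dis: "V1 \<inter> V2 = {}" and inj: "inj_on r (V1 \<union> V2)" and im: "r ` V1 = V1" "r ` V2 = V2"
 shows "(\<Sum>S\<in>stab r (V1 \<union> V2). f S) = (\<Sum>S1\<in>stab r V1. \<Sum>S2\<in>stab r V2. f (S1 \<union> S2))"
 unfolding sum.cartesian_product
proof (rule sum.reindex_bij_witness[of _ "%(S1, S2). S1 \<union> S2" "%S. (S \<inter> V1, S \<inter> V2)"])
 fix S assume "S \<in> stab r (V1 \<union> V2)"
 then have S: "S \<subseteq> V1 \<union> V2" "r ` S = S" by (simp_all add: stab_def)
 have e: "S \<inter> V1 \<union> S \<inter> V2 = S" using S(1) by blast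
 show "(case (S \<inter> V1, S \<inter> V2) of (S1, S2) => S1 \<union> S2) = S" using e by simp
 show "(case (S \<inter> V1, S \<inter> V2) of (S1, S2) => f (S1 \<union> S2)) = f S" using e by simp
 have "r ` (S \<inter> V1) = S \<inter> V1" "r ` (S \<inter> V2) = S \<inter> V2"
  using inj_on_image_Int[OF inj S(1), of V1] inj_on_image_Int[OF inj S(1), of V2] S(2) im by simp_all
 then show "(S \<inter> V1, S \<inter> V2) \<in> stab r V1 \<times> stab r V2" by (simp add: stab_def)
next
 fix p assume "p \<in> stab r V1 \<times> stab r V2"
 then obtain S1 S2 where p: "p = (S1, S2)" "S1 \<subseteq> V1" "S2 \<subseteq> V2" "r ` S1 = S1" "r ` S2 = S2" by (auto simp: stab_def)
 have "(S1 \<union> S2) \<inter> V1 = S1" "(S1 \<union> S2) \<inter> V2 = S2" using p(2,3) dis by blast+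
 then show "((case p of (S1, S2) => S1 \<union> S2) \<inter> V1, (case p of (S1, S2) => S1 \<union> S2) \<inter> V2) = p" by (simp add: p(1))
 show "(case p of (S1, S2) => S1 \<union> S2) \<in> stab r (V1 \<union> V2)" using p(2-5) by (auto simp: p(1) stab_def image_Un)
qed

lemma stab_swap:
 fixes f :: "nat set => complex"
 assumes inj: "inj_on r V" and im: "r ` V = V"
 shows "(\<Sum>S\<in>stab r V. f (V - S)) = (\<Sum>S\<in>stab r V. f S)"
proof (rule sum.reindex_bij_witness[of _ "%S. V - S" "%S. V - S"])
 have d: "V - S \<in> stab r V" if "S \<in> stab r V" for S
  using inj_on_image_set_diff[OF inj Diff_subset stab_sub[OF that]] that im by (simp add: stab_def double_diff)
 then show "!!S. S \<in> stab r V ==> V - S \<in> stab r V" "!!S. S \<in> stab r V ==> V - S \<in> stab r V" by blast+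
qed (auto simp: stab_def)

lemma pointD:
 assumes "point G V r d"
 shows "finite V" "inj_on r V" "r ` V = V" "j \<in> V ==> r j \<in> V" "j \<in> V ==> d j \<in> carrier G"
 using assms by (auto simp: point_def bij_betw_def)

lemma point_union: "point G V1 r d ==> point G V2 r d ==> V1 \<inter> V2 = {} ==> point G (V1 \<union> V2) r d"
 by (auto simp: point_def intro: bij_betw_combine)

lemma point_V_stab: "point G V r d ==> V \<in> stab r V" "{} \<in> stab r V"
 by (auto simp: stab_def dest: pointD(3))

lemma stab_empty: "stab r {} = {{}}"
 by (auto simp: stab_def)

section \<open>Labellings of disjoint unions\<close>

context subgroup_pair begin

definition join_labs :: "nat set => nat set => (nat => 'g) => (nat => 'g) => nat => 'g" where
 "join_labs S1 S2 \<tau>1 \<tau>2 = (\<lambda>j\<in>S1 \<union> S2. if j \<in> S1 then \<tau>1 j else \<tau>2 j)"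

lemma join_labs_simps:
 "j \<in> S1 ==> join_labs S1 S2 \<tau>1 \<tau>2 j = \<tau>1 j"
 "S1 \<inter> S2 = {} ==> j \<in> S2 ==> join_labs S1 S2 \<tau>1 \<tau>2 j = \<tau>2 j"
 by (auto simp: join_labs_def)

lemma twist_cong: "\<tau> j = \<tau>' j ==> \<tau> (r j) = \<tau>' (r j) ==> twist r d \<tau> j = twist r d \<tau>' j"
 by (simp add: twist_def)

lemma twist_join:
 assumes "S1 \<inter> S2 = {}"
 shows "j \<in> S1 ==> r j \<in> S1 ==> twist r d (join_labs S1 S2 \<tau>1 \<tau>2) j = twist r d \<tau>1 j"
  and "j \<in> S2 ==> r j \<in> S2 ==> twist r d (join_labs S1 S2 \<tau>1 \<tau>2) j = twist r d \<tau>2 j"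
 by (rule twist_cong, simp_all add: join_labs_simps assms)+

lemma labs_restrict:
 assumes \<tau>: "\<tau> \<in> labs S r d" and sub: "S1 \<subseteq> S" and r: "!!j. j \<in> S1 ==> r j \<in> S1"
 shows "restrict \<tau> S1 \<in> labs S1 r d"
proof -
 have "twist r d (restrict \<tau> S1) j \<in> H" if j: "j \<in> S1" for j
 proof -
  have "twist r d (restrict \<tau> S1) j = twist r d \<tau> j" by (rule twist_cong) (simp_all add: j r)
  then show ?thesis using \<tau> sub j by (auto simp: labs_def)
 qed
 then show ?thesis using \<tau> sub by (auto simp: labs_def)
qed

text \<open>\<open>twist\<close> at \<open>j\<close> involves the labels at \<open>j\<close> and
  \<open>r j\<close> only, so labellings of disjoint stable sets are chosen independently.\<close>

lemma sum_labs_union: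
 fixes F :: "(nat => 'g) => complex"
 assumes dis: "S1 \<inter> S2 = {}" and r: "!!j. j \<in> S1 ==> r j \<in> S1" "!!j. j \<in> S2 ==> r j \<in> S2"
 shows "(\<Sum>\<tau>\<in>labs (S1 \<union> S2) r d. F \<tau>) = (\<Sum>\<tau>1\<in>labs S1 r d. \<Sum>\<tau>2\<in>labs S2 r d. F (join_labs S1 S2 \<tau>1 \<tau>2))"
 unfolding sum.cartesian_product
proof (rule sum.reindex_bij_witness[of _ "%(\<tau>1, \<tau>2). join_labs S1 S2 \<tau>1 \<tau>2" "%\<tau>. (restrict \<tau> S1, restrict \<tau> S2)"])
 fix \<tau> assume \<tau>: "\<tau> \<in> labs (S1 \<union> S2) r d"
 then have ex: "\<tau> \<in> extensional (S1 \<union> S2)" by (auto simp: labs_def PiE_def)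
 have e: "join_labs S1 S2 (restrict \<tau> S1) (restrict \<tau> S2) = \<tau>"
 proof
  fix j show "join_labs S1 S2 (restrict \<tau> S1) (restrict \<tau> S2) j = \<tau> j"
   using extensional_arb[OF ex, of j] by (auto simp: join_labs_def)
 qed
 show "(case (restrict \<tau> S1, restrict \<tau> S2) of (\<tau>1, \<tau>2) => join_labs S1 S2 \<tau>1 \<tau>2) = \<tau>" using e by simp
 show "(case (restrict \<tau> S1, restrict \<tau> S2) of (\<tau>1, \<tau>2) => F (join_labs S1 S2 \<tau>1 \<tau>2)) = F \<tau>" using e by simp
 show "(restrict \<tau> S1, restrict \<tau> S2) \<in> labs S1 r d \<times> labs S2 r d"
  using labs_restrict[OF \<tau> Un_upper1 r(1)] labs_restrict[OF \<tau> Un_upper2 r(2)] by simp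
next
 fix p assume "p \<in> labs S1 r d \<times> labs S2 r d"
 then obtain \<tau>1 \<tau>2 where p: "p = (\<tau>1, \<tau>2)" and \<tau>1: "\<tau>1 \<in> labs S1 r d" and \<tau>2: "\<tau>2 \<in> labs S2 r d" by auto
 have ex: "\<tau>1 \<in> extensional S1" "\<tau>2 \<in> extensional S2" using \<tau>1 \<tau>2 by (auto simp: labs_def PiE_def)
 have "restrict (join_labs S1 S2 \<tau>1 \<tau>2) S1 j = \<tau>1 j" for j
  using extensional_arb[OF ex(1), of j] by (cases "j \<in> S1") (simp_all add: join_labs_simps)
 moreover have "restrict (join_labs S1 S2 \<tau>1 \<tau>2) S2 j = \<tau>2 j" for j
  using extensional_arb[OF ex(2), of j] dis by (cases "j \<in> S2") (simp_all add: join_labs_simps)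
 ultimately show "(restrict (case p of (\<tau>1, \<tau>2) => join_labs S1 S2 \<tau>1 \<tau>2) S1, restrict (case p of (\<tau>1, \<tau>2) => join_labs S1 S2 \<tau>1 \<tau>2) S2) = p"
  by (simp add: p fun_eq_iff)
 have "join_labs S1 S2 \<tau>1 \<tau>2 \<in> S1 \<union> S2 \<rightarrow>\<^sub>E L" using \<tau>1 \<tau>2 by (auto simp: join_labs_def labs_def)
 moreover have "twist r d (join_labs S1 S2 \<tau>1 \<tau>2) j \<in> H" if "j \<in> S1 \<union> S2" for j
 proof (cases "j \<in> S1")
  case True
  then show ?thesis using twist_join(1)[OF dis, where j = j and r = r, OF True r(1)[OF True]] \<tau>1 by (simp add: labs_def)
 next
  case False
  then have j: "j \<in> S2" using that by simp
  then show ?thesis using twist_join(2)[OF dis, where j = j and r = r, OF j r(2)[OF j]] \<tau>2 by (simp add: labs_def)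
 qed
 ultimately show "(case p of (\<tau>1, \<tau>2) => join_labs S1 S2 \<tau>1 \<tau>2) \<in> labs (S1 \<union> S2) r d" by (simp add: p labs_def)
qed

lemma labs_empty: "labs {} r d = {%_. undefined}"
 by (simp add: labs_def)

end

section \<open>The module axioms\<close>

context rep_pair begin

lemma tens_AM_closed: "x \<in> carrier A ==> y \<in> carrier M ==> tens A M x y \<in> carrier AM"
 using keys_tens[OF A.T.tgroup_axioms M.T.tgroup_axioms] by simp

abbreviation gact where "gact x y \<equiv> ind_map K G (tens A M x y)"

lemma gact_closed: "x \<in> carrier A ==> y \<in> carrier M ==> gact x y \<in> carrier M"
 by (rule ind_map_closed[OF tens_AM_closed])

text \<open>Twisting changes labels but not \<open>r\<close>, so a labelling of \<open>U\<close> and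
  a stable subset of \<open>U\<close> can be chosen in either order. Induction to the wreath
  products of \<open>G\<close> is therefore multiplicative.\<close>

lemma ihat_gprod:
 assumes a: "a \<in> carrier A" and b: "b \<in> carrier A" and pt: "point G U r d"
 shows "ihat (A.gprod a b) U r d = (\<Sum>S\<in>stab r U. ihat a S r d * ihat b (U - S) r d)"
proof -
 have "ihat (A.gprod a b) U r d = (\<Sum>\<tau>\<in>labs U r d. \<Sum>S\<in>stab r U. hat K a S r (twist r d \<tau>) * hat K b (U - S) r (twist r d \<tau>))"
  unfolding ihat_def by (rule sum.cong[OF refl]) (rule A.gprod_eval[OF a b point_twist[OF pt]])
 also have "... = (\<Sum>S\<in>stab r U. \<Sum>\<tau>\<in>labs U r d. hat K a S r (twist r d \<tau>) * hat K b (U - S) r (twist r d \<tau>))"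
  by (rule sum.swap)
 also have "... = (\<Sum>S\<in>stab r U. ihat a S r d * ihat b (U - S) r d)"
 proof (rule sum.cong[OF refl])
  fix S assume S: "S \<in> stab r U"
  note p1 = point_stab(1)[OF pt S] and p2 = point_stab(2)[OF pt S]
  have dis: "S \<inter> (U - S) = {}" by blast
  have U: "U = S \<union> (U - S)" using stab_sub[OF S] by blast
  have "(\<Sum>\<tau>\<in>labs U r d. hat K a S r (twist r d \<tau>) * hat K b (U - S) r (twist r d \<tau>))
   = (\<Sum>\<tau>\<in>labs (S \<union> (U - S)) r d. hat K a S r (twist r d \<tau>) * hat K b (U - S) r (twist r d \<tau>))" using U by simp
  also have "... = (\<Sum>\<tau>1\<in>labs S r d. \<Sum>\<tau>2\<in>labs (U - S) r d.
    hat K a S r (twist r d (join_labs S (U - S) \<tau>1 \<tau>2)) * hat K b (U - S) r (twist r d (join_labs S (U - S) \<tau>1 \<tau>2)))"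
   by (rule sum_labs_union[OF dis pointD(4)[OF p1] pointD(4)[OF p2]])
  also have "... = (\<Sum>\<tau>1\<in>labs S r d. \<Sum>\<tau>2\<in>labs (U - S) r d. hat K a S r (twist r d \<tau>1) * hat K b (U - S) r (twist r d \<tau>2))"
  proof (intro sum.cong refl)
   fix \<tau>1 \<tau>2 assume \<tau>: "\<tau>1 \<in> labs S r d" "\<tau>2 \<in> labs (U - S) r d"
   have "hat K a S r (twist r d \<tau>1) = hat K a S r (twist r d (join_labs S (U - S) \<tau>1 \<tau>2))"
    by (rule hat_cong[OF finite_group_K A.M_RG[OF a] point_twist[OF p1 \<tau>(1)] refl])
     (rule sym, rule twist_join(1)[OF dis], assumption, rule pointD(4)[OF p1], assumption)
   moreover have "hat K b (U - S) r (twist r d \<tau>2) = hat K b (U - S) r (twist r d (join_labs S (U - S) \<tau>1 \<tau>2))"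
    by (rule hat_cong[OF finite_group_K A.M_RG[OF b] point_twist[OF p2 \<tau>(2)] refl])
     (rule sym, rule twist_join(2)[OF dis], assumption, rule pointD(4)[OF p2], assumption)
   ultimately show "hat K a S r (twist r d (join_labs S (U - S) \<tau>1 \<tau>2)) * hat K b (U - S) r (twist r d (join_labs S (U - S) \<tau>1 \<tau>2))
    = hat K a S r (twist r d \<tau>1) * hat K b (U - S) r (twist r d \<tau>2)" by (simp only:)
  qed
  also have "... = ihat a S r d * ihat b (U - S) r d" unfolding ihat_def by (simp only: sum_product)
  finally show "(\<Sum>\<tau>\<in>labs U r d. hat K a S r (twist r d \<tau>) * hat K b (U - S) r (twist r d \<tau>)) = ihat a S r d * ihat b (U - S) r d" .
 qed
 finally show ?thesis .
qed

text \<open>Associativity of convolution, with \<open>ihat_gprod\<close> recombining the two factors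
  from \<open>A\<close>.\<close>

lemma gact_assoc:
 assumes a: "a \<in> carrier A" and b: "b \<in> carrier A" and x: "x \<in> carrier M"
 shows "gact a (gact b x) = gact (A.gprod a b) x"
proof (rule M.hat_eqI)
 show "gact a (gact b x) \<in> carrier M" by (rule gact_closed[OF a gact_closed[OF b x]])
 show "gact (A.gprod a b) x \<in> carrier M" by (rule gact_closed[OF A.gprod_closed[OF a b] x])
 fix V r d assume pt: "point G V r d"
 have "hat G (gact a (gact b x)) V r d = (\<Sum>S\<in>stab r V. ihat a S r d * hat G (gact b x) (V - S) r d)"
  by (rule act_eval[OF a gact_closed[OF b x] pt])
 also have "... = (\<Sum>S\<in>stab r V. \<Sum>T\<in>stab r (V - S). ihat a S r d * (ihat b T r d * hat G x (V - S - T) r d))"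
  by (rule sum.cong[OF refl]) (simp only: act_eval[OF b x point_stab(2)[OF pt]] sum_distrib_left)
 also have "... = (\<Sum>U\<in>stab r V. \<Sum>S\<in>stab r U. ihat a S r d * (ihat b (U - S) r d * hat G x (V - S - (U - S)) r d))"
  by (rule stab_sum_assoc[OF pointD(1,2)[OF pt]])
 also have "... = (\<Sum>U\<in>stab r V. (\<Sum>S\<in>stab r U. ihat a S r d * ihat b (U - S) r d) * hat G x (V - U) r d)"
  unfolding sum_distrib_right
 proof (intro sum.cong refl)
  fix U S assume "U \<in> stab r V" "S \<in> stab r U"
  then have "V - S - (U - S) = V - U" using stab_sub by blast
  then show "ihat a S r d * (ihat b (U - S) r d * hat G x (V - S - (U - S)) r d) = ihat a S r d * ihat b (U - S) r d * hat G x (V - U) r d"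
   by (simp only: mult.assoc)
 qed
 also have "... = (\<Sum>U\<in>stab r V. ihat (A.gprod a b) U r d * hat G x (V - U) r d)"
  by (rule sum.cong[OF refl]) (simp only: ihat_gprod[OF a b point_stab(1)[OF pt]])
 also have "... = hat G (gact (A.gprod a b) x) V r d"
  by (rule act_eval[OF A.gprod_closed[OF a b] x pt, symmetric])
 finally show "hat G (gact a (gact b x)) V r d = hat G (gact (A.gprod a b) x) V r d" .
qed

lemma ihat_unit:
 assumes pt: "point G S r d" shows "ihat (R_unit K z) S r d = (if S = {} then of_int z else 0)"
proof (cases "S = {}")
 case True
 then show ?thesis unfolding ihat_def by (simp add: labs_empty A.hat_unit[OF A.point_empty])
next
 case False
 have "ihat (R_unit K z) S r d = (\<Sum>\<tau>\<in>labs S r d. 0)" unfolding ihat_def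
  by (rule sum.cong[OF refl]) (simp only: A.hat_unit[OF point_twist[OF pt]] False if_False)
 then show ?thesis using False by simp
qed

lemma gact_unit:
 assumes x: "x \<in> carrier M" shows "gact (R_unit K z) x = x [^]\<^bsub>M\<^esub> z"
proof (rule M.hat_eqI[OF gact_closed[OF A.R_unit_closed x] M.M.int_pow_closed[OF x]])
 fix V r d assume pt: "point G V r d"
 have fs: "finite (stab r V)" by (rule finite_stab[OF pointD(1)[OF pt]])
 have "hat G (gact (R_unit K z) x) V r d = (\<Sum>S\<in>stab r V. ihat (R_unit K z) S r d * hat G x (V - S) r d)"
  by (rule act_eval[OF A.R_unit_closed x pt])
 also have "... = (\<Sum>S\<in>stab r V. if S = {} then of_int z * hat G x V r d else 0)"
  by (rule sum.cong[OF refl]) (simp add: ihat_unit[OF point_stab(1)[OF pt]])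
 also have "... = of_int z * hat G x V r d" using fs by (simp add: sum.delta point_V_stab(2))
 also have "... = hat G (x [^]\<^bsub>M\<^esub> z) V r d" by (rule M.M.add_fun_int_pow[OF M.add_fun_hat[OF pt] x, symmetric])
 finally show "hat G (gact (R_unit K z) x) V r d = hat G (x [^]\<^bsub>M\<^esub> z) V r d" .
qed

lemma coact_counit:
 assumes x: "x \<in> carrier M" shows "zlift M (%(a, y). y [^]\<^bsub>M\<^esub> R_counit K a) (res_map K G x) = x"
proof -
 have c: "(case p of (a, y) => y [^]\<^bsub>M\<^esub> R_counit K a) \<in> carrier M" if "p \<in> keys (res_map K G x)" for p
 proof -
  have "p \<in> irr A \<times> irr M" using that res_map_closed[OF x] by auto
  from irr_pair[OF this] show ?thesis by (simp add: case_prod_beta M.M.int_pow_closed)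
 qed
 show ?thesis
 proof (rule M.hat_eqI[OF M.M.zlift_closed[OF c] x])
  fix V r d assume pt: "point G V r d"
  have "hat G (zlift M (%(a, y). y [^]\<^bsub>M\<^esub> R_counit K a) (res_map K G x)) V r d
   = lin (res_map K G x) (%p. hat G (case p of (a, y) => y [^]\<^bsub>M\<^esub> R_counit K a) V r d)"
   by (rule M.M.add_fun_zlift[OF M.add_fun_hat[OF pt] c])
  also have "... = lin (res_map K G x) (%(a, y). hat G (y [^]\<^bsub>M\<^esub> R_counit K a) V r d)" by (simp add: case_prod_unfold)
  also have "... = lin (res_map K G x) (%(a, y). hat K a {} r d * hat G y V r d)"
   by (rule lin_AM_cong[OF res_map_closed[OF x]]) (simp only: A.counit_eval M.M.add_fun_int_pow[OF M.add_fun_hat[OF pt]])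
  also have "... = hat G x ({} \<union> V) r d" by (rule res_eval[OF x A.point_empty pt]) simp
  finally show "hat G (zlift M (%(a, y). y [^]\<^bsub>M\<^esub> R_counit K a) (res_map K G x)) V r d = hat G x V r d" by simp
 qed
qed

text \<open>Both sides evaluate to the value of \<open>x\<close> at
  \<open>V1 \<union> V2 \<union> V3\<close>; associativity of union takes the place of comparing
  embeddings.\<close>

lemma coact_coassoc:
 assumes x: "x \<in> carrier M"
 shows "tensor_assoc (tensor_map (tensor A A) M (res_map K K) (%y. y) (res_map K G x)) =
   tensor_map A AM (%a. a) (res_map K G) (res_map K G x)"
proof (rule tensor3_eqI)
 let ?u = "tensor_map (tensor A A) M (res_map K K) (%y. y) (res_map K G x)"
 have uk: "keys ?u \<subseteq> irr (tensor A A) \<times> irr M"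
  by (rule tensor_map_closed[OF x tgroup_tensor M.T.tgroup_axioms A.comult_closed])
 show "tensor_map A AM (%a. a) (res_map K G) (res_map K G x) \<in> carrier (tensor A AM)"
  using tensor_map_closed[OF x A.T.tgroup_axioms tgroup_tensor _ res_map_closed, of "%a. a"] by simp
 have "keys (tensor_assoc ?u) \<subseteq> irr A \<times> irr AM"
  unfolding tensor_assoc_def
 proof (rule keys_frag_extend_subset)
  fix p assume "p \<in> keys ?u"
  then obtain a b c where p: "p = (frag_of (a, b), c)" "a \<in> irr A" "b \<in> irr A" "c \<in> irr M" using uk by auto
  show "keys (case p of (s, c) => frag_extend (%(a, b). frag_of (a, frag_of (b, c))) s) \<subseteq> irr A \<times> irr AM"
   using p(2-4) by (simp add: p(1) keys_frag_of)
 qed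
 then show "tensor_assoc ?u \<in> carrier (tensor A AM)" by simp
 fix V1 V2 V3 r d assume dis: "V1 \<inter> V2 = {}" "V1 \<inter> V3 = {}" "V2 \<inter> V3 = {}"
  and p1: "point K V1 r d" and p2: "point K V2 r d" and p3: "point G V3 r d"
 have p12: "point K (V1 \<union> V2) r d" by (rule point_union[OF p1 p2 dis(1)])
 have p3': "point G V2 r d" using p2 by (simp add: point_def H_sub)
 have p23: "point G (V2 \<union> V3) r d" by (rule point_union[OF p3' p3 dis(3)])
 let ?Q = "%s. lin s (%(u, v). hat K u V2 r d * hat G v V3 r d)"
 let ?E = "%t. lin t (%(w, s). hat K w V1 r d * ?Q s)"
 let ?P = "%s. lin s (%(a, b). hat K a V1 r d * hat K b V2 r d)"
 have aQ: "add_fun AM ?Q" and aP: "add_fun (tensor A A) ?P" by (rule add_fun_tensor)+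
 have "?E (tensor_assoc ?u) = lin ?u (%(s, c). lin s (%(a, b). hat K a V1 r d * (hat K b V2 r d * hat G c V3 r d)))"
  by (simp add: tensor_assoc_def lin_extend case_prod_unfold)
 also have "... = lin ?u (%(s, c). ?P s * hat G c V3 r d)"
  by (simp only: mult.assoc[symmetric] case_prod_unfold lin_mult_right)
 also have "... = lin (res_map K G x) (%(a, m). ?P (res_map K K a) * hat G m V3 r d)"
  by (rule lin_res_tensor_map[OF x tgroup_tensor M.T.tgroup_axioms A.comult_closed _ aP M.add_fun_hat[OF p3]])
 also have "... = lin (res_map K G x) (%(a, m). hat K a (V1 \<union> V2) r d * hat G m V3 r d)"
  by (rule lin_AM_cong[OF res_map_closed[OF x]]) (simp only: A.comult_eval[OF _ p1 p2 dis(1)])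
 also have "... = hat G x (V1 \<union> V2 \<union> V3) r d" by (rule res_eval[OF x p12 p3]) (use dis in blast)
 finally have l: "?E (tensor_assoc ?u) = hat G x (V1 \<union> V2 \<union> V3) r d" .
 have "?E (tensor_map A AM (%a. a) (res_map K G) (res_map K G x)) = lin (res_map K G x) (%(a, m). hat K a V1 r d * ?Q (res_map K G m))"
  by (rule lin_res_tensor_map[OF x A.T.tgroup_axioms tgroup_tensor _ res_map_closed A.add_fun_hat[OF p1] aQ])
 also have "... = lin (res_map K G x) (%(a, m). hat K a V1 r d * hat G m (V2 \<union> V3) r d)"
  by (rule lin_AM_cong[OF res_map_closed[OF x]]) (simp only: res_eval[OF _ p2 p3 dis(3)])
 also have "... = hat G x (V1 \<union> (V2 \<union> V3)) r d" by (rule res_eval[OF x p1 p23]) (use dis in blast)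
 finally show "?E (tensor_assoc ?u) = ?E (tensor_map A AM (%a. a) (res_map K G) (res_map K G x))" unfolding l by (simp only: Un_assoc)
qed

section \<open>The Hopf axiom\<close>

text \<open>\<open>inv a \<otimes> x \<otimes> b\<close> is \<open>inv a \<otimes> b\<close> times a
  conjugate of \<open>x\<close>, which lies in \<open>H\<close> by normality. With
  \<open>a = \<tau> (r j)\<close> and \<open>b = \<tau> j\<close> this makes admissible labellings
  constant on cycles.\<close>

lemma conj_mem_iff:
 assumes nrm: "!!g x. g \<in> carrier G ==> x \<in> H ==> g \<otimes> x \<otimes> inv g \<in> H"
  and a: "a \<in> L" and b: "b \<in> L" and x: "x \<in> H"
 shows "inv a \<otimes> x \<otimes> b \<in> H \<longleftrightarrow> a = b"
proof -
 have ac: "a \<in> carrier G" and bc: "b \<in> carrier G" and xc: "x \<in> carrier G"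
  using L_sub[OF a] L_sub[OF b] H_sub[OF x] by simp_all
 have "inv b \<otimes> x \<otimes> inv (inv b) \<in> H" by (rule nrm[OF _ x]) (simp add: bc)
 then have c: "inv b \<otimes> x \<otimes> b \<in> H" using bc by simp
 show ?thesis
 proof
  assume "inv a \<otimes> x \<otimes> b \<in> H"
  from H_closed(1)[OF this H_closed(2)[OF c]]
  have "inv a \<otimes> b \<in> H" using ac bc xc by (simp add: G.m_assoc G.inv_mult_group G.inv_mult_cancel)
  then have "rp a = rp b" using rp_eq_iff[OF ac bc] by simp
  then show "a = b" by (simp only: rp_L[OF a] rp_L[OF b])
 qed (use c in simp)
qed

text \<open>Over \<open>S1\<close> the labels lie in \<open>H\<close>, so an admissible
  \<open>\<tau>1\<close> is constant on cycles and twisting conjugates all labels of a cycle by one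
  element of \<open>G\<close>. On \<open>H\<close> this agrees with conjugation by an element of
  \<open>H\<close>, a gauge transformation over \<open>H\<close>, so \<open>\<tau>1\<close> drops
  out and only the number of choices remains. Over \<open>S2\<close> the labels are arbitrary in
  \<open>G\<close> and the sum over labellings stays.\<close>

lemma ihat_union:
 assumes nrm: "!!g x. g \<in> carrier G ==> x \<in> H ==> g \<otimes> x \<otimes> inv g \<in> H"
  and inner: "!!g. g \<in> carrier G ==> \<exists>h\<in>H. \<forall>x\<in>H. g \<otimes> x \<otimes> inv g = h \<otimes> x \<otimes> inv h"
  and x: "x \<in> carrier A" and p1: "point K S1 r d" and p2: "point G S2 r d" and dis: "S1 \<inter> S2 = {}"
 shows "ihat x (S1 \<union> S2) r d = of_nat (card (labs S1 r d)) *
  (\<Sum>\<tau>\<in>labs S2 r d. hat K x (S1 \<union> S2) r (%j. if j \<in> S1 then d j else twist r d \<tau> j))"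
proof -
 \<comment> \<open>Twisting conjugates by \<open>inv g\<close>, so the assumption on inner
   automorphisms is applied to \<open>inv g\<close> and the element of \<open>H\<close> found there
   is inverted.\<close>
 define c where "c g = (SOME h. h \<in> H & (\<forall>x\<in>H. inv g \<otimes> x \<otimes> g = inv h \<otimes> x \<otimes> h))" for g
 have c: "c g \<in> H & (\<forall>x\<in>H. inv g \<otimes> x \<otimes> g = inv (c g) \<otimes> x \<otimes> c g)" if g: "g \<in> carrier G" for g
  unfolding c_def
 proof (rule someI_ex)
  have ig: "inv g \<in> carrier G" using g by simp
  obtain h where h: "h \<in> H" "\<forall>x\<in>H. inv g \<otimes> x \<otimes> inv (inv g) = h \<otimes> x \<otimes> inv h" using inner[OF ig] by blast
  have hc: "h \<in> carrier G" by (rule H_sub[OF h(1)])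
  have "inv g \<otimes> x \<otimes> g = inv (inv h) \<otimes> x \<otimes> inv h" if "x \<in> H" for x
   using bspec[OF h(2) that] g hc by simp
  then show "\<exists>h. h \<in> H & (\<forall>x\<in>H. inv g \<otimes> x \<otimes> g = inv h \<otimes> x \<otimes> h)" using H_closed(2)[OF h(1)] by blast
 qed
 have p1G: "point G S1 r d" using p1 by (simp add: point_def H_sub)
 have r: "r j \<in> S1" if "j \<in> S1" for j by (rule pointD(4)[OF p1 that])
 have r2: "r j \<in> S2" if "j \<in> S2" for j by (rule pointD(4)[OF p2 that])
 have dH: "d j \<in> H" if "j \<in> S1" for j using pointD(5)[OF p1 that] by simp
 have p12: "point G (S1 \<union> S2) r d" by (rule point_union[OF p1G p2 dis])
 have trm: "hat K x (S1 \<union> S2) r (twist r d (join_labs S1 S2 \<tau>1 \<tau>2)) = hat K x (S1 \<union> S2) r (%j. if j \<in> S1 then d j else twist r d \<tau>2 j)"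
  if \<tau>1: "\<tau>1 \<in> labs S1 r d" and \<tau>2: "\<tau>2 \<in> labs S2 r d" for \<tau>1 \<tau>2
 proof -
  let ?d = "%j. if j \<in> S1 then d j else twist r d \<tau>2 j"
  let ?d' = "twist r d (join_labs S1 S2 \<tau>1 \<tau>2)"
  have tL: "\<tau>1 j \<in> L" if "j \<in> S1" for j using \<tau>1 that by (auto simp: labs_def)
  have tc: "\<tau>1 j \<in> carrier G" if "j \<in> S1" for j by (rule L_sub[OF tL[OF that]])
  have tw: "inv (\<tau>1 (r j)) \<otimes> d j \<otimes> \<tau>1 j \<in> H" if "j \<in> S1" for j using \<tau>1 that by (simp add: labs_def twist_def)
  have const: "\<tau>1 (r j) = \<tau>1 j" if j: "j \<in> S1" for j
   using conj_mem_iff[OF nrm tL[OF r[OF j]] tL[OF j] dH[OF j]] tw[OF j] by blast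
  have d'1: "?d' j = inv (\<tau>1 j) \<otimes> d j \<otimes> \<tau>1 j" if j: "j \<in> S1" for j
   unfolding twist_join(1)[OF dis, where j = j and r = r, OF j r[OF j]] by (simp only: twist_def const[OF j])
  have d'2: "?d' j = twist r d \<tau>2 j" if j: "j \<in> S2" for j
   by (rule twist_join(2)[OF dis, where j = j and r = r, OF j r2[OF j]])
  have t2: "twist r d \<tau>2 j \<in> H" if "j \<in> S2" for j using \<tau>2 that by (simp add: labs_def)
  have bij: "finite (S1 \<union> S2)" "bij_betw r (S1 \<union> S2) (S1 \<union> S2)" using p12 by (simp_all add: point_def)
  have n2: "j \<notin> S1" if "j \<in> S2" for j using that dis by blast
  have pd: "point K (S1 \<union> S2) r ?d" using bij dH t2 by (auto simp: point_def)
  have pd': "point K (S1 \<union> S2) r ?d'"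
  proof -
   have "?d' j \<in> H" if j: "j \<in> S1" for j
    using tw[OF j] unfolding d'1[OF j] const[OF j] .
   then show ?thesis using bij d'2 t2 by (auto simp: point_def)
  qed
  \<comment> \<open>The gauge equation compares \<open>?f\<close> at \<open>j\<close> and at
    \<open>r j\<close>; constancy of \<open>\<tau>1\<close> on cycles makes the two values equal.
    Off \<open>S1\<close> the labels already agree.\<close>
  let ?f = "%j. if j \<in> S1 then c (\<tau>1 j) else \<one>"
  have gauge: "?f (r j) \<otimes> ?d' j = ?d j \<otimes> ?f j" if j: "j \<in> S1 \<union> S2" for j
  proof (cases "j \<in> S1")
   case True
   have ch: "c (\<tau>1 j) \<in> H" and ce: "inv (\<tau>1 j) \<otimes> d j \<otimes> \<tau>1 j = inv (c (\<tau>1 j)) \<otimes> d j \<otimes> c (\<tau>1 j)"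
    using c[OF tc[OF True]] dH[OF True] by blast+
   have cc: "c (\<tau>1 j) \<in> carrier G" and dc: "d j \<in> carrier G" using H_sub[OF ch] H_sub[OF dH[OF True]] by simp_all
   have "c (\<tau>1 j) \<otimes> (inv (c (\<tau>1 j)) \<otimes> d j \<otimes> c (\<tau>1 j)) = d j \<otimes> c (\<tau>1 j)"
    using cc dc by (simp add: G.m_assoc G.inv_mult_cancel)
   then show ?thesis using True r[OF True] by (simp add: d'1 const ce)
  next
   case False
   then have j2: "j \<in> S2" using j by simp
   have tc2: "twist r d \<tau>2 j \<in> carrier G" by (rule H_sub[OF t2[OF j2]])
   show ?thesis using False n2[OF r2[OF j2]] tc2 by (simp add: d'2[OF j2])
  qed
  have fH: "?f j \<in> carrier K" if "j \<in> S1 \<union> S2" for j using c tc H_closed(3) by simp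
  show ?thesis by (rule hat_gauge[OF finite_group_K A.M_RG[OF x] pd pd' fH, symmetric]) (use gauge in simp)+
 qed
 have "ihat x (S1 \<union> S2) r d = (\<Sum>\<tau>1\<in>labs S1 r d. \<Sum>\<tau>2\<in>labs S2 r d. hat K x (S1 \<union> S2) r (twist r d (join_labs S1 S2 \<tau>1 \<tau>2)))"
  unfolding ihat_def by (rule sum_labs_union[OF dis r r2])
 also have "... = (\<Sum>\<tau>1\<in>labs S1 r d. \<Sum>\<tau>2\<in>labs S2 r d. hat K x (S1 \<union> S2) r (%j. if j \<in> S1 then d j else twist r d \<tau>2 j))"
  by (intro sum.cong refl trm)
 finally show ?thesis by simp
qed

text \<open>At a pair \<open>V1\<close>, \<open>V2\<close> both sides become a sum over stable
  \<open>S1 \<subseteq> V1\<close> and \<open>S2 \<subseteq> V2\<close>, and the factor counting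
  labellings of \<open>S1\<close> must come from \<open>P\<close>. Keeping \<open>P\<close> abstract
  lets the proof serve twice: with \<Psi> for the module, and with the identity for the bialgebra
  axiom of R(G), where there is just one labelling.\<close>

lemma hopf:
 assumes nrm: "!!g x. g \<in> carrier G ==> x \<in> H ==> g \<otimes> x \<otimes> inv g \<in> H"
  and inner: "!!g. g \<in> carrier G ==> \<exists>h\<in>H. \<forall>x\<in>H. g \<otimes> x \<otimes> inv g = h \<otimes> x \<otimes> inv h"
  and P: "!!h. h \<in> carrier A ==> P h \<in> carrier A"
  and PE: "!!h S r d. h \<in> carrier A ==> point K S r d ==> hat K (P h) S r d = of_nat (card (labs S r d)) * hat K h S r d"
  and h: "h \<in> carrier A" and x: "x \<in> carrier M"
 shows "res_map K G (gact h x) = frag_extend (%(h1, h2). frag_extend (%(x1, x2).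
    tens A M (A.gprod (P h1) x1) (gact h2 x2)) (res_map K G x)) (res_map K K h)"
  (is "_ = ?R")
proof (rule tensor_eqI[OF res_map_closed[OF gact_closed[OF h x]]])
 have cl: "w \<in> carrier A & v \<in> carrier M" if "(w, v) \<in> keys (res_map K G x)" for w v
  using subsetD[OF _ that, of "irr A \<times> irr M"] res_map_closed[OF x] irr_pair[of "(w, v)"] by simp
 have cl': "w \<in> carrier A & v \<in> carrier A" if "(w, v) \<in> keys (res_map K K h)" for w v
 proof -
  have "(w, v) \<in> irr A \<times> irr A" using subsetD[OF _ that, of "irr A \<times> irr A"] A.comult_closed[OF h] by simp
  then show ?thesis using A.irr_M_closed by blast
 qed
 have "keys ?R \<subseteq> irr A \<times> irr M"
 proof (intro keys_frag_extend_subset)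
  fix p assume p: "p \<in> keys (res_map K K h)"
  obtain h1 h2 where p': "p = (h1, h2)" by (cases p)
  show "keys (case p of (h1, h2) => frag_extend (%(x1, x2). tens A M (A.gprod (P h1) x1) (gact h2 x2)) (res_map K G x)) \<subseteq> irr A \<times> irr M"
   unfolding p' prod.case
  proof (rule keys_frag_extend_subset)
   fix q assume q: "q \<in> keys (res_map K G x)"
   obtain x1 x2 where q': "q = (x1, x2)" by (cases q)
   have hc: "h1 \<in> carrier A" "h2 \<in> carrier A" using cl'[of h1 h2] p p' by simp_all
   have xc: "x1 \<in> carrier A" "x2 \<in> carrier M" using cl[of x1 x2] q q' by simp_all
   show "keys (case q of (x1, x2) => tens A M (A.gprod (P h1) x1) (gact h2 x2)) \<subseteq> irr A \<times> irr M"
    using tens_AM_closed[OF A.gprod_closed[OF P[OF hc(1)] xc(1)] gact_closed[OF hc(2) xc(2)]] by (simp add: q')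
  qed
 qed
 then show "?R \<in> carrier AM" by simp
 fix V1 V2 r d assume dis: "V1 \<inter> V2 = {}" and p1: "point K V1 r d" and p2: "point G V2 r d"
 have p1G: "point G V1 r d" using p1 by (simp add: point_def H_sub)
 have pV: "point G (V1 \<union> V2) r d" by (rule point_union[OF p1G p2 dis])
 let ?c = "%S1. of_nat (card (labs S1 r d)) :: complex"
 let ?I = "%S1 S2. \<Sum>\<tau>\<in>labs S2 r d. hat K h (S1 \<union> S2) r (%j. if j \<in> S1 then d j else twist r d \<tau> j)"
 have "E2 V1 V2 r d (res_map K G (gact h x)) = hat G (gact h x) (V1 \<union> V2) r d"
  by (rule res_eval[OF gact_closed[OF h x] p1 p2 dis])
 also have "... = (\<Sum>S\<in>stab r (V1 \<union> V2). ihat h S r d * hat G x (V1 \<union> V2 - S) r d)" by (rule act_eval[OF h x pV])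
 also have "... = (\<Sum>S1\<in>stab r V1. \<Sum>S2\<in>stab r V2. ihat h (S1 \<union> S2) r d * hat G x (V1 \<union> V2 - (S1 \<union> S2)) r d)"
  by (rule stab_sum_union[OF dis pointD(2)[OF pV] pointD(3)[OF p1] pointD(3)[OF p2]])
 also have "... = (\<Sum>S1\<in>stab r V1. \<Sum>S2\<in>stab r V2. ?c S1 * ?I S1 S2 * hat G x ((V1 - S1) \<union> (V2 - S2)) r d)"
 proof (intro sum.cong refl)
  fix S1 S2 assume S1: "S1 \<in> stab r V1" and S2: "S2 \<in> stab r V2"
  have sub: "S1 \<subseteq> V1" "S2 \<subseteq> V2" using stab_sub[OF S1] stab_sub[OF S2] .
  have e: "V1 \<union> V2 - (S1 \<union> S2) = (V1 - S1) \<union> (V2 - S2)" using sub dis by blast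
  have d12: "S1 \<inter> S2 = {}" using sub dis by blast
  have "ihat h (S1 \<union> S2) r d = ?c S1 * ?I S1 S2"
   by (rule ihat_union[OF nrm inner h point_stab(1)[OF p1 S1] point_stab(1)[OF p2 S2] d12])
  then show "ihat h (S1 \<union> S2) r d * hat G x (V1 \<union> V2 - (S1 \<union> S2)) r d = ?c S1 * ?I S1 S2 * hat G x ((V1 - S1) \<union> (V2 - S2)) r d"
   by (simp only: e)
 qed
 finally have l: "E2 V1 V2 r d (res_map K G (gact h x))
  = (\<Sum>S1\<in>stab r V1. \<Sum>S2\<in>stab r V2. ?c S1 * ?I S1 S2 * hat G x ((V1 - S1) \<union> (V2 - S2)) r d)" .
 \<comment> \<open>The twisted labels concern \<open>S2\<close> alone, so the two evaluations join
   into one labelling of \<open>S1 \<union> S2\<close> over \<open>H\<close>, at which the coproduct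
   of \<open>h\<close> can be evaluated.\<close>
 have Hsum: "lin (res_map K K h) (%(h1, h2). hat K h1 S1 r d * ihat h2 S2 r d) = ?I S1 S2"
  if S1: "S1 \<in> stab r V1" and S2: "S2 \<in> stab r V2" for S1 S2
 proof -
  have d12: "S1 \<inter> S2 = {}" using stab_sub[OF S1] stab_sub[OF S2] dis by blast
  have n2: "j \<notin> S1" if "j \<in> S2" for j using that d12 by blast
  have "lin (res_map K K h) (%(h1, h2). hat K h1 S1 r d * ihat h2 S2 r d)
   = (\<Sum>\<tau>\<in>labs S2 r d. lin (res_map K K h) (%(h1, h2). hat K h1 S1 r d * hat K h2 S2 r (twist r d \<tau>)))"
   unfolding ihat_def by (simp only: sum_distrib_left case_prod_unfold lin_fun_sum)
  also have "... = ?I S1 S2"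
  proof (rule sum.cong[OF refl])
   fix \<tau> assume \<tau>: "\<tau> \<in> labs S2 r d"
   let ?d = "%j. if j \<in> S1 then d j else twist r d \<tau> j"
   note q1 = point_stab(1)[OF p1 S1] and q2 = point_twist[OF point_stab(1)[OF p2 S2] \<tau>]
   have q1': "point K S1 r ?d" using q1 by (simp add: point_def)
   have q2': "point K S2 r ?d" using q2 n2 by (simp add: point_def)
   have "lin (res_map K K h) (%(h1, h2). hat K h1 S1 r d * hat K h2 S2 r (twist r d \<tau>))
    = lin (res_map K K h) (%(h1, h2). hat K h1 S1 r ?d * hat K h2 S2 r ?d)"
   proof (rule A.lin_MM_cong[OF A.comult_closed[OF h]])
    fix w v assume wv: "w \<in> carrier A" "v \<in> carrier A"
    have "hat K w S1 r d = hat K w S1 r ?d"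
     by (rule hat_cong[OF finite_group_K A.M_RG[OF wv(1)] q1 refl]) simp
    moreover have "hat K v S2 r (twist r d \<tau>) = hat K v S2 r ?d"
     by (rule hat_cong[OF finite_group_K A.M_RG[OF wv(2)] q2 refl]) (simp add: n2)
    ultimately show "hat K w S1 r d * hat K v S2 r (twist r d \<tau>) = hat K w S1 r ?d * hat K v S2 r ?d" by (simp only:)
   qed
   also have "... = hat K h (S1 \<union> S2) r ?d" by (rule A.comult_eval[OF h q1' q2' d12])
   finally show "lin (res_map K K h) (%(h1, h2). hat K h1 S1 r d * hat K h2 S2 r (twist r d \<tau>)) = hat K h (S1 \<union> S2) r ?d" .
  qed
  finally show ?thesis .
 qed
 have Xsum: "lin (res_map K G x) (%(x1, x2). hat K x1 (V1 - S1) r d * hat G x2 (V2 - S2) r d) = hat G x ((V1 - S1) \<union> (V2 - S2)) r d"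
  if S1: "S1 \<in> stab r V1" and S2: "S2 \<in> stab r V2" for S1 S2
  by (rule res_eval[OF x point_stab(2)[OF p1 S1] point_stab(2)[OF p2 S2]]) (use dis in blast)
 have "E2 V1 V2 r d ?R
  = lin (res_map K K h) (%(h1, h2). lin (res_map K G x) (%(x1, x2).
    lin (tens A M (A.gprod (P h1) x1) (gact h2 x2)) (%(w, v). hat K w V1 r d * hat G v V2 r d)))"
  by (simp add: lin_extend case_prod_unfold)
 also have "... = lin (res_map K K h) (%(h1, h2). lin (res_map K G x) (%(x1, x2).
    \<Sum>S1\<in>stab r V1. \<Sum>S2\<in>stab r V2. ?c S1 * ((hat K h1 S1 r d * ihat h2 S2 r d) * (hat K x1 (V1 - S1) r d * hat G x2 (V2 - S2) r d))))"
 proof (rule A.lin_MM_cong[OF A.comult_closed[OF h]], rule lin_AM_cong[OF res_map_closed[OF x]])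
  fix h1 h2 x1 x2 assume hc: "h1 \<in> carrier A" "h2 \<in> carrier A" and xc: "x1 \<in> carrier A" "x2 \<in> carrier M"
  have "lin (tens A M (A.gprod (P h1) x1) (gact h2 x2)) (%(w, v). hat K w V1 r d * hat G v V2 r d)
   = hat K (A.gprod (P h1) x1) V1 r d * hat G (gact h2 x2) V2 r d"
   by (rule lin_tens[OF A.T.tgroup_axioms M.T.tgroup_axioms A.gprod_closed[OF P[OF hc(1)] xc(1)] gact_closed[OF hc(2) xc(2)]
    A.add_fun_hat[OF p1] M.add_fun_hat[OF p2]])
  also have "hat K (A.gprod (P h1) x1) V1 r d = (\<Sum>S1\<in>stab r V1. ?c S1 * hat K h1 S1 r d * hat K x1 (V1 - S1) r d)"
   unfolding A.gprod_eval[OF P[OF hc(1)] xc(1) p1]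
   by (rule sum.cong[OF refl]) (simp only: PE[OF hc(1) point_stab(1)[OF p1]])
  also have "hat G (gact h2 x2) V2 r d = (\<Sum>S2\<in>stab r V2. ihat h2 S2 r d * hat G x2 (V2 - S2) r d)" by (rule act_eval[OF hc(2) xc(2) p2])
  also have "(\<Sum>S1\<in>stab r V1. ?c S1 * hat K h1 S1 r d * hat K x1 (V1 - S1) r d) * (\<Sum>S2\<in>stab r V2. ihat h2 S2 r d * hat G x2 (V2 - S2) r d)
   = (\<Sum>S1\<in>stab r V1. \<Sum>S2\<in>stab r V2. ?c S1 * ((hat K h1 S1 r d * ihat h2 S2 r d) * (hat K x1 (V1 - S1) r d * hat G x2 (V2 - S2) r d)))"
   unfolding sum_product by (intro sum.cong refl) (simp only: mult.assoc mult.left_commute)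
  finally show "lin (tens A M (A.gprod (P h1) x1) (gact h2 x2)) (%(w, v). hat K w V1 r d * hat G v V2 r d)
   = (\<Sum>S1\<in>stab r V1. \<Sum>S2\<in>stab r V2. ?c S1 * ((hat K h1 S1 r d * ihat h2 S2 r d) * (hat K x1 (V1 - S1) r d * hat G x2 (V2 - S2) r d)))" .
 qed
 \<comment> \<open>For fixed \<open>S1\<close> and \<open>S2\<close> the summand is a factor in
   \<open>h1\<close>, \<open>h2\<close> times a factor in \<open>x1\<close>, \<open>x2\<close>;
   \<open>Hsum\<close> and \<open>Xsum\<close> evaluate them separately.\<close>
 also have "... = (\<Sum>S1\<in>stab r V1. \<Sum>S2\<in>stab r V2. ?c S1 * (lin (res_map K K h) (%(h1, h2). hat K h1 S1 r d * ihat h2 S2 r d)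
   * lin (res_map K G x) (%(x1, x2). hat K x1 (V1 - S1) r d * hat G x2 (V2 - S2) r d)))"
  by (simp only: case_prod_unfold lin_fun_sum lin_mult_left lin_mult_right)
 also have "... = (\<Sum>S1\<in>stab r V1. \<Sum>S2\<in>stab r V2. ?c S1 * ?I S1 S2 * hat G x ((V1 - S1) \<union> (V2 - S2)) r d)"
  by (intro sum.cong refl) (simp only: Hsum Xsum mult.assoc)
 finally show "E2 V1 V2 r d (res_map K G (gact h x)) = E2 V1 V2 r d ?R"
  unfolding l ..
qed

end

section \<open>Convolution powers of the identity and the antipode\<close>

text \<open>For a permutation \<open>r\<close> of a finite \<open>V\<close>, the number of
  colourings of \<open>V\<close> with \<open>n\<close> colours constant on cycles, where
  \<open>S\<close> is the set of points of one colour. It equals \<open>n\<close> to the number of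
  cycles, but this recursion is the form that iterated convolution produces.\<close>

primrec ncol :: "nat => (nat => nat) => nat set => nat" where
 "ncol 0 r V = (if V = {} then 1 else 0)"
| "ncol (Suc n) r V = (\<Sum>S\<in>stab r V. ncol n r (V - S))"

lemma finite_invariant_funs: "finite X ==> finite S ==> finite {u \<in> S \<rightarrow>\<^sub>E X. \<forall>i\<in>S. u (r i) = u i}"
 by (rule finite_subset[of _ "S \<rightarrow>\<^sub>E X"]) (auto intro: finite_PiE)

text \<open>A colouring is split into the stable set where it takes the colour \<open>a\<close> and
  a colouring of the rest by \<open>X\<close>.\<close>

lemma ncol_Suc_funs:
 assumes a: "a \<notin> X" and S: "finite S" "inj_on r S" "r ` S = S" and X: "finite X"
 shows "card {u \<in> S \<rightarrow>\<^sub>E insert a X. \<forall>i\<in>S. u (r i) = u i} = (\<Sum>T\<in>stab r S. card {u \<in> S - T \<rightarrow>\<^sub>E X. \<forall>i\<in>S - T. u (r i) = u i})"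
proof -
 let ?B = "%T. {u \<in> S - T \<rightarrow>\<^sub>E X. \<forall>i\<in>S - T. u (r i) = u i}"
 let ?C = "{u \<in> S \<rightarrow>\<^sub>E insert a X. \<forall>i\<in>S. u (r i) = u i}"
 let ?f = "%u. ({i \<in> S. u i = a}, restrict u (S - {i \<in> S. u i = a}))"
 let ?g = "%(T, u). (\<lambda>i\<in>S. if i \<in> T then a else u i)"
 have rS: "r i \<in> S" if "i \<in> S" for i using S(3) that by blast
 have stT: "r i \<in> T \<longleftrightarrow> i \<in> T" if T: "T \<in> stab r S" and i: "i \<in> S" for T i
 proof
  assume "r i \<in> T"
  then obtain j where j: "j \<in> T" "r i = r j" using T by (auto simp: stab_def)
  have "j \<in> S" using j(1) stab_sub[OF T] by blast
  then show "i \<in> T" using inj_onD[OF S(2) j(2) i] j(1) by simp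
 next
  assume "i \<in> T" then show "r i \<in> T" using T by (auto simp: stab_def)
 qed
 have "bij_betw ?f ?C (SIGMA T:stab r S. ?B T)"
 proof (rule bij_betw_byWitness[where f' = ?g])
  show "\<forall>u\<in>?C. ?g (?f u) = u"
  proof
   fix u assume u: "u \<in> ?C"
   show "?g (?f u) = u"
   proof
    fix i show "?g (?f u) i = u i" using u by (cases "i \<in> S") (auto simp: PiE_iff extensional_def)
   qed
  qed
  show "\<forall>p\<in>(SIGMA T:stab r S. ?B T). ?f (?g p) = p"
  proof
   fix p assume "p \<in> (SIGMA T:stab r S. ?B T)"
   then obtain T u where p: "p = (T, u)" "T \<in> stab r S" "u \<in> S - T \<rightarrow>\<^sub>E X" by auto
   have e: "{i \<in> S. ?g p i = a} = T" using stab_sub[OF p(2)] p(3) a by (auto simp: p(1) PiE_iff)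
   have "restrict (?g p) (S - T) i = u i" for i using p(3) by (cases "i \<in> S - T") (auto simp: p(1) PiE_iff extensional_def)
   then have "restrict (?g p) (S - T) = u" by blast
   then show "?f (?g p) = p" unfolding e by (simp add: p(1))
  qed
  show "?f ` ?C \<subseteq> (SIGMA T:stab r S. ?B T)"
  proof
   fix q assume "q \<in> ?f ` ?C"
   then obtain u where u: "u \<in> S \<rightarrow>\<^sub>E insert a X" "\<forall>i\<in>S. u (r i) = u i" "q = ?f u" by blast
   let ?T = "{i \<in> S. u i = a}"
   have im: "r ` ?T = ?T"
   proof
    show "r ` ?T \<subseteq> ?T" using u(2) rS by auto
    show "?T \<subseteq> r ` ?T"
    proof
     fix i assume i: "i \<in> ?T"
     then obtain j where j: "j \<in> S" "i = r j" using S(3) by blast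
     then have "u j = a" using u(2) i by auto
     then show "i \<in> r ` ?T" using j by blast
    qed
   qed
   then have T: "?T \<in> stab r S" by (auto simp: stab_def)
   have "restrict u (S - ?T) \<in> ?B ?T"
   proof -
    have "r i \<in> S - ?T" if "i \<in> S - ?T" for i using that rS u(2) by auto
    then show ?thesis using u(1,2) by (auto simp: PiE_iff)
   qed
   then show "q \<in> (SIGMA T:stab r S. ?B T)" using T u(3) by simp
  qed
  show "?g ` (SIGMA T:stab r S. ?B T) \<subseteq> ?C"
  proof
   fix q assume "q \<in> ?g ` (SIGMA T:stab r S. ?B T)"
   then obtain T u where q: "q = ?g (T, u)" "T \<in> stab r S" "u \<in> S - T \<rightarrow>\<^sub>E X" "\<forall>i\<in>S - T. u (r i) = u i" by auto
   have "q \<in> S \<rightarrow>\<^sub>E insert a X" using q(3) by (auto simp: q(1) PiE_iff)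
   moreover have "q (r i) = q i" if i: "i \<in> S" for i
    using i rS[OF i] stT[OF q(2) i] q(4) by (auto simp: q(1))
   ultimately show "q \<in> ?C" by blast
  qed
 qed
 then have "card ?C = card (SIGMA T:stab r S. ?B T)" by (rule bij_betw_same_card)
 also have "... = (\<Sum>T\<in>stab r S. card (?B T))"
  by (rule card_SigmaI[OF finite_stab[OF S(1)]]) (intro ballI finite_invariant_funs[OF X], use S(1) in simp)
 finally show ?thesis .
qed

lemma card_invariant_funs:
 assumes "finite X" "finite S" "inj_on r S" "r ` S = S"
 shows "card {u \<in> S \<rightarrow>\<^sub>E X. \<forall>i\<in>S. u (r i) = u i} = ncol (card X) r S"
 using assms
proof (induction X arbitrary: S rule: finite_induct)
 case empty
 show ?case
 proof (cases "S = {}")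
  case False
  then have "S \<rightarrow>\<^sub>E {} = ({} :: (nat => 'a) set)" by (auto simp: PiE_eq_empty_iff)
  then show ?thesis using False by simp
 qed simp
next
 case (insert a X)
 have "card {u \<in> S \<rightarrow>\<^sub>E insert a X. \<forall>i\<in>S. u (r i) = u i} = (\<Sum>T\<in>stab r S. card {u \<in> S - T \<rightarrow>\<^sub>E X. \<forall>i\<in>S - T. u (r i) = u i})"
  by (rule ncol_Suc_funs[OF insert.hyps(2) insert.prems insert.hyps(1)])
 also have "... = (\<Sum>T\<in>stab r S. ncol (card X) r (S - T))"
 proof (rule sum.cong[OF refl])
  fix T assume T: "T \<in> stab r S"
  have i: "inj_on r (S - T)" by (rule inj_on_subset[OF insert.prems(2) Diff_subset])
  have "r ` (S - T) = S - T"
   using inj_on_image_set_diff[OF insert.prems(2) Diff_subset stab_sub[OF T]] T insert.prems(3) stab_sub[OF T] by (simp add: stab_def double_diff)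
  then show "card {u \<in> S - T \<rightarrow>\<^sub>E X. \<forall>i\<in>S - T. u (r i) = u i} = ncol (card X) r (S - T)"
   by (rule insert.IH[OF finite_Diff[OF insert.prems(1)] i])
 qed
 finally show ?case using insert.hyps by simp
qed

text \<open>On stable sets with at most \<open>n\<close> elements, \<open>anti n\<close> is the convolution inverse of the constant 1.\<close>

primrec anti :: "nat => (nat => nat) => nat set => complex" where
 "anti 0 r V = (if V = {} then 1 else 0)"
| "anti (Suc n) r V = (if V = {} then 1 else 0) - (\<Sum>S\<in>stab r V - {V}. anti n r S)"

text \<open>Each level of the recursion passes to proper subsets, so levels beyond the cardinality
  change nothing.\<close>

lemma anti_stable: "finite V ==> card V \<le> n ==> anti n r V = anti (card V) r V"
proof (induction n arbitrary: V rule: less_induct)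
 case (less n)
 show ?case
 proof (cases "V = {}")
  case True
  then show ?thesis by (cases n) (simp_all add: stab_empty)
 next
  case False
  then obtain c where c: "card V = Suc c" using less.prems(1) by (cases "card V") auto
  then obtain m where m: "n = Suc m" using less.prems(2) by (cases n) auto
  have sm: "card S \<le> c & finite S" if "S \<in> stab r V - {V}" for S
  proof -
   have "S \<subset> V" using that stab_sub by blast
   have "finite S" using \<open>S \<subset> V\<close> by (intro finite_subset[OF _ less.prems(1)]) blast
   moreover have "card S < card V" by (rule psubset_card_mono[OF less.prems(1) \<open>S \<subset> V\<close>])
   ultimately show ?thesis using c by simp
  qed
  have "(\<Sum>S\<in>stab r V - {V}. anti m r S) = (\<Sum>S\<in>stab r V - {V}. anti c r S)"
  proof (rule sum.cong[OF refl])
   fix S assume S: "S \<in> stab r V - {V}"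
   have cm: "c \<le> m" using less.prems(2) c m by simp
   have "anti m r S = anti (card S) r S" using less.IH[of m S] sm[OF S] cm m by simp
   moreover have "anti c r S = anti (card S) r S" using less.IH[of c S] sm[OF S] cm m by simp
   ultimately show "anti m r S = anti c r S" by simp
  qed
  then show ?thesis unfolding c m by simp
 qed
qed

text \<open>The recursion is arranged so that the value at a nonempty \<open>V\<close> cancels the
  sum over its proper stable subsets; \<open>anti_stable\<close> brings the levels into
  line.\<close>

lemma sum_anti:
 assumes V: "finite V" "r ` V = V"
 shows "(\<Sum>S\<in>stab r V. anti (card S) r S) = (if V = {} then 1 else 0)"
proof (cases "V = {}")
 case True
 then show ?thesis by (simp add: stab_empty)
next
 case False
 then obtain c where c: "card V = Suc c" using V(1) by (cases "card V") auto
 have "(\<Sum>S\<in>stab r V. anti (card S) r S) = anti (card V) r V + (\<Sum>S\<in>stab r V - {V}. anti (card S) r S)"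
  by (rule sum.remove[OF finite_stab[OF V(1)]]) (simp add: stab_def V(2))
 also have "(\<Sum>S\<in>stab r V - {V}. anti (card S) r S) = (\<Sum>S\<in>stab r V - {V}. anti c r S)"
 proof (rule sum.cong[OF refl])
  fix S assume "S \<in> stab r V - {V}"
  then have "S \<subset> V" using stab_sub by blast
  have "finite S" using \<open>S \<subset> V\<close> by (intro finite_subset[OF _ V(1)]) blast
  moreover have "card S \<le> c" using psubset_card_mono[OF V(1) \<open>S \<subset> V\<close>] c by simp
  ultimately have "card S \<le> c" "finite S" by simp_all
  then show "anti (card S) r S = anti c r S" by (rule anti_stable[symmetric, rotated])
 qed
 finally show ?thesis using False unfolding c by simp
qed

section \<open>Operators acting by scalars at points, and the antipode\<close>

context rep_tgroup begin

text \<open>Operators that are diagonal in the evaluation at points, with scalars independent of the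
  labels. The identity, unit after counit, \<Psi> and the antipode are of this kind, and convolution
  of operators becomes convolution of scalars.\<close>

definition multiplier :: "('g repgrp => 'g repgrp) => ((nat => nat) => nat set => complex) => bool" where
 "multiplier T m \<longleftrightarrow> (\<forall>x\<in>carrier M. T x \<in> carrier M & (\<forall>V r d. point G V r d --> hat G (T x) V r d = m r V * hat G x V r d))"

lemma multiplierD:
 assumes "multiplier T m" "x \<in> carrier M"
 shows "T x \<in> carrier M" "point G V r d ==> hat G (T x) V r d = m r V * hat G x V r d"
 using assms by (simp_all add: multiplier_def)

lemma multiplier_hom: assumes T: "multiplier T m" shows "T \<in> hom M M"
proof (rule homI)
 fix x y assume x: "x \<in> carrier M" and y: "y \<in> carrier M"
 note xy = M.m_closed[OF x y]
 show "T (x \<otimes>\<^bsub>M\<^esub> y) = T x \<otimes>\<^bsub>M\<^esub> T y"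
 proof (rule hat_eqI[OF multiplierD(1)[OF T xy] M.m_closed[OF multiplierD(1)[OF T x] multiplierD(1)[OF T y]]])
  fix V r d assume pt: "point G V r d"
  show "hat G (T (x \<otimes>\<^bsub>M\<^esub> y)) V r d = hat G (T x \<otimes>\<^bsub>M\<^esub> T y) V r d"
   unfolding multiplierD(2)[OF T xy pt] add_fun_mult[OF add_fun_hat[OF pt] x y]
    add_fun_mult[OF add_fun_hat[OF pt] multiplierD(1)[OF T x] multiplierD(1)[OF T y]] multiplierD(2)[OF T x pt] multiplierD(2)[OF T y pt]
   by (rule distrib_left)
 qed
qed (rule multiplierD(1)[OF T])

lemma comp_eqI:
 assumes x: "x \<in> RG G" and y: "y \<in> RG G"
  and eq: "!!V r d. point G V r d ==> card V = n ==> hat G x V r d = hat G y V r d"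
 shows "x n = y n"
proof (rule finite_group.K0_eqI[OF finite_group_W])
 show "x n \<in> carrier (KW n G)" "y n \<in> carrier (KW n G)" using x y by (simp_all add: RG_def)
 fix g assume g: "g \<in> carrier (wreath n G)"
 obtain q f where g': "g = (q, f)" by (cases g)
 have P: "presents G n (%i. i) q (%i. f (q i)) g" unfolding g' by (rule presents_self) (use g g' in simp)
 have im: "(%i. i) ` {1..n} = {1..n}" by simp
 show "kch (wreath n G) (x n) g = kch (wreath n G) (y n) g"
  using eq[OF presents_point[OF P]] unfolding im hat_presents[OF finite_group_axioms x P im] hat_presents[OF finite_group_axioms y P im] by simp
qed

lemma multiplier_graded: assumes T: "multiplier T m" shows "graded_map M M T"
 unfolding graded_map_def
proof (intro allI subsetI)
 fix n z assume "z \<in> T ` grade M n"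
 then obtain x where x: "x \<in> grade M n" "z = T x" by blast
 have xc: "x \<in> carrier M" and xn: "!!k. k ~= n ==> x k = \<one>\<^bsub>M\<^esub> k" using x(1) by (simp_all add: grade_iff one_M)
 have "z k = \<one>\<^bsub>M\<^esub> k" if k: "k ~= n" for k unfolding x(2)
 proof (rule comp_eqI[OF M_RG[OF multiplierD(1)[OF T xc]] M_RG[OF M.one_closed]])
  fix V r d assume pt: "point G V r d" and c: "card V = k"
  have "hat G x V r d = hat G \<one>\<^bsub>M\<^esub> V r d" unfolding hat_def c by (simp only: xn[OF k])
  also have "... = 0" by (rule M.add_fun_one[OF add_fun_hat[OF pt]])
  finally show "hat G (T x) V r d = hat G \<one>\<^bsub>M\<^esub> V r d"
   unfolding multiplierD(2)[OF T xc pt] M.add_fun_one[OF add_fun_hat[OF pt]] by simp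
 qed
 then show "z \<in> grade M n" using multiplierD(1)[OF T xc] x(2) by (simp add: grade_iff one_M)
qed

lemma multiplier_id: "multiplier (%x. x) (%r V. 1)"
 by (simp add: multiplier_def)

lemma multiplier_unit_counit: "multiplier (%x. R_unit G (R_counit G x)) (%r V. if V = {} then 1 else 0)"
 unfolding multiplier_def
proof (intro ballI conjI allI impI)
 fix x V r d assume x: "x \<in> carrier M" and pt: "point G V r d"
 show "hat G (R_unit G (R_counit G x)) V r d = (if V = {} then 1 else 0) * hat G x V r d"
  unfolding hat_unit[OF pt] using counit_eval[OF x, of r d] by simp
qed (rule R_unit_closed)

lemma multiplier_conv:
 assumes S: "multiplier S m" and T: "multiplier T m'"
 shows "multiplier (%x. ind_map G G (tensor_map M M S T (res_map G G x))) (%r V. \<Sum>U\<in>stab r V. m r U * m' r (V - U))"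
 unfolding multiplier_def
proof (intro ballI conjI allI impI)
 fix x assume x: "x \<in> carrier M"
 let ?t = "tensor_map M M S T (res_map G G x)"
 have t: "?t \<in> carrier (tensor M M)"
  using comult_tensor_map_closed[OF x T.tgroup_axioms T.tgroup_axioms multiplierD(1)[OF S] multiplierD(1)[OF T]] by simp
 show "ind_map G G ?t \<in> carrier M" by (rule prod_closed[OF t])
 fix V r d assume pt: "point G V r d"
 have "hat G (ind_map G G ?t) V r d = (\<Sum>U\<in>stab r V. lin ?t (%(w, v). subgroup_pair.ihat G (carrier G) w U r d * hat G v (V - U) r d))"
  using rep_pair.ind_map_eval[OF self_pair _ pt, unfolded carrier_update_self, OF t] .
 also have "... = (\<Sum>U\<in>stab r V. lin ?t (%(w, v). hat G w U r d * hat G v (V - U) r d))"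
  by (rule sum.cong[OF refl], rule lin_MM_cong[OF t])
   (simp only: subgroup_pair.ihat_full[OF self_subgroup_pair refl M_RG point_stab(1)[OF pt]])
 also have "... = (\<Sum>U\<in>stab r V. m r U * m' r (V - U) * hat G x V r d)"
 proof (rule sum.cong[OF refl])
  fix U assume U: "U \<in> stab r V"
  note p1 = point_stab(1)[OF pt U] and p2 = point_stab(2)[OF pt U]
  have "lin ?t (%(w, v). hat G w U r d * hat G v (V - U) r d) = lin (res_map G G x) (%(w, v). hat G (S w) U r d * hat G (T v) (V - U) r d)"
   by (rule lin_comult_tensor_map[OF x T.tgroup_axioms T.tgroup_axioms multiplierD(1)[OF S] multiplierD(1)[OF T] add_fun_hat[OF p1] add_fun_hat[OF p2]])
  also have "... = lin (res_map G G x) (%(w, v). (m r U * m' r (V - U)) * (hat G w U r d * hat G v (V - U) r d))"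
   by (rule lin_MM_cong[OF comult_closed[OF x]]) (simp only: multiplierD(2)[OF S _ p1] multiplierD(2)[OF T _ p2] mult.assoc mult.left_commute)
  also have "... = (m r U * m' r (V - U)) * lin (res_map G G x) (%(w, v). hat G w U r d * hat G v (V - U) r d)"
   by (simp only: case_prod_unfold lin_mult_left)
  also have "lin (res_map G G x) (%(w, v). hat G w U r d * hat G v (V - U) r d) = hat G x (U \<union> (V - U)) r d"
   by (rule comult_eval[OF x p1 p2]) blast
  also have "U \<union> (V - U) = V" using stab_sub[OF U] by blast
  finally show "lin ?t (%(w, v). hat G w U r d * hat G v (V - U) r d) = m r U * m' r (V - U) * hat G x V r d" .
 qed
 finally show "hat G (ind_map G G ?t) V r d = (\<Sum>U\<in>stab r V. m r U * m' r (V - U)) * hat G x V r d" by (simp only: sum_distrib_right)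
qed

lemma multiplier_diff:
 assumes S: "multiplier S m" and T: "multiplier T m'"
 shows "multiplier (%x. S x \<otimes>\<^bsub>M\<^esub> inv\<^bsub>M\<^esub> T x) (%r V. m r V - m' r V)"
 unfolding multiplier_def
proof (intro ballI conjI allI impI)
 fix x assume x: "x \<in> carrier M"
 note Sc = multiplierD(1)[OF S x] and Tc = multiplierD(1)[OF T x]
 show "S x \<otimes>\<^bsub>M\<^esub> inv\<^bsub>M\<^esub> T x \<in> carrier M" by (rule M.m_closed[OF Sc M.inv_closed[OF Tc]])
 fix V r d assume pt: "point G V r d"
 show "hat G (S x \<otimes>\<^bsub>M\<^esub> inv\<^bsub>M\<^esub> T x) V r d = (m r V - m' r V) * hat G x V r d"
  unfolding add_fun_mult[OF add_fun_hat[OF pt] Sc M.inv_closed[OF Tc]] M.add_fun_inv[OF add_fun_hat[OF pt] Tc]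
   multiplierD(2)[OF S x pt] multiplierD(2)[OF T x pt] by (simp add: left_diff_distrib)
qed

lemma multiplier_cong:
 assumes "multiplier T m" "!!V r d. point G V r d ==> m r V = m' r V"
 shows "multiplier T m'"
 using assms by (simp add: multiplier_def)

text \<open>A function of points need not come from an operator on the lattice R(G), so the operator
  is built from known ones: the next level is unit after counit, minus the convolution of the
  present level with the difference of the identity and unit after counit.\<close>

lemma exists_anti: "\<exists>T. multiplier T (anti n)"
proof (induction n)
 case 0
 show ?case by (rule exI, rule multiplier_cong[OF multiplier_unit_counit]) simp
next
 case (Suc n)
 then obtain T where T: "multiplier T (anti n)" by blast
 let ?J = "%x. x \<otimes>\<^bsub>M\<^esub> inv\<^bsub>M\<^esub> R_unit G (R_counit G x)"
 have J: "multiplier ?J (%r V. 1 - (if V = {} then 1 else 0))" by (rule multiplier_diff[OF multiplier_id multiplier_unit_counit])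
 note D = multiplier_diff[OF multiplier_unit_counit multiplier_conv[OF T J]]
 show ?case
 proof (rule exI, rule multiplier_cong[OF D])
  fix V :: "nat set" and r :: "nat => nat" and d assume pt: "point G V r d"
  have fs: "finite (stab r V)" by (rule finite_stab[OF pointD(1)[OF pt]])
  \<comment> \<open>The scalar of \<open>?J\<close> is 0 at the empty set and 1 elsewhere, so
    \<open>U = V\<close> drops out.\<close>
  have "(\<Sum>U\<in>stab r V. anti n r U * (1 - (if V - U = {} then 1 else 0)))
   = (\<Sum>U\<in>stab r V - {V}. anti n r U * (1 - (if V - U = {} then 1 else 0)))"
   by (rule sum.mono_neutral_right[OF fs]) auto
  also have "... = (\<Sum>U\<in>stab r V - {V}. anti n r U)"
  proof (rule sum.cong[OF refl])
   fix U assume "U \<in> stab r V - {V}"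
   then have "V - U ~= {}" using stab_sub by blast
   then show "anti n r U * (1 - (if V - U = {} then 1 else 0)) = anti n r U" by (simp only: if_False diff_0_right mult_1_right)
  qed
  finally show "(if V = {} then 1 else 0) - (\<Sum>U\<in>stab r V. anti n r U * (1 - (if V - U = {} then 1 else 0))) = anti (Suc n) r V"
   by (simp only: anti.simps)
 qed
qed

lemma antipode_multiplier: "\<exists>T. multiplier T (%r V. anti (card V) r V)"
proof -
 obtain T where T: "multiplier (T n) (anti n)" for n using exists_anti by metis
 \<comment> \<open>Degree \<open>n\<close> sees sets with \<open>n\<close> elements only, and for
   them level \<open>n\<close> of the recursion is final; the operators are glued degree by
   degree.\<close>
 let ?T = "%x n. T n x n"
 have "multiplier ?T (%r V. anti (card V) r V)"
  unfolding multiplier_def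
 proof (intro ballI conjI allI impI)
  fix x assume x: "x \<in> carrier M"
  have Tx: "T n x \<in> carrier M" for n by (rule multiplierD(1)[OF T x])
  \<comment> \<open>Keeps the support finite: an operator acting by scalars cannot create a
    component in a degree where \<open>x\<close> has none.\<close>
  have "T n x n = \<one>\<^bsub>KW n G\<^esub>" if n: "x n = \<one>\<^bsub>KW n G\<^esub>" for n
  proof -
   have "T n x n = \<one>\<^bsub>M\<^esub> n"
   proof (rule comp_eqI[OF M_RG[OF Tx] M_RG[OF M.one_closed]])
    fix V r d assume pt: "point G V r d" and c: "card V = n"
    have "x n = \<one>\<^bsub>M\<^esub> n" using n by (simp add: one_M)
    then have "hat G x V r d = hat G \<one>\<^bsub>M\<^esub> V r d" unfolding hat_def c by (simp only:)
    also have "... = 0" by (rule M.add_fun_one[OF add_fun_hat[OF pt]])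
    finally show "hat G (T n x) V r d = hat G \<one>\<^bsub>M\<^esub> V r d"
     unfolding multiplierD(2)[OF T x pt] M.add_fun_one[OF add_fun_hat[OF pt]] by simp
   qed
   then show ?thesis by (simp add: one_M)
  qed
  then have "{n. T n x n ~= \<one>\<^bsub>KW n G\<^esub>} \<subseteq> {n. x n ~= \<one>\<^bsub>KW n G\<^esub>}" by blast
  then have "finite {n. T n x n ~= \<one>\<^bsub>KW n G\<^esub>}" by (rule finite_subset) (use x in \<open>simp add: carrier_M\<close>)
  then show "?T x \<in> carrier M" using M_comp[OF Tx] by (simp add: carrier_M)
  fix V r d assume pt: "point G V r d"
  have "hat G (?T x) V r d = hat G (T (card V) x) V r d" by (simp add: hat_def)
  then show "hat G (?T x) V r d = anti (card V) r V * hat G x V r d" unfolding multiplierD(2)[OF T x pt] .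
 qed
 then show ?thesis by blast
qed

lemma antipode:
 "\<exists>T. T \<in> hom M M & graded_map M M T & (\<forall>x\<in>carrier M.
  ind_map G G (tensor_map M M T (%y. y) (res_map G G x)) = R_unit G (R_counit G x) &
  ind_map G G (tensor_map M M (%y. y) T (res_map G G x)) = R_unit G (R_counit G x))"
proof -
 obtain T where T: "multiplier T (%r V. anti (card V) r V)" using antipode_multiplier by blast
 note 1 = multiplier_conv[OF T multiplier_id] and 2 = multiplier_conv[OF multiplier_id T]
 have "ind_map G G (tensor_map M M T (%y. y) (res_map G G x)) = R_unit G (R_counit G x) &
  ind_map G G (tensor_map M M (%y. y) T (res_map G G x)) = R_unit G (R_counit G x)" if x: "x \<in> carrier M" for x
 proof
  show "ind_map G G (tensor_map M M T (%y. y) (res_map G G x)) = R_unit G (R_counit G x)"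
  proof (rule hat_eqI[OF multiplierD(1)[OF 1 x] R_unit_closed])
   fix V r d assume pt: "point G V r d"
   show "hat G (ind_map G G (tensor_map M M T (%y. y) (res_map G G x))) V r d = hat G (R_unit G (R_counit G x)) V r d"
    unfolding multiplierD(2)[OF 1 x pt] multiplierD(2)[OF multiplier_unit_counit x pt] mult_1_right sum_anti[OF pointD(1,3)[OF pt]] ..
  qed
  show "ind_map G G (tensor_map M M (%y. y) T (res_map G G x)) = R_unit G (R_counit G x)"
  proof (rule hat_eqI[OF multiplierD(1)[OF 2 x] R_unit_closed])
   fix V r d assume pt: "point G V r d"
   show "hat G (ind_map G G (tensor_map M M (%y. y) T (res_map G G x))) V r d = hat G (R_unit G (R_counit G x)) V r d"
    unfolding multiplierD(2)[OF 2 x pt] multiplierD(2)[OF multiplier_unit_counit x pt] mult_1_left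
     stab_swap[OF pointD(2,3)[OF pt], of "%U. anti (card U) r U"] sum_anti[OF pointD(1,3)[OF pt]] ..
  qed
 qed
 then show ?thesis using multiplier_hom[OF T] multiplier_graded[OF T] by blast
qed

end

section \<open>The PSH-algebra R(G)\<close>

lemmas R_psh_ops = R_psh_simps(6-9)

lemma ncol_1: "finite V ==> r ` V = V ==> ncol (Suc 0) r V = 1"
proof -
 assume V: "finite V" "r ` V = V"
 have "(\<Sum>S\<in>stab r V. ncol 0 r (V - S)) = (\<Sum>S\<in>stab r V. if S = V then 1 else 0)"
  by (rule sum.cong[OF refl]) (auto simp: stab_def)
 also have "... = 1" using finite_stab[OF V(1)] V(2) by (simp add: stab_def)
 finally show ?thesis by (simp only: ncol.simps)
qed

lemma (in rep_tgroup) counit_right: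
 assumes x: "x \<in> carrier M" shows "zlift M (%(y, z). y [^]\<^bsub>M\<^esub> R_counit G z) (res_map G G x) = x"
proof -
 have c: "(case p of (y, z) => y [^]\<^bsub>M\<^esub> R_counit G z) \<in> carrier M" if "p \<in> keys (res_map G G x)" for p
 proof -
  have "p \<in> irr M \<times> irr M" using that comult_closed[OF x] by auto
  then have "fst p \<in> carrier M" using irr_M_closed by auto
  then show ?thesis by (simp add: case_prod_beta M.int_pow_closed)
 qed
 show ?thesis
 proof (rule hat_eqI[OF M.zlift_closed[OF c] x])
  fix V r d assume pt: "point G V r d"
  have "hat G (zlift M (%(y, z). y [^]\<^bsub>M\<^esub> R_counit G z) (res_map G G x)) V r d
   = lin (res_map G G x) (%p. hat G (case p of (y, z) => y [^]\<^bsub>M\<^esub> R_counit G z) V r d)"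
   by (rule M.add_fun_zlift[OF add_fun_hat[OF pt] c])
  also have "... = lin (res_map G G x) (%(y, z). hat G (y [^]\<^bsub>M\<^esub> R_counit G z) V r d)" by (simp add: case_prod_unfold)
  also have "... = lin (res_map G G x) (%(y, z). hat G y V r d * hat G z {} r d)"
   by (rule lin_MM_cong[OF comult_closed[OF x]]) (simp only: counit_eval M.add_fun_int_pow[OF add_fun_hat[OF pt]] mult.commute)
  also have "... = hat G x (V \<union> {}) r d" by (rule comult_eval[OF x pt point_empty]) simp
  finally show "hat G (zlift M (%(y, z). y [^]\<^bsub>M\<^esub> R_counit G z) (res_map G G x)) V r d = hat G x V r d" by simp
 qed
qed

lemma (in rep_tgroup) unit_right:
 assumes x: "x \<in> carrier M" shows "gprod x (R_unit G 1) = x"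
proof (rule hat_eqI[OF gprod_closed[OF x R_unit_closed] x])
 fix V r d assume pt: "point G V r d"
 have "hat G (gprod x (R_unit G 1)) V r d = (\<Sum>S\<in>stab r V. hat G x S r d * hat G (R_unit G 1) (V - S) r d)"
  by (rule gprod_eval[OF x R_unit_closed pt])
 also have "... = (\<Sum>S\<in>stab r V. if S = V then hat G x V r d else 0)"
 proof (rule sum.cong[OF refl])
  fix S assume S: "S \<in> stab r V"
  have "V - S = {} \<longleftrightarrow> S = V" using stab_sub[OF S] by blast
  then show "hat G x S r d * hat G (R_unit G 1) (V - S) r d = (if S = V then hat G x V r d else 0)"
   unfolding hat_unit[OF point_stab(2)[OF pt S]] by simp
 qed
 also have "... = hat G x V r d" using finite_stab[OF pointD(1)[OF pt]] point_V_stab(1)[OF pt] by simp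
 finally show "hat G (gprod x (R_unit G 1)) V r d = hat G x V r d" .
qed

lemma (in rep_tgroup) comult_unit: "res_map G G (R_unit G 1) = tens M M (R_unit G 1) (R_unit G 1)"
proof (rule tensor_eqI_self[OF comult_closed[OF R_unit_closed] tens_closed[OF R_unit_closed R_unit_closed]])
 fix V1 V2 r d assume dis: "V1 \<inter> V2 = {}" and p1: "point G V1 r d" and p2: "point G V2 r d"
 have "lin (res_map G G (R_unit G 1)) (%(w, v). hat G w V1 r d * hat G v V2 r d) = hat G (R_unit G 1) (V1 \<union> V2) r d"
  by (rule comult_eval[OF R_unit_closed p1 p2 dis])
 also have "... = hat G (R_unit G 1) V1 r d * hat G (R_unit G 1) V2 r d"
  unfolding hat_unit[OF p1] hat_unit[OF p2] hat_unit[OF point_union[OF p1 p2 dis]] by simp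
 also have "... = lin (tens M M (R_unit G 1) (R_unit G 1)) (%(w, v). hat G w V1 r d * hat G v V2 r d)"
  by (rule lin_tens[OF T.tgroup_axioms T.tgroup_axioms R_unit_closed R_unit_closed add_fun_hat[OF p1] add_fun_hat[OF p2], symmetric])
 finally show "lin (res_map G G (R_unit G 1)) (%(w, v). hat G w V1 r d * hat G v V2 r d)
  = lin (tens M M (R_unit G 1) (R_unit G 1)) (%(w, v). hat G w V1 r d * hat G v V2 r d)" .
qed

lemma (in rep_tgroup) counit_gprod:
 assumes x: "x \<in> carrier M" and y: "y \<in> carrier M"
 shows "R_counit G (gprod x y) = R_counit G x * R_counit G y"
proof -
 have "hat G (gprod x y) {} id undefined = hat G x {} id undefined * hat G y {} id undefined"
  unfolding gprod_eval[OF x y point_empty] by (simp add: stab_empty)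
 then have "(of_int (R_counit G (gprod x y)) :: complex) = of_int (R_counit G x * R_counit G y)"
  unfolding counit_eval[OF gprod_closed[OF x y]] counit_eval[OF x] counit_eval[OF y] of_int_mult .
 then show ?thesis by (simp only: of_int_eq_iff)
qed

text \<open>The instance \<open>H = G\<close> of the Hopf axiom: its conditions on conjugation are
  automatic, and the count of labellings is 1.\<close>

lemma (in rep_tgroup) comult_gprod:
 assumes x: "x \<in> carrier M" and y: "y \<in> carrier M"
 shows "res_map G G (gprod x y) = frag_extend (%(x1, x2). frag_extend (%(y1, y2).
    tens M M (gprod x1 y1) (gprod x2 y2)) (res_map G G y)) (res_map G G x)"
proof (rule rep_pair.hopf[OF self_pair, unfolded carrier_update_self, where P = "%h. h", OF _ _ _ _ x y])
 show "g \<otimes>\<^bsub>G\<^esub> x \<otimes>\<^bsub>G\<^esub> inv\<^bsub>G\<^esub> g \<in> carrier G" if "g \<in> carrier G" "x \<in> carrier G" for g x using that by simp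
 show "\<exists>h\<in>carrier G. \<forall>x\<in>carrier G. g \<otimes>\<^bsub>G\<^esub> x \<otimes>\<^bsub>G\<^esub> inv\<^bsub>G\<^esub> g = h \<otimes>\<^bsub>G\<^esub> x \<otimes>\<^bsub>G\<^esub> inv\<^bsub>G\<^esub> h" if "g \<in> carrier G" for g using that by blast
 show "hat G h S r d = of_nat (card (subgroup_pair.labs G (carrier G) S r d)) * hat G h S r d" if pt: "point G S r d" for h S r d
 proof -
  obtain \<tau> where "subgroup_pair.labs G (carrier G) S r d = {\<tau>}" using subgroup_pair.labs_full[OF self_subgroup_pair refl pt] by blast
  then show ?thesis by simp
 qed
qed

lemma psh_algebra_R_psh:
 assumes G: "finite_group G" shows "psh_algebra (R_psh G)"
proof -
 interpret A: rep_tgroup G "R_psh G" by (rule rep_tgroup_R_psh[OF G])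
 note pair = A.self_pair
 note pair' = rep_pair.ind_map_hom[OF pair] rep_pair.res_map_hom[OF pair] rep_pair.ind_map_graded[OF pair] rep_pair.res_map_graded[OF pair]
  rep_pair.gact_assoc[OF pair, symmetric] rep_pair.coact_coassoc[OF pair] rep_pair.coact_counit[OF pair]
  rep_pair.ind_map_positive[OF pair] rep_pair.res_map_positive[OF pair] rep_pair.ind_res_adjoint[OF pair]
 note ax = pair'[unfolded carrier_update_self] A.unit_hom A.counit_hom A.unit_graded A.counit_graded A.unit_right A.counit_right
  A.comult_gprod A.comult_unit A.counit_gprod A.counit_unit A.antipode A.unit_positive A.counit_positive A.unit_counit_adjoint
 have unit_left: "A.gprod (R_unit G 1) x = x" if x: "x \<in> carrier (R_psh G)" for x
  using rep_pair.gact_unit[OF pair, unfolded carrier_update_self, OF x, of 1] unfolding A.M.int_pow_1[OF x] .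
 have conn: "R_unit G (R_counit G x) = x" if x: "x \<in> grade (R_psh G) 0" for x
 proof -
  have xc: "x \<in> carrier (R_psh G)" and x0: "!!m. m ~= 0 ==> x m = \<one>\<^bsub>KW m G\<^esub>" using x by (simp_all add: A.grade_iff)
  have "R_inj G 0 (x 0) m = x m" for m by (cases "m = 0") (simp_all add: R_inj_same R_inj_other x0)
  then show ?thesis unfolding A.unit_counit[OF xc] by blast
 qed
 show ?thesis
  by (intro psh_algebra.intro psh_algebra_axioms.intro; (unfold R_psh_ops)?; (rule A.graded_tgroup_M | assumption | rule ax unit_left conn; assumption))
qed

section \<open>The operations \<Psi> on R(G)\<close>

context
 fixes G :: "('g, 'm) monoid_scheme"
 assumes G: "finite_group G"
begin

interpretation A: rep_tgroup G "R_psh G" by (rule rep_tgroup_R_psh[OF G])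

text \<open>Nonemptiness of the lists lets \<open>iter_mult\<close> on \<open>y # ws\<close> unfold
  to a product.\<close>

lemma keys_iter_comult:
 "x \<in> carrier (R_psh G) ==> keys (iter_comult (R_psh G) (Suc k) x) \<subseteq> {ws. ws ~= [] & set ws \<subseteq> irr (R_psh G)}"
proof (induction k arbitrary: x)
 case 0
 have "keys (frag_extend (%w. frag_of [w]) (coords (R_psh G) x)) \<subseteq> {ws. ws ~= [] & set ws \<subseteq> irr (R_psh G)}"
 proof (rule keys_frag_extend_subset)
  fix w assume "w \<in> keys (coords (R_psh G) x)"
  then have "w \<in> irr (R_psh G)" using A.T.keys_coords[OF 0] by blast
  then show "keys (frag_of [w]) \<subseteq> {ws. ws ~= [] & set ws \<subseteq> irr (R_psh G)}" by (simp add: keys_frag_of)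
 qed
 then show ?case by simp
next
 case (Suc k)
 have "keys (frag_extend (%(y, z). frag_extend (%ws. frag_of (y # ws)) (iter_comult (R_psh G) (Suc k) z)) (res_map G G x))
  \<subseteq> {ws. ws ~= [] & set ws \<subseteq> irr (R_psh G)}"
 proof (rule keys_frag_extend_subset)
  fix p assume "p \<in> keys (res_map G G x)"
  then obtain y z where p: "p = (y, z)" "y \<in> irr (R_psh G)" "z \<in> irr (R_psh G)" using A.comult_closed[OF Suc.prems] by auto
  have zc: "z \<in> carrier (R_psh G)" using p(3) A.irr_M_closed by blast
  have "keys (frag_extend (%ws. frag_of (y # ws)) (iter_comult (R_psh G) (Suc k) z)) \<subseteq> {ws. ws ~= [] & set ws \<subseteq> irr (R_psh G)}"
  proof (rule keys_frag_extend_subset)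
   fix ws assume "ws \<in> keys (iter_comult (R_psh G) (Suc k) z)"
   then have "set ws \<subseteq> irr (R_psh G)" using Suc.IH[OF zc] by blast
   then show "keys (frag_of (y # ws)) \<subseteq> {ws. ws ~= [] & set ws \<subseteq> irr (R_psh G)}" using p(2) by (simp add: keys_frag_of)
  qed
  then show "keys (case p of (y, z) => frag_extend (%ws. frag_of (y # ws)) (iter_comult (R_psh G) (Suc k) z)) \<subseteq> {ws. ws ~= [] & set ws \<subseteq> irr (R_psh G)}"
   by (simp only: p(1) prod.case)
 qed
 then show ?case by (simp only: iter_comult.simps R_psh_ops)
qed

lemma iter_mult_closed: "ws ~= [] ==> set ws \<subseteq> irr (R_psh G) ==> iter_mult (R_psh G) ws \<in> carrier (R_psh G)"
proof (induction ws)
 case step: (Cons x ws)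
 have x: "x \<in> carrier (R_psh G)" using step.prems A.irr_M_closed by auto
 show ?case
 proof (cases ws)
  case Nil
  then show ?thesis using x by simp
 next
  case (Cons y zs)
  have "iter_mult (R_psh G) ws \<in> carrier (R_psh G)" using step.IH step.prems Cons by simp
  then show ?thesis using A.gprod_closed[OF x] unfolding Cons by (simp add: R_psh_ops)
 qed
qed simp

text \<open>Every further coproduct and product splits a stable set \<open>S\<close> off
  \<open>V\<close>, and the values on the two parts recombine to the value at \<open>V\<close>. What
  accumulates is the number of ordered decompositions, which obeys the recursion of
  \<open>ncol\<close>.\<close>

lemma iter_eval:
 "x \<in> carrier (R_psh G) ==> point G V r d ==>
  lin (iter_comult (R_psh G) (Suc k) x) (%ws. hat G (iter_mult (R_psh G) ws) V r d) = of_nat (ncol (Suc k) r V) * hat G x V r d"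
proof (induction k arbitrary: x V)
 case 0
 have "lin (iter_comult (R_psh G) (Suc 0) x) (%ws. hat G (iter_mult (R_psh G) ws) V r d) = lin (coords (R_psh G) x) (%w. hat G w V r d)"
  by (simp add: lin_extend)
 also have "... = hat G x V r d" by (rule A.T.lin_coords[OF A.add_fun_hat[OF 0(2)] 0(1)])
 finally show ?case unfolding ncol_1[OF pointD(1,3)[OF 0(2)]] by simp
next
 case (Suc k)
 note x = Suc.prems(1) and pt = Suc.prems(2)
 let ?h = "%x S. hat G x S r d"
 have "lin (iter_comult (R_psh G) (Suc (Suc k)) x) (%ws. ?h (iter_mult (R_psh G) ws) V)
  = lin (res_map G G x) (%(y, z). lin (iter_comult (R_psh G) (Suc k) z) (%ws. ?h (iter_mult (R_psh G) (y # ws)) V))"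
  by (simp only: iter_comult.simps R_psh_ops lin_extend lin_of case_prod_unfold)
 also have "... = lin (res_map G G x) (%(y, z). \<Sum>S\<in>stab r V. of_nat (ncol (Suc k) r (V - S)) * (?h y S * ?h z (V - S)))"
 proof (rule A.lin_MM_cong[OF A.comult_closed[OF x]])
  fix y z assume y: "y \<in> carrier (R_psh G)" and z: "z \<in> carrier (R_psh G)"
  have "lin (iter_comult (R_psh G) (Suc k) z) (%ws. ?h (iter_mult (R_psh G) (y # ws)) V)
   = lin (iter_comult (R_psh G) (Suc k) z) (%ws. \<Sum>S\<in>stab r V. ?h y S * ?h (iter_mult (R_psh G) ws) (V - S))"
  proof (rule lin_cong)
   fix ws assume "ws \<in> keys (iter_comult (R_psh G) (Suc k) z)"
   then have ws: "ws ~= []" "set ws \<subseteq> irr (R_psh G)" using keys_iter_comult[OF z] by blast+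
   obtain v vs where v: "ws = v # vs" using ws(1) by (cases ws) auto
   have "iter_mult (R_psh G) (y # ws) = A.gprod y (iter_mult (R_psh G) ws)" unfolding v by (simp only: iter_mult.simps R_psh_ops)
   then show "?h (iter_mult (R_psh G) (y # ws)) V = (\<Sum>S\<in>stab r V. ?h y S * ?h (iter_mult (R_psh G) ws) (V - S))"
    using A.gprod_eval[OF y iter_mult_closed[OF ws] pt] by simp
  qed
  also have "... = (\<Sum>S\<in>stab r V. ?h y S * lin (iter_comult (R_psh G) (Suc k) z) (%ws. ?h (iter_mult (R_psh G) ws) (V - S)))"
   by (simp only: lin_fun_sum lin_mult_left)
  also have "... = (\<Sum>S\<in>stab r V. of_nat (ncol (Suc k) r (V - S)) * (?h y S * ?h z (V - S)))"
   by (rule sum.cong[OF refl]) (simp only: Suc.IH[OF z point_stab(2)[OF pt]] mult.left_commute)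
  finally show "lin (iter_comult (R_psh G) (Suc k) z) (%ws. ?h (iter_mult (R_psh G) (y # ws)) V)
   = (\<Sum>S\<in>stab r V. of_nat (ncol (Suc k) r (V - S)) * (?h y S * ?h z (V - S)))" .
 qed
 also have "... = (\<Sum>S\<in>stab r V. of_nat (ncol (Suc k) r (V - S)) * lin (res_map G G x) (%(y, z). ?h y S * ?h z (V - S)))"
  by (simp only: case_prod_unfold lin_fun_sum lin_mult_left)
 also have "... = (\<Sum>S\<in>stab r V. of_nat (ncol (Suc k) r (V - S)) * ?h x V)"
 proof (rule sum.cong[OF refl])
  fix S assume S: "S \<in> stab r V"
  have "lin (res_map G G x) (%(y, z). ?h y S * ?h z (V - S)) = ?h x (S \<union> (V - S))"
   by (rule A.comult_eval[OF x point_stab(1)[OF pt S] point_stab(2)[OF pt S]]) blast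
  also have "S \<union> (V - S) = V" using stab_sub[OF S] by blast
  finally show "of_nat (ncol (Suc k) r (V - S)) * lin (res_map G G x) (%(y, z). ?h y S * ?h z (V - S)) = of_nat (ncol (Suc k) r (V - S)) * ?h x V" by simp
 qed
 also have "... = of_nat (ncol (Suc (Suc k)) r V) * ?h x V"
  by (simp only: ncol.simps(2)[of "Suc k"] of_nat_sum sum_distrib_right)
 finally show ?case .
qed

lemma psh_Psi_multiplier: "A.multiplier (psh_Psi (R_psh G) k) (%r V. of_nat (ncol k r V))"
proof (cases k)
 case 0
 have e: "psh_Psi (R_psh G) k = (%x. R_unit G (R_counit G x))" unfolding 0 psh_Psi_def[abs_def] R_psh_ops by simp
 show ?thesis unfolding e by (rule A.multiplier_cong[OF A.multiplier_unit_counit]) (simp add: 0)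
next
 case (Suc n)
 have e: "psh_Psi (R_psh G) k x = zlift (R_psh G) (iter_mult (R_psh G)) (iter_comult (R_psh G) (Suc n) x)" for x
  by (simp only: psh_Psi_def Suc nat.distinct if_False)
 show ?thesis unfolding A.multiplier_def
 proof (intro ballI conjI allI impI)
  fix x assume x: "x \<in> carrier (R_psh G)"
  have c: "iter_mult (R_psh G) ws \<in> carrier (R_psh G)" if "ws \<in> keys (iter_comult (R_psh G) (Suc n) x)" for ws
   using iter_mult_closed subsetD[OF keys_iter_comult[OF x] that] by blast
  show "psh_Psi (R_psh G) k x \<in> carrier (R_psh G)" unfolding e by (rule A.M.zlift_closed[OF c])
  fix V r d assume pt: "point G V r d"
  show "hat G (psh_Psi (R_psh G) k x) V r d = of_nat (ncol k r V) * hat G x V r d"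
  proof -
   have "hat G (psh_Psi (R_psh G) k x) V r d = lin (iter_comult (R_psh G) (Suc n) x) (%ws. hat G (iter_mult (R_psh G) ws) V r d)"
    unfolding e by (rule A.M.add_fun_zlift[OF A.add_fun_hat[OF pt] c])
   also have "... = of_nat (ncol k r V) * hat G x V r d" unfolding Suc by (rule iter_eval[OF x pt])
   finally show ?thesis .
  qed
 qed
qed

end

theorem theorem16:
  fixes G :: "('g, 'm) monoid_scheme" and H :: "'g set"
  assumes "group G" and "finite (carrier G)" and "H \<lhd> G"
    and "\<And>g. g \<in> carrier G \<Longrightarrow>
      \<exists>h\<in>H. \<forall>x\<in>H. g \<otimes>\<^bsub>G\<^esub> x \<otimes>\<^bsub>G\<^esub> inv\<^bsub>G\<^esub> g = h \<otimes>\<^bsub>G\<^esub> x \<otimes>\<^bsub>G\<^esub> inv\<^bsub>G\<^esub> h"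
  shows "psh_module (card (rcosets\<^bsub>G\<^esub> H)) (R_psh (G\<lparr>carrier := H\<rparr>)) (R_group G)
    (ind_map (G\<lparr>carrier := H\<rparr>) G) (res_map (G\<lparr>carrier := H\<rparr>) G)"
proof -
 interpret N: normal H G by (rule assms(3))
 have fG: "finite_group G" using assms(1,2) by (intro finite_group.intro finite_group_axioms.intro)
 have sp: "subgroup_pair G H" by (intro subgroup_pair.intro subgroup_pair_axioms.intro fG N.subgroup_axioms)
 interpret S: subgroup_pair G H by (rule sp)
 let ?A = "R_psh S.K" and ?k = "card (rcosets\<^bsub>G\<^esub> H)"
 have A: "rep_tgroup S.K ?A" by (rule rep_tgroup_R_psh[OF S.finite_group_K])
 interpret P: rep_pair G H ?A "R_group G"
  by (intro rep_pair.intro sp A rep_tgroup_R_group fG)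
 have nrm: "g \<otimes>\<^bsub>G\<^esub> x \<otimes>\<^bsub>G\<^esub> inv\<^bsub>G\<^esub> g \<in> H" if "g \<in> carrier G" "x \<in> H" for g x
  using that by (rule N.inv_op_closed2)
 note Psi = psh_Psi_multiplier[OF S.finite_group_K, of ?k]
 \<comment> \<open>At a point over \<open>H\<close> the admissible labellings are the functions to
   \<open>L\<close> constant on cycles, by \<open>conj_mem_iff\<close>. They are colourings with as
   many colours as there are cosets, and their number is the scalar of \<Psi>.\<close>
 have lab: "hat S.K (psh_Psi ?A ?k h) U r d = of_nat (card (S.labs U r d)) * hat S.K h U r d"
  if h: "h \<in> carrier ?A" and pt: "point S.K U r d" for h U r d
 proof -
  have dH: "d j \<in> H" "r j \<in> U" if "j \<in> U" for j using pointD(4,5)[OF pt that] by simp_all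
  have "S.twist r d \<tau> j \<in> H \<longleftrightarrow> \<tau> (r j) = \<tau> j" if \<tau>: "\<tau> \<in> U \<rightarrow>\<^sub>E S.L" and j: "j \<in> U" for \<tau> j
   unfolding S.twist_def
   by (rule P.conj_mem_iff[OF nrm PiE_mem[OF \<tau> dH(2)[OF j]] PiE_mem[OF \<tau> j] dH(1)[OF j]])
  then have "S.labs U r d = {\<tau> \<in> U \<rightarrow>\<^sub>E S.L. \<forall>j\<in>U. \<tau> (r j) = \<tau> j}" unfolding S.labs_def by auto
  then have "card (S.labs U r d) = ncol ?k r U"
   using card_invariant_funs[where X = S.L, OF finite_set pointD(1,2,3)[OF pt]] by (simp only: S.card_L)
  then show ?thesis using P.A.multiplierD(2)[OF Psi h pt] by simp
 qed
 have hopf: "res_map S.K G (P.gact h x) = frag_extend (%(h1, h2). frag_extend (%(x1, x2).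
   tens ?A (R_group G) (P.A.gprod (psh_Psi ?A ?k h1) x1) (P.gact h2 x2)) (res_map S.K G x)) (res_map S.K S.K h)"
  if "h \<in> carrier ?A" "x \<in> carrier (R_group G)" for h x
  by (rule P.hopf[OF nrm assms(4) P.A.multiplierD(1)[OF Psi] lab that])
 note ax = P.ind_map_hom P.res_map_hom P.ind_map_graded P.res_map_graded P.ind_map_positive P.res_map_positive P.ind_res_adjoint
  P.gact_assoc P.coact_coassoc P.gact_unit P.coact_counit hopf
 show ?thesis
  by (intro psh_module.intro psh_module_axioms.intro; (unfold R_psh_ops)?;
   (rule psh_algebra_R_psh[OF S.finite_group_K] P.M.graded_tgroup_M | rule ax; assumption))
qed

end
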